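(* Let $T>0$, $d\ge 1$, let $F,m:[0,T]\times\mathbb{R}^d\to\mathbb{R}^d$ and $\sigma:[0,T]\times\mathbb{R}^d\to\mathbb{R}^{d\times d}$ satisfy the assumptions (A1), (A2), (A3) stated in the context, let $W$ be a $d$-dimensional Wiener process, let $x_0\in\mathbb{R}^d$, and let $Y$ be a solution of the stochastic differential equation $$dY_t=\{F(t,Y_t)+m(t,Y_t)\}\,dt+\sigma(t,Y_t)\,dW_t,\qquad Y_0=x_0,\quad 0\le t\le T.$$ Let $\mathbf{g}(t;0,\cdot)$, its inverse map $\mathbf{g}^{-1}(0;t,\cdot)$, the Jacobian matrix $\mathbf{g}_*(t;0,x)$, its inverse $\mathbf{g}_*^{-1}(t;0,x)$ and the vectors $c_{ij}(t;0,x)\in\mathbb{R}^d$ be as defined in the context. Then the process $$\widetilde Y_t:=\mathbf{g}^{-1}(0;t,Y_t),\qquad 0\le t\le T,$$ satisfies the Itô stochastic differential equation $$d\widetilde Y_t=\widetilde m(t,\widetilde Y_t)\,dt+\widetilde\sigma(t,\widetilde Y_t)\,dW_t,\qquad \widetilde Y_0=x_0,$$ with coefficients $$\widetilde m(t,x)=\mathbf{g}_*^{-1}(t;0,x)\Big\{m(t,\mathbf{g}(t;0,x))-\frac12\sum_{i,j=1}^d c_{ij}(t;0,x)\sum_{p=1}^d\sigma_{ip}(t,\mathbf{g}(t;0,x))\,\sigma_{jp}(t,\mathbf{g}(t;0,x))\Big\},$$ $$\widetilde\sigma(t,x)=\mathbf{g}_*^{-1}(t;0,x)\,\sigma(t,\mathbf{g}(t;0,x)),$$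 and the functions $\widetilde m$ and $\widetilde\sigma$ are bounded on $[0,T]\times\mathbb{R}^d$.
   Context: Assumptions. (A1) Uniform ellipticity: with $a:=\sigma\sigma^*$ ($\sigma^*$ the transpose of $\sigma$), there is $\Lambda\ge 1$ such that $\Lambda^{-1}|\xi|^2\le\langle a(t,x)\xi,\xi\rangle\le\Lambda|\xi|^2$ for all $(t,x,\xi)\in[0,T]\times(\mathbb{R}^d)^2$. (A2) Smoothness of the drift: $F$ is two times continuously differentiable in $[0,T]\times\mathbb{R}^d$, and there is a finite constant $M_F$ such that $\max_{t\in[0,T]}\|D_x^\nu F(t,x)\|\le M_F$ for all $x\in\mathbb{R}^d$ and all multi-indices $\nu$ with $|\nu|=1,2$. ($F$ itself may be unbounded.) (A3) $m$ is continuous and bounded on $[0,T]\times\mathbb{R}^d$. Notation. For $x\in\mathbb{R}^d$, $t\mapsto\mathbf{g}(t;0,x)$ denotes the unique solution on $[0,T]$ of the ODE $\dot{\mathbf{x}}=F(t,\mathbf{x})$ with $\mathbf{g}(0;0,x)=x$ (it exists on all of $[0,T]$ under (A2)). For each $t$, $\mathbf{g}^{-1}(0;t,\cdot)$ denotes the inverse of the map $x\mapsto\mathbf{g}(t;0,x)$ of $\mathbb{R}^d$ to itself. The matrix $\mathbf{g}_*(t;0,x)=(z_{ik}(t;0,x))_{i,k=1}^d$ with $z_{ik}(t;0,x)=\partial\mathbf{g}_i(t;0,x)/\partial x_k$ is the Jacobian matrix with respect to the initial condition, and $\mathbf{g}_*^{-1}(t;0,x)=(z^{ik}(t;0,x))_{i,k=1}^d$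 is its inverse matrix. For $1\le j,k\le d$, $c_{jk}(t;0,x)=(c^1_{jk}(t;0,x),\dots,c^d_{jk}(t;0,x))^T$ with $$c^i_{jk}(t;0,x)=\sum_{l,p=1}^d\frac{\partial z_{il}(t;0,x)}{\partial x_p}\,z^{pj}(t;0,x)\,z^{lk}(t;0,x).$$ *)

theory Defs
  imports "HOL-Probability.Probability"
begin

section \<open>Assumptions on the coefficients\<close>

definition partial_deriv :: "'d \<Rightarrow> (real^'d \<Rightarrow> 'b::real_normed_vector) \<Rightarrow> real^'d \<Rightarrow> 'b" where
  "partial_deriv k f x = vector_derivative (\<lambda>h. f (x + h *\<^sub>R axis k 1)) (at 0)"

text \<open>
  Derivatives are taken within \<open>S\<close>, so that on \<open>{0..T} \<times> UNIV\<close> the time derivatives at the end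
  points are one-sided.
\<close>

definition C2_on :: "'a::real_normed_vector set \<Rightarrow> ('a \<Rightarrow> 'b::real_normed_vector) \<Rightarrow> bool" where
  "C2_on S f \<longleftrightarrow>
    (\<exists>(f' :: 'a \<Rightarrow> 'a \<Rightarrow>\<^sub>L 'b) (f'' :: 'a \<Rightarrow> 'a \<Rightarrow>\<^sub>L ('a \<Rightarrow>\<^sub>L 'b)).
      (\<forall>z\<in>S. (f has_derivative blinfun_apply (f' z)) (at z within S)) \<and>
      (\<forall>z\<in>S. (f' has_derivative blinfun_apply (f'' z)) (at z within S)) \<and>
      continuous_on S f'')"

definition uniformly_elliptic :: "real \<Rightarrow> (real \<Rightarrow> real^'d \<Rightarrow> real^'d^'d) \<Rightarrow> bool" where
  "uniformly_elliptic T \<sigma> \<longleftrightarrow>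
    (\<exists>\<Lambda>\<ge>1. \<forall>t\<in>{0..T}. \<forall>x \<xi>.
      (1 / \<Lambda>) * (norm \<xi>)\<^sup>2 \<le> ((\<sigma> t x ** transpose (\<sigma> t x)) *v \<xi>) \<bullet> \<xi> \<and>
      ((\<sigma> t x ** transpose (\<sigma> t x)) *v \<xi>) \<bullet> \<xi> \<le> \<Lambda> * (norm \<xi>)\<^sup>2)"

definition smooth_drift :: "real \<Rightarrow> (real \<Rightarrow> real^'d \<Rightarrow> real^'d) \<Rightarrow> bool" where
  "smooth_drift T F \<longleftrightarrow>
    C2_on ({0..T} \<times> UNIV) (\<lambda>(t, x). F t x) \<and>
    (\<exists>M_F. \<forall>t\<in>{0..T}. \<forall>x i j.
      norm (partial_deriv i (F t) x) \<le> M_F \<and>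
      norm (partial_deriv j (partial_deriv i (F t)) x) \<le> M_F)"

definition continuous_bounded_drift :: "real \<Rightarrow> (real \<Rightarrow> real^'d \<Rightarrow> real^'d) \<Rightarrow> bool" where
  "continuous_bounded_drift T m \<longleftrightarrow>
    continuous_on ({0..T} \<times> UNIV) (\<lambda>(t, x). m t x) \<and>
    bounded ((\<lambda>(t, x). m t x) ` ({0..T} \<times> UNIV))"


section \<open>The flow of the drift\<close>

definition solves_ode :: "(real \<Rightarrow> real^'d \<Rightarrow> real^'d) \<Rightarrow> real \<Rightarrow> real^'d \<Rightarrow> (real \<Rightarrow> real^'d) \<Rightarrow> bool" where
  "solves_ode F T x y \<longleftrightarrow>
    y 0 = x \<and> (\<forall>t\<in>{0..T}. (y has_vector_derivative F t (y t)) (at t within {0..T}))"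

text \<open>
  The value at time \<open>t\<close> of the unique solution starting from \<open>x\<close> at time \<open>0\<close>.  The description
  is applied to the value and not to the solution because functions that solve the equation on
  \<open>{0..T}\<close> are arbitrary outside this interval.
\<close>

definition ode_flow :: "(real \<Rightarrow> real^'d \<Rightarrow> real^'d) \<Rightarrow> real \<Rightarrow> real \<Rightarrow> real^'d \<Rightarrow> real^'d" where
  "ode_flow F T t x = (THE v. \<exists>y. solves_ode F T x y \<and> v = y t)"

definition inverse_flow :: "(real \<Rightarrow> real^'d \<Rightarrow> real^'d) \<Rightarrow> real \<Rightarrow> real \<Rightarrow> real^'d \<Rightarrow> real^'d" where
  "inverse_flow F T t = inv (ode_flow F T t)"

definition flow_jacobian :: "(real \<Rightarrow> real^'d \<Rightarrow> real^'d) \<Rightarrow> real \<Rightarrow> real \<Rightarrow> real^'d \<Rightarrow> real^'d^'d" where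
  "flow_jacobian F T t x = (\<chi> i k. partial_deriv k (\<lambda>y. ode_flow F T t y $ i) x)"

definition flow_jacobian_inv :: "(real \<Rightarrow> real^'d \<Rightarrow> real^'d) \<Rightarrow> real \<Rightarrow> real \<Rightarrow> real^'d \<Rightarrow> real^'d^'d" where
  "flow_jacobian_inv F T t x = matrix_inv (flow_jacobian F T t x)"

definition flow_c :: "(real \<Rightarrow> real^'d \<Rightarrow> real^'d) \<Rightarrow> real \<Rightarrow> 'd \<Rightarrow> 'd \<Rightarrow> real \<Rightarrow> real^'d \<Rightarrow> real^'d" where
  "flow_c F T j k t x =
    (\<chi> i. \<Sum>l\<in>UNIV. \<Sum>p\<in>UNIV.
      partial_deriv p (\<lambda>y. flow_jacobian F T t y $ i $ l) x *
      flow_jacobian_inv F T t x $ p $ j * flow_jacobian_inv F T t x $ l $ k)"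

definition transformed_drift ::
  "(real \<Rightarrow> real^'d \<Rightarrow> real^'d) \<Rightarrow> (real \<Rightarrow> real^'d \<Rightarrow> real^'d) \<Rightarrow> (real \<Rightarrow> real^'d \<Rightarrow> real^'d^'d) \<Rightarrow>
    real \<Rightarrow> real \<Rightarrow> real^'d \<Rightarrow> real^'d" where
  "transformed_drift F m \<sigma> T t x =
    flow_jacobian_inv F T t x *v
      (m t (ode_flow F T t x) -
       (1 / 2) *\<^sub>R (\<Sum>i\<in>UNIV. \<Sum>j\<in>UNIV.
         (\<Sum>p\<in>UNIV. \<sigma> t (ode_flow F T t x) $ i $ p * \<sigma> t (ode_flow F T t x) $ j $ p)
           *\<^sub>R flow_c F T i j t x))"

definition transformed_diffusion ::
  "(real \<Rightarrow> real^'d \<Rightarrow> real^'d) \<Rightarrow> (real \<Rightarrow> real^'d \<Rightarrow> real^'d^'d) \<Rightarrow>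
    real \<Rightarrow> real \<Rightarrow> real^'d \<Rightarrow> real^'d^'d" where
  "transformed_diffusion F \<sigma> T t x = flow_jacobian_inv F T t x ** \<sigma> t (ode_flow F T t x)"


section \<open>Wiener processes and the Ito integral\<close>

definition filtration_upto :: "'w measure \<Rightarrow> real \<Rightarrow> (real \<Rightarrow> 'w measure) \<Rightarrow> bool" where
  "filtration_upto M T \<F> \<longleftrightarrow>
    (\<forall>t\<in>{0..T}. subalgebra M (\<F> t)) \<and>
    (\<forall>s\<in>{0..T}. \<forall>t\<in>{0..T}. s \<le> t \<longrightarrow> subalgebra (\<F> t) (\<F> s))"

definition wiener_process ::
  "'w measure \<Rightarrow> real \<Rightarrow> (real \<Rightarrow> 'w measure) \<Rightarrow> (real \<Rightarrow> 'w \<Rightarrow> real^'d) \<Rightarrow> bool" where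
  "wiener_process M T \<F> W \<longleftrightarrow>
    prob_space M \<and> filtration_upto M T \<F> \<and>
    (\<forall>t\<in>{0..T}. W t \<in> borel_measurable (\<F> t)) \<and>
    (AE \<omega> in M. W 0 \<omega> = 0) \<and>
    (AE \<omega> in M. continuous_on {0..T} (\<lambda>t. W t \<omega>)) \<and>
    (\<forall>s t. 0 \<le> s \<and> s < t \<and> t \<le> T \<longrightarrow>
      prob_space.indep_set M (sets (\<F> s))
        {(\<lambda>\<omega>. W t \<omega> - W s \<omega>) -` A \<inter> space M | A. A \<in> sets borel} \<and>
      prob_space.indep_vars M (\<lambda>_. borel) (\<lambda>i \<omega>. (W t \<omega> - W s \<omega>) $ i) UNIV \<and>
      (\<forall>i. distributed M lborel (\<lambda>\<omega>. (W t \<omega> - W s \<omega>) $ i) (normal_density 0 (sqrt (t - s)))))"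

definition progressive_upto ::
  "(real \<Rightarrow> 'w measure) \<Rightarrow> real \<Rightarrow> (real \<Rightarrow> 'w \<Rightarrow> 'b::topological_space) \<Rightarrow> bool" where
  "progressive_upto \<F> t H \<longleftrightarrow>
    (\<forall>s\<in>{0..t}. (\<lambda>(r, \<omega>). H r \<omega>) \<in> borel_measurable (restrict_space borel {0..s} \<Otimes>\<^sub>M \<F> s))"

definition ito_integrand ::
  "'w measure \<Rightarrow> (real \<Rightarrow> 'w measure) \<Rightarrow> real \<Rightarrow> (real \<Rightarrow> 'w \<Rightarrow> real^'n^'m) \<Rightarrow> bool" where
  "ito_integrand M \<F> t H \<longleftrightarrow>
    progressive_upto \<F> t H \<and>
    (AE \<omega> in M. (\<integral>\<^sup>+s\<in>{0..t}. ennreal ((norm (H s \<omega>))\<^sup>2) \<partial>lborel) < \<infinity>)"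

text \<open>
  The triple \<open>k\<close>, \<open>\<tau>\<close>, \<open>\<xi>\<close> represents the step process that equals \<open>\<xi> i\<close> on the time interval
  \<open>{\<tau> i<..\<tau> (Suc i)}\<close>, for \<open>i < k\<close>.
\<close>

definition step_process ::
  "'w measure \<Rightarrow> (real \<Rightarrow> 'w measure) \<Rightarrow> real \<Rightarrow> nat \<Rightarrow> (nat \<Rightarrow> real) \<Rightarrow>
    (nat \<Rightarrow> 'w \<Rightarrow> real^'n^'m) \<Rightarrow> bool" where
  "step_process M \<F> t k \<tau> \<xi> \<longleftrightarrow>
    \<tau> 0 = 0 \<and> \<tau> k = t \<and> (\<forall>i<k. \<tau> i \<le> \<tau> (Suc i)) \<and>
    (\<forall>i<k. \<xi> i \<in> borel_measurable (\<F> (\<tau> i)) \<and> bounded (\<xi> i ` space M))"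

definition step_value ::
  "nat \<Rightarrow> (nat \<Rightarrow> real) \<Rightarrow> (nat \<Rightarrow> 'w \<Rightarrow> real^'n^'m) \<Rightarrow> real \<Rightarrow> 'w \<Rightarrow> real^'n^'m" where
  "step_value k \<tau> \<xi> s \<omega> = (\<Sum>i<k. indicator {\<tau> i<..\<tau> (Suc i)} s *\<^sub>R \<xi> i \<omega>)"

definition step_integral ::
  "(real \<Rightarrow> 'w \<Rightarrow> real^'n) \<Rightarrow> nat \<Rightarrow> (nat \<Rightarrow> real) \<Rightarrow> (nat \<Rightarrow> 'w \<Rightarrow> real^'n^'m) \<Rightarrow> 'w \<Rightarrow> real^'m" where
  "step_integral W k \<tau> \<xi> \<omega> = (\<Sum>i<k. \<xi> i \<omega> *v (W (\<tau> (Suc i)) \<omega> - W (\<tau> i) \<omega>))"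

definition tendsto_0_in_prob :: "'w measure \<Rightarrow> (nat \<Rightarrow> 'w \<Rightarrow> ennreal) \<Rightarrow> bool" where
  "tendsto_0_in_prob M Z \<longleftrightarrow>
    (\<forall>\<epsilon>>0. (\<lambda>n. measure M {\<omega> \<in> space M. ennreal \<epsilon> < Z n \<omega>}) \<longlonglongrightarrow> 0)"

text \<open>
  \<open>has_ito_integral M \<F> W t H J\<close>: the random variable \<open>J\<close> is (a version of) the Ito integral of
  \<open>H\<close> with respect to \<open>W\<close> over \<open>{0..t}\<close>, that is, the limit in probability of the integrals of
  step processes approximating \<open>H\<close>.  When \<open>W\<close> is a Wiener process, such a sequence exists for
  each \<open>H\<close> with \<open>ito_integrand M \<F> t H\<close>, and almost surely \<open>J\<close> does not depend on its choice.
\<close>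

definition has_ito_integral ::
  "'w measure \<Rightarrow> (real \<Rightarrow> 'w measure) \<Rightarrow> (real \<Rightarrow> 'w \<Rightarrow> real^'n) \<Rightarrow> real \<Rightarrow>
    (real \<Rightarrow> 'w \<Rightarrow> real^'n^'m) \<Rightarrow> ('w \<Rightarrow> real^'m) \<Rightarrow> bool" where
  "has_ito_integral M \<F> W t H J \<longleftrightarrow>
    ito_integrand M \<F> t H \<and> J \<in> borel_measurable M \<and>
    (\<exists>k \<tau> \<xi>.
      (\<forall>n. step_process M \<F> t (k n) (\<tau> n) (\<xi> n)) \<and>
      tendsto_0_in_prob M (\<lambda>n \<omega>.
        \<integral>\<^sup>+s\<in>{0..t}. ennreal ((norm (step_value (k n) (\<tau> n) (\<xi> n) s \<omega> - H s \<omega>))\<^sup>2) \<partial>lborel) \<and>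
      tendsto_0_in_prob M (\<lambda>n \<omega>. ennreal (norm (step_integral W (k n) (\<tau> n) (\<xi> n) \<omega> - J \<omega>))))"

text \<open>
  \<open>Y\<close> is a continuous adapted process with \<open>dY = b(t,Y) dt + S(t,Y) dW\<close> on \<open>{0..T}\<close> and
  \<open>Y 0 = x0\<close>.  All paths of \<open>Y\<close> are continuous, so no completeness of the filtration is needed.
  The integral equation is required almost surely for each \<open>t\<close>; as \<open>Y\<close> is continuous, this is the
  same as requiring it almost surely for all \<open>t\<close> simultaneously with a continuous version of the
  stochastic integral.
\<close>

definition sde_solution ::
  "'w measure \<Rightarrow> real \<Rightarrow> (real \<Rightarrow> 'w measure) \<Rightarrow> (real \<Rightarrow> 'w \<Rightarrow> real^'n) \<Rightarrow>
    (real \<Rightarrow> real^'d \<Rightarrow> real^'d) \<Rightarrow> (real \<Rightarrow> real^'d \<Rightarrow> real^'n^'d) \<Rightarrow> real^'d \<Rightarrow>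
    (real \<Rightarrow> 'w \<Rightarrow> real^'d) \<Rightarrow> bool" where
  "sde_solution M T \<F> W b S x0 Y \<longleftrightarrow>
    (\<forall>t\<in>{0..T}. Y t \<in> borel_measurable (\<F> t)) \<and>
    (\<forall>\<omega>\<in>space M. continuous_on {0..T} (\<lambda>t. Y t \<omega>)) \<and>
    (AE \<omega> in M. Y 0 \<omega> = x0) \<and>
    (AE \<omega> in M. set_integrable lborel {0..T} (\<lambda>s. b s (Y s \<omega>))) \<and>
    (\<forall>t\<in>{0..T}. \<exists>J.
      has_ito_integral M \<F> W t (\<lambda>s \<omega>. S s (Y s \<omega>)) J \<and>
      (AE \<omega> in M. Y t \<omega> = x0 + (LINT s:{0..t}|lborel. b s (Y s \<omega>)) + J \<omega>))"

end

theory Submission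
  imports Defs
begin

text \<open>
  Neither a general Ito formula nor any time regularity of the inverse flow is needed.  Write
  \<open>X t\<close> for the transformed process and \<open>g\<close> for the flow.  Over a grid interval from \<open>a\<close> to \<open>b\<close>
  both \<open>Y b = g b (X b)\<close> and \<open>g b (X a)\<close> arise from \<open>Y a = g a (X a)\<close> by following the drift \<open>F\<close>,
  so that their difference consists, up to negligible terms, of the increment of \<open>m dt + \<sigma> dW\<close>
  only.  A second-order Taylor expansion of \<open>inv (g b)\<close> at \<open>g b (X a)\<close>, at the fixed time \<open>b\<close>,
  expresses \<open>X b - X a\<close> by this difference.  In the sum over the grid the linear terms yield the new
  drift and the new stochastic integral; in the quadratic terms the products of the increments of
  \<open>W\<close> may be replaced by the length of the interval, which yields the correction by the \<open>c_jk\<close>.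

  Ellipticity bounds \<open>\<sigma>\<close>.  Hence the given stochastic integral is an \<open>L\<^sup>2\<close> limit of integrals of
  uniformly bounded step processes on arbitrarily fine grids, all error terms tend to \<open>0\<close> in \<open>L\<^sup>2\<close>,
  and along a subsequence the above computation can be carried out path by path.
\<close>

section \<open>Ordinary differential equations with Lipschitz right-hand side\<close>

text \<open>Comparing \<open>Y b\<close> with \<open>g b (X a)\<close> disposes of the unbounded
  \<open>F\<close>: only the difference of \<open>F\<close> along two paths issuing from the same
  point remains, and the Lipschitz bound makes it small. Yet the weights \<open>w b (X a)\<close>
  and \<open>q b (X a)\<close> are known at time \<open>a\<close>, because \<open>b\<close> is
  deterministic; hence the isometry and the orthogonality of martingale differences apply to the
  weighted sums. The other obstacle is the form of the given integral.
  \<open>has_ito_integral\<close> offers, for each time separately, step processes without a common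
  bound, without control of the mesh and with convergence in probability only. Clipping at the bound
  of \<open>\<sigma>\<close>, subdividing the grid and passing to a subsequence repair this. The
  errors of the approximated stochastic increments are controlled in square sum but not in absolute
  sum; this is why linear and quadratic terms need different arguments. The new stochastic integral
  is not built separately: \<open>X t\<close> minus its initial value and its drift integral is
  shown to be a limit of step integrals.\<close>

lemma has_real_derivative_inner_self:
  fixes z :: "real \<Rightarrow> 'a::real_inner"
  assumes "(z has_vector_derivative z') (at s within S)"
  shows "((\<lambda>s. z s \<bullet> z s) has_real_derivative (2 * (z s \<bullet> z'))) (at s within S)"
proof -
  have "((\<lambda>s. z s \<bullet> z s) has_derivative (\<lambda>h. z s \<bullet> (h *\<^sub>R z') + (h *\<^sub>R z') \<bullet> z s)) (at s within S)"
    using has_derivative_inner assms unfolding has_vector_derivative_def by blast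
  moreover have "(\<lambda>h. z s \<bullet> (h *\<^sub>R z') + (h *\<^sub>R z') \<bullet> z s) = (*) (2 * (z s \<bullet> z'))"
    by (auto simp: inner_commute algebra_simps)
  ultimately show ?thesis
    by (simp add: has_field_derivative_def)
qed

lemma mvt_within:
  fixes p :: "real \<Rightarrow> real"
  assumes p: "\<And>s. s \<in> {0..T} \<Longrightarrow> (p has_real_derivative p' s) (at s within {0..T})"
    and t: "0 < t" "t \<le> T"
  obtains s where "s \<in> {0..T}" "p t - p 0 = p' s * t"
proof -
  have "(p has_derivative (\<lambda>h. p' s * h)) (at s within {0..t})" if "0 \<le> s" "s \<le> t" for s
  proof -
    have "(p has_real_derivative p' s) (at s within {0..t})"
      by (rule DERIV_subset[OF p]) (use that t in auto)
    then show ?thesis by (simp add: has_field_derivative_def)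
  qed
  from mvt_simple[OF t(1) this] obtain s where "s \<in> {0<..<t}" "p t - p 0 = p' s * (t - 0)"
    by auto
  then show ?thesis using t by (intro that[of s]) auto
qed

text \<open>The square of the norm is differentiable also where \<open>z\<close> vanishes. By
  \<open>2 * norm z * \<rho> \<le> (norm z)^2 + \<rho>^2\<close> the weight with rate
  \<open>2 * L + 1\<close> absorbs all growth, and the weighted square has derivative at most
  \<open>\<rho>^2\<close>. The mean value theorem takes the place of integration, so
  \<open>z'\<close> may be any derivative, continuous or not.\<close>

lemma gronwall_square:
  fixes z z' :: "real \<Rightarrow> 'a::real_inner"
  assumes z: "\<And>s. s \<in> {0..T} \<Longrightarrow> (z has_vector_derivative z' s) (at s within {0..T})"
    and bound: "\<And>s. s \<in> {0..T} \<Longrightarrow> norm (z' s) \<le> L * norm (z s) + \<rho>"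
    and L: "0 \<le> L" and t: "t \<in> {0..T}"
  shows "(norm (z t))\<^sup>2 \<le> exp ((2 * L + 1) * t) * ((norm (z 0))\<^sup>2 + \<rho>\<^sup>2 * t)"
proof (cases "t = 0")
  case False
  with t have t: "0 < t" "t \<le> T" by auto
  define c where "c = 2 * L + 1"
  have c: "0 \<le> c" using L by (simp add: c_def)
  define p where "p s = exp (- c * s) * (z s \<bullet> z s)" for s
  define p' where "p' s = exp (- c * s) * (2 * (z s \<bullet> z' s) - c * (z s \<bullet> z s))" for s
  have p: "(p has_real_derivative p' s) (at s within {0..T})" if "s \<in> {0..T}" for s
  proof -
    have 2: "((\<lambda>s. exp (- c * s)) has_real_derivative (- c * exp (- c * s))) (at s within {0..T})"
      by (auto intro!: derivative_eq_intros)
    show ?thesis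
      unfolding p_def p'_def
      by (rule DERIV_cong[OF DERIV_mult[OF 2 has_real_derivative_inner_self[OF z[OF that]]]])
        (simp add: algebra_simps)
  qed
  have p': "p' s \<le> \<rho>\<^sup>2" if s: "s \<in> {0..T}" for s
  proof -
    have "z s \<bullet> z' s \<le> norm (z s) * norm (z' s)"
      by (rule norm_cauchy_schwarz)
    also have "\<dots> \<le> norm (z s) * (L * norm (z s) + \<rho>)"
      by (intro mult_left_mono bound s) auto
    finally have "2 * (z s \<bullet> z' s) \<le> 2 * L * (norm (z s))\<^sup>2 + 2 * norm (z s) * \<rho>"
      by (simp add: algebra_simps power2_eq_square)
    also have "\<dots> \<le> 2 * L * (norm (z s))\<^sup>2 + (norm (z s))\<^sup>2 + \<rho>\<^sup>2"
      using zero_le_power2[of "norm (z s) - \<rho>"] by (simp add: power2_diff)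
    finally have "2 * (z s \<bullet> z' s) - c * (z s \<bullet> z s) \<le> \<rho>\<^sup>2"
      by (simp add: c_def power2_norm_eq_inner[symmetric] algebra_simps)
    then have "p' s \<le> exp (- c * s) * \<rho>\<^sup>2"
      unfolding p'_def by (intro mult_left_mono) auto
    also have "\<dots> \<le> 1 * \<rho>\<^sup>2"
      using c s by (intro mult_right_mono) auto
    finally show ?thesis by simp
  qed
  obtain s where s: "s \<in> {0..T}" "p t - p 0 = p' s * t"
    by (rule mvt_within[OF p t])
  have "p t \<le> p 0 + \<rho>\<^sup>2 * t"
    using s(2) mult_right_mono[OF p'[OF s(1)], of t] t by linarith
  then have "exp (c * t) * p t \<le> exp (c * t) * (p 0 + \<rho>\<^sup>2 * t)"
    by (intro mult_left_mono) auto
  moreover have "exp (c * t) * p t = (norm (z t))\<^sup>2"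
    by (simp add: p_def power2_norm_eq_inner mult.assoc[symmetric] flip: exp_add)
  moreover have "p 0 = (norm (z 0))\<^sup>2"
    by (simp add: p_def power2_norm_eq_inner)
  ultimately show ?thesis
    by (metis c_def)
qed auto

text \<open>A single constant that dominates the exponential factor, the elapsed time and 1. Its
  square then bounds the product of both factors in \<open>gronwall_square\<close>, and taking roots
  leaves one power of it.\<close>

definition gronwall_const :: "real \<Rightarrow> real \<Rightarrow> real" where
  "gronwall_const L T = exp ((2 * L + 1) * T) * (1 + T)"

lemma gronwall_const_ge_1: "0 \<le> L \<Longrightarrow> 0 \<le> T \<Longrightarrow> 1 \<le> gronwall_const L T"
  unfolding gronwall_const_def using mult_mono[of 1 "exp ((2 * L + 1) * T)" 1 "1 + T"] by simp

lemma gronwall: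
  fixes z z' :: "real \<Rightarrow> 'a::real_inner"
  assumes z: "\<And>s. s \<in> {0..T} \<Longrightarrow> (z has_vector_derivative z' s) (at s within {0..T})"
    and bound: "\<And>s. s \<in> {0..T} \<Longrightarrow> norm (z' s) \<le> L * norm (z s) + \<rho>"
    and L: "0 \<le> L" "0 \<le> \<rho>" and t: "t \<in> {0..T}"
  shows "norm (z t) \<le> gronwall_const L T * (norm (z 0) + \<rho>)"
proof (rule power2_le_imp_le)
  let ?K = "gronwall_const L T"
  have T: "0 \<le> T" using t by auto
  have 1: "exp ((2 * L + 1) * t) \<le> ?K"
  proof -
    have "exp ((2 * L + 1) * t) \<le> exp ((2 * L + 1) * T) * 1"
      using t L by (auto intro!: mult_left_mono)
    also have "\<dots> \<le> ?K" unfolding gronwall_const_def using T by (intro mult_left_mono) auto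
    finally show ?thesis .
  qed
  have 2: "t \<le> ?K"
  proof -
    have "t \<le> 1 * (1 + T)" using t by auto
    also have "\<dots> \<le> ?K" unfolding gronwall_const_def using T L by (intro mult_right_mono) auto
    finally show ?thesis .
  qed
  have K1: "1 \<le> ?K" using gronwall_const_ge_1 L T by blast
  have "(norm (z t))\<^sup>2 \<le> exp ((2 * L + 1) * t) * ((norm (z 0))\<^sup>2 + \<rho>\<^sup>2 * t)"
    by (rule gronwall_square[OF z bound L(1) t])
  also have "\<dots> \<le> ?K * ((norm (z 0))\<^sup>2 * ?K + \<rho>\<^sup>2 * ?K)"
    using t 1 2 K1 mult_left_mono[of 1 ?K "(norm (z 0))\<^sup>2"]
    by (intro mult_mono add_mono) auto
  also have "\<dots> = ?K\<^sup>2 * ((norm (z 0))\<^sup>2 + \<rho>\<^sup>2)"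
    by (simp add: power2_eq_square algebra_simps)
  also have "\<dots> \<le> ?K\<^sup>2 * (norm (z 0) + \<rho>)\<^sup>2"
    using L by (intro mult_left_mono) (auto simp: power2_sum)
  finally show "(norm (z t))\<^sup>2 \<le> (?K * (norm (z 0) + \<rho>))\<^sup>2"
    by (simp add: power_mult_distrib)
  show "0 \<le> ?K * (norm (z 0) + \<rho>)" using K1 L by auto
qed

text \<open>The weight \<open>exp (2 * L * s)\<close> makes the squared norm nondecreasing. This
  backward estimate yields injectivity of the flow and Lipschitz bounds for its inverse without
  running the equation backwards in time.\<close>

lemma gronwall_lower:
  fixes z z' :: "real \<Rightarrow> 'a::real_inner"
  assumes z: "\<And>s. s \<in> {0..T} \<Longrightarrow> (z has_vector_derivative z' s) (at s within {0..T})"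
    and bound: "\<And>s. s \<in> {0..T} \<Longrightarrow> norm (z' s) \<le> L * norm (z s)"
    and L: "0 \<le> L" and t: "t \<in> {0..T}"
  shows "norm (z 0) \<le> exp (L * T) * norm (z t)"
proof (cases "t = 0")
  case True
  then show ?thesis using L t mult_right_mono[of 1 "exp (L * T)" "norm (z 0)"] by auto
next
  case False
  with t have t: "0 < t" "t \<le> T" by auto
  define p where "p s = exp (2 * L * s) * (z s \<bullet> z s)" for s
  define p' where "p' s = exp (2 * L * s) * (2 * (z s \<bullet> z' s) + 2 * L * (z s \<bullet> z s))" for s
  have p: "(p has_real_derivative p' s) (at s within {0..T})" if "s \<in> {0..T}" for s
  proof -
    have 2: "((\<lambda>s. exp (2 * L * s)) has_real_derivative (2 * L * exp (2 * L * s))) (at s within {0..T})"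
      by (auto intro!: derivative_eq_intros)
    show ?thesis
      unfolding p_def p'_def
      by (rule DERIV_cong[OF DERIV_mult[OF 2 has_real_derivative_inner_self[OF z[OF that]]]])
        (simp add: algebra_simps)
  qed
  have p': "0 \<le> p' s" if s: "s \<in> {0..T}" for s
  proof -
    have "- (z s \<bullet> z' s) \<le> norm (z s) * norm (z' s)"
      using norm_cauchy_schwarz[of "- z s" "z' s"] by simp
    also have "\<dots> \<le> norm (z s) * (L * norm (z s))"
      by (intro mult_left_mono bound s) auto
    finally have "0 \<le> 2 * (z s \<bullet> z' s) + 2 * L * (z s \<bullet> z s)"
      by (simp add: algebra_simps power2_eq_square power2_norm_eq_inner[symmetric])
    then show ?thesis
      unfolding p'_def by (intro mult_nonneg_nonneg) auto
  qed
  obtain s where s: "s \<in> {0..T}" "p t - p 0 = p' s * t"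
    by (rule mvt_within[OF p t])
  have "p 0 \<le> p t"
    using s p'[OF s(1)] t by (metis diff_ge_0_iff_ge less_imp_le mult_nonneg_nonneg)
  then have "(norm (z 0))\<^sup>2 \<le> exp (2 * L * t) * (norm (z t))\<^sup>2"
    by (simp add: p_def power2_norm_eq_inner)
  also have "\<dots> \<le> exp (2 * L * T) * (norm (z t))\<^sup>2"
    using t L by (auto intro!: mult_right_mono mult_left_mono)
  also have "\<dots> = (exp (L * T) * norm (z t))\<^sup>2"
    by (simp add: power_mult_distrib power2_eq_square algebra_simps flip: exp_add)
  finally show ?thesis
    by (rule power2_le_imp_le) auto
qed

text \<open>Picard's contraction on the whole interval at once: with the Bielecki weight
  \<open>exp (- \<kappa> * t)\<close> the integral operator has Lipschitz constant at most
  \<open>L / \<kappa>\<close>, however long the interval is.\<close>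

lemma ode_exists:
  fixes f :: "real \<Rightarrow> 'a::euclidean_space \<Rightarrow> 'a"
  assumes T: "0 \<le> T" and cont: "continuous_on ({0..T} \<times> UNIV) (\<lambda>(t, x). f t x)"
    and lip: "\<And>t x y. t \<in> {0..T} \<Longrightarrow> norm (f t x - f t y) \<le> L * norm (x - y)" and L: "0 \<le> L"
  obtains y where "y 0 = x0" "\<And>t. t \<in> {0..T} \<Longrightarrow> (y has_vector_derivative f t (y t)) (at t within {0..T})"
proof -
  \<comment> \<open>The summand 1 keeps \<open>\<kappa>\<close> positive when
    \<open>L = 0\<close>.\<close>
  define \<kappa> where "\<kappa> = 2 * L + 1"
  have \<kappa>: "0 < \<kappa>" "L / \<kappa> \<le> 1 / 2" using L by (auto simp: \<kappa>_def divide_simps)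
  \<comment> \<open>Clamping the time to \<open>{0..T}\<close> extends functions on the interval to
    bounded continuous functions on the line, the complete space in which the fixed point is
    sought.\<close>
  define c where "c t = max 0 (min T t)" for t :: real
  have c: "c t \<in> {0..T}" "t \<in> {0..T} \<Longrightarrow> c t = t" for t using T by (auto simp: c_def)
  have c_cont: "continuous_on UNIV c" unfolding c_def by (intro continuous_intros)
  have comp_cont: "continuous_on {0..T} (\<lambda>s. f s (h s))" if "continuous_on {0..T} h" for h
    using continuous_on_compose2[OF cont continuous_on_Pair[OF continuous_on_id that]] by fastforce
  \<comment> \<open>The unknown is \<open>exp (- \<kappa> * t) *\<^sub>R y t\<close> instead of
    \<open>y t\<close>; thereby the ordinary supremum distance plays the role of the weighted
    one.\<close>
  define q where "q z t = exp (- \<kappa> * c t) *\<^sub>R (x0 + integral {0..c t} (\<lambda>s. f s (exp (\<kappa> * s) *\<^sub>R z s)))"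
    for z :: "real \<Rightarrow> 'a" and t
  have f_cont: "continuous_on {0..T} (\<lambda>s. f s (exp (\<kappa> * s) *\<^sub>R apply_bcontfun z s))" for z :: "real \<Rightarrow>\<^sub>C 'a"
    by (intro comp_cont continuous_intros continuous_on_apply_bcontfun)
  have q_bcont: "q (apply_bcontfun z) \<in> bcontfun" for z
  proof -
    define r where "r t = exp (- \<kappa> * t) *\<^sub>R (x0 + integral {0..t} (\<lambda>s. f s (exp (\<kappa> * s) *\<^sub>R apply_bcontfun z s)))" for t
    have r: "continuous_on {0..T} r"
      unfolding r_def by (intro continuous_intros indefinite_integral_continuous_1 integrable_continuous_real f_cont)
    have "q (apply_bcontfun z) = r \<circ> c" by (auto simp: q_def r_def)
    moreover have "continuous_on UNIV (r \<circ> c)"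
      by (rule continuous_on_compose[OF c_cont]) (use c r in \<open>auto intro: continuous_on_subset\<close>)
    moreover have "bounded (range (r \<circ> c))"
      using c by (intro bounded_subset[OF compact_imp_bounded[OF compact_continuous_image[OF r compact_Icc]]]) auto
    ultimately show ?thesis by (simp add: bcontfun_def)
  qed
  define Q where "Q z = Bcontfun (q (apply_bcontfun z))" for z
  have Q: "apply_bcontfun (Q z) = q (apply_bcontfun z)" for z
    using q_bcont by (simp add: Q_def Bcontfun_inverse)
  have contr: "dist (Q z) (Q w) \<le> 1 / 2 * dist z w" for z w
  proof (rule dist_bound)
    fix t
    let ?I = "\<lambda>z s. f s (exp (\<kappa> * s) *\<^sub>R apply_bcontfun z s)"
    have ct: "0 \<le> c t" "c t \<le> T" using c[of t] by auto
    have int: "?I z integrable_on {0..c t}" for z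
      using ct by (intro integrable_continuous_real continuous_on_subset[OF f_cont]) auto
    have "norm (integral {0..c t} (\<lambda>s. ?I z s - ?I w s)) \<le> integral {0..c t} (\<lambda>s. L * dist z w * exp (\<kappa> * s))"
    proof (rule integral_norm_bound_integral)
      show "(\<lambda>s. ?I z s - ?I w s) integrable_on {0..c t}" using int by (intro integrable_diff)
      show "(\<lambda>s. L * dist z w * exp (\<kappa> * s)) integrable_on {0..c t}"
        by (intro integrable_continuous_real continuous_intros)
      fix s assume s: "s \<in> {0..c t}"
      have "norm (?I z s - ?I w s) \<le> L * norm (exp (\<kappa> * s) *\<^sub>R apply_bcontfun z s - exp (\<kappa> * s) *\<^sub>R apply_bcontfun w s)"
        using s ct by (intro lip) auto
      also have "\<dots> = L * exp (\<kappa> * s) * dist (apply_bcontfun z s) (apply_bcontfun w s)"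
        by (simp add: dist_norm flip: scaleR_diff_right)
      also have "\<dots> \<le> L * exp (\<kappa> * s) * dist z w"
        using L by (intro mult_left_mono dist_bounded) auto
      finally show "norm (?I z s - ?I w s) \<le> L * dist z w * exp (\<kappa> * s)" by (simp add: mult_ac)
    qed
    also have "integral {0..c t} (\<lambda>s. L * dist z w * exp (\<kappa> * s)) = L * dist z w / \<kappa> * exp (\<kappa> * c t) - L * dist z w / \<kappa> * exp (\<kappa> * 0)"
      by (intro integral_unique fundamental_theorem_of_calculus ct)
        (use \<kappa> in \<open>auto intro!: derivative_eq_intros simp flip: has_real_derivative_iff_has_vector_derivative\<close>)
    also have "\<dots> \<le> L * dist z w / \<kappa> * exp (\<kappa> * c t)"
      using \<kappa> L by auto
    finally have *: "norm (integral {0..c t} (\<lambda>s. ?I z s - ?I w s)) \<le> L * dist z w / \<kappa> * exp (\<kappa> * c t)" .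
    have "dist (apply_bcontfun (Q z) t) (apply_bcontfun (Q w) t) =
        exp (- \<kappa> * c t) * norm (integral {0..c t} (\<lambda>s. ?I z s - ?I w s))"
      by (simp add: Q q_def dist_norm integral_diff[OF int int] flip: scaleR_diff_right)
    also have "\<dots> \<le> exp (- \<kappa> * c t) * (L * dist z w / \<kappa> * exp (\<kappa> * c t))"
      by (intro mult_left_mono *) auto
    also have "\<dots> = L / \<kappa> * dist z w"
      by (simp add: exp_minus)
    also have "\<dots> \<le> 1 / 2 * dist z w"
      using \<kappa> by (intro mult_right_mono) auto
    finally show "dist (apply_bcontfun (Q z) t) (apply_bcontfun (Q w) t) \<le> 1 / 2 * dist z w" .
  qed
  obtain z where z: "Q z = z"
    using banach_fix_type[of "1 / 2" Q] contr by auto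
  define y where "y t = x0 + integral {0..t} (\<lambda>s. f s (exp (\<kappa> * s) *\<^sub>R apply_bcontfun z s))" for t
  have zy: "exp (\<kappa> * t) *\<^sub>R apply_bcontfun z t = y t" if "t \<in> {0..T}" for t
  proof -
    have "exp (\<kappa> * t) *\<^sub>R apply_bcontfun z t = exp (\<kappa> * t) *\<^sub>R q (apply_bcontfun z) t"
      using Q[of z] z by simp
    also have "\<dots> = y t" using c(2)[OF that] by (simp add: q_def y_def flip: exp_add)
    finally show ?thesis .
  qed
  show ?thesis
  proof
    show "y 0 = x0" by (simp add: y_def)
    fix t assume t: "t \<in> {0..T}"
    have "((\<lambda>t. integral {0..t} (\<lambda>s. f s (exp (\<kappa> * s) *\<^sub>R apply_bcontfun z s))) has_vector_derivative
       f t (exp (\<kappa> * t) *\<^sub>R apply_bcontfun z t)) (at t within {0..T})"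
      by (rule integral_has_vector_derivative[OF f_cont t])
    then show "(y has_vector_derivative f t (y t)) (at t within {0..T})"
      using zy[OF t] has_vector_derivative_add[OF has_vector_derivative_const[of x0]]
      unfolding y_def by fastforce
  qed
qed

section \<open>The flow of the drift and its spatial derivatives\<close>

text \<open>The first and second spatial derivatives are kept as bounded linear maps
  \<open>A\<close> and \<open>B\<close>, with one common bound. All estimates for the flow are then
  free of coordinates; partial derivatives return only when the coefficients of the transformed
  equation are identified.\<close>

locale smooth_flow =
  fixes T L :: real and F :: "real \<Rightarrow> 'a::euclidean_space \<Rightarrow> 'a"
    and A :: "real \<Rightarrow> 'a \<Rightarrow> 'a \<Rightarrow>\<^sub>L 'a" and B :: "real \<Rightarrow> 'a \<Rightarrow> 'a \<Rightarrow>\<^sub>L ('a \<Rightarrow>\<^sub>L 'a)"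
  assumes T: "0 \<le> T" and L: "0 \<le> L"
    and contF: "continuous_on ({0..T} \<times> UNIV) (\<lambda>(t, x). F t x)"
    and contA: "continuous_on ({0..T} \<times> UNIV) (\<lambda>(t, x). A t x)"
    and contB: "continuous_on ({0..T} \<times> UNIV) (\<lambda>(t, x). B t x)"
    and derF: "t \<in> {0..T} \<Longrightarrow> (F t has_derivative blinfun_apply (A t x)) (at x)"
    and derA: "t \<in> {0..T} \<Longrightarrow> (A t has_derivative blinfun_apply (B t x)) (at x)"
    and boundA: "t \<in> {0..T} \<Longrightarrow> norm (A t x) \<le> L"
    and boundB: "t \<in> {0..T} \<Longrightarrow> norm (B t x) \<le> L"
begin

lemma lipF: "t \<in> {0..T} \<Longrightarrow> norm (F t x - F t y) \<le> L * norm (x - y)"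
  by (rule differentiable_bound[of UNIV "F t" "\<lambda>x. blinfun_apply (A t x)"])
    (use derF boundA in \<open>auto simp flip: norm_blinfun.rep_eq\<close>)

lemma lipA: "t \<in> {0..T} \<Longrightarrow> norm (A t x - A t y) \<le> L * norm (x - y)"
  by (rule differentiable_bound[of UNIV "A t" "\<lambda>x. blinfun_apply (B t x)"])
    (use derA boundB in \<open>auto simp flip: norm_blinfun.rep_eq\<close>)

lemma A_apply: "t \<in> {0..T} \<Longrightarrow> norm (blinfun_apply (A t x) h) \<le> L * norm h"
  by (meson boundA mult_right_mono norm_blinfun norm_ge_zero order_trans)

lemma norm_blinfun2: "norm (blinfun_apply (blinfun_apply C h) k) \<le> norm C * norm h * norm k"
  for C :: "'a \<Rightarrow>\<^sub>L ('a \<Rightarrow>\<^sub>L 'a)"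
  by (meson mult_right_mono norm_blinfun norm_ge_zero order_trans)

lemma B_apply: "t \<in> {0..T} \<Longrightarrow> norm (blinfun_apply (blinfun_apply (B t x) h) k) \<le> L * norm h * norm k"
  by (rule order_trans[OF norm_blinfun2]) (intro mult_right_mono boundB; simp)

text \<open>Mean value inequality for \<open>F\<close> minus its linearisation at \<open>x\<close>,
  whose derivative \<open>A t z - A t x\<close> is at most \<open>L * norm (y - x)\<close> on the
  segment.\<close>

lemma taylorF:
  assumes t: "t \<in> {0..T}"
  shows "norm (F t y - F t x - blinfun_apply (A t x) (y - x)) \<le> L * (norm (y - x))\<^sup>2"
proof -
  have "norm ((F t y - blinfun_apply (A t x) y) - (F t x - blinfun_apply (A t x) x)) \<le> (L * norm (y - x)) * norm (y - x)"
  proof (rule differentiable_bound[of "closed_segment x y" _ "\<lambda>z. blinfun_apply (A t z - A t x)"])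
    fix z assume z: "z \<in> closed_segment x y"
    show "((\<lambda>y. F t y - blinfun_apply (A t x) y) has_derivative blinfun_apply (A t z - A t x)) (at z within closed_segment x y)"
      using t by (auto intro!: derivative_eq_intros has_derivative_at_withinI[OF derF] simp: blinfun.diff_left)
    have "norm (A t z - A t x) \<le> L * norm (z - x)" by (rule lipA[OF t])
    also have "\<dots> \<le> L * norm (y - x)"
      using z segment_bound1[OF z] L by (intro mult_left_mono) (auto simp: norm_minus_commute)
    finally show "onorm (blinfun_apply (A t z - A t x)) \<le> L * norm (y - x)"
      by (simp add: norm_blinfun.rep_eq)
  qed auto
  then show ?thesis by (simp add: power2_eq_square blinfun.diff_right algebra_simps)
qed

section \<open>Existence, uniqueness and Lipschitz dependence of the flow\<close>

definition "K = gronwall_const L T"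

lemma K: "1 \<le> K" "0 \<le> K" unfolding K_def using gronwall_const_ge_1[OF L T] by auto

text \<open>The right-hand side is a parameter because the same notion serves the flow and its first
  and second variational equations.\<close>

definition is_sol :: "(real \<Rightarrow> 'a \<Rightarrow> 'a) \<Rightarrow> 'a \<Rightarrow> (real \<Rightarrow> 'a) \<Rightarrow> bool" where
  "is_sol f x y \<longleftrightarrow> y 0 = x \<and> (\<forall>t\<in>{0..T}. (y has_vector_derivative f t (y t)) (at t within {0..T}))"

lemma is_sol_dist:
  assumes "is_sol f x y" "is_sol f x' y'" and "t \<in> {0..T}"
    and lip: "\<And>t x y. t \<in> {0..T} \<Longrightarrow> norm (f t x - f t y) \<le> L * norm (x - y)"
  shows "norm (y t - y' t) \<le> K * norm (x - x')"
proof -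
  have "norm (y t - y' t) \<le> gronwall_const L T * (norm (y 0 - y' 0) + 0)"
  proof (rule gronwall[OF _ _ L _ \<open>t \<in> {0..T}\<close>])
    show "((\<lambda>t. y t - y' t) has_vector_derivative f s (y s) - f s (y' s)) (at s within {0..T})"
      if "s \<in> {0..T}" for s
      using assms(1,2) that by (intro has_vector_derivative_diff) (auto simp: is_sol_def)
  qed (use lip in auto)
  then show ?thesis using assms(1,2) by (simp add: is_sol_def K_def)
qed

lemma is_sol_unique:
  assumes "is_sol f x y" "is_sol f x y'" and "t \<in> {0..T}"
    and lip: "\<And>t x y. t \<in> {0..T} \<Longrightarrow> norm (f t x - f t y) \<le> L * norm (x - y)"
  shows "y t = y' t"
  using is_sol_dist[OF assms] by simp

text \<open>The choice is made for the whole solution and evaluated afterwards, so that all values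
  for one \<open>x\<close> belong to the same solution. Uniqueness later identifies them with
  \<open>ode_flow\<close>.\<close>

definition g :: "real \<Rightarrow> 'a \<Rightarrow> 'a" where
  "g t x = (SOME y. is_sol F x y) t"

lemma g_is_sol: "is_sol F x (\<lambda>t. g t x)"
proof -
  have "\<exists>y. is_sol F x y"
    by (rule ode_exists[OF T contF lipF L, of x]) (auto simp: is_sol_def)
  then show ?thesis unfolding g_def by (rule someI_ex)
qed

lemma g_unique: "is_sol F x y \<Longrightarrow> t \<in> {0..T} \<Longrightarrow> y t = g t x"
  by (rule is_sol_unique[OF _ g_is_sol]) (auto intro: lipF)

lemma g_0: "g 0 x = x"
  using g_is_sol by (auto simp: is_sol_def)

lemma g_deriv: "t \<in> {0..T} \<Longrightarrow> ((\<lambda>t. g t x) has_vector_derivative F t (g t x)) (at t within {0..T})"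
  using g_is_sol by (auto simp: is_sol_def)

lemma g_lip: "t \<in> {0..T} \<Longrightarrow> norm (g t x - g t y) \<le> K * norm (x - y)"
  by (rule is_sol_dist[OF g_is_sol g_is_sol]) (auto intro: lipF)

lemma g_lower: "t \<in> {0..T} \<Longrightarrow> norm (x - y) \<le> exp (L * T) * norm (g t x - g t y)"
  using gronwall_lower[where z="\<lambda>t. g t x - g t y" and z'="\<lambda>t. F t (g t x) - F t (g t y)", OF _ lipF L]
  by (simp add: g_0 has_vector_derivative_diff g_deriv)

lemma g_cont_t: "continuous_on {0..T} (\<lambda>t. g t x)"
  using g_deriv by (meson has_vector_derivative_continuous continuous_on_eq_continuous_within)

text \<open>A change of the space variable is handled at the new time, where the hypothesis is
  uniform in time; the change of time is then made at the old point. Gronwall estimates deliver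
  exactly this uniformity, so the lemma serves \<open>g\<close>, \<open>v\<close> and
  \<open>u\<close> alike.\<close>

lemma joint_continuity:
  fixes f :: "real \<Rightarrow> 'a \<Rightarrow> 'c::metric_space"
  assumes t: "\<And>x. continuous_on {0..T} (\<lambda>t. f t x)"
    and x: "\<And>x e. 0 < e \<Longrightarrow> \<exists>d>0. \<forall>y. norm (y - x) < d \<longrightarrow> (\<forall>t\<in>{0..T}. dist (f t y) (f t x) \<le> e)"
  shows "continuous_on ({0..T} \<times> UNIV) (\<lambda>(t, x). f t x)"
  unfolding continuous_on_iff
proof (intro ballI allI impI)
  fix p :: "real \<times> 'a" and e :: real assume p: "p \<in> {0..T} \<times> UNIV" and e: "0 < e"
  obtain t x where px: "p = (t, x)" "t \<in> {0..T}" using p by auto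
  obtain d1 where d1: "d1 > 0" "\<And>y s. norm (y - x) < d1 \<Longrightarrow> s \<in> {0..T} \<Longrightarrow> dist (f s y) (f s x) \<le> e / 3"
    using x[of "e/3" x] e by auto
  obtain d2 where d2: "d2 > 0" "\<And>s. s \<in> {0..T} \<Longrightarrow> dist s t < d2 \<Longrightarrow> dist (f s x) (f t x) < e / 3"
    using t[of x, unfolded continuous_on_iff, rule_format, OF px(2), of "e/3"] e by auto
  show "\<exists>d>0. \<forall>q\<in>{0..T} \<times> UNIV. dist q p < d \<longrightarrow> dist (case q of (t, x) \<Rightarrow> f t x) (case p of (t, x) \<Rightarrow> f t x) < e"
  proof (intro exI[of _ "min d1 d2"] conjI ballI impI)
    fix q :: "real \<times> 'a" assume q: "q \<in> {0..T} \<times> UNIV" "dist q p < min d1 d2"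
    obtain s y where qy: "q = (s, y)" "s \<in> {0..T}" using q by auto
    have "dist s t < d2" "norm (y - x) < d1"
      using q(2) dist_fst_le[of q p] dist_snd_le[of q p] by (auto simp: qy px dist_norm)
    then have "dist (f s y) (f s x) \<le> e / 3" "dist (f s x) (f t x) < e / 3"
      using d1 d2 qy by auto
    then show "dist (case q of (t, x) \<Rightarrow> f t x) (case p of (t, x) \<Rightarrow> f t x) < e"
      using dist_triangle[of "f s y" "f t x" "f s x"] e by (simp add: qy px)
  qed (use d1 d2 in auto)
qed

lemma g_cont: "continuous_on ({0..T} \<times> UNIV) (\<lambda>(t, x). g t x)"
proof (rule joint_continuity[OF g_cont_t])
  fix x :: 'a and e :: real assume e: "0 < e"
  have "dist (g t y) (g t x) \<le> e" if "norm (y - x) < e / K" "t \<in> {0..T}" for t y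
  proof -
    have "dist (g t y) (g t x) \<le> K * norm (y - x)" using g_lip that by (simp add: dist_norm)
    also have "\<dots> \<le> K * (e / K)" using that K by (intro mult_left_mono) auto
    finally show ?thesis using K by simp
  qed
  then show "\<exists>d>0. \<forall>y. norm (y - x) < d \<longrightarrow> (\<forall>t\<in>{0..T}. dist (g t y) (g t x) \<le> e)"
    using e K by (intro exI[of _ "e / K"]) auto
qed

lemma comp_g_cont:
  assumes "continuous_on ({0..T} \<times> UNIV) (\<lambda>(t, x). f t x)"
  shows "continuous_on {0..T} (\<lambda>t. f t (g t x))"
  using continuous_on_compose2[OF assms continuous_on_Pair[OF continuous_on_id g_cont_t]] by fastforce

text \<open>\<open>v\<close> solves the linearised equation along the flow and turns out to be the spatial derivative of \<open>g\<close>.\<close>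

definition v :: "real \<Rightarrow> 'a \<Rightarrow> 'a \<Rightarrow> 'a" where
  "v t x h = (SOME y. is_sol (\<lambda>t. blinfun_apply (A t (g t x))) h y) t"

lemma A_lip: "t \<in> {0..T} \<Longrightarrow> norm (blinfun_apply (A t x) h - blinfun_apply (A t x) k) \<le> L * norm (h - k)"
  using A_apply[of t x "h - k"] by (simp add: blinfun.diff_right)

lemma A_g_cont: "continuous_on ({0..T} \<times> UNIV) (\<lambda>(t, h). blinfun_apply (A t (g t x)) h)"
proof -
  have "continuous_on ({0..T} \<times> (UNIV :: 'a set)) (\<lambda>p. A (fst p) (g (fst p) x))"
    by (rule continuous_on_compose2[OF comp_g_cont[OF contA]]) (auto intro: continuous_intros)
  then show ?thesis
    unfolding case_prod_unfold by (intro continuous_intros)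
qed

lemma v_is_sol: "is_sol (\<lambda>t. blinfun_apply (A t (g t x))) h (\<lambda>t. v t x h)"
proof -
  have "\<exists>y. is_sol (\<lambda>t. blinfun_apply (A t (g t x))) h y"
    by (rule ode_exists[OF T A_g_cont[of x] A_lip L, of h]) (auto simp: is_sol_def)
  then show ?thesis unfolding v_def by (rule someI_ex)
qed

lemma v_unique: "is_sol (\<lambda>t. blinfun_apply (A t (g t x))) h y \<Longrightarrow> t \<in> {0..T} \<Longrightarrow> y t = v t x h"
  by (rule is_sol_unique[OF _ v_is_sol]) (auto intro: A_lip)

lemma v_0: "v 0 x h = h"
  using v_is_sol by (auto simp: is_sol_def)

lemma v_deriv: "t \<in> {0..T} \<Longrightarrow> ((\<lambda>t. v t x h) has_vector_derivative A t (g t x) (v t x h)) (at t within {0..T})"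
  using v_is_sol by (auto simp: is_sol_def)

text \<open>Superposition: a linear combination of solutions solves the linearised equation again,
  and uniqueness identifies it.\<close>

lemma v_linear:
  assumes t: "t \<in> {0..T}" shows "linear (v t x)"
proof
  show "v t x (h + k) = v t x h + v t x k" for h k
    by (rule sym, rule v_unique[OF _ t])
      (auto simp: is_sol_def v_0 blinfun.add_right intro!: has_vector_derivative_add v_deriv)
  show "v t x (c *\<^sub>R h) = c *\<^sub>R v t x h" for c h
    by (rule sym, rule v_unique[OF _ t])
      (auto simp: is_sol_def v_0 blinfun.scaleR_right
        intro!: bounded_linear.has_vector_derivative[OF bounded_linear_scaleR_right] v_deriv)
qed

lemma v_bound: "t \<in> {0..T} \<Longrightarrow> norm (v t x h) \<le> K * norm h"
  using gronwall[where z="\<lambda>t. v t x h" and \<rho>=0, OF v_deriv _ L] A_apply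
  by (simp add: v_0 K_def)

lemma v_lower: "t \<in> {0..T} \<Longrightarrow> norm h \<le> exp (L * T) * norm (v t x h)"
  using gronwall_lower[where z="\<lambda>t. v t x h", OF v_deriv A_apply L]
  by (simp add: v_0)

text \<open>The difference solves the linearised equation along \<open>y\<close> with the source
  \<open>(A (g y) - A (g x)) (v x)\<close>. The source contributes \<open>L\<close>, one
  \<open>K\<close> from \<open>g_lip\<close> and one \<open>K\<close> from \<open>v_bound\<close>;
  Gronwall contributes the third \<open>K\<close>.\<close>

lemma v_lip:
  assumes t: "t \<in> {0..T}"
  shows "norm (v t y h - v t x h) \<le> K ^ 3 * L * norm (y - x) * norm h"
proof -
  define \<rho> where "\<rho> = L * (K * norm (y - x)) * (K * norm h)"
  have "norm (v t y h - v t x h) \<le> gronwall_const L T * (norm (v 0 y h - v 0 x h) + \<rho>)"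
  proof (rule gronwall[OF _ _ L _ t])
    fix s assume s: "s \<in> {0..T}"
    show "((\<lambda>t. v t y h - v t x h) has_vector_derivative
      (A s (g s y) (v s y h) - A s (g s x) (v s x h))) (at s within {0..T})"
      by (intro has_vector_derivative_diff v_deriv s)
    have 1: "A s (g s y) (v s y h) - A s (g s x) (v s x h) =
      A s (g s y) (v s y h - v s x h) + (A s (g s y) - A s (g s x)) (v s x h)"
      by (simp add: blinfun.diff_left blinfun.diff_right)
    have 2: "norm (A s (g s y) - A s (g s x)) * norm (v s x h) \<le> (L * (K * norm (y - x))) * (K * norm h)"
      using order_trans[OF lipA[OF s] mult_left_mono[OF g_lip[OF s] L]] v_bound[OF s] L K
      by (intro mult_mono) auto
    show "norm (A s (g s y) (v s y h) - A s (g s x) (v s x h)) \<le> L * norm (v s y h - v s x h) + \<rho>"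
      unfolding 1 \<rho>_def
      by (intro norm_triangle_mono A_apply[OF s] order_trans[OF norm_blinfun] 2)
  qed (use L K in \<open>auto simp: \<rho>_def\<close>)
  then show ?thesis by (simp add: v_0 \<rho>_def K_def[symmetric] power3_eq_cube mult_ac)
qed

lemma v_cont: "continuous_on ({0..T} \<times> UNIV) (\<lambda>(t, x). v t x h)"
proof (rule joint_continuity)
  show "continuous_on {0..T} (\<lambda>t. v t x h)" for x
    using v_deriv by (meson has_vector_derivative_continuous continuous_on_eq_continuous_within)
  fix x :: 'a and e :: real assume e: "0 < e"
  define C where "C = K ^ 3 * L * norm h + 1"
  have C: "0 < C" using K L by (auto simp: C_def intro!: add_nonneg_pos)
  have "dist (v t y h) (v t x h) \<le> e" if "norm (y - x) < e / C" "t \<in> {0..T}" for t y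
  proof -
    have "dist (v t y h) (v t x h) \<le> (K ^ 3 * L * norm h) * norm (y - x)"
      using v_lip that by (simp add: dist_norm mult_ac)
    also have "\<dots> \<le> C * (e / C)" using that C K L unfolding C_def
      by (intro mult_mono) auto
    finally show ?thesis using C by simp
  qed
  then show "\<exists>d>0. \<forall>y. norm (y - x) < d \<longrightarrow> (\<forall>t\<in>{0..T}. dist (v t y h) (v t x h) \<le> e)"
    using e C by (intro exI[of _ "e / C"]) auto
qed

text \<open>The remainder starts at 0 and solves the linearised equation with the Taylor remainder
  of \<open>F\<close> as its source, of size \<open>L * (K * norm (y - x))^2\<close>.\<close>

lemma g_taylor1:
  assumes t: "t \<in> {0..T}"
  shows "norm (g t y - g t x - v t x (y - x)) \<le> K ^ 3 * L * (norm (y - x))\<^sup>2"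
proof -
  define \<rho> where "\<rho> = L * (K * norm (y - x))\<^sup>2"
  have "norm (g t y - g t x - v t x (y - x)) \<le> gronwall_const L T * (norm (g 0 y - g 0 x - v 0 x (y - x)) + \<rho>)"
  proof (rule gronwall[OF _ _ L _ t])
    fix s assume s: "s \<in> {0..T}"
    show "((\<lambda>t. g t y - g t x - v t x (y - x)) has_vector_derivative
      (F s (g s y) - F s (g s x) - A s (g s x) (v s x (y - x)))) (at s within {0..T})"
      by (intro has_vector_derivative_diff v_deriv g_deriv s)
    have 1: "F s (g s y) - F s (g s x) - A s (g s x) (v s x (y - x)) =
      A s (g s x) (g s y - g s x - v s x (y - x)) + (F s (g s y) - F s (g s x) - A s (g s x) (g s y - g s x))"
      by (simp add: blinfun.diff_right)
    have 2: "L * (norm (g s y - g s x))\<^sup>2 \<le> \<rho>"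
      unfolding \<rho>_def using L by (intro mult_left_mono power_mono g_lip[OF s]) auto
    show "norm (F s (g s y) - F s (g s x) - A s (g s x) (v s x (y - x))) \<le>
      L * norm (g s y - g s x - v s x (y - x)) + \<rho>"
      unfolding 1 by (intro norm_triangle_mono A_apply[OF s] order_trans[OF taylorF[OF s] 2])
  qed (use L in \<open>auto simp: \<rho>_def\<close>)
  then show ?thesis
    by (simp add: v_0 g_0 \<rho>_def K_def[symmetric] power3_eq_cube power2_eq_square mult_ac)
qed

lemma has_derivative_if_quadratic:
  fixes f f' :: "'a \<Rightarrow> 'a"
  assumes lin: "linear f'" and q: "\<And>y. norm (f y - f x - f' (y - x)) \<le> C * (norm (y - x))\<^sup>2"
  shows "(f has_derivative f') (at x)"
proof (rule has_derivativeI_sandwich[of 1])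
  show "bounded_linear f'" using lin linear_conv_bounded_linear by blast
  show "((\<lambda>y. C * norm (y - x)) \<longlongrightarrow> 0) (at x)"
    by (rule tendsto_eq_intros tendsto_norm_zero LIM_zero tendsto_ident_at refl | simp)+
  fix y assume "y \<noteq> x" "dist y x < 1"
  then show "norm ((f y - f x) - f' (y - x)) / norm (y - x) \<le> C * norm (y - x)"
    using q[of y] by (simp add: divide_simps power2_eq_square mult.assoc)
qed auto

lemma g_has_derivative: "t \<in> {0..T} \<Longrightarrow> (g t has_derivative v t x) (at x)"
  by (rule has_derivative_if_quadratic[OF v_linear g_taylor1])

lemma g_bounded:
  obtains S where "0 \<le> S" "\<And>t x. t \<in> {0..T} \<Longrightarrow> x \<in> cball 0 R \<Longrightarrow> norm (g t x) \<le> S"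
proof -
  have "compact ((\<lambda>(t, x). g t x) ` ({0..T} \<times> cball 0 R))"
    by (intro compact_continuous_image continuous_on_subset[OF g_cont] compact_Times) auto
  then have "bounded ((\<lambda>(t, x). g t x) ` ({0..T} \<times> cball 0 R))"
    by (rule compact_imp_bounded)
  then obtain S where S: "\<And>p. p \<in> {0..T} \<times> cball 0 R \<Longrightarrow> norm ((\<lambda>(t, x). g t x) p) \<le> S"
    unfolding bounded_iff by blast
  show ?thesis
  proof (rule that[of "\<bar>S\<bar>"])
    show "norm (g t x) \<le> \<bar>S\<bar>" if "t \<in> {0..T}" "x \<in> cball 0 R" for t x
      using S[of "(t, x)"] that by auto
  qed simp
qed

text \<open>The second derivative has no explicit modulus of continuity; compactness supplies one
  that is uniform in time and over a ball of initial points. This uniformity matters because the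
  expansions are later applied at base points that move along a path.\<close>

lemma B_unif:
  assumes e: "0 < e"
  obtains d where "0 < d" "\<And>t x q. t \<in> {0..T} \<Longrightarrow> x \<in> cball 0 R \<Longrightarrow> norm (q - g t x) < d \<Longrightarrow>
    norm (B t q - B t (g t x)) \<le> e"
proof -
  obtain S where S: "0 \<le> S" "\<And>t x. t \<in> {0..T} \<Longrightarrow> x \<in> cball 0 R \<Longrightarrow> norm (g t x) \<le> S"
    using g_bounded[of R] by blast
  \<comment> \<open>The radius \<open>S + 1\<close> leaves room around the image of the ball; the
    competitor \<open>q\<close> stays within it since its distance from \<open>g t x\<close> is
    below 1.\<close>
  have "uniformly_continuous_on ({0..T} \<times> cball 0 (S + 1)) (\<lambda>(t, x). B t x)"
    by (intro compact_uniformly_continuous continuous_on_subset[OF contB] compact_Times) auto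
  from uniformly_continuous_onE[OF this e] obtain d where d: "0 < d"
    "\<And>p p'. p \<in> {0..T} \<times> cball 0 (S + 1) \<Longrightarrow> p' \<in> {0..T} \<times> cball 0 (S + 1) \<Longrightarrow> dist p' p < d \<Longrightarrow>
      dist (case p' of (t, x) \<Rightarrow> B t x) (case p of (t, x) \<Rightarrow> B t x) < e"
    by metis
  show ?thesis
  proof (rule that[of "min d 1"])
    fix t :: real and x q :: 'a assume *: "t \<in> {0..T}" "x \<in> cball 0 R" "norm (q - g t x) < min d 1"
    have "norm q \<le> norm (g t x) + norm (q - g t x)"
      by (metis add.commute diff_add_cancel norm_triangle_ineq)
    with S(2)[OF *(1,2)] * have "norm q \<le> S + 1" by simp
    then show "norm (B t q - B t (g t x)) \<le> e"
      using d(2)[of "(t, g t x)" "(t, q)"] S(2)[OF *(1,2)] * by (auto simp: dist_Pair_Pair dist_norm)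
  qed (use d in auto)
qed

text \<open>The modulus is transported to initial points by the Lipschitz bound of the flow, hence
  \<open>d / K\<close>. The second estimate is the mean value inequality for \<open>A t\<close>
  minus its linearisation at \<open>g t x\<close>.\<close>

lemma B_unif_init:
  assumes e: "0 < e"
  obtains d where "0 < d" "\<And>t x y. t \<in> {0..T} \<Longrightarrow> x \<in> cball 0 R \<Longrightarrow> norm (y - x) < d \<Longrightarrow>
    norm (B t (g t y) - B t (g t x)) \<le> e \<and>
    norm (A t (g t y) - A t (g t x) - B t (g t x) (g t y - g t x)) \<le> e * norm (g t y - g t x)"
proof -
  obtain d where d: "0 < d" "\<And>t x q. t \<in> {0..T} \<Longrightarrow> x \<in> cball 0 R \<Longrightarrow> norm (q - g t x) < d \<Longrightarrow>
    norm (B t q - B t (g t x)) \<le> e"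
    using B_unif[OF e, of R] by blast
  show ?thesis
  proof (rule that[of "d / K"])
    fix t :: real and x y :: 'a assume *: "t \<in> {0..T}" "x \<in> cball 0 R" "norm (y - x) < d / K"
    have "norm (g t y - g t x) \<le> K * norm (y - x)" by (rule g_lip[OF *(1)])
    also have "\<dots> < d" using * K by (simp add: field_simps)
    finally have gd: "norm (g t y - g t x) < d" .
    have "norm ((A t (g t y) - B t (g t x) (g t y)) - (A t (g t x) - B t (g t x) (g t x))) \<le> e * norm (g t y - g t x)"
    proof (rule differentiable_bound[of "closed_segment (g t x) (g t y)" _ "\<lambda>z. blinfun_apply (B t z - B t (g t x))"])
      fix z assume z: "z \<in> closed_segment (g t x) (g t y)"
      show "((\<lambda>y. A t y - blinfun_apply (B t (g t x)) y) has_derivative blinfun_apply (B t z - B t (g t x)))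
        (at z within closed_segment (g t x) (g t y))"
        using *(1) by (auto intro!: derivative_eq_intros has_derivative_at_withinI[OF derA] simp: blinfun.diff_left)
      show "onorm (blinfun_apply (B t z - B t (g t x))) \<le> e"
        using d(2)[OF *(1,2), of z] segment_bound1[OF z] gd
        by (simp add: norm_blinfun.rep_eq norm_minus_commute)
    qed auto
    then show "norm (B t (g t y) - B t (g t x)) \<le> e \<and>
      norm (A t (g t y) - A t (g t x) - B t (g t x) (g t y - g t x)) \<le> e * norm (g t y - g t x)"
      using d(2)[OF *(1,2) gd] by (simp add: blinfun.diff_right algebra_simps)
  qed (use d K in auto)
qed

text \<open>\<open>u\<close> solves the second variational equation and turns out to be the second spatial derivative of \<open>g\<close>.\<close>

definition u :: "real \<Rightarrow> 'a \<Rightarrow> 'a \<Rightarrow> 'a \<Rightarrow> 'a" where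
  "u t x h k = (SOME y. is_sol (\<lambda>t y. A t (g t x) y + B t (g t x) (v t x h) (v t x k)) 0 y) t"

lemma v_cont_t: "continuous_on {0..T} (\<lambda>t. v t x h)"
  using v_deriv by (meson has_vector_derivative_continuous continuous_on_eq_continuous_within)

lemma u_rhs_lip: "t \<in> {0..T} \<Longrightarrow> norm ((A t (g t x) y + B t (g t x) (v t x h) (v t x k)) -
  (A t (g t x) z + B t (g t x) (v t x h) (v t x k))) \<le> L * norm (y - z)"
  using A_lip by simp

lemma u_rhs_cont:
  "continuous_on ({0..T} \<times> UNIV) (\<lambda>(t, y). A t (g t x) y + B t (g t x) (v t x h) (v t x k))"
proof -
  have "continuous_on ({0..T} \<times> (UNIV :: 'a set)) (\<lambda>p. A (fst p) (g (fst p) x))"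
    by (rule continuous_on_compose2[OF comp_g_cont[OF contA]]) (auto intro: continuous_intros)
  moreover have "continuous_on ({0..T} \<times> (UNIV :: 'a set)) (\<lambda>p. B (fst p) (g (fst p) x))"
    by (rule continuous_on_compose2[OF comp_g_cont[OF contB]]) (auto intro: continuous_intros)
  moreover have "continuous_on ({0..T} \<times> (UNIV :: 'a set)) (\<lambda>p. v (fst p) x h)" for h
    by (rule continuous_on_compose2[OF v_cont_t]) (auto intro: continuous_intros)
  ultimately show ?thesis
    unfolding case_prod_unfold by (intro continuous_intros)
qed

lemma u_is_sol: "is_sol (\<lambda>t y. A t (g t x) y + B t (g t x) (v t x h) (v t x k)) 0 (\<lambda>t. u t x h k)"
proof -
  have "\<exists>y. is_sol (\<lambda>t y. A t (g t x) y + B t (g t x) (v t x h) (v t x k)) 0 y"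
    by (rule ode_exists[OF T u_rhs_cont[of x h k] u_rhs_lip L, of 0]) (auto simp: is_sol_def)
  then show ?thesis unfolding u_def by (rule someI_ex)
qed

lemma u_unique: "is_sol (\<lambda>t y. A t (g t x) y + B t (g t x) (v t x h) (v t x k)) 0 y \<Longrightarrow> t \<in> {0..T} \<Longrightarrow> y t = u t x h k"
  by (rule is_sol_unique[OF _ u_is_sol _ u_rhs_lip])

lemma u_0: "u 0 x h k = 0"
  using u_is_sol by (auto simp: is_sol_def)

lemma u_deriv: "t \<in> {0..T} \<Longrightarrow> ((\<lambda>t. u t x h k) has_vector_derivative
    A t (g t x) (u t x h k) + B t (g t x) (v t x h) (v t x k)) (at t within {0..T})"
  using u_is_sol by (auto simp: is_sol_def)

lemma u_linear1:
  assumes t: "t \<in> {0..T}" shows "linear (\<lambda>h. u t x h k)"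
proof
  show "u t x (h + h') k = u t x h k + u t x h' k" for h h'
    by (rule sym, rule u_unique[OF _ t])
      (auto simp: is_sol_def u_0 blinfun.add_right blinfun.add_left linear_add[OF v_linear] algebra_simps
         intro!: has_vector_derivative_eq_rhs[OF has_vector_derivative_add[OF u_deriv u_deriv]])
  show "u t x (c *\<^sub>R h) k = c *\<^sub>R u t x h k" for c h
    by (rule sym, rule u_unique[OF _ t])
      (auto simp: is_sol_def u_0 blinfun.scaleR_right blinfun.scaleR_left linear_scale[OF v_linear] algebra_simps
        intro!: has_vector_derivative_eq_rhs[OF bounded_linear.has_vector_derivative[OF bounded_linear_scaleR_right u_deriv]])
qed

lemma u_linear2:
  assumes t: "t \<in> {0..T}" shows "linear (\<lambda>k. u t x h k)"
proof
  show "u t x h (k + k') = u t x h k + u t x h k'" for k k'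
    by (rule sym, rule u_unique[OF _ t])
      (auto simp: is_sol_def u_0 blinfun.add_right blinfun.add_left linear_add[OF v_linear] algebra_simps
         intro!: has_vector_derivative_eq_rhs[OF has_vector_derivative_add[OF u_deriv u_deriv]])
  show "u t x h (c *\<^sub>R k) = c *\<^sub>R u t x h k" for c k
    by (rule sym, rule u_unique[OF _ t])
      (auto simp: is_sol_def u_0 blinfun.scaleR_right blinfun.scaleR_left linear_scale[OF v_linear] algebra_simps
        intro!: has_vector_derivative_eq_rhs[OF bounded_linear.has_vector_derivative[OF bounded_linear_scaleR_right u_deriv]])
qed

lemma B_v_bound:
  assumes t: "t \<in> {0..T}"
  shows "norm (B t x (v t y h) (v t z k)) \<le> L * K\<^sup>2 * norm h * norm k"
proof -
  have "norm (B t x (v t y h) (v t z k)) \<le> L * norm (v t y h) * norm (v t z k)"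
    by (rule B_apply[OF t])
  also have "\<dots> \<le> L * (K * norm h) * (K * norm k)"
    using L K by (intro mult_mono v_bound[OF t] mult_left_mono) auto
  finally show ?thesis by (simp add: power2_eq_square mult_ac)
qed

lemma u_bound:
  assumes t: "t \<in> {0..T}"
  shows "norm (u t x h k) \<le> K ^ 3 * L * norm h * norm k"
proof -
  have "norm (u t x h k) \<le> gronwall_const L T * (norm (u 0 x h k) + L * K\<^sup>2 * norm h * norm k)"
  proof (rule gronwall[OF u_deriv _ L _ t])
    fix s assume "s \<in> {0..T}"
    then show "norm (A s (g s x) (u s x h k) + B s (g s x) (v s x h) (v s x k)) \<le>
      L * norm (u s x h k) + L * K\<^sup>2 * norm h * norm k"
      by (intro norm_triangle_mono A_apply B_v_bound)
  qed (use L K in auto)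
  then show ?thesis by (simp add: u_0 K_def[symmetric] power3_eq_cube power2_eq_square mult_ac)
qed

text \<open>The difference of two second variations has a source of four terms. The three that
  contain differences of \<open>A\<close> or of \<open>v\<close> are of order
  \<open>norm (y - x)\<close> and are collected in \<open>C\<close>; the difference of
  \<open>B\<close> is only as small as the modulus permits.\<close>

lemma u_unif:
  assumes e: "0 < e"
  obtains d where "0 < d" "\<And>t x y h k. t \<in> {0..T} \<Longrightarrow> x \<in> cball 0 R \<Longrightarrow> norm (y - x) < d \<Longrightarrow>
    norm (u t y h k - u t x h k) \<le> e * norm h * norm k"
proof -
  define C where "C = L * K * (K ^ 3 * L) + L * K ^ 4 * L + L * K ^ 4 * L + 1"
  have C: "1 \<le> C" using L K by (auto simp: C_def)
  \<comment> \<open>Gronwall turns the source into \<open>K * (C * e' + e' * K\<^sup>2)\<close> as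
    soon as \<open>norm (y - x) < e'\<close>; this choice makes it equal to
    \<open>e\<close>.\<close>
  define e' where "e' = e / (K * (K\<^sup>2 + C))"
  have e': "0 < e'" using e C K by (auto simp: e'_def intro!: divide_pos_pos mult_pos_pos add_nonneg_pos)
  obtain d where d: "0 < d" "\<And>t x y. t \<in> {0..T} \<Longrightarrow> x \<in> cball 0 R \<Longrightarrow> norm (y - x) < d \<Longrightarrow>
    norm (B t (g t y) - B t (g t x)) \<le> e'"
    using B_unif_init[OF e', of R] by metis
  show ?thesis
  proof (rule that[of "min d e'"])
    fix t :: real and x y h k :: 'a assume t: "t \<in> {0..T}" and x: "x \<in> cball 0 R" and y: "norm (y - x) < min d e'"
    define \<rho> where "\<rho> = (C * norm (y - x) + e' * K\<^sup>2) * norm h * norm k"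
    have "norm (u t y h k - u t x h k) \<le> gronwall_const L T * (norm (u 0 y h k - u 0 x h k) + \<rho>)"
    proof (rule gronwall[OF has_vector_derivative_diff[OF u_deriv u_deriv] _ L _ t])
      fix s assume s: "s \<in> {0..T}"
      let ?r = "A s (g s y) (u s y h k) + B s (g s y) (v s y h) (v s y k) - (A s (g s x) (u s x h k) + B s (g s x) (v s x h) (v s x k))"
      have eq: "?r = A s (g s y) (u s y h k - u s x h k) + ((A s (g s y) - A s (g s x)) (u s x h k) +
        ((B s (g s y) - B s (g s x)) (v s y h) (v s y k) + (B s (g s x) (v s y h - v s x h) (v s y k) +
          B s (g s x) (v s x h) (v s y k - v s x k))))"
        by (simp add: blinfun.diff_left blinfun.diff_right)
      have 1: "norm ((A s (g s y) - A s (g s x)) (u s x h k)) \<le> (L * (K * norm (y - x))) * (K ^ 3 * L * norm h * norm k)"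
        using order_trans[OF lipA[OF s] mult_left_mono[OF g_lip[OF s] L]] u_bound[OF s] L K
        by (intro order_trans[OF norm_blinfun] mult_mono) auto
      have 2: "norm ((B s (g s y) - B s (g s x)) (v s y h) (v s y k)) \<le> e' * (K * norm h) * (K * norm k)"
        using d(2)[OF s x] y v_bound[OF s] K e'
        by (intro order_trans[OF norm_blinfun2] mult_mono mult_nonneg_nonneg) auto
      have 3: "norm (B s (g s x) (v s y h - v s x h) (v s y k)) \<le> L * (K ^ 3 * L * norm (y - x) * norm h) * (K * norm k)"
        using v_bound[OF s] v_lip[OF s] L K
        by (intro order_trans[OF B_apply[OF s]] mult_mono mult_nonneg_nonneg) auto
      have 4: "norm (B s (g s x) (v s x h) (v s y k - v s x k)) \<le> L * (K * norm h) * (K ^ 3 * L * norm (y - x) * norm k)"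
        using v_bound[OF s] v_lip[OF s] L K
        by (intro order_trans[OF B_apply[OF s]] mult_mono mult_nonneg_nonneg) auto
      have "norm ?r \<le> L * norm (u s y h k - u s x h k) + (((L * (K * norm (y - x))) * (K ^ 3 * L * norm h * norm k)) +
        (e' * (K * norm h) * (K * norm k) + (L * (K ^ 3 * L * norm (y - x) * norm h) * (K * norm k) +
          L * (K * norm h) * (K ^ 3 * L * norm (y - x) * norm k))))"
        unfolding eq by (intro norm_triangle_mono A_apply[OF s] 1 2 3 4)
      also have "\<dots> = L * norm (u s y h k - u s x h k) + (((C - 1) * norm (y - x) + e' * K\<^sup>2) * norm h * norm k)"
        by (simp add: C_def algebra_simps power2_eq_square power3_eq_cube power4_eq_xxxx)
      also have "\<dots> \<le> L * norm (u s y h k - u s x h k) + \<rho>"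
        unfolding \<rho>_def by (intro add_left_mono mult_right_mono add_right_mono) auto
      finally show "norm ?r \<le> L * norm (u s y h k - u s x h k) + \<rho>" .
    qed (use C e' in \<open>auto simp: \<rho>_def\<close>)
    also have "\<dots> \<le> K * ((C * e' + e' * K\<^sup>2) * norm h * norm k)"
      using y K C unfolding \<rho>_def u_0 K_def[symmetric] 
      by (auto intro!: mult_left_mono mult_right_mono)
    also have "\<dots> = e * norm h * norm k"
    proof -
      have "K * (C * e' + e' * K\<^sup>2) = e' * (K * (K\<^sup>2 + C))" by (simp add: algebra_simps)
      also have "\<dots> = e" using K C add_nonneg_pos[of "K\<^sup>2" C] by (simp add: e'_def)
      finally show ?thesis by (metis mult.assoc)
    qed
    finally show "norm (u t y h k - u t x h k) \<le> e * norm h * norm k" .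
  qed (use d e' in auto)
qed

lemma u_cont: "continuous_on ({0..T} \<times> UNIV) (\<lambda>(t, x). u t x h k)"
proof (rule joint_continuity)
  show "continuous_on {0..T} (\<lambda>t. u t x h k)" for x
    using u_deriv by (meson has_vector_derivative_continuous continuous_on_eq_continuous_within)
  fix x :: 'a and e :: real assume e: "0 < e"
  define e' where "e' = e / (norm h * norm k + 1)"
  have e': "0 < e'" using e by (auto simp: e'_def intro!: divide_pos_pos add_nonneg_pos)
  obtain d where d: "0 < d" "\<And>t x' y h k. t \<in> {0..T} \<Longrightarrow> x' \<in> cball 0 (norm x) \<Longrightarrow> norm (y - x') < d \<Longrightarrow>
    norm (u t y h k - u t x' h k) \<le> e' * norm h * norm k"
    using u_unif[OF e'] by metis
  have "e' * norm h * norm k \<le> e"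
    using e by (simp add: e'_def divide_simps add_nonneg_pos)
  then show "\<exists>d>0. \<forall>y. norm (y - x) < d \<longrightarrow> (\<forall>t\<in>{0..T}. dist (u t y h k) (u t x h k) \<le> e)"
    using d(1) d(2)[of _ x _ h k] by (intro exI[of _ d]) (force simp: dist_norm)
qed

text \<open>The remainder solves the linearised equation with three sources: a product of two
  first-order differences, the Taylor remainder of \<open>A\<close>, and \<open>B\<close> applied to
  the Taylor remainder of \<open>g\<close>. The outer two are of second order in
  \<open>y - x\<close>; the middle one is small relative to \<open>y - x\<close>, uniformly over the
  ball and in time.\<close>

lemma v_taylor:
  assumes e: "0 < e"
  obtains d where "0 < d" "\<And>t x y k. t \<in> {0..T} \<Longrightarrow> x \<in> cball 0 R \<Longrightarrow> norm (y - x) < d \<Longrightarrow>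
    norm (v t y k - v t x k - u t x (y - x) k) \<le> e * norm (y - x) * norm k"
proof -
  define C where "C = L * K * (K ^ 3 * L) + L * (K ^ 3 * L) * K + 1"
  have C: "1 \<le> C" using L K by (auto simp: C_def)
  define e' where "e' = e / (K * (K\<^sup>2 + C))"
  have e': "0 < e'" using e C K by (auto simp: e'_def intro!: divide_pos_pos mult_pos_pos add_nonneg_pos)
  obtain d where d: "0 < d" "\<And>t x y. t \<in> {0..T} \<Longrightarrow> x \<in> cball 0 R \<Longrightarrow> norm (y - x) < d \<Longrightarrow>
    norm (A t (g t y) - A t (g t x) - B t (g t x) (g t y - g t x)) \<le> e' * norm (g t y - g t x)"
    using B_unif_init[OF e', of R] by metis
  show ?thesis
  proof (rule that[of "min d e'"])
    fix t :: real and x y k :: 'a assume t: "t \<in> {0..T}" and x: "x \<in> cball 0 R" and y: "norm (y - x) < min d e'"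
    define h where "h = y - x"
    define \<rho> where "\<rho> = (C * norm h + e' * K\<^sup>2) * norm h * norm k"
    have "norm (v t y k - v t x k - u t x h k) \<le> gronwall_const L T * (norm (v 0 y k - v 0 x k - u 0 x h k) + \<rho>)"
    proof (rule gronwall[OF has_vector_derivative_diff[OF has_vector_derivative_diff[OF v_deriv v_deriv] u_deriv] _ L _ t])
      fix s assume s: "s \<in> {0..T}"
      let ?r = "A s (g s y) (v s y k) - A s (g s x) (v s x k) - (A s (g s x) (u s x h k) + B s (g s x) (v s x h) (v s x k))"
      have eq: "?r = A s (g s x) (v s y k - v s x k - u s x h k) + ((A s (g s y) - A s (g s x)) (v s y k - v s x k) +
        ((A s (g s y) - A s (g s x) - B s (g s x) (g s y - g s x)) (v s x k) + 
         B s (g s x) (g s y - g s x - v s x h) (v s x k)))"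
        by (simp add: blinfun.diff_left blinfun.diff_right)
      have 1: "norm ((A s (g s y) - A s (g s x)) (v s y k - v s x k)) \<le> (L * (K * norm h)) * (K ^ 3 * L * norm h * norm k)"
        using order_trans[OF lipA[OF s] mult_left_mono[OF g_lip[OF s] L]] v_lip[OF s] L K
        by (intro order_trans[OF norm_blinfun] mult_mono) (auto simp: h_def)
      have 2: "norm ((A s (g s y) - A s (g s x) - B s (g s x) (g s y - g s x)) (v s x k)) \<le> (e' * (K * norm h)) * (K * norm k)"
        using order_trans[OF d(2)[OF s x] mult_left_mono[OF g_lip[OF s], of e']] y v_bound[OF s] K e'
        by (intro order_trans[OF norm_blinfun] mult_mono mult_nonneg_nonneg) (auto simp: h_def)
      have 3: "norm (B s (g s x) (g s y - g s x - v s x h) (v s x k)) \<le> L * (K ^ 3 * L * (norm h)\<^sup>2) * (K * norm k)"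
        using v_bound[OF s] g_taylor1[OF s] L K
        by (intro order_trans[OF B_apply[OF s]] mult_mono mult_nonneg_nonneg) (auto simp: h_def)
      have "norm ?r \<le> L * norm (v s y k - v s x k - u s x h k) + ((L * (K * norm h)) * (K ^ 3 * L * norm h * norm k) +
         ((e' * (K * norm h)) * (K * norm k) + L * (K ^ 3 * L * (norm h)\<^sup>2) * (K * norm k)))"
        unfolding eq by (intro norm_triangle_mono A_apply[OF s] 1 2 3)
      also have "\<dots> = L * norm (v s y k - v s x k - u s x h k) + ((C - 1) * norm h + e' * K\<^sup>2) * norm h * norm k"
        by (simp add: C_def algebra_simps power2_eq_square power3_eq_cube power4_eq_xxxx)
      also have "\<dots> \<le> L * norm (v s y k - v s x k - u s x h k) + \<rho>"
        unfolding \<rho>_def by (intro add_left_mono mult_right_mono add_right_mono) auto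
      finally show "norm ?r \<le> L * norm (v s y k - v s x k - u s x h k) + \<rho>" .
    qed (use C e' in \<open>auto simp: \<rho>_def\<close>)
    also have "\<dots> \<le> K * ((C * e' + e' * K\<^sup>2) * norm h * norm k)"
      using y K C unfolding \<rho>_def u_0 v_0 K_def[symmetric] 
      by (auto intro!: mult_left_mono mult_right_mono simp: h_def)
    also have "\<dots> = e * norm h * norm k"
    proof -
      have "K * (C * e' + e' * K\<^sup>2) = e' * (K * (K\<^sup>2 + C))" by (simp add: algebra_simps)
      also have "\<dots> = e" using K C add_nonneg_pos[of "K\<^sup>2" C] by (simp add: e'_def)
      finally show ?thesis by (metis mult.assoc)
    qed
    finally show "norm (v t y k - v t x k - u t x (y - x) k) \<le> e * norm (y - x) * norm k"
      by (simp add: h_def)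
  qed (use d e' in auto)
qed

lemma v_has_derivative:
  assumes t: "t \<in> {0..T}"
  shows "((\<lambda>x. v t x k) has_derivative (\<lambda>h. u t x h k)) (at x)"
  unfolding has_derivative_at_alt
proof (intro conjI allI impI)
  show "bounded_linear (\<lambda>h. u t x h k)"
    using u_linear1[OF t] linear_conv_bounded_linear by blast
  fix e :: real assume e: "0 < e"
  define e' where "e' = e / (norm k + 1)"
  have e': "0 < e'" using e by (auto simp: e'_def intro!: divide_pos_pos add_nonneg_pos)
  obtain d where d: "0 < d" "\<And>t x' y k. t \<in> {0..T} \<Longrightarrow> x' \<in> cball 0 (norm x) \<Longrightarrow> norm (y - x') < d \<Longrightarrow>
    norm (v t y k - v t x' k - u t x' (y - x') k) \<le> e' * norm (y - x') * norm k"
    using v_taylor[OF e', of "norm x"] by metis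
  have "e' * norm k \<le> e"
    using e by (simp add: e'_def divide_simps add_nonneg_pos)
  then have *: "e' * norm (y - x) * norm k \<le> e * norm (y - x)" for y
    using mult_right_mono[of "e' * norm k" e "norm (y - x)"] by (simp add: mult_ac)
  show "\<exists>d>0. \<forall>y. norm (y - x) < d \<longrightarrow> norm (v t y k - v t x k - u t x (y - x) k) \<le> e * norm (y - x)"
    using d(1) d(2)[OF t, of x _ k] order_trans[OF _ *] by (intro exI[of _ d]) force
qed

text \<open>The factor of the backward estimates: a Lipschitz constant of every inverse map
  \<open>inv (g t)\<close> and a bound for the inverse Jacobian at every point.\<close>

definition E :: real where "E = exp (L * T)"

lemma E: "1 \<le> E" "0 \<le> E" using T L by (auto simp: E_def)

section \<open>The inverse flow and the inverse Jacobian\<close>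

lemma inj_g: "t \<in> {0..T} \<Longrightarrow> inj (g t)"
  using g_lower[of t] by (intro injI) (metis cancel_comm_monoid_add_class.diff_cancel mult_zero_right norm_le_zero_iff norm_zero right_minus_eq)

lemma g_cont_x: "t \<in> {0..T} \<Longrightarrow> continuous_on UNIV (g t)"
  by (meson g_has_derivative has_derivative_continuous continuous_at_imp_continuous_on)

text \<open>The image is open by invariance of domain, and closed because the lower bound pulls
  Cauchy sequences of values back to Cauchy sequences of points. A nonempty open and closed set is
  the whole space.\<close>

lemma surj_g:
  assumes t: "t \<in> {0..T}"
  shows "surj (g t)"
proof -
  have "open (range (g t))"
    using invariance_of_domain[OF g_cont_x[OF t] open_UNIV] inj_g[OF t] by simp
  moreover have "closed (range (g t))"
  proof (rule complete_imp_closed, rule completeI)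
    fix f :: "nat \<Rightarrow> 'a" assume f: "\<forall>n. f n \<in> range (g t)" "Cauchy f"
    from f(1) have "\<forall>n. \<exists>x. f n = g t x" by blast
    then obtain x where x: "\<And>n. f n = g t (x n)" by metis
    have "Cauchy x"
    proof (rule metric_CauchyI)
      fix e :: real assume "0 < e"
      then obtain N where N: "\<And>m n. m \<ge> N \<Longrightarrow> n \<ge> N \<Longrightarrow> dist (f m) (f n) < e / E"
        using metric_CauchyD[OF f(2), of "e / E"] E by auto
      have "dist (x m) (x n) < e" if "m \<ge> N" "n \<ge> N" for m n
      proof -
        have "dist (x m) (x n) \<le> E * dist (f m) (f n)"
          using g_lower[OF t] by (simp add: x dist_norm E_def)
        also have "\<dots> < e" using N[OF that] E by (simp add: field_simps)
        finally show ?thesis .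
      qed
      then show "\<exists>N. \<forall>m\<ge>N. \<forall>n\<ge>N. dist (x m) (x n) < e" by blast
    qed
    then obtain l where "x \<longlonglongrightarrow> l" using Cauchy_convergent convergent_def by blast
    then have "(\<lambda>n. g t (x n)) \<longlonglongrightarrow> g t l"
      using g_cont_x[OF t] by (metis continuous_on_tendsto_compose UNIV_I always_eventually)
    moreover have "f = (\<lambda>n. g t (x n))" using x by blast
    ultimately show "\<exists>l\<in>range (g t). f \<longlonglongrightarrow> l" by blast
  qed
  ultimately show ?thesis
    using clopen[of "range (g t)"] by auto
qed

lemma g_inv [simp]: "t \<in> {0..T} \<Longrightarrow> g t (inv (g t) y) = y"
  by (simp add: surj_f_inv_f surj_g)

lemma inv_g [simp]: "t \<in> {0..T} \<Longrightarrow> inv (g t) (g t x) = x"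
  by (simp add: inj_g)

text \<open>With \<open>x\<close> the preimage of \<open>y\<close> at time \<open>t\<close>, the
  lower bound at the new time \<open>s\<close> reduces the claim to the continuity of
  \<open>g s x\<close> in \<open>s\<close> for this one point.\<close>

lemma inv_g_cont: "continuous_on ({0..T} \<times> UNIV) (\<lambda>(t, y). inv (g t) y)"
  unfolding continuous_on_iff
proof (intro ballI allI impI)
  fix p :: "real \<times> 'a" and e :: real assume p: "p \<in> {0..T} \<times> UNIV" and e: "0 < e"
  obtain t y where py: "p = (t, y)" "t \<in> {0..T}" using p by auto
  define x where "x = inv (g t) y"
  have y: "y = g t x" using py by (simp add: x_def)
  obtain d where d: "d > 0" "\<And>s. s \<in> {0..T} \<Longrightarrow> dist s t < d \<Longrightarrow> dist (g s x) (g t x) < e / (2 * E)"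
    using g_cont_t[of x, unfolded continuous_on_iff, rule_format, OF py(2), of "e / (2 * E)"] e E by auto
  show "\<exists>d>0. \<forall>q\<in>{0..T} \<times> UNIV. dist q p < d \<longrightarrow>
    dist (case q of (t, y) \<Rightarrow> inv (g t) y) (case p of (t, y) \<Rightarrow> inv (g t) y) < e"
  proof (intro exI[of _ "min d (e / (2 * E))"] conjI ballI impI)
    fix q :: "real \<times> 'a" assume q: "q \<in> {0..T} \<times> UNIV" "dist q p < min d (e / (2 * E))"
    obtain s z where qz: "q = (s, z)" "s \<in> {0..T}" using q by auto
    have s: "dist s t < d" "dist z y < e / (2 * E)"
      using q(2) dist_fst_le[of q p] dist_snd_le[of q p] by (auto simp: qz py)
    have "dist (inv (g s) z) x \<le> E * dist z (g s x)"
      using g_lower[OF qz(2), of "inv (g s) z" x] qz by (simp add: dist_norm E_def)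
    also have "\<dots> \<le> E * (dist z y + dist (g s x) (g t x))"
      using E dist_triangle2[of z "g s x" y] by (intro mult_left_mono) (auto simp: y)
    also have "\<dots> < E * (e / (2 * E) + e / (2 * E))"
      using s d(2)[OF qz(2) s(1)] E by (intro mult_strict_left_mono add_strict_mono) auto
    also have "\<dots> = e" using E by simp
    finally show "dist (case q of (t, y) \<Rightarrow> inv (g t) y) (case p of (t, y) \<Rightarrow> inv (g t) y) < e"
      by (simp add: qz py x_def)
  qed (use d e E in auto)
qed

text \<open>The inverse Jacobian as a linear map.\<close>

definition w :: "real \<Rightarrow> 'a \<Rightarrow> 'a \<Rightarrow> 'a" where
  "w t x = inv (v t x)"

lemma bij_v:
  assumes t: "t \<in> {0..T}" shows "bij (v t x)"
proof -
  have "z = 0" if "v t x z = 0" for z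
    using v_lower[OF t, of z x] that by simp
  then have "inj (v t x)"
    using linear_injective_0[OF v_linear[OF t]] by blast
  then show ?thesis
    using linear_injective_imp_surjective[OF v_linear[OF t]] by (auto simp: bij_def)
qed

lemma v_w [simp]: "t \<in> {0..T} \<Longrightarrow> v t x (w t x y) = y"
  unfolding w_def using bij_v by (meson bij_inv_eq_iff)

lemma w_v [simp]: "t \<in> {0..T} \<Longrightarrow> w t x (v t x y) = y"
  unfolding w_def using bij_v by (meson bij_is_inj inv_f_f)

lemma w_linear: assumes t: "t \<in> {0..T}" shows "linear (w t x)"
proof
  show "w t x (a + b) = w t x a + w t x b" for a b
    by (metis linear_add[OF v_linear[OF t]] v_w[OF t] w_v[OF t])
  show "w t x (c *\<^sub>R a) = c *\<^sub>R w t x a" for c a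
    by (metis linear_scale[OF v_linear[OF t]] v_w[OF t] w_v[OF t])
qed

lemma w_bound: "t \<in> {0..T} \<Longrightarrow> norm (w t x y) \<le> E * norm y"
  using v_lower[of t "w t x y" x] by (simp add: E_def)

text \<open>Applying \<open>v s z\<close> to the difference of the old and the new value gives
  \<open>v s z k - v t x k\<close> for the fixed vector \<open>k\<close>; continuity of
  \<open>v\<close> and the bound \<open>E\<close> for the inverse do the rest.\<close>

lemma w_cont: "continuous_on ({0..T} \<times> UNIV) (\<lambda>(t, x). w t x y)"
  unfolding continuous_on_iff
proof (intro ballI allI impI)
  fix p :: "real \<times> 'a" and e :: real assume p: "p \<in> {0..T} \<times> UNIV" and e: "0 < e"
  obtain t x where px: "p = (t, x)" "t \<in> {0..T}" using p by auto
  define k where "k = w t x y"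
  obtain d where d: "d > 0" "\<And>q. q \<in> {0..T} \<times> UNIV \<Longrightarrow> dist q p < d \<Longrightarrow>
      dist (case q of (t, x) \<Rightarrow> v t x k) (case p of (t, x) \<Rightarrow> v t x k) < e / E"
    using v_cont[of k, unfolded continuous_on_iff, rule_format, OF p, of "e / E"] e E by auto
  show "\<exists>d>0. \<forall>q\<in>{0..T} \<times> UNIV. dist q p < d \<longrightarrow>
    dist (case q of (t, x) \<Rightarrow> w t x y) (case p of (t, x) \<Rightarrow> w t x y) < e"
  proof (intro exI[of _ d] conjI ballI impI)
    fix q :: "real \<times> 'a" assume q: "q \<in> {0..T} \<times> UNIV" "dist q p < d"
    obtain s z where qz: "q = (s, z)" "s \<in> {0..T}" using q by auto
    have "norm (k - w s z y) \<le> E * norm (v s z (k - w s z y))"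
      using v_lower[OF qz(2)] by (simp add: E_def)
    also have "v s z (k - w s z y) = v s z k - v t x k"
      using px qz by (simp add: linear_diff[OF v_linear] k_def)
    also have "E * norm \<dots> < E * (e / E)"
      using d(2)[OF q] E by (intro mult_strict_left_mono) (auto simp: qz px dist_norm)
    finally show "dist (case q of (t, x) \<Rightarrow> w t x y) (case p of (t, x) \<Rightarrow> w t x y) < e"
      using E by (simp add: qz px dist_norm k_def norm_minus_commute)
  qed (use d in auto)
qed

section \<open>Second-order expansions of the flow and of its inverse\<close>

lemma g_taylor2:
  assumes e: "0 < e"
  obtains d where "0 < d" "\<And>t x h. t \<in> {0..T} \<Longrightarrow> x \<in> cball 0 R \<Longrightarrow> norm h < d \<Longrightarrow>
    norm (g t (x + h) - g t x - v t x h - (1 / 2) *\<^sub>R u t x h h) \<le> e * (norm h)\<^sup>2"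
proof -
  obtain d where d: "0 < d" "\<And>t x y k. t \<in> {0..T} \<Longrightarrow> x \<in> cball 0 R \<Longrightarrow> norm (y - x) < d \<Longrightarrow>
    norm (v t y k - v t x k - u t x (y - x) k) \<le> e * norm (y - x) * norm k"
    using v_taylor[OF e, of R] by blast
  show ?thesis
  proof (rule that[OF d(1)])
    fix t :: real and x h :: 'a assume t: "t \<in> {0..T}" and x: "x \<in> cball 0 R" and h: "norm h < d"
    \<comment> \<open>The flow along the segment minus its first- and second-order terms: the
      derivative of \<open>f\<close> is exactly the remainder of \<open>v_taylor\<close> in
      direction \<open>h\<close>, so the mean value inequality integrates that expansion.\<close>
    define f where "f \<theta> = g t (x + \<theta> *\<^sub>R h) - \<theta> *\<^sub>R v t x h - (\<theta>\<^sup>2 / 2) *\<^sub>R u t x h h" for \<theta> :: real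
    have "norm (f 1 - f 0) \<le> (e * (norm h)\<^sup>2) * norm (1 - (0 :: real))"
    proof (rule differentiable_bound[of "{0..1}" f "\<lambda>\<theta> s. s *\<^sub>R (v t (x + \<theta> *\<^sub>R h) h - v t x h - \<theta> *\<^sub>R u t x h h)"])
      fix \<theta> :: real assume \<theta>: "\<theta> \<in> {0..1}"
      show "(f has_derivative (\<lambda>s. s *\<^sub>R (v t (x + \<theta> *\<^sub>R h) h - v t x h - \<theta> *\<^sub>R u t x h h))) (at \<theta> within {0..1})"
      proof -
        have "((\<lambda>\<theta>. g t (x + \<theta> *\<^sub>R h)) has_derivative (\<lambda>s. v t (x + \<theta> *\<^sub>R h) (s *\<^sub>R h))) (at \<theta> within {0..1})"
          by (rule has_derivative_compose[OF _ g_has_derivative[OF t]]) (auto intro!: derivative_eq_intros)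
        then show ?thesis
          unfolding f_def
          by (auto intro!: derivative_eq_intros simp: linear_scale[OF v_linear[OF t]] algebra_simps fun_eq_iff)
      qed
      have "norm (\<theta> *\<^sub>R h) \<le> norm h" using \<theta> by (simp add: mult_left_le_one_le)
      have "norm (v t (x + \<theta> *\<^sub>R h) h - v t x h - \<theta> *\<^sub>R u t x h h) \<le> e * norm (\<theta> *\<^sub>R h) * norm h"
        using d(2)[OF t x, of "x + \<theta> *\<^sub>R h" h] h \<open>norm (\<theta> *\<^sub>R h) \<le> norm h\<close>
        by (simp add: linear_scale[OF u_linear1[OF t]])
      also have "\<dots> \<le> e * norm h * norm h"
        using e \<open>norm (\<theta> *\<^sub>R h) \<le> norm h\<close> by (intro mult_right_mono mult_left_mono) auto
      finally have *: "norm (v t (x + \<theta> *\<^sub>R h) h - v t x h - \<theta> *\<^sub>R u t x h h) \<le> e * (norm h)\<^sup>2"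
        by (simp add: power2_eq_square mult.assoc)
      show "onorm (\<lambda>s. s *\<^sub>R (v t (x + \<theta> *\<^sub>R h) h - v t x h - \<theta> *\<^sub>R u t x h h)) \<le> e * (norm h)\<^sup>2"
      proof (rule onorm_le)
        show "norm (s *\<^sub>R (v t (x + \<theta> *\<^sub>R h) h - v t x h - \<theta> *\<^sub>R u t x h h)) \<le> e * (norm h)\<^sup>2 * norm s" for s :: real
          using mult_left_mono[OF *, of "norm s"] by (simp add: mult_ac)
      qed
    qed auto
    then show "norm (g t (x + h) - g t x - v t x h - (1 / 2) *\<^sub>R u t x h h) \<le> e * (norm h)\<^sup>2"
      by (simp add: f_def algebra_simps)
  qed
qed

text \<open>In the notation of the paper, \<open>q t x e_j e_k\<close> is the inverse Jacobian applied to \<open>c_jk(t;0,x)\<close>.\<close>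

definition q :: "real \<Rightarrow> 'a \<Rightarrow> 'a \<Rightarrow> 'a \<Rightarrow> 'a" where
  "q t x a b = w t x (u t x (w t x a) (w t x b))"

text \<open>Bound of the bilinear map \<open>q\<close>: one factor \<open>E\<close> for the outer
  inverse Jacobian and one for each argument, while \<open>K ^ 3 * L\<close> bounds
  \<open>u\<close>.\<close>

definition Q :: real where "Q = E ^ 3 * (K ^ 3 * L)"

lemma Q: "0 \<le> Q" using E K L by (simp add: Q_def)

lemma q_bound: 
  assumes t: "t \<in> {0..T}" shows "norm (q t x a b) \<le> Q * norm a * norm b"
proof -
  have "norm (q t x a b) \<le> E * (K ^ 3 * L * norm (w t x a) * norm (w t x b))"
    unfolding q_def using E by (intro order_trans[OF w_bound[OF t]] mult_left_mono u_bound t) auto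
  also have "\<dots> \<le> E * (K ^ 3 * L * (E * norm a) * (E * norm b))"
    using E K L by (intro mult_left_mono mult_mono w_bound[OF t]) auto
  finally show ?thesis by (simp add: Q_def power3_eq_cube mult_ac)
qed

lemma q_linear1: "t \<in> {0..T} \<Longrightarrow> linear (\<lambda>a. q t x a b)"
  unfolding q_def
  using linear_compose[OF linear_compose[OF w_linear u_linear1] w_linear] by (simp add: o_def)

lemma q_linear2: "t \<in> {0..T} \<Longrightarrow> linear (\<lambda>b. q t x a b)"
  unfolding q_def
  using linear_compose[OF linear_compose[OF w_linear u_linear2] w_linear] by (simp add: o_def)

text \<open>The expansion of the flow is solved for \<open>h = y - x\<close>: applying
  \<open>w\<close> to the increment of the values gives \<open>h\<close> plus half of
  \<open>w (u h h)\<close> up to a small term. Inside the quadratic term \<open>h\<close> may be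
  replaced by \<open>w\<close> of the increment at the cost of a third-order error. The second
  derivative of the inverse thus appears as \<open>- q\<close>.\<close>

lemma inverse_taylor2:
  assumes e: "0 < e"
  obtains d where "0 < d" "\<And>t x y. t \<in> {0..T} \<Longrightarrow> x \<in> cball 0 R \<Longrightarrow> norm (g t y - g t x) < d \<Longrightarrow>
    norm (y - x - w t x (g t y - g t x) + (1 / 2) *\<^sub>R q t x (g t y - g t x) (g t y - g t x))
      \<le> e * (norm (g t y - g t x))\<^sup>2"
proof -
  define U where "U = K ^ 3 * L"
  have U: "0 \<le> U" using K L by (simp add: U_def)
  \<comment> \<open>The quotient turns the flow's own remainder, seen through \<open>w\<close> and
    \<open>norm h \<le> E * norm \<delta>\<close>, into at most half of the allowed error; the cap 1
    permits the crude bound \<open>norm r \<le> (norm h)^2\<close> elsewhere.\<close>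
  define \<eta> where "\<eta> = min 1 (e / (2 * E ^ 3))"
  have \<eta>: "0 < \<eta>" "\<eta> \<le> 1" "E * \<eta> * E\<^sup>2 \<le> e / 2"
  proof -
    show "0 < \<eta>" "\<eta> \<le> 1" using e E by (auto simp: \<eta>_def)
    have "E * \<eta> * E\<^sup>2 = E ^ 3 * \<eta>" by (simp add: power2_eq_square power3_eq_cube)
    also have "\<dots> \<le> E ^ 3 * (e / (2 * E ^ 3))" using E by (intro mult_left_mono) (auto simp: \<eta>_def)
    also have "\<dots> = e / 2" using E by simp
    finally show "E * \<eta> * E\<^sup>2 \<le> e / 2" .
  qed
  \<comment> \<open>Coefficient of the third-order error: one half and an outer \<open>E\<close>,
    times the bound \<open>U\<close> of \<open>u\<close>, times the second-order bound of
    \<open>w t x \<delta> - h\<close>, times \<open>2 * E\<close> for the two remaining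
    arguments.\<close>
  define C where "C = (1 / 2) * (E * (U * (E * (U / 2 + 1) * E\<^sup>2) * (2 * E)))"
  have C: "0 \<le> C" using U E by (auto simp: C_def)
  obtain d where d: "0 < d" "\<And>t x h. t \<in> {0..T} \<Longrightarrow> x \<in> cball 0 R \<Longrightarrow> norm h < d \<Longrightarrow>
    norm (g t (x + h) - g t x - v t x h - (1 / 2) *\<^sub>R u t x h h) \<le> \<eta> * (norm h)\<^sup>2"
    using g_taylor2[OF \<eta>(1), of R] by blast
  show ?thesis
  \<comment> \<open>The first radius guarantees \<open>norm h < d\<close>; the second makes
    \<open>C * norm \<delta>\<close> at most \<open>e / 2\<close>.\<close>
  proof (rule that[of "min (d / E) (e / (2 * (C + 1)))"])
    fix t :: real and x y :: 'a assume t: "t \<in> {0..T}" and x: "x \<in> cball 0 R"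
      and \<delta>: "norm (g t y - g t x) < min (d / E) (e / (2 * (C + 1)))"
    define \<delta> where "\<delta> = g t y - g t x"
    define h where "h = y - x"
    have h: "norm h \<le> E * norm \<delta>"
      using g_lower[OF t, of y x] by (simp add: h_def \<delta>_def E_def)
    have "norm h < d"
      using h \<delta> E mult_strict_left_mono[of "norm \<delta>" "d / E" E] by (auto simp: \<delta>_def)
    define r where "r = \<delta> - v t x h - (1 / 2) *\<^sub>R u t x h h"
    have r: "norm r \<le> \<eta> * (norm h)\<^sup>2"
      using d(2)[OF t x \<open>norm h < d\<close>] by (simp add: r_def \<delta>_def h_def)
    have "\<delta> = v t x h + (1 / 2) *\<^sub>R u t x h h + r" by (simp add: r_def)
    then have w\<delta>: "w t x \<delta> = h + (1 / 2) *\<^sub>R w t x (u t x h h) + w t x r"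
      using w_linear[OF t] t by (simp add: linear_add linear_scale)
    define e' where "e' = w t x \<delta> - h"
    have "norm e' \<le> (1 / 2) * (E * (U * norm h * norm h)) + E * norm r"
    proof -
      have "e' = (1 / 2) *\<^sub>R w t x (u t x h h) + w t x r" by (simp add: e'_def w\<delta>)
      moreover have "norm (w t x (u t x h h)) \<le> E * (U * norm h * norm h)"
        unfolding U_def by (rule order_trans[OF w_bound[OF t] mult_left_mono[OF u_bound[OF t] E(2)]])
      ultimately show ?thesis
        by (auto intro!: norm_triangle_mono w_bound[OF t])
    qed
    also have "\<dots> \<le> (1 / 2) * (E * (U * norm h * norm h)) + E * (1 * (norm h)\<^sup>2)"
    proof -
      have "norm r \<le> 1 * (norm h)\<^sup>2"
        by (rule order_trans[OF r]) (use \<eta> in \<open>intro mult_right_mono; simp\<close>)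
      then show ?thesis
        using E by (intro add_left_mono mult_left_mono) auto
    qed
    also have "\<dots> = E * (U / 2 + 1) * (norm h)\<^sup>2"
      by (simp add: algebra_simps power2_eq_square)
    also have "\<dots> \<le> E * (U / 2 + 1) * (E * norm \<delta>)\<^sup>2"
      using h E U by (intro mult_left_mono power_mono) auto
    finally have e': "norm e' \<le> E * (U / 2 + 1) * E\<^sup>2 * (norm \<delta>)\<^sup>2"
      by (simp add: power_mult_distrib mult_ac)
    have uu: "u t x (w t x \<delta>) (w t x \<delta>) - u t x h h = u t x e' (w t x \<delta>) + u t x h e'"
      unfolding e'_def by (simp add: linear_diff[OF u_linear1[OF t]] linear_diff[OF u_linear2[OF t]])
    have "norm (u t x (w t x \<delta>) (w t x \<delta>) - u t x h h) \<le> U * norm e' * norm (w t x \<delta>) + U * norm h * norm e'"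
      unfolding uu U_def by (intro norm_triangle_mono u_bound t)
    also have "\<dots> \<le> U * norm e' * (E * norm \<delta>) + U * (E * norm \<delta>) * norm e'"
      using U h by (intro add_mono mult_left_mono mult_right_mono w_bound t) auto
    also have "\<dots> = U * norm e' * (2 * E * norm \<delta>)" by (simp add: algebra_simps)
    also have "\<dots> \<le> U * (E * (U / 2 + 1) * E\<^sup>2 * (norm \<delta>)\<^sup>2) * (2 * E * norm \<delta>)"
      using U E by (intro mult_right_mono mult_left_mono e') auto
    finally have uu_le: "norm (u t x (w t x \<delta>) (w t x \<delta>) - u t x h h) \<le> \<dots>" .
    have eq: "y - x - w t x \<delta> + (1 / 2) *\<^sub>R q t x \<delta> \<delta> =
      (1 / 2) *\<^sub>R w t x (u t x (w t x \<delta>) (w t x \<delta>) - u t x h h) - w t x r"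
    proof -
      have "y - x = h" by (simp add: h_def)
      moreover have "h - w t x \<delta> = - ((1 / 2) *\<^sub>R w t x (u t x h h)) - w t x r" by (simp add: w\<delta>)
      ultimately show ?thesis
        by (simp only:) (simp add: q_def linear_diff[OF w_linear[OF t]] algebra_simps)
    qed
    have "norm (y - x - w t x \<delta> + (1 / 2) *\<^sub>R q t x \<delta> \<delta>) \<le>
      (1 / 2) * (E * (U * (E * (U / 2 + 1) * E\<^sup>2 * (norm \<delta>)\<^sup>2) * (2 * E * norm \<delta>))) + E * (\<eta> * (E * norm \<delta>)\<^sup>2)"
      unfolding eq
    proof (intro order_trans[OF norm_triangle_ineq4] add_mono)
      show "norm ((1 / 2) *\<^sub>R w t x (u t x (w t x \<delta>) (w t x \<delta>) - u t x h h)) \<le>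
        (1 / 2) * (E * (U * (E * (U / 2 + 1) * E\<^sup>2 * (norm \<delta>)\<^sup>2) * (2 * E * norm \<delta>)))"
        unfolding norm_scaleR by (intro mult_mono order_trans[OF w_bound[OF t] mult_left_mono[OF uu_le E(2)]]) auto
      have "norm r \<le> \<eta> * (E * norm \<delta>)\<^sup>2"
        by (rule order_trans[OF r]) (use h \<eta> in \<open>intro mult_left_mono power_mono; simp\<close>)
      then show "norm (w t x r) \<le> E * (\<eta> * (E * norm \<delta>)\<^sup>2)"
        using order_trans[OF w_bound[OF t] mult_left_mono[OF _ E(2)]] by blast
    qed
    also have "\<dots> = (C * norm \<delta> + E * \<eta> * E\<^sup>2) * (norm \<delta>)\<^sup>2"
      by (simp add: C_def algebra_simps power2_eq_square)
    also have "\<dots> \<le> (e / 2 + e / 2) * (norm \<delta>)\<^sup>2"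
    proof (intro mult_right_mono add_mono \<eta>)
      have "C * norm \<delta> \<le> (C + 1) * (e / (2 * (C + 1)))"
        using \<delta> C by (intro mult_mono) (auto simp: \<delta>_def)
      also have "\<dots> = e / 2" using C by (simp add: field_simps)
      finally show "C * norm \<delta> \<le> e / 2" .
    qed auto
    finally show "norm (y - x - w t x (g t y - g t x) + (1 / 2) *\<^sub>R q t x (g t y - g t x) (g t y - g t x))
      \<le> e * (norm (g t y - g t x))\<^sup>2"
      by (simp add: \<delta>_def)
  qed (use d e C E in auto)
qed

end

lemma borel_measurable_vec_nth [measurable (raw)]:
  fixes X :: "'w \<Rightarrow> 'b::real_normed_vector ^ 'k"
  assumes [measurable]: "X \<in> borel_measurable N"
  shows "(\<lambda>\<omega>. X \<omega> $ i) \<in> borel_measurable N"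
proof -
  have [measurable]: "(\<lambda>x :: 'b ^ 'k. x $ i) \<in> borel_measurable borel"
    by (intro borel_measurable_continuous_onI continuous_intros)
  show ?thesis by measurable
qed

section \<open>Increments of a Wiener process\<close>

locale wiener =
  fixes M :: "'w measure" and T :: real and \<F> :: "real \<Rightarrow> 'w measure" and W :: "real \<Rightarrow> 'w \<Rightarrow> real^'n"
  assumes wiener: "wiener_process M T \<F> W" and T: "0 \<le> T"
begin

sublocale prob_space M
  using wiener by (auto simp: wiener_process_def)

lemma subalg: "t \<in> {0..T} \<Longrightarrow> subalgebra M (\<F> t)"
  using wiener by (auto simp: wiener_process_def filtration_upto_def)

lemma subalg_mono: "s \<in> {0..T} \<Longrightarrow> t \<in> {0..T} \<Longrightarrow> s \<le> t \<Longrightarrow> subalgebra (\<F> t) (\<F> s)"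
  using wiener by (auto simp: wiener_process_def filtration_upto_def)

lemma space_F: "t \<in> {0..T} \<Longrightarrow> space (\<F> t) = space M"
  using subalg by (auto simp: subalgebra_def)

lemma adapted_measurable: "t \<in> {0..T} \<Longrightarrow> X \<in> measurable (\<F> t) N \<Longrightarrow> X \<in> measurable M N"
  using subalg measurable_from_subalg by blast

lemma adapted_mono: "s \<in> {0..T} \<Longrightarrow> t \<in> {0..T} \<Longrightarrow> s \<le> t \<Longrightarrow> X \<in> measurable (\<F> s) N \<Longrightarrow> X \<in> measurable (\<F> t) N"
  using subalg_mono measurable_from_subalg by blast

lemma W_adapted: "t \<in> {0..T} \<Longrightarrow> W t \<in> borel_measurable (\<F> t)"
  using wiener by (auto simp: wiener_process_def)

lemma W_measurable: "t \<in> {0..T} \<Longrightarrow> W t \<in> borel_measurable M"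
  using W_adapted adapted_measurable by blast

lemma W_adapted_mono: "s \<in> {0..T} \<Longrightarrow> t \<in> {0..T} \<Longrightarrow> s \<le> t \<Longrightarrow> W s \<in> borel_measurable (\<F> t)"
  using W_adapted adapted_mono by blast

text \<open>Independence is given for the sigma-algebra of the past and the preimages of Borel sets
  under the whole increment vector. It passes to smaller sigma-algebras, hence to a known variable
  \<open>X\<close> and a Borel function of the increment.\<close>

lemma indep_increment:
  fixes f :: "real^'n \<Rightarrow> real" and X :: "'w \<Rightarrow> real"
  assumes st: "0 \<le> s" "s < t" "t \<le> T" and X: "X \<in> borel_measurable (\<F> s)" and f: "f \<in> borel_measurable borel"
  shows "indep_var borel X borel (\<lambda>\<omega>. f (W t \<omega> - W s \<omega>))"
proof -
  let ?D = "\<lambda>\<omega>. W t \<omega> - W s \<omega>"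
  have sM: "s \<in> {0..T}" "t \<in> {0..T}" using st by auto
  have D: "?D \<in> borel_measurable M" using W_measurable sM by measurable
  have XM: "X \<in> borel_measurable M" using adapted_measurable[OF sM(1) X] .
  have ind: "indep_set (sets (\<F> s)) {?D -` A \<inter> space M | A. A \<in> sets borel}"
    using wiener st unfolding wiener_process_def by blast
  have fD: "(\<lambda>\<omega>. f (?D \<omega>)) \<in> borel_measurable M" using D f by measurable
  show ?thesis
    unfolding indep_var_eq
  proof (intro conjI XM fD)
    have 1: "sigma_sets (space M) {X -` A \<inter> space M |A. A \<in> sets borel} \<subseteq> sets (\<F> s)"
      using measurable_sets[OF X] sets.sigma_sets_subset[of "{X -` A \<inter> space M |A. A \<in> sets borel}" "\<F> s"]
      unfolding space_F[OF sM(1)] by blast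
    \<comment> \<open>Preimages of all Borel sets already form a sigma-algebra, so generating adds
      nothing.\<close>
    have 2: "sigma_sets (space M) {?D -` A \<inter> space M |A. A \<in> sets borel} = {?D -` A \<inter> space M |A. A \<in> sets borel}"
      using sets_vimage_algebra[of "space M" ?D borel] sets_vimage_algebra2[of ?D "space M" borel] by simp
    have "(\<lambda>\<omega>. f (?D \<omega>)) -` A \<inter> space M = ?D -` (f -` A) \<inter> space M" for A by auto
    moreover have "f -` A \<in> sets borel" if "A \<in> sets borel" for A
      using measurable_sets[OF f that] by simp
    ultimately have "{(\<lambda>\<omega>. f (?D \<omega>)) -` A \<inter> space M |A. A \<in> sets borel} \<subseteq> {?D -` A \<inter> space M |A. A \<in> sets borel}"
      by blast
    from sigma_sets_mono'[OF this, of "space M"]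
    have 3: "sigma_sets (space M) {(\<lambda>\<omega>. f (?D \<omega>)) -` A \<inter> space M |A. A \<in> sets borel} \<subseteq> {?D -` A \<inter> space M |A. A \<in> sets borel}"
      unfolding 2 .
    show "indep_set (sigma_sets (space M) {X -` A \<inter> space M |A. A \<in> sets borel})
      (sigma_sets (space M) {(\<lambda>\<omega>. f (?D \<omega>)) -` A \<inter> space M |A. A \<in> sets borel})"
      unfolding indep_set_def
      by (rule indep_sets_mono_sets[OF ind[unfolded indep_set_def]]) (use 1 3 in \<open>auto split: bool.split\<close>)
  qed
qed

text \<open>The Wiener property speaks of \<open>s < t\<close> only. Grids may contain intervals of
  length 0, so the degenerate case is included; there the increment is 0 and the factor
  constant.\<close>

lemma expectation_increment:
  fixes f :: "real^'n \<Rightarrow> real" and X :: "'w \<Rightarrow> real"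
  assumes st: "0 \<le> s" "s \<le> t" "t \<le> T" and X: "X \<in> borel_measurable (\<F> s)" and f: "f \<in> borel_measurable borel"
    and int: "integrable M X" "integrable M (\<lambda>\<omega>. f (W t \<omega> - W s \<omega>))"
  shows "integrable M (\<lambda>\<omega>. X \<omega> * f (W t \<omega> - W s \<omega>))"
    and "expectation (\<lambda>\<omega>. X \<omega> * f (W t \<omega> - W s \<omega>)) = expectation X * expectation (\<lambda>\<omega>. f (W t \<omega> - W s \<omega>))"
proof -
  have "integrable M (\<lambda>\<omega>. X \<omega> * f (W t \<omega> - W s \<omega>)) \<and>
    expectation (\<lambda>\<omega>. X \<omega> * f (W t \<omega> - W s \<omega>)) = expectation X * expectation (\<lambda>\<omega>. f (W t \<omega> - W s \<omega>))"
  proof (cases "s = t")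
    case True
    then show ?thesis using int by (simp add: prob_space)
  next
    case False
    then have "s < t" using st by simp
    note ind = indep_increment[OF st(1) this st(3) X f]
    show ?thesis
      using indep_var_integrable[OF ind int] indep_var_lebesgue_integral[OF ind int] by blast
  qed
  then show "integrable M (\<lambda>\<omega>. X \<omega> * f (W t \<omega> - W s \<omega>))"
    and "expectation (\<lambda>\<omega>. X \<omega> * f (W t \<omega> - W s \<omega>)) = expectation X * expectation (\<lambda>\<omega>. f (W t \<omega> - W s \<omega>))"
    by auto
qed

lemma has_moments:
  assumes st: "0 \<le> s" "s \<le> t" "t \<le> T"
  shows "integrable M (\<lambda>\<omega>. ((W t \<omega> - W s \<omega>) $ i) ^ k)" (is ?int)
    and "expectation (\<lambda>\<omega>. (W t \<omega> - W s \<omega>) $ i) = 0" (is ?m1)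
    and "expectation (\<lambda>\<omega>. ((W t \<omega> - W s \<omega>) $ i)\<^sup>2) = t - s" (is ?m2)
    and "expectation (\<lambda>\<omega>. ((W t \<omega> - W s \<omega>) $ i) ^ 4) = 3 * (t - s)\<^sup>2" (is ?m4)
proof -
  have "?int \<and> ?m1 \<and> ?m2 \<and> ?m4"
  proof (cases "s = t")
    case False
    then have st: "0 \<le> s" "s < t" "t \<le> T" using st by auto
    define r where "r = sqrt (t - s)"
    have r: "0 < r" "r\<^sup>2 = t - s" using st by (auto simp: r_def)
    have D: "distributed M lborel (\<lambda>\<omega>. (W t \<omega> - W s \<omega>) $ i) (normal_density 0 r)"
      using wiener st unfolding wiener_process_def r_def by blast
    have int: "integrable M (\<lambda>\<omega>. ((W t \<omega> - W s \<omega>) $ i) ^ k)" for k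
      using distributed_integrable[OF D, of "\<lambda>x. x ^ k"] integrable_normal_moment[OF r(1), of 0 k] by simp
    have E: "expectation (\<lambda>\<omega>. ((W t \<omega> - W s \<omega>) $ i) ^ k) = integral\<^sup>L lborel (\<lambda>x. normal_density 0 r x * x ^ k)" for k
      using distributed_integral[OF D, of "\<lambda>x. x ^ k"] by simp
    have m1: ?m1 using E[of 1] integral_normal_moment_odd[OF r(1), of 0 0] by simp
    have m2: ?m2 using E[of 2] integral_normal_moment_even[OF r(1), of 0 1] r by (simp add: fact_2)
    have m4: ?m4 using E[of 4] integral_normal_moment_even[OF r(1), of 0 2] r
      by (simp add: fact_numeral power_divide power2_eq_square)
    show ?thesis using int m1 m2 m4 by blast
  qed (cases k; auto)
  then show ?int ?m1 ?m2 ?m4 by auto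
qed

lemma has_mixed_moment:
  assumes st: "0 \<le> s" "s \<le> t" "t \<le> T"
  shows "integrable M (\<lambda>\<omega>. (W t \<omega> - W s \<omega>) $ i * (W t \<omega> - W s \<omega>) $ j)" (is ?int)
    and "expectation (\<lambda>\<omega>. (W t \<omega> - W s \<omega>) $ i * (W t \<omega> - W s \<omega>) $ j) = (if i = j then t - s else 0)" (is ?E)
proof -
  have "?int \<and> ?E"
  proof (cases "i = j")
    case True
    then show ?thesis using has_moments(1)[OF st, of i 2] has_moments(3)[OF st, of i] by (simp add: power2_eq_square)
  next
    case False
    show ?thesis
    proof (cases "s = t")
      case False
      then have st': "0 \<le> s" "s < t" "t \<le> T" using st by auto
      have "indep_vars (\<lambda>_. borel) (\<lambda>i \<omega>. (W t \<omega> - W s \<omega>) $ i) UNIV"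
        using wiener st' unfolding wiener_process_def by blast
      then have "indep_vars (\<lambda>_. borel) (\<lambda>i \<omega>. (W t \<omega> - W s \<omega>) $ i) {i, j}"
        by (rule indep_vars_subset) auto
      from indep_vars_integrable[OF _ this] indep_vars_lebesgue_integral[OF _ this]
      show ?thesis
        using has_moments(1)[OF st, of _ 1] has_moments(2)[OF st] \<open>i \<noteq> j\<close> by simp
    qed auto
  qed
  then show ?int ?E by auto
qed

text \<open>The constant is \<open>8 = 3 + 3 + 2\<close>: from
  \<open>(a * b - c)^2 \<le> a^4 + b^4 + 2 * c^2\<close> and the Gaussian fourth moments
  \<open>3 * (t - s)^2\<close>.\<close>

lemma quadratic_variation_moments:
  fixes i j :: 'n
  defines "q s t \<omega> \<equiv> (W t \<omega> - W s \<omega>) $ i * (W t \<omega> - W s \<omega>) $ j - (if i = j then t - s else 0)"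
  assumes st: "0 \<le> s" "s \<le> t" "t \<le> T"
  shows "integrable M (q s t)" "expectation (q s t) = 0"
    and "integrable M (\<lambda>\<omega>. (q s t \<omega>)\<^sup>2)" "expectation (\<lambda>\<omega>. (q s t \<omega>)\<^sup>2) \<le> 8 * (t - s)\<^sup>2"
proof -
  show "integrable M (q s t)" "expectation (q s t) = 0"
    using has_mixed_moment[OF st, of i j] unfolding q_def[abs_def]
    by (auto simp: prob_space simp del: vector_minus_component)
  have sM: "s \<in> {0..T}" "t \<in> {0..T}" using st by auto
  note [measurable] = W_measurable[OF sM(1)] W_measurable[OF sM(2)]
  have le: "(q s t \<omega>)\<^sup>2 \<le> ((W t \<omega> - W s \<omega>) $ i) ^ 4 + ((W t \<omega> - W s \<omega>) $ j) ^ 4 + 2 * (t - s)\<^sup>2" for \<omega>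
  proof -
    define a b c where "a = (W t \<omega> - W s \<omega>) $ i" "b = (W t \<omega> - W s \<omega>) $ j" "c = (if i = j then t - s else 0)"
    have "(a * b - c)\<^sup>2 \<le> 2 * (a * b)\<^sup>2 + 2 * c\<^sup>2"
      using zero_le_power2[of "a * b + c"] by (simp add: power2_eq_square algebra_simps)
    also have "2 * (a * b)\<^sup>2 \<le> a ^ 4 + b ^ 4"
      using zero_le_power2[of "a\<^sup>2 - b\<^sup>2"] by (simp add: power2_eq_square power4_eq_xxxx algebra_simps)
    also have "2 * c\<^sup>2 \<le> 2 * (t - s)\<^sup>2" by (simp add: a_b_c_def)
    finally show ?thesis by (simp add: q_def a_b_c_def)
  qed
  have int: "integrable M (\<lambda>\<omega>. ((W t \<omega> - W s \<omega>) $ i) ^ 4 + ((W t \<omega> - W s \<omega>) $ j) ^ 4 + 2 * (t - s)\<^sup>2)"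
    using has_moments(1)[OF st] by auto
  show int2: "integrable M (\<lambda>\<omega>. (q s t \<omega>)\<^sup>2)"
    by (rule Bochner_Integration.integrable_bound[OF int])
      (use le in \<open>auto simp: q_def intro!: AE_I2 order_trans[OF _ abs_ge_self]\<close>)
  have "expectation (\<lambda>\<omega>. (q s t \<omega>)\<^sup>2) \<le> expectation (\<lambda>\<omega>. ((W t \<omega> - W s \<omega>) $ i) ^ 4 + ((W t \<omega> - W s \<omega>) $ j) ^ 4 + 2 * (t - s)\<^sup>2)"
    by (intro integral_mono int int2 le)
  also have "\<dots> = 8 * (t - s)\<^sup>2"
    using has_moments(1)[OF st, of i 4] has_moments(1)[OF st, of j 4] has_moments(4)[OF st] by (simp add: prob_space)
  finally show "expectation (\<lambda>\<omega>. (q s t \<omega>)\<^sup>2) \<le> 8 * (t - s)\<^sup>2" .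
qed

end

section \<open>Mean square convergence of Ito integrals\<close>

lemma bounded_imageE:
  assumes "bounded (f ` S)"
  obtains C where "0 \<le> C" "\<And>x. x \<in> S \<Longrightarrow> norm (f x) \<le> C"
proof -
  obtain C where "\<And>y. y \<in> f ` S \<Longrightarrow> norm y \<le> C"
    using assms unfolding bounded_iff by blast
  then show ?thesis
    by (intro that[of "\<bar>C\<bar>"]) (auto intro: order_trans[OF _ abs_ge_self])
qed

text \<open>As a measure on the interval itself it is finite, so its product with \<open>M\<close>
  is finite as well, and its sets match the measurable spaces that occur in progressive
  measurability.\<close>

definition time_measure :: "real \<Rightarrow> real measure" where
  "time_measure T = restrict_space lborel {0..T}"

lemma space_time_measure [simp]: "space (time_measure T) = {0..T}"
  by (simp add: time_measure_def space_restrict_space)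

lemma sets_time_measure: "sets (time_measure T) = sets (restrict_space borel {0..T})"
  unfolding time_measure_def by (rule sets_restrict_space_cong) simp

lemma finite_time_measure: "finite_measure (time_measure T)"
  by (rule finite_measureI) (simp add: time_measure_def emeasure_restrict_space space_restrict_space emeasure_lborel_Icc_eq)

lemma measurable_id_time_measure [measurable]: "(\<lambda>x. x) \<in> measurable (time_measure T) borel"
  unfolding time_measure_def by (rule measurable_restrict_space1) simp

lemma nn_integral_time_measure:
  "(\<integral>\<^sup>+s. f s \<partial>time_measure T) = (\<integral>\<^sup>+s\<in>{0..T}. f s \<partial>lborel)"
  unfolding time_measure_def by (rule nn_integral_restrict_space) simp

text \<open>The squared \<open>L\<^sup>2\<close> norm with values in \<open>ennreal\<close>, so that
  estimates and limits can be stated before any integrability is known. Instead of Minkowski's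
  inequality, squares of sums are bounded with factors 2.\<close>

definition nsq :: "'a measure \<Rightarrow> ('a \<Rightarrow> 'b::real_normed_vector) \<Rightarrow> ennreal" where
  "nsq N f = (\<integral>\<^sup>+x. ennreal ((norm (f x))\<^sup>2) \<partial>N)"

lemma power2_norm_add_le: "(norm (a + b))\<^sup>2 \<le> 2 * (norm a)\<^sup>2 + 2 * (norm b)\<^sup>2"
  for a b :: "'b::real_normed_vector"
proof -
  have "(norm (a + b))\<^sup>2 \<le> (norm a + norm b)\<^sup>2"
    by (intro power_mono norm_triangle_ineq) auto
  also have "\<dots> \<le> 2 * (norm a)\<^sup>2 + 2 * (norm b)\<^sup>2"
    using zero_le_power2[of "norm a - norm b"] by (simp add: power2_sum power2_diff)
  finally show ?thesis .
qed

lemma nsq_add: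
  fixes f g :: "'a \<Rightarrow> 'b::{real_normed_vector, second_countable_topology}"
  assumes [measurable]: "f \<in> borel_measurable N" "g \<in> borel_measurable N"
  shows "nsq N (\<lambda>x. f x + g x) \<le> 2 * nsq N f + 2 * nsq N g"
proof -
  have "nsq N (\<lambda>x. f x + g x) \<le> (\<integral>\<^sup>+x. 2 * ennreal ((norm (f x))\<^sup>2) + 2 * ennreal ((norm (g x))\<^sup>2) \<partial>N)"
    unfolding nsq_def
  proof (intro nn_integral_mono)
    fix x
    have "ennreal ((norm (f x + g x))\<^sup>2) \<le> ennreal (2 * (norm (f x))\<^sup>2 + 2 * (norm (g x))\<^sup>2)"
      by (intro ennreal_leI power2_norm_add_le)
    then show "ennreal ((norm (f x + g x))\<^sup>2) \<le> 2 * ennreal ((norm (f x))\<^sup>2) + 2 * ennreal ((norm (g x))\<^sup>2)"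
      by (simp add: ennreal_plus ennreal_mult)
  qed
  also have "\<dots> = 2 * nsq N f + 2 * nsq N g"
    unfolding nsq_def by (simp add: nn_integral_add nn_integral_cmult)
  finally show ?thesis .
qed

lemma nsq_mono: "(\<And>x. x \<in> space N \<Longrightarrow> norm (f x) \<le> norm (g x)) \<Longrightarrow> nsq N f \<le> nsq N g"
  unfolding nsq_def by (intro nn_integral_mono ennreal_leI power_mono) auto

lemma nsq_mono_mult:
  assumes "\<And>x. x \<in> space N \<Longrightarrow> norm (f x) \<le> c * norm (g x)" "g \<in> borel_measurable N"
  shows "nsq N f \<le> ennreal (c\<^sup>2) * nsq N g"
proof -
  have "nsq N f \<le> (\<integral>\<^sup>+x. ennreal (c\<^sup>2) * ennreal ((norm (g x))\<^sup>2) \<partial>N)"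
    unfolding nsq_def
  proof (intro nn_integral_mono)
    fix x assume "x \<in> space N"
    then have "(norm (f x))\<^sup>2 \<le> (c * norm (g x))\<^sup>2"
      using assms(1) by (intro power_mono) auto
    then show "ennreal ((norm (f x))\<^sup>2) \<le> ennreal (c\<^sup>2) * ennreal ((norm (g x))\<^sup>2)"
      by (simp add: ennreal_mult[symmetric] power_mult_distrib)
  qed
  also have "\<dots> = ennreal (c\<^sup>2) * nsq N g"
    unfolding nsq_def using assms(2) by (intro nn_integral_cmult) measurable
  finally show ?thesis .
qed

lemma nsq_minus_commute: "nsq N (\<lambda>x. f x - g x) = nsq N (\<lambda>x. g x - f x)"
  by (simp add: nsq_def norm_minus_commute)

lemma ennreal_tendsto_0_mult: "(f \<longlongrightarrow> 0) F \<Longrightarrow> c < \<infinity> \<Longrightarrow> ((\<lambda>n. c * f n) \<longlongrightarrow> (0::ennreal)) F"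
  using ennreal_tendsto_cmult[of c f 0 F] by simp

lemma tendsto_0_if_le_2_sum:
  fixes f g h :: "nat \<Rightarrow> ennreal"
  assumes "\<And>n. f n \<le> 2 * g n + 2 * h n" "g \<longlonglongrightarrow> 0" "h \<longlonglongrightarrow> 0"
  shows "f \<longlonglongrightarrow> 0"
proof (rule tendsto_sandwich[OF always_eventually always_eventually tendsto_const])
  show "(\<lambda>n. 2 * g n + 2 * h n) \<longlonglongrightarrow> 0"
    using tendsto_add[OF ennreal_tendsto_0_mult[OF assms(2), of 2] ennreal_tendsto_0_mult[OF assms(3), of 2]] by simp
qed (use assms in auto)

section \<open>Norm estimates and measurability for matrices\<close>

lemma norm_matrix_vector_le: "norm (A *v x) \<le> norm A * norm x" for A :: "real^'n^'m"
proof -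
  have "norm (A *v x) = L2_set (\<lambda>i. \<bar>A $ i \<bullet> x\<bar>) UNIV"
    by (simp add: norm_vec_def matrix_vector_mul_component)
  also have "\<dots> \<le> L2_set (\<lambda>i. norm x * norm (A $ i)) UNIV"
    by (intro L2_set_mono) (auto simp: mult.commute[of "norm x"] Cauchy_Schwarz_ineq2)
  also have "\<dots> = norm A * norm x"
    by (simp add: L2_set_right_distrib[symmetric] norm_vec_def[of A] mult.commute)
  finally show ?thesis .
qed

lemma norm_matrix_matrix_le: "norm (A ** B) \<le> norm A * norm B" for A :: "real^'n^'m" and B :: "real^'k^'n"
proof -
  have row: "(A ** B) $ i = transpose B *v (A $ i)" for i
    by (simp add: vec_eq_iff matrix_matrix_mult_def matrix_vector_mult_def transpose_def mult.commute)
  have tr: "norm (transpose B) = norm B"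
  proof -
    have "norm (transpose B) ^ 2 = norm B ^ 2"
      unfolding power2_norm_eq_inner inner_vec_def transpose_def by (simp add: sum.swap[of "\<lambda>i j. B $ j $ i * B $ j $ i"])
    then show ?thesis by simp
  qed
  have "norm (A ** B) = L2_set (\<lambda>i. norm (transpose B *v (A $ i))) UNIV"
    by (simp add: norm_vec_def[of "A ** B"] row)
  also have "\<dots> \<le> L2_set (\<lambda>i. norm B * norm (A $ i)) UNIV"
    using norm_matrix_vector_le[of "transpose B"] by (intro L2_set_mono) (auto simp: tr)
  also have "\<dots> = norm A * norm B"
    by (simp add: L2_set_right_distrib[symmetric] norm_vec_def[of A] mult.commute)
  finally show ?thesis .
qed

lemma borel_measurable_matrix_vector_mult [measurable (raw)]:
  fixes A :: "'w \<Rightarrow> real^'n^'m"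
  assumes [measurable]: "A \<in> borel_measurable N" "x \<in> borel_measurable N"
  shows "(\<lambda>\<omega>. A \<omega> *v x \<omega>) \<in> borel_measurable N"
  unfolding matrix_vector_mult_def
  by (rule borel_measurable_continuous_on[where f="\<lambda>p. \<chi> i. \<Sum>j\<in>UNIV. fst p $ i $ j * snd p $ j" and g="\<lambda>\<omega>. (A \<omega>, x \<omega>)", simplified])
    (auto intro!: continuous_intros)

lemma borel_measurable_matrix_matrix_mult [measurable (raw)]:
  fixes A :: "'w \<Rightarrow> real^'n^'m" and B :: "'w \<Rightarrow> real^'k^'n"
  assumes [measurable]: "A \<in> borel_measurable N" "B \<in> borel_measurable N"
  shows "(\<lambda>\<omega>. A \<omega> ** B \<omega>) \<in> borel_measurable N"
  unfolding matrix_matrix_mult_def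
  by (rule borel_measurable_continuous_on[where f="\<lambda>p. \<chi> i j. \<Sum>k\<in>UNIV. fst p $ i $ k * snd p $ k $ j" and g="\<lambda>\<omega>. (A \<omega>, B \<omega>)", simplified])
    (auto intro!: continuous_intros)

section \<open>The isometry for simple integrands\<close>

context wiener
begin

abbreviation P :: "(real \<times> 'w) measure" where "P \<equiv> time_measure T \<Otimes>\<^sub>M M"

sublocale time: finite_measure "time_measure T"
  by (rule finite_time_measure)

sublocale pair: pair_sigma_finite "time_measure T" M
  by standard

lemma finite_P: "finite_measure P"
proof (rule finite_measureI)
  have "emeasure P (space P) = emeasure (time_measure T) (space (time_measure T)) * emeasure M (space M)"
    unfolding space_pair_measure by (rule emeasure_pair_measure_Times[OF sets.top sets.top])
  then show "emeasure P (space P) \<noteq> \<infinity>"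
    by (simp add: ennreal_mult_eq_top_iff emeasure_eq_measure time.emeasure_eq_measure del: space_time_measure)
qed

lemma space_P: "space P = {0..T} \<times> space M"
  by (simp add: space_pair_measure)

lemma integrable_bounded:
  fixes X :: "'w \<Rightarrow> real"
  assumes "X \<in> borel_measurable M" "bounded (X ` space M)"
  shows "integrable M X"
proof -
  obtain C where "\<And>\<omega>. \<omega> \<in> space M \<Longrightarrow> norm (X \<omega>) \<le> C"
    using assms(2) unfolding bounded_iff by blast
  then show ?thesis
    using assms(1) by (intro integrable_const_bound[of _ C]) auto
qed

text \<open>The longer increment is split at \<open>b\<close>. Its part after \<open>b\<close> has
  mean 0 and is independent of everything known at \<open>b\<close>, so only the product of two
  increments over the same interval contributes.\<close>

lemma increment_product_ordered:
  fixes Z :: "'w \<Rightarrow> real"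
  assumes t: "0 \<le> c" "c \<le> b" "b \<le> d" "d \<le> T" and Z: "Z \<in> borel_measurable (\<F> c)" "bounded (Z ` space M)"
  shows "integrable M (\<lambda>\<omega>. Z \<omega> * ((W b \<omega> - W c \<omega>) $ p * (W d \<omega> - W c \<omega>) $ q))"
    and "expectation (\<lambda>\<omega>. Z \<omega> * ((W b \<omega> - W c \<omega>) $ p * (W d \<omega> - W c \<omega>) $ q)) =
      expectation Z * (if p = q then b - c else 0)"
proof -
  have bc: "c \<in> {0..T}" "b \<in> {0..T}" "d \<in> {0..T}" "c \<le> T" "b \<le> T" "0 \<le> b" using t by auto
  have ZM: "integrable M Z" by (rule integrable_bounded[OF adapted_measurable[OF bc(1) Z(1)] Z(2)])
  have c1: "(\<lambda>x :: real^'n. x $ p * x $ q) \<in> borel_measurable borel" "(\<lambda>x :: real^'n. x $ p) \<in> borel_measurable borel"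
    "(\<lambda>x :: real^'n. x $ q) \<in> borel_measurable borel" by measurable
  note 1 = expectation_increment[OF t(1,2) bc(5) Z(1) c1(1) ZM has_mixed_moment(1)[OF t(1,2) bc(5)]]
  define X where "X \<omega> = Z \<omega> * (W b \<omega> - W c \<omega>) $ p" for \<omega>
  have X: "integrable M X"
    unfolding X_def using has_moments(1)[OF t(1,2) bc(5), of p 1]
    by (intro expectation_increment(1)[OF t(1,2) bc(5) Z(1) c1(2) ZM]) simp
  have Xb: "X \<in> borel_measurable (\<F> b)"
    unfolding X_def using W_adapted[OF bc(2)] W_adapted_mono[OF bc(1,2) t(2)] adapted_mono[OF bc(1,2) t(2) Z(1)] by measurable
  note 2 = expectation_increment[OF bc(6) t(3,4) Xb c1(3) X]
  have i2: "integrable M (\<lambda>\<omega>. (W d \<omega> - W b \<omega>) $ q)" using has_moments(1)[OF bc(6) t(3,4), of q 1] by simp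
  have eq: "Z \<omega> * ((W b \<omega> - W c \<omega>) $ p * (W d \<omega> - W c \<omega>) $ q) =
    Z \<omega> * ((W b \<omega> - W c \<omega>) $ p * (W b \<omega> - W c \<omega>) $ q) + X \<omega> * (W d \<omega> - W b \<omega>) $ q" for \<omega>
    by (simp add: X_def algebra_simps)
  show "integrable M (\<lambda>\<omega>. Z \<omega> * ((W b \<omega> - W c \<omega>) $ p * (W d \<omega> - W c \<omega>) $ q))"
    unfolding eq by (intro Bochner_Integration.integrable_add 1 2 i2)
  show "expectation (\<lambda>\<omega>. Z \<omega> * ((W b \<omega> - W c \<omega>) $ p * (W d \<omega> - W c \<omega>) $ q)) =
      expectation Z * (if p = q then b - c else 0)"
    unfolding eq Bochner_Integration.integral_add[OF 1(1) 2(1)[OF i2]] 1(2) 2(2)[OF i2]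
    using has_moments(2)[OF bc(6) t(3,4)] has_mixed_moment(2)[OF t(1,2) bc(5)] by simp
qed

text \<open>Since \<open>a \<le> c\<close>, the number \<open>max 0 (min b d - c)\<close> is the
  length of the overlap of the two intervals. Having the covariance for arbitrary overlaps makes the
  isometry available without passing to a common refinement of grids.\<close>

lemma increment_product:
  fixes \<xi> \<eta> :: "'w \<Rightarrow> real"
  assumes t: "0 \<le> a" "a \<le> c" "a \<le> b" "b \<le> T" "c \<le> d" "d \<le> T"
    and \<xi>: "\<xi> \<in> borel_measurable (\<F> a)" "bounded (\<xi> ` space M)" and \<eta>: "\<eta> \<in> borel_measurable (\<F> c)" "bounded (\<eta> ` space M)"
  shows "integrable M (\<lambda>\<omega>. (\<xi> \<omega> * (W b \<omega> - W a \<omega>) $ p) * (\<eta> \<omega> * (W d \<omega> - W c \<omega>) $ q)) \<and>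
    expectation (\<lambda>\<omega>. (\<xi> \<omega> * (W b \<omega> - W a \<omega>) $ p) * (\<eta> \<omega> * (W d \<omega> - W c \<omega>) $ q)) =
      (if p = q then expectation (\<lambda>\<omega>. \<xi> \<omega> * \<eta> \<omega>) * max 0 (min b d - c) else 0)"
proof -
  have T4: "a \<in> {0..T}" "b \<in> {0..T}" "c \<in> {0..T}" "d \<in> {0..T}" "0 \<le> c" "c \<le> T" "a \<le> T" using t by auto
  have c1: "(\<lambda>x :: real^'n. x $ p) \<in> borel_measurable borel"
    "(\<lambda>x :: real^'n. x $ q) \<in> borel_measurable borel" by measurable
  define Z where "Z \<omega> = \<xi> \<omega> * \<eta> \<omega>" for \<omega>
  have Z: "Z \<in> borel_measurable (\<F> c)"
    unfolding Z_def using \<eta>(1) adapted_mono[OF T4(1,3) t(2) \<xi>(1)] by measurable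
  have Zb: "bounded (Z ` space M)"
  proof -
    obtain C D where "\<And>\<omega>. \<omega> \<in> space M \<Longrightarrow> norm (\<xi> \<omega>) \<le> C" "\<And>\<omega>. \<omega> \<in> space M \<Longrightarrow> norm (\<eta> \<omega>) \<le> D"
      using \<xi>(2) \<eta>(2) unfolding bounded_iff by (metis imageI)
    then have "norm (Z \<omega>) \<le> \<bar>C\<bar> * \<bar>D\<bar>" if "\<omega> \<in> space M" for \<omega>
      unfolding Z_def norm_mult using that by (meson abs_ge_self abs_ge_zero mult_mono norm_ge_zero order_trans)
    then show ?thesis unfolding bounded_iff by blast
  qed
  \<comment> \<open>an increment ending before \<open>c\<close> is known at time \<open>c\<close> and hence orthogonal to the second factor\<close>
  have before: "integrable M (\<lambda>\<omega>. Z \<omega> * (W b' \<omega> - W a \<omega>) $ p * (W d \<omega> - W c \<omega>) $ q) \<and>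
      expectation (\<lambda>\<omega>. Z \<omega> * (W b' \<omega> - W a \<omega>) $ p * (W d \<omega> - W c \<omega>) $ q) = 0"
    if b': "a \<le> b'" "b' \<le> c" for b'
  proof -
    have T5: "b' \<in> {0..T}" "0 \<le> b'" "b' \<le> T" using b' t by auto
    have X: "(\<lambda>\<omega>. Z \<omega> * (W b' \<omega> - W a \<omega>) $ p) \<in> borel_measurable (\<F> c)"
      using Z W_adapted_mono[OF T4(1,3) t(2)] W_adapted_mono[OF T5(1) T4(3) b'(2)] by measurable
    have int\<xi>: "integrable M (\<lambda>\<omega>. (W b' \<omega> - W a \<omega>) $ p)"
      using has_moments(1)[OF t(1) b'(1) T5(3), of p 1] by simp
    obtain C where C: "\<And>\<omega>. \<omega> \<in> space M \<Longrightarrow> norm (Z \<omega>) \<le> C"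
      using Zb unfolding bounded_iff by (metis imageI)
    have iX: "integrable M (\<lambda>\<omega>. Z \<omega> * (W b' \<omega> - W a \<omega>) $ p)"
    proof (rule Bochner_Integration.integrable_bound[OF integrable_mult_right[OF int\<xi>, of C] adapted_measurable[OF T4(3) X]], rule AE_I2)
      fix \<omega> assume "\<omega> \<in> space M"
      then have "\<bar>Z \<omega>\<bar> \<le> \<bar>C\<bar>" using C[of \<omega>] by simp
      then show "norm (Z \<omega> * (W b' \<omega> - W a \<omega>) $ p) \<le> norm (C * (W b' \<omega> - W a \<omega>) $ p)"
        unfolding real_norm_def abs_mult by (intro mult_right_mono) auto
    qed
    have i2: "integrable M (\<lambda>\<omega>. (W d \<omega> - W c \<omega>) $ q)"
      using has_moments(1)[OF T4(5) t(5,6), of q 1] by simp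
    show ?thesis
      using expectation_increment[OF T4(5) t(5,6) X c1(2) iX i2] has_moments(2)[OF T4(5) t(5,6)] by simp
  qed
  show ?thesis
  proof (cases "b \<le> c")
    case True
    then show ?thesis using before[OF t(3) True] t by (simp add: Z_def mult_ac max_def)
  next
    case False
    then have cb: "c \<le> b" by simp
    have main: "integrable M (\<lambda>\<omega>. Z \<omega> * ((W b \<omega> - W c \<omega>) $ p * (W d \<omega> - W c \<omega>) $ q)) \<and>
      expectation (\<lambda>\<omega>. Z \<omega> * ((W b \<omega> - W c \<omega>) $ p * (W d \<omega> - W c \<omega>) $ q)) =
        expectation Z * (if p = q then min b d - c else 0)"
    proof (cases "b \<le> d")
      case True
      then show ?thesis
        using increment_product_ordered[OF T4(5) cb True t(6) Z Zb, of p q] by simp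
    next
      case False
      then have "d \<le> b" by simp
      then show ?thesis
        using increment_product_ordered[OF T4(5) t(5) \<open>d \<le> b\<close> t(4) Z Zb, of q p] by (simp add: mult.commute)
    qed
    have eq: "(\<xi> \<omega> * (W b \<omega> - W a \<omega>) $ p) * (\<eta> \<omega> * (W d \<omega> - W c \<omega>) $ q) =
      Z \<omega> * (W c \<omega> - W a \<omega>) $ p * (W d \<omega> - W c \<omega>) $ q + Z \<omega> * ((W b \<omega> - W c \<omega>) $ p * (W d \<omega> - W c \<omega>) $ q)" for \<omega>
      by (simp add: Z_def algebra_simps)
    have "max 0 (min b d - c) = min b d - c" using cb t by simp
    then show ?thesis
      unfolding eq using before[OF t(2) order_refl] main
      by (simp add: Z_def[abs_def] del: vector_minus_component)
  qed
qed

text \<open>A relation between an integrand and its integral rather than a function on integrands: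
  sums may be formed without a common grid, and no question of independence of the representation
  arises.\<close>

inductive simple :: "(real \<times> 'w \<Rightarrow> real^'n^'m) \<Rightarrow> ('w \<Rightarrow> real^'m) \<Rightarrow> bool" where
  elem: "0 \<le> a \<Longrightarrow> a \<le> b \<Longrightarrow> b \<le> T \<Longrightarrow> \<xi> \<in> borel_measurable (\<F> a) \<Longrightarrow> bounded (\<xi> ` space M) \<Longrightarrow>
    simple (\<lambda>z. indicator {a<..b} (fst z) *\<^sub>R \<xi> (snd z)) (\<lambda>\<omega>. \<xi> \<omega> *v (W b \<omega> - W a \<omega>))"
| add: "simple \<phi> I \<Longrightarrow> simple \<psi> J \<Longrightarrow> simple (\<lambda>z. \<phi> z + \<psi> z) (\<lambda>\<omega>. I \<omega> + J \<omega>)"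

lemma simple_measurable:
  assumes "simple \<phi> I"
  shows "\<phi> \<in> borel_measurable P" "I \<in> borel_measurable M" "\<exists>C. \<forall>z\<in>space P. norm (\<phi> z) \<le> C"
proof -
  have "\<phi> \<in> borel_measurable P \<and> I \<in> borel_measurable M \<and> (\<exists>C. \<forall>z\<in>space P. norm (\<phi> z) \<le> C)"
    using assms
  proof induction
    case (elem a b \<xi>)
    then have ab: "a \<in> {0..T}" "b \<in> {0..T}" by auto
    note [measurable] = adapted_measurable[OF ab(1) elem(4)] W_measurable[OF ab(1)] W_measurable[OF ab(2)]
    obtain C where C: "\<And>\<omega>. \<omega> \<in> space M \<Longrightarrow> norm (\<xi> \<omega>) \<le> C"
      using elem(5) unfolding bounded_iff by (metis imageI)
    have "norm (indicator {a<..b} (fst z) *\<^sub>R \<xi> (snd z)) \<le> C" if "z \<in> space P" for z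
    proof -
      have "snd z \<in> space M" using that by (auto simp: space_P)
      then show ?thesis using C[of "snd z"] order_trans[OF norm_ge_zero C[of "snd z"]] by (simp add: indicator_def)
    qed
    then have "\<exists>C. \<forall>z\<in>space P. norm (indicator {a<..b} (fst z) *\<^sub>R \<xi> (snd z)) \<le> C" by blast
    moreover have "(\<lambda>z. indicator {a<..b} (fst z) *\<^sub>R \<xi> (snd z)) \<in> borel_measurable P" by measurable
    moreover have "(\<lambda>\<omega>. \<xi> \<omega> *v (W b \<omega> - W a \<omega>)) \<in> borel_measurable M" by measurable
    ultimately show ?case by blast
  next
    case (add \<phi> I \<psi> J)
    then obtain C D where "\<forall>z\<in>space P. norm (\<phi> z) \<le> C" "\<forall>z\<in>space P. norm (\<psi> z) \<le> D" by blast
    then have "\<forall>z\<in>space P. norm (\<phi> z + \<psi> z) \<le> C + D" by (auto intro: norm_triangle_mono)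
    then show ?case using add by auto
  qed
  then show "\<phi> \<in> borel_measurable P" "I \<in> borel_measurable M" "\<exists>C. \<forall>z\<in>space P. norm (\<phi> z) \<le> C" by auto
qed

lemma integrable_simple_inner:
  assumes "simple \<phi> I" "simple \<psi> J"
  shows "integrable P (\<lambda>z. \<phi> z \<bullet> \<psi> z)"
proof -
  obtain C D where C: "\<forall>z\<in>space P. norm (\<phi> z) \<le> C" and D: "\<forall>z\<in>space P. norm (\<psi> z) \<le> D"
    using simple_measurable(3)[OF assms(1)] simple_measurable(3)[OF assms(2)] by blast
  note [measurable] = simple_measurable(1)[OF assms(1)] simple_measurable(1)[OF assms(2)]
  have "norm (\<phi> z \<bullet> \<psi> z) \<le> C * D" if "z \<in> space P" for z
  proof -
    have "norm (\<phi> z \<bullet> \<psi> z) \<le> norm (\<phi> z) * norm (\<psi> z)" using Cauchy_Schwarz_ineq2 by auto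
    also have "\<dots> \<le> C * D" using C D that by (meson mult_mono norm_ge_zero order_trans)
    finally show ?thesis .
  qed
  then show ?thesis
    by (intro finite_measure.integrable_const_bound[OF finite_P, of _ "C * D"]) auto
qed

lemma elem_inner_ordered:
  fixes \<xi> \<eta> :: "'w \<Rightarrow> real^'n^'m"
  assumes t: "0 \<le> a" "a \<le> c" "a \<le> b" "b \<le> T" "c \<le> d" "d \<le> T"
    and \<xi>: "\<xi> \<in> borel_measurable (\<F> a)" "bounded (\<xi> ` space M)" and \<eta>: "\<eta> \<in> borel_measurable (\<F> c)" "bounded (\<eta> ` space M)"
  shows "integrable M (\<lambda>\<omega>. (\<xi> \<omega> *v (W b \<omega> - W a \<omega>)) \<bullet> (\<eta> \<omega> *v (W d \<omega> - W c \<omega>))) \<and>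
    expectation (\<lambda>\<omega>. (\<xi> \<omega> *v (W b \<omega> - W a \<omega>)) \<bullet> (\<eta> \<omega> *v (W d \<omega> - W c \<omega>))) =
      expectation (\<lambda>\<omega>. \<xi> \<omega> \<bullet> \<eta> \<omega>) * max 0 (min b d - c)"
proof -
  have bnd: "bounded ((\<lambda>\<omega>. \<zeta> \<omega> $ i $ p) ` space M)" if \<zeta>: "bounded (\<zeta> ` space M)" for \<zeta> :: "'w \<Rightarrow> real^'n^'m" and i p
  proof -
    have "norm (\<zeta> \<omega> $ i $ p) \<le> norm (\<zeta> \<omega>)" for \<omega>
      by (rule order_trans[OF Finite_Cartesian_Product.norm_nth_le Finite_Cartesian_Product.norm_nth_le])
    moreover obtain C where "\<And>\<omega>. \<omega> \<in> space M \<Longrightarrow> norm (\<zeta> \<omega>) \<le> C"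
      using bounded_imageE[OF \<zeta>] by blast
    ultimately have "\<And>\<omega>. \<omega> \<in> space M \<Longrightarrow> norm (\<zeta> \<omega> $ i $ p) \<le> C" by (meson order_trans)
    then show ?thesis unfolding bounded_iff by blast
  qed
  have T4: "a \<in> {0..T}" "c \<in> {0..T}" using t by auto
  note [measurable] = \<xi>(1) \<eta>(1)
  have prod: "integrable M (\<lambda>\<omega>. (\<xi> \<omega> $ i $ p * (W b \<omega> - W a \<omega>) $ p) * (\<eta> \<omega> $ i $ q * (W d \<omega> - W c \<omega>) $ q)) \<and>
    expectation (\<lambda>\<omega>. (\<xi> \<omega> $ i $ p * (W b \<omega> - W a \<omega>) $ p) * (\<eta> \<omega> $ i $ q * (W d \<omega> - W c \<omega>) $ q)) =
      (if p = q then expectation (\<lambda>\<omega>. \<xi> \<omega> $ i $ p * \<eta> \<omega> $ i $ q) * max 0 (min b d - c) else 0)" for i p q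
    by (rule increment_product[OF t]) (use \<xi> \<eta> bnd in auto)
  have eq: "(\<xi> \<omega> *v (W b \<omega> - W a \<omega>)) \<bullet> (\<eta> \<omega> *v (W d \<omega> - W c \<omega>)) =
    (\<Sum>i\<in>UNIV. \<Sum>p\<in>UNIV. \<Sum>q\<in>UNIV. (\<xi> \<omega> $ i $ p * (W b \<omega> - W a \<omega>) $ p) * (\<eta> \<omega> $ i $ q * (W d \<omega> - W c \<omega>) $ q))" for \<omega>
    by (simp add: inner_vec_def matrix_vector_mult_def sum_product)
  have int\<xi>\<eta>: "integrable M (\<lambda>\<omega>. \<xi> \<omega> $ i $ p * \<eta> \<omega> $ i $ p)" for i p
  proof (rule integrable_bounded)
    show "(\<lambda>\<omega>. \<xi> \<omega> $ i $ p * \<eta> \<omega> $ i $ p) \<in> borel_measurable M"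
      using adapted_measurable[OF T4(1) \<xi>(1)] adapted_measurable[OF T4(2) \<eta>(1)] by measurable
    obtain C D where "\<And>\<omega>. \<omega> \<in> space M \<Longrightarrow> norm (\<xi> \<omega> $ i $ p) \<le> C" "\<And>\<omega>. \<omega> \<in> space M \<Longrightarrow> norm (\<eta> \<omega> $ i $ p) \<le> D"
      using bnd[OF \<xi>(2), of i p] bnd[OF \<eta>(2), of i p] unfolding bounded_iff by (metis imageI)
    then have "norm (\<xi> \<omega> $ i $ p * \<eta> \<omega> $ i $ p) \<le> \<bar>C\<bar> * \<bar>D\<bar>" if "\<omega> \<in> space M" for \<omega>
      unfolding norm_mult using that by (meson abs_ge_self abs_ge_zero mult_mono norm_ge_zero order_trans)
    then show "bounded ((\<lambda>\<omega>. \<xi> \<omega> $ i $ p * \<eta> \<omega> $ i $ p) ` space M)" unfolding bounded_iff by blast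
  qed
  have "expectation (\<lambda>\<omega>. \<xi> \<omega> \<bullet> \<eta> \<omega>) = (\<Sum>i\<in>UNIV. \<Sum>p\<in>UNIV. expectation (\<lambda>\<omega>. \<xi> \<omega> $ i $ p * \<eta> \<omega> $ i $ p))"
    unfolding inner_vec_def inner_real_def using int\<xi>\<eta> by simp
  then show ?thesis
    unfolding eq using prod int\<xi>\<eta> by (simp add: sum_distrib_right)
qed

text \<open>The overlap length is the \<open>time_measure\<close> of the intersection of the
  intervals, and Fubini turns the covariance into an inner product on the product space. The two
  orders of the left end points are symmetric.\<close>

lemma elem_inner:
  fixes \<xi> \<eta> :: "'w \<Rightarrow> real^'n^'m"
  assumes t: "0 \<le> a" "a \<le> b" "b \<le> T" "0 \<le> c" "c \<le> d" "d \<le> T"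
    and \<xi>: "\<xi> \<in> borel_measurable (\<F> a)" "bounded (\<xi> ` space M)" and \<eta>: "\<eta> \<in> borel_measurable (\<F> c)" "bounded (\<eta> ` space M)"
  shows "integrable M (\<lambda>\<omega>. (\<xi> \<omega> *v (W b \<omega> - W a \<omega>)) \<bullet> (\<eta> \<omega> *v (W d \<omega> - W c \<omega>))) \<and>
    expectation (\<lambda>\<omega>. (\<xi> \<omega> *v (W b \<omega> - W a \<omega>)) \<bullet> (\<eta> \<omega> *v (W d \<omega> - W c \<omega>))) =
     (\<integral>z. (indicator {a<..b} (fst z) *\<^sub>R \<xi> (snd z)) \<bullet> (indicator {c<..d} (fst z) *\<^sub>R \<eta> (snd z)) \<partial>P)"
proof -
  let ?l = "max 0 (min b d - max a c)"
  have 1: "integrable M (\<lambda>\<omega>. (\<xi> \<omega> *v (W b \<omega> - W a \<omega>)) \<bullet> (\<eta> \<omega> *v (W d \<omega> - W c \<omega>))) \<and>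
    expectation (\<lambda>\<omega>. (\<xi> \<omega> *v (W b \<omega> - W a \<omega>)) \<bullet> (\<eta> \<omega> *v (W d \<omega> - W c \<omega>))) = expectation (\<lambda>\<omega>. \<xi> \<omega> \<bullet> \<eta> \<omega>) * ?l"
  proof (cases "a \<le> c")
    case True
    then show ?thesis using elem_inner_ordered[OF t(1) True t(2,3,5,6) \<xi> \<eta>] by (simp add: max.absorb2)
  next
    case False
    then have "c \<le> a" by simp
    then show ?thesis
      using elem_inner_ordered[OF t(4) \<open>c \<le> a\<close> t(5,6,2,3) \<eta> \<xi>] by (simp add: max.absorb1 inner_commute min.commute)
  qed
  have "(\<integral>z. (indicator {a<..b} (fst z) *\<^sub>R \<xi> (snd z)) \<bullet> (indicator {c<..d} (fst z) *\<^sub>R \<eta> (snd z)) \<partial>P) =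
    (\<integral>s. (\<integral>\<omega>. (indicator {a<..b} s *\<^sub>R \<xi> \<omega>) \<bullet> (indicator {c<..d} s *\<^sub>R \<eta> \<omega>) \<partial>M) \<partial>time_measure T)"
    using pair.integral_fst'[OF integrable_simple_inner[OF simple.elem[OF t(1-3) \<xi>] simple.elem[OF t(4-6) \<eta>]]] by simp
  also have "\<dots> = (\<integral>s. expectation (\<lambda>\<omega>. \<xi> \<omega> \<bullet> \<eta> \<omega>) * indicator {max a c<..min b d} s \<partial>time_measure T)"
    by (intro Bochner_Integration.integral_cong) (auto simp: indicator_def)
  also have "\<dots> = expectation (\<lambda>\<omega>. \<xi> \<omega> \<bullet> \<eta> \<omega>) * measure (time_measure T) {max a c<..min b d}"
    using t by (simp add: time_measure_def sets_restrict_space_iff Int_absorb2 subset_eq) 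
  also have "measure (time_measure T) {max a c<..min b d} = ?l"
    using t by (simp add: time_measure_def measure_restrict_space subset_eq) (auto simp: max_def min_def)
  finally show ?thesis using 1 by simp
qed

text \<open>The isometry is proved in its polarised form because inner products are additive in each
  argument, as the two nested inductions require.\<close>

lemma simple_inner:
  assumes "simple \<phi> I" "simple \<psi> J"
  shows "integrable M (\<lambda>\<omega>. I \<omega> \<bullet> J \<omega>) \<and> expectation (\<lambda>\<omega>. I \<omega> \<bullet> J \<omega>) = (\<integral>z. \<phi> z \<bullet> \<psi> z \<partial>P)"
  using assms
proof (induction arbitrary: \<psi> J)
  case (elem a b \<xi>)
  show ?case using elem(6)
  proof induction
    case (elem c d \<eta>)
    then show ?case using elem_inner \<open>0 \<le> a\<close> \<open>a \<le> b\<close> \<open>b \<le> T\<close> \<open>\<xi> \<in> borel_measurable (\<F> a)\<close> \<open>bounded (\<xi> ` space M)\<close> by blast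
  next
    case (add \<phi>1 I1 \<phi>2 I2)
    note s = simple.elem[OF elem(1-5)]
    show ?case
      using add integrable_simple_inner[OF s add(1)] integrable_simple_inner[OF s add(2)] by (simp add: inner_add_right)
  qed
next
  case (add \<phi>1 I1 \<phi>2 I2)
  then show ?case
    using add.IH[OF add.prems] integrable_simple_inner[OF add(1) add.prems] integrable_simple_inner[OF add(2) add.prems]
    by (simp add: inner_add_left)
qed

lemma simple_isometry:
  assumes "simple \<phi> I"
  shows "nsq M I = nsq P \<phi>"
proof -
  have "nsq M I = ennreal (expectation (\<lambda>\<omega>. I \<omega> \<bullet> I \<omega>))"
    unfolding nsq_def power2_norm_eq_inner using simple_inner[OF assms assms] by (intro nn_integral_eq_integral) auto
  also have "\<dots> = ennreal (\<integral>z. \<phi> z \<bullet> \<phi> z \<partial>P)" using simple_inner[OF assms assms] by simp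
  also have "\<dots> = nsq P \<phi>"
    unfolding nsq_def power2_norm_eq_inner using integrable_simple_inner[OF assms assms] by (intro nn_integral_eq_integral[symmetric]) auto
  finally show ?thesis .
qed

end

lemma matrix_vector_mult_uminus_left: "(- A) *v x = - (A *v x)" for A :: "real^'n^'m"
  by (simp add: matrix_vector_mult_def vec_eq_iff sum_negf)

lemma matrix_matrix_mult_zero_right: "A ** 0 = 0" for A :: "real^'n^'m"
  by (simp add: matrix_matrix_mult_def vec_eq_iff)

lemma matrix_matrix_mult_diff_right: "A ** (B - C) = A ** B - A ** C" for A :: "real^'n^'m"
  by (simp add: matrix_matrix_mult_def vec_eq_iff sum_subtractf right_diff_distrib)

section \<open>Linear operations on integrals and their mean square closure\<close>

context wiener
begin

lemma simple_uminus: "simple \<phi> I \<Longrightarrow> simple (\<lambda>z. - \<phi> z) (\<lambda>\<omega>. - I \<omega>)"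
proof (induction rule: simple.induct)
  case (elem a b \<xi>)
  have "bounded ((\<lambda>\<omega>. - \<xi> \<omega>) ` space M)" using elem(5) unfolding bounded_iff by auto
  then have "simple (\<lambda>z. indicator {a<..b} (fst z) *\<^sub>R (- \<xi> (snd z))) (\<lambda>\<omega>. (- \<xi> \<omega>) *v (W b \<omega> - W a \<omega>))"
    using elem by (intro simple.elem) auto
  then show ?case by (simp add: matrix_vector_mult_uminus_left)
next
  case (add \<phi> I \<psi> J)
  then show ?case using simple.add[OF add.IH] by simp
qed

lemma simple_diff: "simple \<phi> I \<Longrightarrow> simple \<psi> J \<Longrightarrow> simple (\<lambda>z. \<phi> z - \<psi> z) (\<lambda>\<omega>. I \<omega> - J \<omega>)"
  using simple.add[of \<phi> I "\<lambda>z. - \<psi> z" "\<lambda>\<omega>. - J \<omega>"] simple_uminus[of \<psi> J] by simp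

lemma simple_zero: "simple (\<lambda>z. 0 :: real^'n^'m) (\<lambda>\<omega>. 0)"
proof -
  have "bounded ((\<lambda>\<omega>. 0 :: real^'n^'m) ` space M)" by (simp add: image_constant_conv)
  from simple.elem[OF _ _ _ _ this, of 0 0] show ?thesis using T by simp
qed

lemma simple_sum: "(\<And>i. i < (k::nat) \<Longrightarrow> simple (\<phi> i) (I i)) \<Longrightarrow> simple (\<lambda>z. \<Sum>i<k. \<phi> i z) (\<lambda>\<omega>. \<Sum>i<k. I i \<omega>)"
  by (induction k) (auto intro: simple_zero simple.add)

text \<open>A matrix known at time \<open>s\<close> may be moved out of an integral over times after
  \<open>s\<close>. One and the same \<open>J\<close> has to serve the restricted integrand and its
  multiple; it depends on the representation by elementary pieces, hence the existential
  form.\<close>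

lemma simple_restrict:
  assumes "simple \<phi> I" and st: "0 \<le> s" "s \<le> t" "t \<le> T"
    and \<theta>: "\<theta> \<in> borel_measurable (\<F> s)" "bounded (\<theta> ` space M)"
  shows "\<exists>J. simple (\<lambda>z. indicator {s<..t} (fst z) *\<^sub>R \<phi> z) J \<and>
    simple (\<lambda>z. \<theta> (snd z) ** (indicator {s<..t} (fst z) *\<^sub>R \<phi> z)) (\<lambda>\<omega>. \<theta> \<omega> *v J \<omega>)"
  using assms(1)
proof (induction rule: simple.induct)
  case (elem a b \<xi>)
  \<comment> \<open>The intersection of the two intervals. Because \<open>s \<le> a'\<close>, the
    factor \<open>\<theta>\<close> is known at the left end point \<open>a'\<close>, so the product
    is again an elementary integrand.\<close>
  define a' b' where "a' = max a s" and "b' = min b t"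
  have ind: "indicator {s<..t} r * indicator {a<..b} r = (indicator {a'<..b'} r :: real)" for r
    by (auto simp: indicator_def a'_def b'_def)
  show ?case
  proof (cases "a' \<le> b'")
    case True
    have *: "0 \<le> a'" "b' \<le> T" "a \<in> {0..T}" "a' \<in> {0..T}" "a \<le> a'" "s \<le> a'" "s \<in> {0..T}"
      using elem st True by (auto simp: a'_def b'_def)
    have m: "\<xi> \<in> borel_measurable (\<F> a')" "\<theta> \<in> borel_measurable (\<F> a')"
      using adapted_mono[OF *(3,4,5) elem(4)] adapted_mono[OF *(7,4,6) \<theta>(1)] by auto
    have b: "bounded ((\<lambda>\<omega>. \<theta> \<omega> ** \<xi> \<omega>) ` space M)"
    proof -
      obtain C where C: "0 \<le> C" "\<And>\<omega>. \<omega> \<in> space M \<Longrightarrow> norm (\<theta> \<omega>) \<le> C" using bounded_imageE[OF \<theta>(2)] by metis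
      obtain D where D: "0 \<le> D" "\<And>\<omega>. \<omega> \<in> space M \<Longrightarrow> norm (\<xi> \<omega>) \<le> D" using bounded_imageE[OF elem(5)] by metis
      have "norm (\<theta> \<omega> ** \<xi> \<omega>) \<le> C * D" if "\<omega> \<in> space M" for \<omega>
        using C D that by (intro order_trans[OF norm_matrix_matrix_le] mult_mono) auto
      then show ?thesis unfolding bounded_iff by blast
    qed
    have 1: "simple (\<lambda>z. indicator {a'<..b'} (fst z) *\<^sub>R \<xi> (snd z)) (\<lambda>\<omega>. \<xi> \<omega> *v (W b' \<omega> - W a' \<omega>))"
      using * True m elem(5) by (intro simple.elem) auto
    have 2: "simple (\<lambda>z. indicator {a'<..b'} (fst z) *\<^sub>R (\<theta> (snd z) ** \<xi> (snd z))) (\<lambda>\<omega>. (\<theta> \<omega> ** \<xi> \<omega>) *v (W b' \<omega> - W a' \<omega>))"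
      using * True m b by (intro simple.elem) auto
    have 3: "\<theta> (snd z) ** (c *\<^sub>R \<xi> (snd z)) = c *\<^sub>R (\<theta> (snd z) ** \<xi> (snd z))" for c and z :: "real \<times> 'w"
      by (simp add: matrix_matrix_mult_def vec_eq_iff sum_distrib_left mult_ac)
    show ?thesis
      using 1 2 by (intro exI[of _ "\<lambda>\<omega>. \<xi> \<omega> *v (W b' \<omega> - W a' \<omega>)"]) (simp add: ind 3 matrix_vector_mul_assoc)
  next
    case False
    then have "indicator {s<..t} r * indicator {a<..b} r = (0 :: real)" for r unfolding ind by (auto simp: indicator_def)
    then have "indicator {s<..t} (fst z) *\<^sub>R indicator {a<..b} (fst z) *\<^sub>R \<xi> (snd z) = 0" for z :: "real \<times> 'w"
      unfolding scaleR_scaleR by simp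
    then show ?thesis
      by (intro exI[of _ "\<lambda>\<omega>. 0"]) (simp only: matrix_matrix_mult_zero_right matrix_vector_mult_0_right simple_zero simp_thms)
  qed
next
  case (add \<phi> I \<psi> J)
  from add.IH(1) obtain I' where I':
    "simple (\<lambda>z. indicator {s<..t} (fst z) *\<^sub>R \<phi> z) I'"
    "simple (\<lambda>z. \<theta> (snd z) ** (indicator {s<..t} (fst z) *\<^sub>R \<phi> z)) (\<lambda>\<omega>. \<theta> \<omega> *v I' \<omega>)"
    by (elim exE conjE)
  from add.IH(2) obtain J' where J':
    "simple (\<lambda>z. indicator {s<..t} (fst z) *\<^sub>R \<psi> z) J'"
    "simple (\<lambda>z. \<theta> (snd z) ** (indicator {s<..t} (fst z) *\<^sub>R \<psi> z)) (\<lambda>\<omega>. \<theta> \<omega> *v J' \<omega>)"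
    by (elim exE conjE)
  show ?case
    using simple.add[OF I'(1) J'(1)] simple.add[OF I'(2) J'(2)]
    by (intro exI[of _ "\<lambda>\<omega>. I' \<omega> + J' \<omega>"])
      (simp only: scaleR_add_right matrix_add_ldistrib matrix_vector_right_distrib simp_thms)
qed

text \<open>The mean square closure of \<open>simple\<close>; adaptedness of the integrand is
  encoded in its approximability. Integrals up to a time \<open>s\<close> are expressed by
  integrands that carry the factor \<open>indicator {0<..s}\<close>.\<close>

definition ito :: "(real \<times> 'w \<Rightarrow> real^'n^'m) \<Rightarrow> ('w \<Rightarrow> real^'m) \<Rightarrow> bool" where
  "ito \<phi> J \<longleftrightarrow> \<phi> \<in> borel_measurable P \<and> J \<in> borel_measurable M \<and>
    (\<exists>\<psi> I. (\<forall>n. simple (\<psi> n) (I n)) \<and> (\<lambda>n. nsq P (\<lambda>z. \<psi> n z - \<phi> z)) \<longlonglongrightarrow> 0 \<and> (\<lambda>n. nsq M (\<lambda>\<omega>. I n \<omega> - J \<omega>)) \<longlonglongrightarrow> 0)"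

lemma simple_imp_ito: "simple \<phi> I \<Longrightarrow> ito \<phi> I"
  unfolding ito_def using simple_measurable[of \<phi> I]
  by (auto intro!: exI[of _ "\<lambda>_. \<phi>"] exI[of _ "\<lambda>_. I"] simp: nsq_def)

text \<open>The constant 4 results from splitting squares twice with factor 2. It is harmless, since
  the bound is only used for quantities that tend to 0.\<close>

lemma ito_bound:
  assumes "ito \<phi> J"
  shows "nsq M J \<le> 4 * nsq P \<phi>"
proof -
  obtain \<psi> I where s: "\<And>n. simple (\<psi> n) (I n)" and \<psi>: "(\<lambda>n. nsq P (\<lambda>z. \<psi> n z - \<phi> z)) \<longlonglongrightarrow> 0"
    and I: "(\<lambda>n. nsq M (\<lambda>\<omega>. I n \<omega> - J \<omega>)) \<longlonglongrightarrow> 0" and [measurable]: "\<phi> \<in> borel_measurable P" "J \<in> borel_measurable M"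
    using assms unfolding ito_def by blast
  note [measurable] = simple_measurable(1,2)[OF s]
  have "nsq M J \<le> 2 * nsq M (\<lambda>\<omega>. I n \<omega> - J \<omega>) + (4 * nsq P (\<lambda>z. \<psi> n z - \<phi> z) + 4 * nsq P \<phi>)" for n
  proof -
    have "nsq M J = nsq M (\<lambda>\<omega>. (J \<omega> - I n \<omega>) + I n \<omega>)" by simp
    also have "\<dots> \<le> 2 * nsq M (\<lambda>\<omega>. J \<omega> - I n \<omega>) + 2 * nsq M (I n)" by (intro nsq_add) measurable
    also have "nsq M (I n) = nsq P (\<lambda>z. (\<psi> n z - \<phi> z) + \<phi> z)" using simple_isometry[OF s] by simp
    also have "2 * nsq M (\<lambda>\<omega>. J \<omega> - I n \<omega>) + 2 * \<dots> \<le> 2 * nsq M (\<lambda>\<omega>. J \<omega> - I n \<omega>) + 2 * (2 * nsq P (\<lambda>z. \<psi> n z - \<phi> z) + 2 * nsq P \<phi>)"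
      by (intro add_left_mono mult_left_mono nsq_add) auto
    finally show ?thesis
      by (simp add: nsq_minus_commute[of M J] algebra_simps mult.assoc[symmetric])
  qed
  moreover have "(\<lambda>n. 2 * nsq M (\<lambda>\<omega>. I n \<omega> - J \<omega>) + (4 * nsq P (\<lambda>z. \<psi> n z - \<phi> z) + 4 * nsq P \<phi>)) \<longlonglongrightarrow> 0 + (0 + 4 * nsq P \<phi>)"
    by (intro tendsto_add ennreal_tendsto_0_mult I \<psi> tendsto_const) auto
  ultimately show ?thesis
    using LIMSEQ_le_const by fastforce
qed

lemma ito_add:
  assumes "ito \<phi>1 J1" "ito \<phi>2 J2"
  shows "ito (\<lambda>z. \<phi>1 z + \<phi>2 z) (\<lambda>\<omega>. J1 \<omega> + J2 \<omega>)"
proof -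
  obtain \<psi>1 I1 where s1: "\<And>n. simple (\<psi>1 n) (I1 n)" and 1: "(\<lambda>n. nsq P (\<lambda>z. \<psi>1 n z - \<phi>1 z)) \<longlonglongrightarrow> 0"
     "(\<lambda>n. nsq M (\<lambda>\<omega>. I1 n \<omega> - J1 \<omega>)) \<longlonglongrightarrow> 0" and [measurable]: "\<phi>1 \<in> borel_measurable P" "J1 \<in> borel_measurable M"
    using assms(1) unfolding ito_def by blast
  obtain \<psi>2 I2 where s2: "\<And>n. simple (\<psi>2 n) (I2 n)" and 2: "(\<lambda>n. nsq P (\<lambda>z. \<psi>2 n z - \<phi>2 z)) \<longlonglongrightarrow> 0"
     "(\<lambda>n. nsq M (\<lambda>\<omega>. I2 n \<omega> - J2 \<omega>)) \<longlonglongrightarrow> 0" and [measurable]: "\<phi>2 \<in> borel_measurable P" "J2 \<in> borel_measurable M"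
    using assms(2) unfolding ito_def by blast
  note [measurable] = simple_measurable(1,2)[OF s1] simple_measurable(1,2)[OF s2]
  have a: "nsq P (\<lambda>z. (\<psi>1 n z + \<psi>2 n z) - (\<phi>1 z + \<phi>2 z)) \<le> 2 * nsq P (\<lambda>z. \<psi>1 n z - \<phi>1 z) + 2 * nsq P (\<lambda>z. \<psi>2 n z - \<phi>2 z)" for n
    using nsq_add[of "\<lambda>z. \<psi>1 n z - \<phi>1 z" P "\<lambda>z. \<psi>2 n z - \<phi>2 z"] by (simp add: algebra_simps)
  have b: "nsq M (\<lambda>z. (I1 n z + I2 n z) - (J1 z + J2 z)) \<le> 2 * nsq M (\<lambda>z. I1 n z - J1 z) + 2 * nsq M (\<lambda>z. I2 n z - J2 z)" for n
    using nsq_add[of "\<lambda>z. I1 n z - J1 z" M "\<lambda>z. I2 n z - J2 z"] by (simp add: algebra_simps)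
  show ?thesis
    unfolding ito_def
  proof (intro conjI exI allI)
    show "simple (\<lambda>z. \<psi>1 n z + \<psi>2 n z) (\<lambda>\<omega>. I1 n \<omega> + I2 n \<omega>)" for n by (intro simple.add s1 s2)
    show "(\<lambda>n. nsq P (\<lambda>z. (\<psi>1 n z + \<psi>2 n z) - (\<phi>1 z + \<phi>2 z))) \<longlonglongrightarrow> 0"
      using tendsto_0_if_le_2_sum[OF a 1(1) 2(1)] .
    show "(\<lambda>n. nsq M (\<lambda>z. (I1 n z + I2 n z) - (J1 z + J2 z))) \<longlonglongrightarrow> 0"
      using tendsto_0_if_le_2_sum[OF b 1(2) 2(2)] .
  qed measurable
qed

lemma ito_uminus:
  assumes "ito \<phi> J" shows "ito (\<lambda>z. - \<phi> z) (\<lambda>\<omega>. - J \<omega>)"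
proof -
  obtain \<psi> I where s: "\<And>n. simple (\<psi> n) (I n)" and 1: "(\<lambda>n. nsq P (\<lambda>z. \<psi> n z - \<phi> z)) \<longlonglongrightarrow> 0"
     "(\<lambda>n. nsq M (\<lambda>\<omega>. I n \<omega> - J \<omega>)) \<longlonglongrightarrow> 0" and [measurable]: "\<phi> \<in> borel_measurable P" "J \<in> borel_measurable M"
    using assms unfolding ito_def by blast
  show ?thesis
    unfolding ito_def
  proof (intro conjI exI allI)
    show "simple (\<lambda>z. - \<psi> n z) (\<lambda>\<omega>. - I n \<omega>)" for n by (intro simple_uminus s)
    show "(\<lambda>n. nsq P (\<lambda>z. - \<psi> n z - - \<phi> z)) \<longlonglongrightarrow> 0" using 1(1) by (simp add: nsq_minus_commute[of P \<phi>])
    show "(\<lambda>n. nsq M (\<lambda>z. - I n z - - J z)) \<longlonglongrightarrow> 0" using 1(2) by (simp add: nsq_minus_commute[of M J])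
  qed measurable
qed

lemma ito_diff: "ito \<phi>1 J1 \<Longrightarrow> ito \<phi>2 J2 \<Longrightarrow> ito (\<lambda>z. \<phi>1 z - \<phi>2 z) (\<lambda>\<omega>. J1 \<omega> - J2 \<omega>)"
  using ito_add[of \<phi>1 J1 "\<lambda>z. - \<phi>2 z" "\<lambda>\<omega>. - J2 \<omega>"] ito_uminus[of \<phi>2 J2] by simp

lemma ito_sum: "(\<And>i. i < (k::nat) \<Longrightarrow> ito (\<phi> i) (J i)) \<Longrightarrow> ito (\<lambda>z. \<Sum>i<k. \<phi> i z) (\<lambda>\<omega>. \<Sum>i<k. J i \<omega>)"
  by (induction k) (auto intro: simple_imp_ito simple_zero ito_add)

text \<open>As \<open>\<phi>\<close> vanishes outside the interval, cutting the approximations off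
  there only brings them closer to it. A bounded matrix known at the left end then acts on integrand
  and integral alike.\<close>

lemma ito_restrict:
  assumes "ito \<phi> J" and st: "0 \<le> s" "s \<le> t" "t \<le> T"
    and \<theta>: "\<theta> \<in> borel_measurable (\<F> s)" "bounded (\<theta> ` space M)"
    and supp: "\<And>z. z \<in> space P \<Longrightarrow> fst z \<notin> {s<..t} \<Longrightarrow> \<phi> z = 0"
  shows "ito (\<lambda>z. \<theta> (snd z) ** \<phi> z) (\<lambda>\<omega>. \<theta> \<omega> *v J \<omega>)"
proof -
  obtain \<psi> I where s: "\<And>n. simple (\<psi> n) (I n)" and 1: "(\<lambda>n. nsq P (\<lambda>z. \<psi> n z - \<phi> z)) \<longlonglongrightarrow> 0"
     "(\<lambda>n. nsq M (\<lambda>\<omega>. I n \<omega> - J \<omega>)) \<longlonglongrightarrow> 0" and [measurable]: "\<phi> \<in> borel_measurable P" "J \<in> borel_measurable M"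
    using assms(1) unfolding ito_def by blast
  define \<zeta> where "\<zeta> n z = indicator {s<..t} (fst z) *\<^sub>R \<psi> n z" for n z
  have "\<forall>n. \<exists>I'. simple (\<zeta> n) I' \<and> simple (\<lambda>z. \<theta> (snd z) ** \<zeta> n z) (\<lambda>\<omega>. \<theta> \<omega> *v I' \<omega>)"
    unfolding \<zeta>_def using simple_restrict[OF s st \<theta>] by (intro allI)
  from choice[OF this] obtain I' where "\<forall>n. simple (\<zeta> n) (I' n) \<and> simple (\<lambda>z. \<theta> (snd z) ** \<zeta> n z) (\<lambda>\<omega>. \<theta> \<omega> *v I' n \<omega>)"
    by (elim exE)
  then have s': "simple (\<zeta> n) (I' n)" and s'': "simple (\<lambda>z. \<theta> (snd z) ** \<zeta> n z) (\<lambda>\<omega>. \<theta> \<omega> *v I' n \<omega>)" for n by auto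
  have [measurable]: "\<theta> \<in> borel_measurable M" using adapted_measurable[OF _ \<theta>(1)] st by auto
  note [measurable] = simple_measurable(1,2)[OF s] simple_measurable(1,2)[OF s']
  obtain C where C: "0 \<le> C" "\<And>\<omega>. \<omega> \<in> space M \<Longrightarrow> norm (\<theta> \<omega>) \<le> C" using bounded_imageE[OF \<theta>(2)] by metis
  have le: "nsq P (\<lambda>z. \<zeta> n z - \<phi> z) \<le> nsq P (\<lambda>z. \<psi> n z - \<phi> z)" for n
  proof (rule nsq_mono)
    fix z assume "z \<in> space P"
    then show "norm (\<zeta> n z - \<phi> z) \<le> norm (\<psi> n z - \<phi> z)"
      using supp[of z] by (cases "fst z \<in> {s<..t}") (auto simp: \<zeta>_def)
  qed
  have \<zeta>: "(\<lambda>n. nsq P (\<lambda>z. \<zeta> n z - \<phi> z)) \<longlonglongrightarrow> 0"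
    by (rule tendsto_sandwich[OF always_eventually always_eventually tendsto_const 1(1)]) (use le in auto)
  \<comment> \<open>The integrals of the cut-off integrands must be seen to have the same limit
    \<open>J\<close>; the isometry applied to the difference of the two approximations achieves
    this.\<close>
  have "nsq M (\<lambda>\<omega>. I' n \<omega> - I n \<omega>) \<le> 2 * nsq P (\<lambda>z. \<zeta> n z - \<phi> z) + 2 * nsq P (\<lambda>z. \<psi> n z - \<phi> z)" for n
  proof -
    have "nsq M (\<lambda>\<omega>. I' n \<omega> - I n \<omega>) = nsq P (\<lambda>z. (\<zeta> n z - \<phi> z) + (\<phi> z - \<psi> n z))"
      using simple_isometry[OF simple_diff[OF s' s]] by simp
    also have "\<dots> \<le> 2 * nsq P (\<lambda>z. \<zeta> n z - \<phi> z) + 2 * nsq P (\<lambda>z. \<phi> z - \<psi> n z)"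
      by (intro nsq_add) measurable
    finally show ?thesis by (simp add: nsq_minus_commute[of P \<phi>])
  qed
  from tendsto_0_if_le_2_sum[OF this \<zeta> 1(1)]
  have 2: "(\<lambda>n. nsq M (\<lambda>\<omega>. I' n \<omega> - I n \<omega>)) \<longlonglongrightarrow> 0" .
  have "nsq M (\<lambda>\<omega>. I' n \<omega> - J \<omega>) \<le> 2 * nsq M (\<lambda>\<omega>. I' n \<omega> - I n \<omega>) + 2 * nsq M (\<lambda>\<omega>. I n \<omega> - J \<omega>)" for n
    using nsq_add[of "\<lambda>\<omega>. I' n \<omega> - I n \<omega>" M "\<lambda>\<omega>. I n \<omega> - J \<omega>"] by simp
  from tendsto_0_if_le_2_sum[OF this 2 1(2)]
  have I': "(\<lambda>n. nsq M (\<lambda>\<omega>. I' n \<omega> - J \<omega>)) \<longlonglongrightarrow> 0" .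
  have mult_tendsto: "(\<lambda>n. f n) \<longlonglongrightarrow> 0" if "\<And>n. f n \<le> ennreal (C\<^sup>2) * g n" "g \<longlonglongrightarrow> 0" for f g :: "nat \<Rightarrow> ennreal"
    by (rule tendsto_sandwich[OF always_eventually always_eventually tendsto_const ennreal_tendsto_0_mult[OF that(2), of "ennreal (C\<^sup>2)"]])
      (use that in auto)
  show ?thesis
    unfolding ito_def
  proof (intro conjI exI allI)
    show "simple (\<lambda>z. \<theta> (snd z) ** \<zeta> n z) (\<lambda>\<omega>. \<theta> \<omega> *v I' n \<omega>)" for n by (rule s'')
    show "(\<lambda>n. nsq P (\<lambda>z. \<theta> (snd z) ** \<zeta> n z - \<theta> (snd z) ** \<phi> z)) \<longlonglongrightarrow> 0"
    proof (rule mult_tendsto[OF nsq_mono_mult \<zeta>])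
      fix n z assume "z \<in> space P"
      then have "norm (\<theta> (snd z)) \<le> C" using C(2)[of "snd z"] by (auto simp: space_P)
      then show "norm (\<theta> (snd z) ** \<zeta> n z - \<theta> (snd z) ** \<phi> z) \<le> C * norm (\<zeta> n z - \<phi> z)"
        unfolding matrix_matrix_mult_diff_right[symmetric]
        by (intro order_trans[OF norm_matrix_matrix_le] mult_right_mono) auto
    qed measurable
    show "(\<lambda>n. nsq M (\<lambda>\<omega>. \<theta> \<omega> *v I' n \<omega> - \<theta> \<omega> *v J \<omega>)) \<longlonglongrightarrow> 0"
    proof (rule mult_tendsto[OF nsq_mono_mult I'])
      fix n \<omega> assume "\<omega> \<in> space M"
      then show "norm (\<theta> \<omega> *v I' n \<omega> - \<theta> \<omega> *v J \<omega>) \<le> C * norm (I' n \<omega> - J \<omega>)"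
        unfolding matrix_vector_mult_diff_distrib[symmetric]
        by (intro order_trans[OF norm_matrix_vector_le] mult_right_mono C) auto
    qed measurable
  qed measurable
qed

end

section \<open>Step processes on a grid and entrywise truncation\<close>

lemma interval_sum_eq:
  fixes h :: "nat \<Rightarrow> 'b::real_vector" and \<tau> :: "nat \<Rightarrow> real"
  assumes \<tau>: "\<And>i. i < k \<Longrightarrow> \<tau> i \<le> \<tau> (Suc i)" and i: "i < k" "s \<in> {\<tau> i<..\<tau> (Suc i)}"
  shows "(\<Sum>j<k. indicator {\<tau> j<..\<tau> (Suc j)} s *\<^sub>R h j) = h i"
proof -
  have mono: "\<tau> i \<le> \<tau> j" if "i \<le> j" "j \<le> k" for i j
    using that
  proof (induction j rule: dec_induct)
    case (step m)
    then have "\<tau> i \<le> \<tau> m" "\<tau> m \<le> \<tau> (Suc m)" using \<tau>[of m] by auto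
    then show ?case by simp
  qed simp
  have "s \<notin> {\<tau> j<..\<tau> (Suc j)}" if "j < k" "j \<noteq> i" for j
    using mono[of "Suc j" i] mono[of "Suc i" j] i that by (cases "j < i") auto
  then have "(\<Sum>j<k. indicator {\<tau> j<..\<tau> (Suc j)} s *\<^sub>R h j) = (\<Sum>j<k. if j = i then h j else 0)"
    using i by (intro sum.cong) auto
  then show ?thesis using i by simp
qed

lemma step_mono:
  assumes "step_process M \<F> t k \<tau> \<xi>" "i \<le> j" "j \<le> k"
  shows "\<tau> i \<le> \<tau> j"
  using assms(2,3)
proof (induction j rule: dec_induct)
  case (step n)
  then show ?case using assms(1) unfolding step_process_def by (metis Suc_le_eq Suc_leD order_trans)
qed simp

lemma step_bounds:
  assumes "step_process M \<F> t k \<tau> \<xi>" "i \<le> k"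
  shows "0 \<le> \<tau> i" "\<tau> i \<le> t"
  using step_mono[OF assms(1), of 0 i] step_mono[OF assms(1), of i k] assms unfolding step_process_def by auto

lemma step_sum_eq:
  fixes h :: "nat \<Rightarrow> 'b::real_vector"
  assumes "step_process M \<F> t k \<tau> \<xi>" "i < k" "s \<in> {\<tau> i<..\<tau> (Suc i)}"
  shows "(\<Sum>j<k. indicator {\<tau> j<..\<tau> (Suc j)} s *\<^sub>R h j) = h i"
  by (rule interval_sum_eq[OF _ assms(2,3)]) (use assms(1) in \<open>auto simp: step_process_def\<close>)

text \<open>At each time at most one summand is nonzero, so any map that fixes 0, linear or not,
  acts termwise. It is applied to squared norms, to clipping and to multiplication by a
  vector.\<close>

lemma step_fun:
  fixes h :: "nat \<Rightarrow> 'b::real_vector" and f :: "'b \<Rightarrow> 'c::real_vector"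
  assumes "step_process M \<F> t k \<tau> \<xi>" "f 0 = 0"
  shows "f (\<Sum>i<k. indicator {\<tau> i<..\<tau> (Suc i)} s *\<^sub>R h i) = (\<Sum>i<k. indicator {\<tau> i<..\<tau> (Suc i)} s *\<^sub>R f (h i))"
proof (cases "\<exists>i<k. s \<in> {\<tau> i<..\<tau> (Suc i)}")
  case True
  then obtain i where i: "i < k" "s \<in> {\<tau> i<..\<tau> (Suc i)}" by blast
  show ?thesis by (simp only: step_sum_eq[OF assms(1) i])
next
  case False
  then have "(\<Sum>i<k. indicator {\<tau> i<..\<tau> (Suc i)} s *\<^sub>R h i) = 0" "(\<Sum>i<k. indicator {\<tau> i<..\<tau> (Suc i)} s *\<^sub>R f (h i)) = 0"
    by (intro sum.neutral; auto)+
  then show ?thesis using assms(2) by simp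
qed

lemma step_norm_integral:
  assumes step: "step_process M \<F> t k \<tau> \<xi>" and "t \<le> u"
  shows "(\<integral>\<^sup>+s\<in>{0..u}. ennreal ((norm (step_value k \<tau> \<xi> s \<omega>))\<^sup>2) \<partial>lborel) =
    ennreal (\<Sum>i<k. (\<tau> (Suc i) - \<tau> i) * (norm (\<xi> i \<omega>))\<^sup>2)"
proof -
  have norm_eq: "(norm (step_value k \<tau> \<xi> s \<omega>))\<^sup>2 = (\<Sum>i<k. indicator {\<tau> i<..\<tau> (Suc i)} s *\<^sub>R (norm (\<xi> i \<omega>))\<^sup>2)" for s
    unfolding step_value_def by (rule step_fun[OF step]) simp
  have "(\<integral>\<^sup>+s\<in>{0..u}. ennreal ((norm (step_value k \<tau> \<xi> s \<omega>))\<^sup>2) \<partial>lborel) =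
    (\<integral>\<^sup>+s. (\<Sum>i<k. ennreal ((norm (\<xi> i \<omega>))\<^sup>2) * indicator {\<tau> i<..\<tau> (Suc i)} s) \<partial>lborel)"
  proof (intro nn_integral_cong)
    fix s
    have "indicator {\<tau> i<..\<tau> (Suc i)} s * indicator {0..u} s = (indicator {\<tau> i<..\<tau> (Suc i)} s :: real)" if "i < k" for i
      using step_bounds[OF step, of i] step_bounds[OF step, of "Suc i"] that \<open>t \<le> u\<close> by (auto simp: indicator_def)
    then have "(\<Sum>i<k. indicator {\<tau> i<..\<tau> (Suc i)} s *\<^sub>R (norm (\<xi> i \<omega>))\<^sup>2) * indicator {0..u} s =
       (\<Sum>i<k. (norm (\<xi> i \<omega>))\<^sup>2 * indicator {\<tau> i<..\<tau> (Suc i)} s)"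
      unfolding sum_distrib_right by (intro sum.cong) (auto simp: mult_ac)
    moreover have "ennreal a * indicator A s = ennreal (a * indicator A s)" for a A
      by (simp add: indicator_def)
    moreover have "(\<Sum>i<k. ennreal ((norm (\<xi> i \<omega>))\<^sup>2 * indicator {\<tau> i<..\<tau> (Suc i)} s)) =
      ennreal (\<Sum>i<k. (norm (\<xi> i \<omega>))\<^sup>2 * indicator {\<tau> i<..\<tau> (Suc i)} s)"
      by (rule sum_ennreal) auto
    ultimately show "ennreal ((norm (step_value k \<tau> \<xi> s \<omega>))\<^sup>2) * indicator {0..u} s =
      (\<Sum>i<k. ennreal ((norm (\<xi> i \<omega>))\<^sup>2) * indicator {\<tau> i<..\<tau> (Suc i)} s)"
      by (simp only: norm_eq)
  qed
  also have "\<dots> = (\<Sum>i<k. ennreal ((norm (\<xi> i \<omega>))\<^sup>2) * ennreal (\<tau> (Suc i) - \<tau> i))"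
    using step by (subst nn_integral_sum) (auto simp: nn_integral_cmult_indicator step_process_def)
  also have "\<dots> = ennreal (\<Sum>i<k. (\<tau> (Suc i) - \<tau> i) * (norm (\<xi> i \<omega>))\<^sup>2)"
  proof -
    have "(\<Sum>i<k. ennreal ((norm (\<xi> i \<omega>))\<^sup>2) * ennreal (\<tau> (Suc i) - \<tau> i)) = (\<Sum>i<k. ennreal ((\<tau> (Suc i) - \<tau> i) * (norm (\<xi> i \<omega>))\<^sup>2))"
      using step by (intro sum.cong refl) (simp add: ennreal_mult[symmetric] step_process_def mult.commute)
    also have "\<dots> = ennreal (\<Sum>i<k. (\<tau> (Suc i) - \<tau> i) * (norm (\<xi> i \<omega>))\<^sup>2)"
      using step by (intro sum_ennreal) (simp add: step_process_def)
    finally show ?thesis .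
  qed
  finally show ?thesis .
qed

text \<open>For \<open>0 \<le> C\<close> this is the nearest-point projection onto the cube of
  matrices with entries of modulus at most \<open>C\<close>. Entry by entry, it moves a point no
  farther from any matrix of the cube, and by no more than the distance to that matrix.\<close>

definition clip :: "real \<Rightarrow> real^'n^'m \<Rightarrow> real^'n^'m" where
  "clip C x = (\<chi> i j. max (- C) (min C (x $ i $ j)))"

lemma norm_le_componentwise_matrix:
  fixes A B :: "real^'n^'m"
  assumes "\<And>i j. \<bar>A $ i $ j\<bar> \<le> \<bar>B $ i $ j\<bar>"
  shows "norm A \<le> norm B"
proof -
  have "norm (A $ i) \<le> norm (B $ i)" for i
    unfolding norm_vec_def[of "A $ i"] norm_vec_def[of "B $ i"] by (intro L2_set_mono) (use assms in auto)
  then show ?thesis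
    unfolding norm_vec_def[of A] norm_vec_def[of B] by (intro L2_set_mono) auto
qed

lemma clip_zero: "0 \<le> C \<Longrightarrow> clip C 0 = 0"
  by (simp add: clip_def vec_eq_iff)

lemma clip_closer:
  assumes "\<And>i j. \<bar>h $ i $ j\<bar> \<le> C" shows "norm (clip C x - h) \<le> norm (x - h)"
proof (rule norm_le_componentwise_matrix)
  show "\<bar>(clip C x - h) $ i $ j\<bar> \<le> \<bar>(x - h) $ i $ j\<bar>" for i j
    using assms[of i j] by (simp add: clip_def max_def min_def abs_if split: if_splits)
qed

lemma clip_dist:
  assumes "\<And>i j. \<bar>h $ i $ j\<bar> \<le> C" shows "norm (x - clip C x) \<le> norm (x - h)"
proof (rule norm_le_componentwise_matrix)
  show "\<bar>(x - clip C x) $ i $ j\<bar> \<le> \<bar>(x - h) $ i $ j\<bar>" for i j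
    using assms[of i j] by (simp add: clip_def max_def min_def abs_if split: if_splits)
qed

lemma norm_matrix_le_if_components_le:
  fixes A :: "real^'n^'m" and C :: real
  assumes "\<And>i j. \<bar>A $ i $ j\<bar> \<le> C"
  shows "norm A \<le> real CARD('m) * (real CARD('n) * C)"
proof -
  have "norm A \<le> (\<Sum>i\<in>UNIV. norm (A $ i))"
    unfolding norm_vec_def by (rule L2_set_le_sum) simp
  also have "\<dots> \<le> (\<Sum>i\<in>(UNIV::'m set). real CARD('n) * C)"
  proof (rule sum_mono)
    fix i
    have "norm (A $ i) \<le> (\<Sum>j\<in>UNIV. \<bar>A $ i $ j\<bar>)" by (rule norm_le_l1_cart)
    also have "\<dots> \<le> (\<Sum>j\<in>(UNIV::'n set). C)" by (intro sum_mono assms)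
    finally show "norm (A $ i) \<le> real CARD('n) * C" by simp
  qed
  finally show ?thesis by simp
qed

lemma norm_clip: "0 \<le> C \<Longrightarrow> norm (clip C x :: real^'n^'m) \<le> real CARD('m) * (real CARD('n) * C)"
  by (rule norm_matrix_le_if_components_le) (auto simp: clip_def)

lemma borel_measurable_clip [measurable]: "clip C \<in> borel_measurable borel"
  unfolding clip_def by (intro borel_measurable_continuous_onI) (auto intro!: continuous_intros)

lemma step_process_map:
  assumes "step_process M \<F> t k \<tau> \<xi>" and f: "f \<in> borel_measurable borel"
    and b: "\<And>i. i < k \<Longrightarrow> bounded ((\<lambda>\<omega>. f (\<xi> i \<omega>)) ` space M)"
  shows "step_process M \<F> t k \<tau> (\<lambda>i \<omega>. f (\<xi> i \<omega>))"
  using assms unfolding step_process_def by (auto intro: measurable_compose)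

section \<open>Stopping, almost sure subsequences and refinement of grids\<close>

context wiener
begin

lemma step_simple:
  assumes "step_process M \<F> t k \<tau> \<xi>" "t \<in> {0..T}"
  shows "simple (\<lambda>z. step_value k \<tau> \<xi> (fst z) (snd z)) (step_integral W k \<tau> \<xi>)"
proof -
  have "simple (\<lambda>z. \<Sum>i<k. indicator {\<tau> i<..\<tau> (Suc i)} (fst z) *\<^sub>R \<xi> i (snd z))
    (\<lambda>\<omega>. \<Sum>i<k. \<xi> i \<omega> *v (W (\<tau> (Suc i)) \<omega> - W (\<tau> i) \<omega>))"
  proof (intro simple_sum simple.elem)
    fix i assume i: "i < k"
    show "0 \<le> \<tau> i" using step_bounds(1)[OF assms(1), of i] i by simp
    show "\<tau> (Suc i) \<le> T" using step_bounds(2)[OF assms(1), of "Suc i"] i assms(2) by simp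
  qed (use assms(1) in \<open>auto simp: step_process_def\<close>)
  then show ?thesis unfolding step_value_def step_integral_def by simp
qed

lemma nsq_P:
  assumes [measurable]: "\<phi> \<in> borel_measurable P"
  shows "nsq P \<phi> = (\<integral>\<^sup>+\<omega>. (\<integral>\<^sup>+s\<in>{0..T}. ennreal ((norm (\<phi> (s, \<omega>)))\<^sup>2) \<partial>lborel) \<partial>M)"
  unfolding nsq_def nn_integral_time_measure[symmetric]
  by (rule pair.nn_integral_snd[symmetric]) measurable

text \<open>
  The step process is stopped as soon as its quadratic variation would exceed \<open>\<delta>\<close>; the isometry and
  Chebyshev's inequality bound the integral of the stopped process.
\<close>

lemma step_lenglart:
  assumes step: "step_process M \<F> t k \<tau> \<eta>" and t: "t \<in> {0..T}" and e: "0 < \<epsilon>" "0 < \<delta>"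
  shows "prob {\<omega> \<in> space M. \<epsilon> < norm (step_integral W k \<tau> \<eta> \<omega>)} \<le>
    prob {\<omega> \<in> space M. \<delta> < (\<Sum>i<k. (\<tau> (Suc i) - \<tau> i) * (norm (\<eta> i \<omega>))\<^sup>2)} + \<delta> / \<epsilon>\<^sup>2"
proof -
  define S where "S i \<omega> = (\<Sum>j<i. (\<tau> (Suc j) - \<tau> j) * (norm (\<eta> j \<omega>))\<^sup>2)" for i \<omega>
  \<comment> \<open>The test involves \<open>S (Suc i)\<close>, which already contains the
    contribution of the interval about to begin. It is known at \<open>\<tau> i\<close>, as the
    interval length is deterministic; so stopping is adapted and the threshold is never
    overshot.\<close>
  define \<eta>' where "\<eta>' i \<omega> = (if S (Suc i) \<omega> \<le> \<delta> then \<eta> i \<omega> else 0)" for i \<omega>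
  have \<tau>: "\<tau> i \<in> {0..T}" if "i \<le> k" for i
    using step_bounds[OF step that] t by auto
  have \<eta>: "\<eta> j \<in> borel_measurable (\<F> (\<tau> i))" if "j \<le> i" "i < k" for i j
  proof (rule adapted_mono)
    show "\<tau> j \<in> {0..T}" "\<tau> i \<in> {0..T}" using \<tau>[of j] \<tau>[of i] that by auto
    show "\<tau> j \<le> \<tau> i" using that by (intro step_mono[OF step]) auto
    show "\<eta> j \<in> borel_measurable (\<F> (\<tau> j))" using step that by (simp add: step_process_def)
  qed
  have S: "S (Suc i) \<in> borel_measurable (\<F> (\<tau> i))" if "i < k" for i
    unfolding S_def[abs_def]
  proof (intro borel_measurable_sum)
    fix j assume "j \<in> {..<Suc i}"
    then have [measurable]: "\<eta> j \<in> borel_measurable (\<F> (\<tau> i))" using \<eta> that by simp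
    show "(\<lambda>\<omega>. (\<tau> (Suc j) - \<tau> j) * (norm (\<eta> j \<omega>))\<^sup>2) \<in> borel_measurable (\<F> (\<tau> i))" by measurable
  qed
  have step': "step_process M \<F> t k \<tau> \<eta>'"
    unfolding step_process_def
  proof (intro conjI allI impI)
    show "\<eta>' i \<in> borel_measurable (\<F> (\<tau> i))" if "i < k" for i
      unfolding \<eta>'_def[abs_def] using S[OF that] \<eta>[OF order_refl that] by measurable
    show "bounded (\<eta>' i ` space M)" if i: "i < k" for i
    proof -
      obtain C where "0 \<le> C" "\<And>\<omega>. \<omega> \<in> space M \<Longrightarrow> norm (\<eta> i \<omega>) \<le> C"
        using bounded_imageE[of "\<eta> i" "space M"] step i unfolding step_process_def by metis
      then show ?thesis unfolding bounded_iff by (auto simp: \<eta>'_def intro!: exI[of _ C])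
    qed
  qed (use step in \<open>auto simp: step_process_def\<close>)
  have le: "(\<Sum>i<k. (\<tau> (Suc i) - \<tau> i) * (norm (\<eta>' i \<omega>))\<^sup>2) \<le> \<delta>" for \<omega>
  proof -
    \<comment> \<open>The additional bound by \<open>S n \<omega>\<close> is what carries the
      induction: while nothing has been stopped, the new sum is compared with
      \<open>S (Suc n) \<omega>\<close>, which is at most \<open>\<delta>\<close>.\<close>
    have "(\<Sum>i<n. (\<tau> (Suc i) - \<tau> i) * (norm (\<eta>' i \<omega>))\<^sup>2) \<le> min \<delta> (S n \<omega>)" if "n \<le> k" for n
      using that
    proof (induction n)
      case (Suc n)
      have inc: "0 \<le> (\<tau> (Suc n) - \<tau> n) * (norm (\<eta> n \<omega>))\<^sup>2"
        using step Suc.prems by (auto simp: step_process_def)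
      show ?case
      proof (cases "S (Suc n) \<omega> \<le> \<delta>")
        case True
        then show ?thesis using Suc by (simp add: \<eta>'_def) (simp add: S_def)
      next
        case False
        then show ?thesis using Suc inc by (simp add: \<eta>'_def)
      qed
    qed (use e in \<open>simp add: S_def\<close>)
    from this[of k] show ?thesis by simp
  qed
  define I where "I = step_integral W k \<tau> \<eta>"
  define I' where "I' = step_integral W k \<tau> \<eta>'"
  note s = step_simple[OF step t] step_simple[OF step' t]
  note [measurable] = simple_measurable(1,2)[OF s(1)] simple_measurable(1,2)[OF s(2)]
  have [measurable]: "I \<in> borel_measurable M" "I' \<in> borel_measurable M" unfolding I_def I'_def by measurable
  have [measurable]: "S k \<in> borel_measurable M"
    unfolding S_def[abs_def]
  proof (intro borel_measurable_sum)
    fix j assume "j \<in> {..<k}"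
    then have [measurable]: "\<eta> j \<in> borel_measurable M"
      using adapted_measurable[OF \<tau>[of j] \<eta>[of j j]] by simp
    show "(\<lambda>\<omega>. (\<tau> (Suc j) - \<tau> j) * (norm (\<eta> j \<omega>))\<^sup>2) \<in> borel_measurable M" by measurable
  qed
  have "nsq M I' = (\<integral>\<^sup>+\<omega>. (\<integral>\<^sup>+s\<in>{0..T}. ennreal ((norm (step_value k \<tau> \<eta>' s \<omega>))\<^sup>2) \<partial>lborel) \<partial>M)"
    unfolding I'_def simple_isometry[OF s(2)] by (subst nsq_P) auto
  also have "\<dots> \<le> (\<integral>\<^sup>+\<omega>. ennreal \<delta> \<partial>M)"
    using step_norm_integral[OF step', of T] t le by (intro nn_integral_mono) (auto intro: ennreal_leI)
  also have "\<dots> = ennreal \<delta>" by (simp add: emeasure_space_1)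
  finally have nsq: "nsq M I' \<le> ennreal \<delta>" .
  have "ennreal (prob {\<omega> \<in> space M. \<epsilon> < norm (I' \<omega>)}) \<le> ennreal (1 / \<epsilon>\<^sup>2) * nsq M I'"
  proof -
    have "{\<omega> \<in> space M. \<epsilon> < norm (I' \<omega>)} \<subseteq> {\<omega> \<in> space M. 1 \<le> ennreal (1 / \<epsilon>\<^sup>2) * ennreal ((norm (I' \<omega>))\<^sup>2)}"
    proof safe
      fix \<omega> assume "\<epsilon> < norm (I' \<omega>)"
      then have "\<epsilon>\<^sup>2 \<le> (norm (I' \<omega>))\<^sup>2" using e by (intro power_mono) auto
      then have "1 \<le> 1 / \<epsilon>\<^sup>2 * (norm (I' \<omega>))\<^sup>2" using e by (simp add: field_simps)
      then have "ennreal 1 \<le> ennreal (1 / \<epsilon>\<^sup>2 * (norm (I' \<omega>))\<^sup>2)" by (rule ennreal_leI)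
      moreover have "ennreal (1 / \<epsilon>\<^sup>2 * (norm (I' \<omega>))\<^sup>2) = ennreal (1 / \<epsilon>\<^sup>2) * ennreal ((norm (I' \<omega>))\<^sup>2)"
        by (rule ennreal_mult) auto
      ultimately show "1 \<le> ennreal (1 / \<epsilon>\<^sup>2) * ennreal ((norm (I' \<omega>))\<^sup>2)" by (metis ennreal_1)
    qed
    then have "emeasure M {\<omega> \<in> space M. \<epsilon> < norm (I' \<omega>)} \<le> emeasure M {\<omega> \<in> space M. 1 \<le> ennreal (1 / \<epsilon>\<^sup>2) * ennreal ((norm (I' \<omega>))\<^sup>2)}"
      by (intro emeasure_mono) measurable
    also have "\<dots> \<le> ennreal (1 / \<epsilon>\<^sup>2) * (\<integral>\<^sup>+\<omega>\<in>space M. ennreal ((norm (I' \<omega>))\<^sup>2) \<partial>M)"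
      by (rule nn_integral_Markov_inequality) auto
    also have "(\<integral>\<^sup>+\<omega>\<in>space M. ennreal ((norm (I' \<omega>))\<^sup>2) \<partial>M) = nsq M I'"
      unfolding nsq_def by (intro nn_integral_cong) auto
    finally show ?thesis by (simp add: emeasure_eq_measure)
  qed
  also have "\<dots> \<le> ennreal (1 / \<epsilon>\<^sup>2) * ennreal \<delta>" by (intro mult_left_mono nsq) auto
  also have "\<dots> = ennreal (\<delta> / \<epsilon>\<^sup>2)" using e by (simp add: ennreal_mult[symmetric])
  finally have 1: "prob {\<omega> \<in> space M. \<epsilon> < norm (I' \<omega>)} \<le> \<delta> / \<epsilon>\<^sup>2" using e by simp
  have eq: "I \<omega> = I' \<omega>" if "S k \<omega> \<le> \<delta>" for \<omega>
  proof -
    have "S (Suc i) \<omega> \<le> \<delta>" if "i < k" for i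
    proof -
      have "S (Suc i) \<omega> \<le> S k \<omega>"
        unfolding S_def using step that by (intro sum_mono2) (auto simp: step_process_def)
      then show ?thesis using \<open>S k \<omega> \<le> \<delta>\<close> by simp
    qed
    then show ?thesis unfolding I_def I'_def step_integral_def by (intro sum.cong) (auto simp: \<eta>'_def)
  qed
  have "prob {\<omega> \<in> space M. \<epsilon> < norm (I \<omega>)} \<le> prob ({\<omega> \<in> space M. \<delta> < S k \<omega>} \<union> {\<omega> \<in> space M. \<epsilon> < norm (I' \<omega>)})"
    using eq by (intro finite_measure_mono) (auto, metis not_less)
  also have "\<dots> \<le> prob {\<omega> \<in> space M. \<delta> < S k \<omega>} + prob {\<omega> \<in> space M. \<epsilon> < norm (I' \<omega>)}"
    by (intro measure_Un_le) measurable
  finally show ?thesis using 1 unfolding I_def S_def by simp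
qed

text \<open>Truncation at 1 turns convergence in probability of possibly infinite variables into
  convergence of expectations of bounded ones, and that has an almost surely convergent
  subsequence.\<close>

lemma tendsto_0_in_prob_AE_subseq:
  assumes Z: "tendsto_0_in_prob M Z" and [measurable]: "\<And>n. Z n \<in> borel_measurable M"
  shows "\<exists>r::nat\<Rightarrow>nat. strict_mono r \<and> (AE \<omega> in M. (\<lambda>n. Z (r n) \<omega>) \<longlonglongrightarrow> 0)"
proof -
  define u where "u n \<omega> = enn2real (min 1 (Z n \<omega>))" for n \<omega>
  have u: "0 \<le> u n \<omega>" "u n \<omega> \<le> 1" "ennreal (u n \<omega>) = min 1 (Z n \<omega>)" for n \<omega>
  proof -
    show "ennreal (u n \<omega>) = min 1 (Z n \<omega>)" unfolding u_def by (intro ennreal_enn2real) (simp add: min_less_iff_disj)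
    then have "ennreal (u n \<omega>) \<le> ennreal 1" by simp
    then show "u n \<omega> \<le> 1" by (subst (asm) ennreal_le_iff) auto
  qed (simp add: u_def)
  have [measurable]: "u n \<in> borel_measurable M" for n unfolding u_def by measurable
  have int: "integrable M (u n)" for n
    using u by (intro integrable_const_bound[of _ 1]) auto
  have "(\<lambda>n. expectation (u n)) \<longlonglongrightarrow> 0"
  proof (rule LIMSEQ_I)
    fix e :: real assume e: "0 < e"
    have "(\<lambda>n. prob {\<omega> \<in> space M. ennreal (e / 2) < Z n \<omega>}) \<longlonglongrightarrow> 0"
      using Z e unfolding tendsto_0_in_prob_def by simp
    from LIMSEQ_D[OF this, of "e / 2"] e obtain N where N: "\<And>n. n \<ge> N \<Longrightarrow> prob {\<omega> \<in> space M. ennreal (e / 2) < Z n \<omega>} < e / 2"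
      by auto
    have "norm (expectation (u n) - 0) < e" if "n \<ge> N" for n
    proof -
      let ?A = "{\<omega> \<in> space M. ennreal (e / 2) < Z n \<omega>}"
      have "expectation (u n) \<le> expectation (\<lambda>\<omega>. e / 2 + indicator ?A \<omega>)"
      proof (intro integral_mono int)
        show "integrable M (\<lambda>\<omega>. e / 2 + indicator ?A \<omega>)" by (simp add: emeasure_eq_measure)
        fix \<omega> assume \<omega>: "\<omega> \<in> space M"
        show "u n \<omega> \<le> e / 2 + indicator ?A \<omega>"
        proof (cases "\<omega> \<in> ?A")
          case True
          then show ?thesis using u(2)[of n \<omega>] e by simp
        next
          case False
          then have "Z n \<omega> \<le> ennreal (e / 2)" using \<omega> by auto
          then have "ennreal (u n \<omega>) \<le> ennreal (e / 2)" unfolding u(3) by (simp add: min.coboundedI2)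
          then have "u n \<omega> \<le> e / 2" using e by simp
          then show ?thesis by (intro add_increasing2) auto
        qed
      qed
      also have "\<dots> = e / 2 + prob ?A" by (simp add: emeasure_eq_measure prob_space)
      also have "\<dots> < e" using N[OF that] by simp
      finally show ?thesis using u(1) by (simp add: integral_nonneg_AE)
    qed
    then show "\<exists>no. \<forall>n\<ge>no. norm (expectation (u n) - 0) < e" by blast
  qed
  then have "(\<lambda>n. expectation (\<lambda>\<omega>. norm (u n \<omega>))) \<longlonglongrightarrow> 0" using u(1) by simp
  from tendsto_L1_AE_subseq[OF int this] obtain r where r: "strict_mono r" "AE \<omega> in M. (\<lambda>n. u (r n) \<omega>) \<longlonglongrightarrow> 0"
    by blast
  have "(\<lambda>n. Z (r n) \<omega>) \<longlonglongrightarrow> 0" if "(\<lambda>n. u (r n) \<omega>) \<longlonglongrightarrow> 0" for \<omega>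
  proof -
    have 1: "(\<lambda>n. min 1 (Z (r n) \<omega>)) \<longlonglongrightarrow> 0"
      using tendsto_ennrealI[OF that] unfolding u(3) by simp
    \<comment> \<open>Along a null sequence the truncation is eventually inactive.\<close>
    have "eventually (\<lambda>n. min 1 (Z (r n) \<omega>) < 1) sequentially"
      using order_tendstoD(2)[OF 1, of 1] by simp
    then have "eventually (\<lambda>n. min 1 (Z (r n) \<omega>) = Z (r n) \<omega>) sequentially"
      by eventually_elim (auto simp: min_def split: if_splits)
    from Lim_transform_eventually[OF 1 this] show ?thesis .
  qed
  then show ?thesis using r by (intro exI[of _ r]) auto
qed

end

lemma matrix_vector_mult_sum_right: "A *v (\<Sum>i\<in>S. f i) = (\<Sum>i\<in>S. A *v f i)" for A :: "real^'n^'m"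
  by (rule linear_sum[OF matrix_vector_mul_linear])

context wiener
begin

lemma sum_regroup:
  fixes h :: "nat \<Rightarrow> 'b::comm_monoid_add"
  shows "(\<Sum>m<k * N. h m) = (\<Sum>i<k. \<Sum>j<N. h (i * N + j))"
proof -
  have "sum h {i * N..<i * N + N} = (\<Sum>j<N. h (i * N + j))" for i
    using sum.shift_bounds_nat_ivl[of h 0 "i * N" N] by (simp add: add.commute atLeast0LessThan)
  then show ?thesis using sum.nat_group[of h N k] by simp
qed

text \<open>Cutting every interval into \<open>N\<close> equal parts changes neither the process nor
  its integral but forces the mesh below \<open>t / N\<close>. The notion of Ito integral says
  nothing about meshes, so fineness has to be created here.\<close>

lemma step_refine:
  assumes step: "step_process M \<F> t k \<tau> \<xi>" and N: "0 < N" and t: "t \<in> {0..T}"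
  defines "\<tau>' \<equiv> \<lambda>m. \<tau> (m div N) + real (m mod N) / real N * (\<tau> (Suc (m div N)) - \<tau> (m div N))"
    and "\<xi>' \<equiv> \<lambda>m. \<xi> (m div N)"
  shows "step_process M \<F> t (k * N) \<tau>' \<xi>'"
    and "step_value (k * N) \<tau>' \<xi>' = step_value k \<tau> \<xi>"
    and "step_integral W (k * N) \<tau>' \<xi>' = step_integral W k \<tau> \<xi>"
    and "\<And>m. m < k * N \<Longrightarrow> \<tau>' (Suc m) - \<tau>' m \<le> t / real N"
proof -
  \<comment> \<open>The formula includes \<open>j = N\<close>, where quotient and remainder jump to
    the next block; it is needed to join neighbouring blocks and to telescope over one
    block.\<close>
  have \<tau>'_eq: "\<tau>' (i * N + j) = \<tau> i + real j / real N * (\<tau> (Suc i) - \<tau> i)" if "j \<le> N" for i j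
  proof (cases "j = N")
    case True
    then have "i * N + j = Suc i * N" by simp
    then show ?thesis using N True by (simp add: \<tau>'_def)
  next
    case False
    then show ?thesis using that N by (simp add: \<tau>'_def)
  qed
  have split: "\<exists>i j. m = i * N + j \<and> i < k \<and> j < N" if "m < k * N" for m
    using that N by (intro exI[of _ "m div N"] exI[of _ "m mod N"]) (auto simp: less_mult_imp_div_less)
  have \<tau>le: "\<tau> i \<le> \<tau> (Suc i)" if "i < k" for i using step that by (auto simp: step_process_def)
  have diff: "\<tau>' (Suc (i * N + j)) - \<tau>' (i * N + j) = (\<tau> (Suc i) - \<tau> i) / real N" if "j < N" for i j
    using \<tau>'_eq[of j i] \<tau>'_eq[of "Suc j" i] that N by (simp add: field_simps)
  have \<xi>'_eq: "\<xi>' (i * N + j) = \<xi> i" if "j < N" for i j using that by (simp add: \<xi>'_def)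
  have \<tau>'_le: "\<tau>' (i * N + j) \<le> \<tau>' (Suc (i * N + j))" if "i < k" "j < N" for i j
  proof -
    have "0 \<le> (\<tau> (Suc i) - \<tau> i) / real N" using \<tau>le[OF that(1)] by simp
    then show ?thesis using diff[OF that(2), of i] by linarith
  qed
  have ge: "\<tau> i \<le> \<tau>' (i * N + j)" if "i < k" "j < N" for i j
    using \<tau>'_eq[of j i] that \<tau>le[of i] by simp
  show step': "step_process M \<F> t (k * N) \<tau>' \<xi>'"
    unfolding step_process_def
  proof (intro conjI allI impI)
    show "\<tau>' 0 = 0" using \<tau>'_eq[of 0 0] step by (simp add: step_process_def)
    show "\<tau>' (k * N) = t" using \<tau>'_eq[of 0 k] step by (simp add: step_process_def)
    fix m assume "m < k * N"
    then obtain i j where m: "m = i * N + j" "i < k" "j < N" using split by blast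
    show "\<tau>' m \<le> \<tau>' (Suc m)" using \<tau>'_le m by simp
    have "\<tau>' m \<le> \<tau> (Suc i)"
    proof -
      have "real j / real N * (\<tau> (Suc i) - \<tau> i) \<le> 1 * (\<tau> (Suc i) - \<tau> i)"
        using m \<tau>le[of i] by (intro mult_right_mono) auto
      then show ?thesis using \<tau>'_eq[of j i] m by simp
    qed
    then have "\<tau>' m \<le> T" "0 \<le> \<tau>' m" "\<tau> i \<le> T" "0 \<le> \<tau> i"
      using step_bounds[OF step, of "Suc i"] step_bounds[OF step, of i] ge[of i j] m t by auto
    then show "\<xi>' m \<in> borel_measurable (\<F> (\<tau>' m))"
      using m \<xi>'_eq[of j i] ge[of i j] step by (intro adapted_mono[of "\<tau> i" "\<tau>' m"]) (auto simp: step_process_def)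
    show "bounded (\<xi>' m ` space M)" using m \<xi>'_eq[of j i] step by (auto simp: step_process_def)
  qed
  show "step_integral W (k * N) \<tau>' \<xi>' = step_integral W k \<tau> \<xi>"
  proof
    fix \<omega>
    have "(\<Sum>j<N. \<xi>' (i * N + j) \<omega> *v (W (\<tau>' (Suc (i * N + j))) \<omega> - W (\<tau>' (i * N + j)) \<omega>)) =
      \<xi> i \<omega> *v (W (\<tau> (Suc i)) \<omega> - W (\<tau> i) \<omega>)" for i
    proof -
      have "(\<Sum>j<N. \<xi>' (i * N + j) \<omega> *v (W (\<tau>' (Suc (i * N + j))) \<omega> - W (\<tau>' (i * N + j)) \<omega>)) =
        \<xi> i \<omega> *v (\<Sum>j<N. W (\<tau>' (i * N + Suc j)) \<omega> - W (\<tau>' (i * N + j)) \<omega>)"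
        by (simp add: \<xi>'_eq matrix_vector_mult_sum_right)
      also have "(\<Sum>j<N. W (\<tau>' (i * N + Suc j)) \<omega> - W (\<tau>' (i * N + j)) \<omega>) = W (\<tau>' (i * N + N)) \<omega> - W (\<tau>' (i * N)) \<omega>"
        using sum_lessThan_telescope[of "\<lambda>j. W (\<tau>' (i * N + j)) \<omega>" N] by simp
      finally show ?thesis using \<tau>'_eq[of N i] \<tau>'_eq[of 0 i] N by simp
    qed
    then show "step_integral W (k * N) \<tau>' \<xi>' \<omega> = step_integral W k \<tau> \<xi> \<omega>"
      unfolding step_integral_def sum_regroup by simp
  qed
  show "step_value (k * N) \<tau>' \<xi>' = step_value k \<tau> \<xi>"
  proof (intro ext)
    fix s \<omega>
    have "(\<Sum>j<N. indicator {\<tau>' (i * N + j)<..\<tau>' (Suc (i * N + j))} s *\<^sub>R \<xi>' (i * N + j) \<omega>) =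
      indicator {\<tau> i<..\<tau> (Suc i)} s *\<^sub>R \<xi> i \<omega>" if i: "i < k" for i
    proof -
      have ind: "indicator {a<..b} s = (indicator {..b} s - indicator {..a} s :: real)" if "a \<le> b" for a b
        using that by (auto simp: indicator_def)
      have "(\<Sum>j<N. indicator {\<tau>' (i * N + j)<..\<tau>' (Suc (i * N + j))} s *\<^sub>R \<xi>' (i * N + j) \<omega>) =
        (\<Sum>j<N. indicator {..\<tau>' (i * N + Suc j)} s - indicator {..\<tau>' (i * N + j)} s) *\<^sub>R \<xi> i \<omega>"
        unfolding scaleR_left.sum using \<tau>'_le[OF i] by (intro sum.cong) (auto simp: \<xi>'_eq ind)
      also have "(\<Sum>j<N. indicator {..\<tau>' (i * N + Suc j)} s - indicator {..\<tau>' (i * N + j)} s :: real) =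
        indicator {..\<tau>' (i * N + N)} s - indicator {..\<tau>' (i * N)} s"
        using sum_lessThan_telescope[of "\<lambda>j. indicator {..\<tau>' (i * N + j)} s :: real" N] by simp
      finally show ?thesis using \<tau>'_eq[of N i] \<tau>'_eq[of 0 i] N \<tau>le[OF i] by (simp add: ind)
    qed
    then show "step_value (k * N) \<tau>' \<xi>' s \<omega> = step_value k \<tau> \<xi> s \<omega>"
      unfolding step_value_def sum_regroup by simp
  qed
  fix m assume "m < k * N"
  then obtain i j where m: "m = i * N + j" "i < k" "j < N" using split by blast
  have "\<tau> (Suc i) - \<tau> i \<le> t"
    using step_bounds[OF step, of "Suc i"] step_bounds[OF step, of i] m by auto
  then show "\<tau>' (Suc m) - \<tau>' m \<le> t / real N"
    using diff[of j i] m by (simp add: divide_right_mono)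
qed

text \<open>The given step processes are bounded one by one only. Clipping at the bound of
  \<open>H\<close> brings them no farther from \<open>H\<close>, and the part cut off is at most as
  large as their distance from \<open>H\<close>; therefore \<open>step_lenglart\<close> makes its
  integral small in probability.\<close>

lemma has_ito_integral_clip_in_prob:
  assumes t: "t \<in> {0..T}" and J: "J \<in> borel_measurable M"
    and step: "\<And>n. step_process M \<F> t (k n) (\<tau> n) (\<xi> n)"
    and D: "tendsto_0_in_prob M (\<lambda>n \<omega>. \<integral>\<^sup>+s\<in>{0..t}. ennreal ((norm (step_value (k n) (\<tau> n) (\<xi> n) s \<omega> - H s \<omega>))\<^sup>2) \<partial>lborel)"
    and I: "tendsto_0_in_prob M (\<lambda>n \<omega>. ennreal (norm (step_integral W (k n) (\<tau> n) (\<xi> n) \<omega> - J \<omega>)))"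
    and C: "0 \<le> C" "\<And>s \<omega> i j. s \<in> {0..T} \<Longrightarrow> \<omega> \<in> space M \<Longrightarrow> \<bar>H s \<omega> $ i $ j\<bar> \<le> C"
    and H[measurable]: "(\<lambda>(s, \<omega>). H s \<omega>) \<in> borel_measurable P"
  defines "\<eta> \<equiv> \<lambda>n i \<omega>. clip C (\<xi> n i \<omega>)"
  shows "\<And>n. step_process M \<F> t (k n) (\<tau> n) (\<eta> n)"
    and "tendsto_0_in_prob M (\<lambda>n \<omega>. \<integral>\<^sup>+s\<in>{0..t}. ennreal ((norm (step_value (k n) (\<tau> n) (\<eta> n) s \<omega> - H s \<omega>))\<^sup>2) \<partial>lborel)"
    and "tendsto_0_in_prob M (\<lambda>n \<omega>. ennreal (norm (step_integral W (k n) (\<tau> n) (\<eta> n) \<omega> - J \<omega>)))"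
    and "\<And>n. (\<lambda>\<omega>. \<integral>\<^sup>+s\<in>{0..t}. ennreal ((norm (step_value (k n) (\<tau> n) (\<eta> n) s \<omega> - H s \<omega>))\<^sup>2) \<partial>lborel) \<in> borel_measurable M"
proof -
  show step\<eta>: "step_process M \<F> t (k n) (\<tau> n) (\<eta> n)" for n
    unfolding \<eta>_def using C(1) norm_clip[OF C(1)]
    by (intro step_process_map[OF step]) (auto simp: bounded_iff intro!: exI)
  \<comment> \<open>The part cut off is itself a step process on the same grid, so that its integral
    is the difference of the two integrals.\<close>
  have step\<zeta>: "step_process M \<F> t (k n) (\<tau> n) (\<lambda>i \<omega>. \<xi> n i \<omega> - \<eta> n i \<omega>)" for n
    unfolding step_process_def
  proof (intro conjI allI impI)
    fix i assume i: "i < k n"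
    show "(\<lambda>\<omega>. \<xi> n i \<omega> - \<eta> n i \<omega>) \<in> borel_measurable (\<F> (\<tau> n i))"
      using step[of n] step\<eta>[of n] i by (intro borel_measurable_diff) (auto simp: step_process_def)
    show "bounded ((\<lambda>\<omega>. \<xi> n i \<omega> - \<eta> n i \<omega>) ` space M)"
      using step[of n] step\<eta>[of n] i by (intro bounded_minus_comp) (auto simp: step_process_def)
  qed (use step[of n] in \<open>auto simp: step_process_def\<close>)
  note s = step_simple[OF step t] step_simple[OF step\<eta> t] step_simple[OF step\<zeta> t]
  note [measurable] = simple_measurable(1,2)[OF s(1)] simple_measurable(1,2)[OF s(2)] simple_measurable(1,2)[OF s(3)] J
  have Dm: "(\<lambda>\<omega>. \<integral>\<^sup>+s\<in>{0..t}. ennreal ((norm (step_value (k n) (\<tau> n) \<zeta> s \<omega> - H s \<omega>))\<^sup>2) \<partial>lborel) \<in> borel_measurable M"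
    if z: "(\<lambda>z. step_value (k n) (\<tau> n) \<zeta> (fst z) (snd z)) \<in> borel_measurable P" for n \<zeta>
  proof -
    note [measurable] = z
    have "(\<lambda>\<omega>. \<integral>\<^sup>+s. ennreal ((norm (step_value (k n) (\<tau> n) \<zeta> s \<omega> - H s \<omega>))\<^sup>2) * indicator {0..t} s \<partial>time_measure T) \<in> borel_measurable M"
    proof (rule time.borel_measurable_nn_integral)
      have "(\<lambda>(\<omega>, s). ennreal ((norm (step_value (k n) (\<tau> n) \<zeta> (fst (s, \<omega>)) (snd (s, \<omega>)) - (case (s, \<omega>) of (s, \<omega>) \<Rightarrow> H s \<omega>)))\<^sup>2) * indicator {0..t} s) \<in> borel_measurable (M \<Otimes>\<^sub>M time_measure T)"
        by measurable
      then show "(\<lambda>(\<omega>, s). ennreal ((norm (step_value (k n) (\<tau> n) \<zeta> s \<omega> - H s \<omega>))\<^sup>2) * indicator {0..t} s) \<in> borel_measurable (M \<Otimes>\<^sub>M time_measure T)"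
        by simp
    qed
    moreover have "(\<integral>\<^sup>+s. ennreal ((norm (step_value (k n) (\<tau> n) \<zeta> s \<omega> - H s \<omega>))\<^sup>2) * indicator {0..t} s \<partial>time_measure T) =
      (\<integral>\<^sup>+s\<in>{0..t}. ennreal ((norm (step_value (k n) (\<tau> n) \<zeta> s \<omega> - H s \<omega>))\<^sup>2) \<partial>lborel)" for \<omega>
      unfolding nn_integral_time_measure using t by (intro nn_integral_cong) (auto simp: indicator_def)
    ultimately show ?thesis by simp
  qed
  show Dm\<eta>: "(\<lambda>\<omega>. \<integral>\<^sup>+s\<in>{0..t}. ennreal ((norm (step_value (k n) (\<tau> n) (\<eta> n) s \<omega> - H s \<omega>))\<^sup>2) \<partial>lborel) \<in> borel_measurable M" for n
    by (rule Dm) measurable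
  have Dm\<xi>: "(\<lambda>\<omega>. \<integral>\<^sup>+s\<in>{0..t}. ennreal ((norm (step_value (k n) (\<tau> n) (\<xi> n) s \<omega> - H s \<omega>))\<^sup>2) \<partial>lborel) \<in> borel_measurable M" for n
    by (rule Dm) measurable
  have clip_step: "step_value (k n) (\<tau> n) (\<eta> n) s \<omega> = clip C (step_value (k n) (\<tau> n) (\<xi> n) s \<omega>)" for n s \<omega>
    unfolding step_value_def \<eta>_def by (rule step_fun[OF step, symmetric]) (rule clip_zero[OF C(1)])
  have diff_step: "step_value (k n) (\<tau> n) (\<lambda>i \<omega>. \<xi> n i \<omega> - \<eta> n i \<omega>) s \<omega> = step_value (k n) (\<tau> n) (\<xi> n) s \<omega> - step_value (k n) (\<tau> n) (\<eta> n) s \<omega>" for n s \<omega>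
    unfolding step_value_def by (simp add: scaleR_diff_right sum_subtractf)
  show "tendsto_0_in_prob M (\<lambda>n \<omega>. \<integral>\<^sup>+s\<in>{0..t}. ennreal ((norm (step_value (k n) (\<tau> n) (\<eta> n) s \<omega> - H s \<omega>))\<^sup>2) \<partial>lborel)"
    unfolding tendsto_0_in_prob_def
  proof (intro allI impI)
    fix e :: real assume e: "0 < e"
    show "(\<lambda>n. prob {\<omega> \<in> space M. ennreal e < (\<integral>\<^sup>+s\<in>{0..t}. ennreal ((norm (step_value (k n) (\<tau> n) (\<eta> n) s \<omega> - H s \<omega>))\<^sup>2) \<partial>lborel)}) \<longlonglongrightarrow> 0"
    proof (rule tendsto_sandwich[OF always_eventually always_eventually tendsto_const D[unfolded tendsto_0_in_prob_def, rule_format, OF e]], goal_cases)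
      case 2
      show ?case
      proof (intro allI finite_measure_mono subsetI)
        fix n \<omega> assume \<omega>: "\<omega> \<in> {\<omega> \<in> space M. ennreal e < (\<integral>\<^sup>+s\<in>{0..t}. ennreal ((norm (step_value (k n) (\<tau> n) (\<eta> n) s \<omega> - H s \<omega>))\<^sup>2) \<partial>lborel)}"
        have "(\<integral>\<^sup>+s\<in>{0..t}. ennreal ((norm (step_value (k n) (\<tau> n) (\<eta> n) s \<omega> - H s \<omega>))\<^sup>2) \<partial>lborel) \<le>
          (\<integral>\<^sup>+s\<in>{0..t}. ennreal ((norm (step_value (k n) (\<tau> n) (\<xi> n) s \<omega> - H s \<omega>))\<^sup>2) \<partial>lborel)"
          using C(2) \<omega> t unfolding clip_step
          by (intro nn_integral_mono) (auto simp: indicator_def intro!: ennreal_leI power_mono clip_closer)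
        then show "\<omega> \<in> {\<omega> \<in> space M. ennreal e < (\<integral>\<^sup>+s\<in>{0..t}. ennreal ((norm (step_value (k n) (\<tau> n) (\<xi> n) s \<omega> - H s \<omega>))\<^sup>2) \<partial>lborel)}"
          using \<omega> by (auto elim: order.strict_trans2)
      qed (use Dm\<xi> in measurable)
    qed auto
  qed
  show "tendsto_0_in_prob M (\<lambda>n \<omega>. ennreal (norm (step_integral W (k n) (\<tau> n) (\<eta> n) \<omega> - J \<omega>)))"
    unfolding tendsto_0_in_prob_def
  proof (intro allI impI)
    fix e :: real assume e: "0 < e"
    define p1 where "p1 n = prob {\<omega> \<in> space M. ennreal (e / 2) < ennreal (norm (step_integral W (k n) (\<tau> n) (\<xi> n) \<omega> - J \<omega>))}" for n
    define p2 where "p2 \<delta> n = prob {\<omega> \<in> space M. ennreal \<delta> < (\<integral>\<^sup>+s\<in>{0..t}. ennreal ((norm (step_value (k n) (\<tau> n) (\<xi> n) s \<omega> - H s \<omega>))\<^sup>2) \<partial>lborel)}" for \<delta> n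
    have p1: "p1 \<longlonglongrightarrow> 0"
      unfolding p1_def using e I[unfolded tendsto_0_in_prob_def, rule_format, of "e / 2"] by simp
    have p2: "p2 \<delta> \<longlonglongrightarrow> 0" if "0 < \<delta>" for \<delta>
      unfolding p2_def using that D[unfolded tendsto_0_in_prob_def, rule_format, of \<delta>] by simp
    have le: "prob {\<omega> \<in> space M. ennreal e < ennreal (norm (step_integral W (k n) (\<tau> n) (\<eta> n) \<omega> - J \<omega>))} \<le>
      p1 n + (p2 \<delta> n + \<delta> / (e / 2)\<^sup>2)" if \<delta>: "0 < \<delta>" for n \<delta>
    proof -
      let ?I\<xi> = "step_integral W (k n) (\<tau> n) (\<xi> n)" let ?I\<eta> = "step_integral W (k n) (\<tau> n) (\<eta> n)"
      let ?I\<zeta> = "step_integral W (k n) (\<tau> n) (\<lambda>i \<omega>. \<xi> n i \<omega> - \<eta> n i \<omega>)"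
      have eq: "?I\<zeta> \<omega> = ?I\<xi> \<omega> - ?I\<eta> \<omega>" for \<omega>
        unfolding step_integral_def by (simp add: matrix_vector_mult_diff_rdistrib sum_subtractf)
      have "{\<omega> \<in> space M. ennreal e < ennreal (norm (?I\<eta> \<omega> - J \<omega>))} \<subseteq>
        {\<omega> \<in> space M. ennreal (e / 2) < ennreal (norm (?I\<xi> \<omega> - J \<omega>))} \<union> {\<omega> \<in> space M. e / 2 < norm (?I\<zeta> \<omega>)}"
      proof (safe, rule ccontr)
        fix \<omega> assume *: "ennreal e < ennreal (norm (?I\<eta> \<omega> - J \<omega>))" "\<not> ennreal (e / 2) < ennreal (norm (?I\<xi> \<omega> - J \<omega>))" "\<not> e / 2 < norm (?I\<zeta> \<omega>)"
        have "norm (?I\<eta> \<omega> - J \<omega>) \<le> norm (?I\<xi> \<omega> - J \<omega>) + norm (?I\<zeta> \<omega>)"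
          using norm_triangle_ineq4[of "?I\<xi> \<omega> - J \<omega>" "?I\<zeta> \<omega>"] by (simp add: eq)
        then show False using * e by (simp add: ennreal_less_iff)
      qed
      then have "prob {\<omega> \<in> space M. ennreal e < ennreal (norm (?I\<eta> \<omega> - J \<omega>))} \<le>
        prob ({\<omega> \<in> space M. ennreal (e / 2) < ennreal (norm (?I\<xi> \<omega> - J \<omega>))} \<union> {\<omega> \<in> space M. e / 2 < norm (?I\<zeta> \<omega>)})"
        by (intro finite_measure_mono) measurable
      also have "\<dots> \<le> p1 n + prob {\<omega> \<in> space M. e / 2 < norm (?I\<zeta> \<omega>)}"
        unfolding p1_def by (intro measure_Un_le) measurable
      also have "prob {\<omega> \<in> space M. e / 2 < norm (?I\<zeta> \<omega>)} \<le>
        prob {\<omega> \<in> space M. \<delta> < (\<Sum>i<k n. (\<tau> n (Suc i) - \<tau> n i) * (norm (\<xi> n i \<omega> - \<eta> n i \<omega>))\<^sup>2)} + \<delta> / (e / 2)\<^sup>2"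
        by (rule step_lenglart[OF step\<zeta> t]) (use e \<delta> in auto)
      also have "prob {\<omega> \<in> space M. \<delta> < (\<Sum>i<k n. (\<tau> n (Suc i) - \<tau> n i) * (norm (\<xi> n i \<omega> - \<eta> n i \<omega>))\<^sup>2)} \<le> p2 \<delta> n"
        unfolding p2_def
      proof (intro finite_measure_mono subsetI)
        fix \<omega> assume \<omega>: "\<omega> \<in> {\<omega> \<in> space M. \<delta> < (\<Sum>i<k n. (\<tau> n (Suc i) - \<tau> n i) * (norm (\<xi> n i \<omega> - \<eta> n i \<omega>))\<^sup>2)}"
        have "ennreal \<delta> < ennreal (\<Sum>i<k n. (\<tau> n (Suc i) - \<tau> n i) * (norm (\<xi> n i \<omega> - \<eta> n i \<omega>))\<^sup>2)"
          using \<omega> \<delta> by (auto intro: ennreal_lessI)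
        also have "\<dots> = (\<integral>\<^sup>+s\<in>{0..t}. ennreal ((norm (step_value (k n) (\<tau> n) (\<lambda>i \<omega>. \<xi> n i \<omega> - \<eta> n i \<omega>) s \<omega>))\<^sup>2) \<partial>lborel)"
          by (rule step_norm_integral[OF step\<zeta> order_refl, symmetric])
        also have "\<dots> \<le> (\<integral>\<^sup>+s\<in>{0..t}. ennreal ((norm (step_value (k n) (\<tau> n) (\<xi> n) s \<omega> - H s \<omega>))\<^sup>2) \<partial>lborel)"
          using C(2) \<omega> t unfolding diff_step clip_step
          by (intro nn_integral_mono) (auto simp: indicator_def intro!: ennreal_leI power_mono clip_dist)
        finally show "\<omega> \<in> {\<omega> \<in> space M. ennreal \<delta> < (\<integral>\<^sup>+s\<in>{0..t}. ennreal ((norm (step_value (k n) (\<tau> n) (\<xi> n) s \<omega> - H s \<omega>))\<^sup>2) \<partial>lborel)}"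
          using \<omega> by auto
      qed (use Dm\<xi> in measurable)
      finally show ?thesis by simp
    qed
    show "(\<lambda>n. prob {\<omega> \<in> space M. ennreal e < ennreal (norm (step_integral W (k n) (\<tau> n) (\<eta> n) \<omega> - J \<omega>))}) \<longlonglongrightarrow> 0"
    proof (rule LIMSEQ_I)
      fix r :: real assume r: "0 < r"
      \<comment> \<open>Makes the Chebyshev term \<open>\<delta> / (e / 2)^2\<close> equal to
        \<open>r / 2\<close>; the two probabilities share the other half of
        \<open>r\<close>.\<close>
      define \<delta> where "\<delta> = r / 2 * (e / 2)\<^sup>2"
      have \<delta>: "0 < \<delta>" "\<delta> / (e / 2)\<^sup>2 = r / 2" using r e by (auto simp: \<delta>_def)
      have lim: "(\<lambda>n. p1 n + p2 \<delta> n) \<longlonglongrightarrow> 0 + 0" by (intro tendsto_add p1 p2 \<delta>)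
      obtain N where N: "\<And>n. n \<ge> N \<Longrightarrow> norm (p1 n + p2 \<delta> n - 0) < r / 2"
        using LIMSEQ_D[OF lim, of "r / 2"] r by auto
      have "norm (prob {\<omega> \<in> space M. ennreal e < ennreal (norm (step_integral W (k n) (\<tau> n) (\<eta> n) \<omega> - J \<omega>))} - 0) < r" if "n \<ge> N" for n
      proof -
        have "p1 n + p2 \<delta> n < r / 2" using N[OF that] abs_ge_self[of "p1 n + p2 \<delta> n"] unfolding real_norm_def diff_zero by linarith
        then have "p1 n + (p2 \<delta> n + \<delta> / (e / 2)\<^sup>2) < r" unfolding \<delta>(2) by linarith
        then have "prob {\<omega> \<in> space M. ennreal e < ennreal (norm (step_integral W (k n) (\<tau> n) (\<eta> n) \<omega> - J \<omega>))} < r"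
          by (rule order.strict_trans1[OF le[OF \<delta>(1), of n]])
        then show ?thesis by simp
      qed
      then show "\<exists>no. \<forall>n\<ge>no. norm (prob {\<omega> \<in> space M. ennreal e < ennreal (norm (step_integral W (k n) (\<tau> n) (\<eta> n) \<omega> - J \<omega>))} - 0) < r"
        by blast
    qed
  qed
qed

end

lemma ennreal_tendsto_0_le:
  fixes f g :: "nat \<Rightarrow> ennreal"
  assumes "\<And>n. f n \<le> g n" "g \<longlonglongrightarrow> 0" shows "f \<longlonglongrightarrow> 0"
  by (rule tendsto_sandwich[OF _ _ tendsto_const assms(2)]) (use assms(1) in auto)

context wiener
begin

lemma nn_integral_tendsto_0_AE_subseq:
  fixes Z :: "nat \<Rightarrow> 'w \<Rightarrow> ennreal"
  assumes [measurable]: "\<And>n. Z n \<in> borel_measurable M" and lim: "(\<lambda>n. \<integral>\<^sup>+\<omega>. Z n \<omega> \<partial>M) \<longlonglongrightarrow> 0"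
  shows "\<exists>r::nat\<Rightarrow>nat. strict_mono r \<and> (AE \<omega> in M. (\<lambda>n. Z (r n) \<omega>) \<longlonglongrightarrow> 0)"
proof (rule tendsto_0_in_prob_AE_subseq)
  show "tendsto_0_in_prob M Z"
    unfolding tendsto_0_in_prob_def
  proof (intro allI impI)
    fix e :: real assume e: "0 < e"
    have le: "ennreal (prob {\<omega> \<in> space M. ennreal e < Z n \<omega>}) \<le> ennreal (1 / e) * (\<integral>\<^sup>+\<omega>. Z n \<omega> \<partial>M)" for n
    proof -
      have "1 \<le> ennreal (1 / e) * z" if "ennreal e < z" for z
      proof -
        have "ennreal 1 = ennreal (1 / e) * ennreal e" using e by (simp add: ennreal_mult[symmetric])
        also have "\<dots> \<le> ennreal (1 / e) * z" using that by (intro mult_left_mono) auto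
        finally show ?thesis by simp
      qed
      then have "emeasure M {\<omega> \<in> space M. ennreal e < Z n \<omega>} \<le> emeasure M {\<omega> \<in> space M. 1 \<le> ennreal (1 / e) * Z n \<omega>}"
        by (intro emeasure_mono) auto
      also have "\<dots> \<le> ennreal (1 / e) * (\<integral>\<^sup>+\<omega>\<in>space M. Z n \<omega> \<partial>M)"
        by (rule nn_integral_Markov_inequality) auto
      also have "(\<integral>\<^sup>+\<omega>\<in>space M. Z n \<omega> \<partial>M) = (\<integral>\<^sup>+\<omega>. Z n \<omega> \<partial>M)"
        by (intro nn_integral_cong) auto
      finally show ?thesis by (simp add: emeasure_eq_measure)
    qed
    have "(\<lambda>n. ennreal (prob {\<omega> \<in> space M. ennreal e < Z n \<omega>})) \<longlonglongrightarrow> 0"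
      by (rule ennreal_tendsto_0_le[OF le ennreal_tendsto_0_mult[OF lim]]) auto
    then have "(\<lambda>n. ennreal (prob {\<omega> \<in> space M. ennreal e < Z n \<omega>})) \<longlonglongrightarrow> ennreal 0" by simp
    then show "(\<lambda>n. prob {\<omega> \<in> space M. ennreal e < Z n \<omega>}) \<longlonglongrightarrow> 0"
      by (subst (asm) tendsto_ennreal_iff) auto
  qed
qed measurable

text \<open>Step processes vanish at time 0 and after \<open>t\<close>, as
  \<open>indicator {0<..t}\<close> does; the mismatch at time 0 concerns a null set.\<close>

lemma nsq_P_step_diff:
  fixes H :: "real \<Rightarrow> 'w \<Rightarrow> real^'n^'m"
  assumes t: "t \<in> {0..T}" and step: "step_process M \<F> t k \<tau> \<xi>" and H[measurable]: "(\<lambda>(s, \<omega>). H s \<omega>) \<in> borel_measurable P"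
  shows "nsq P (\<lambda>z. step_value k \<tau> \<xi> (fst z) (snd z) - indicator {0<..t} (fst z) *\<^sub>R H (fst z) (snd z)) =
    (\<integral>\<^sup>+\<omega>. (\<integral>\<^sup>+s\<in>{0..t}. ennreal ((norm (step_value k \<tau> \<xi> s \<omega> - H s \<omega>))\<^sup>2) \<partial>lborel) \<partial>M)"
proof -
  note [measurable] = simple_measurable(1)[OF step_simple[OF step t]]
  have [measurable]: "(\<lambda>z. H (fst z) (snd z)) \<in> borel_measurable P" using H by (simp add: case_prod_beta)
  have "nsq P (\<lambda>z. step_value k \<tau> \<xi> (fst z) (snd z) - indicator {0<..t} (fst z) *\<^sub>R H (fst z) (snd z)) =
    (\<integral>\<^sup>+\<omega>. (\<integral>\<^sup>+s\<in>{0..T}. ennreal ((norm (step_value k \<tau> \<xi> s \<omega> - indicator {0<..t} s *\<^sub>R H s \<omega>))\<^sup>2) \<partial>lborel) \<partial>M)"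
    by (subst nsq_P) auto
  also have "\<dots> = (\<integral>\<^sup>+\<omega>. (\<integral>\<^sup>+s\<in>{0..t}. ennreal ((norm (step_value k \<tau> \<xi> s \<omega> - H s \<omega>))\<^sup>2) \<partial>lborel) \<partial>M)"
  proof (rule nn_integral_cong, rule nn_integral_cong_AE)
    fix \<omega>
    have "AE s in lborel. s \<noteq> (0::real)" by (rule AE_lborel_singleton)
    then show "AE s in lborel. ennreal ((norm (step_value k \<tau> \<xi> s \<omega> - indicator {0<..t} s *\<^sub>R H s \<omega>))\<^sup>2) * indicator {0..T} s =
      ennreal ((norm (step_value k \<tau> \<xi> s \<omega> - H s \<omega>))\<^sup>2) * indicator {0..t} s"
    proof eventually_elim
      case (elim s)
      consider "s < 0" | "0 < s" "s \<le> t" | "t < s" using elim by linarith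
      then show ?case
      proof cases
        case 3
        have "step_value k \<tau> \<xi> s \<omega> = 0"
          unfolding step_value_def
        proof (intro sum.neutral ballI)
          fix i assume "i \<in> {..<k}"
          then have "\<tau> (Suc i) < s" using step_bounds(2)[OF step, of "Suc i"] 3 by auto
          then show "indicator {\<tau> i<..\<tau> (Suc i)} s *\<^sub>R \<xi> i \<omega> = 0" by (simp add: indicator_def)
        qed
        then show ?thesis using 3 by simp
      qed (use t in \<open>auto simp: indicator_def\<close>)
    qed
  qed
  finally show ?thesis .
qed

text \<open>
  Fatou's lemma and the isometry turn convergence in probability of the integrals into convergence
  in mean square.
\<close>

lemma has_ito_integral_approx:
  fixes H :: "real \<Rightarrow> 'w \<Rightarrow> real^'n^'m"
  assumes t: "t \<in> {0..T}" and J: "has_ito_integral M \<F> W t H J"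
    and C: "0 \<le> C" "\<And>s \<omega> i j. s \<in> {0..T} \<Longrightarrow> \<omega> \<in> space M \<Longrightarrow> \<bar>H s \<omega> $ i $ j\<bar> \<le> C"
    and H[measurable]: "(\<lambda>(s, \<omega>). H s \<omega>) \<in> borel_measurable P"
  shows "\<exists>k \<tau> \<xi>. (\<forall>n. step_process M \<F> t (k n) (\<tau> n) (\<xi> n)) \<and>
    (\<forall>n i \<omega>. norm (\<xi> n i \<omega>) \<le> real CARD('m) * (real CARD('n) * C)) \<and>
    (\<forall>n i. i < k n \<longrightarrow> \<tau> n (Suc i) - \<tau> n i \<le> t / real (Suc n)) \<and>
    (\<lambda>n. nsq P (\<lambda>z. step_value (k n) (\<tau> n) (\<xi> n) (fst z) (snd z) - indicator {0<..t} (fst z) *\<^sub>R H (fst z) (snd z))) \<longlonglongrightarrow> 0"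
    and "ito (\<lambda>z. indicator {0<..t} (fst z) *\<^sub>R H (fst z) (snd z)) J"
proof -
  let ?B = "real CARD('m) * (real CARD('n) * C)"
  obtain k \<tau> \<xi> where step: "\<And>n. step_process M \<F> t (k n) (\<tau> n) (\<xi> n)"
    and D0: "tendsto_0_in_prob M (\<lambda>n \<omega>. \<integral>\<^sup>+s\<in>{0..t}. ennreal ((norm (step_value (k n) (\<tau> n) (\<xi> n) s \<omega> - H s \<omega>))\<^sup>2) \<partial>lborel)"
    and I0: "tendsto_0_in_prob M (\<lambda>n \<omega>. ennreal (norm (step_integral W (k n) (\<tau> n) (\<xi> n) \<omega> - J \<omega>)))"
    using J unfolding has_ito_integral_def by blast
  have Jm[measurable]: "J \<in> borel_measurable M" using J by (simp add: has_ito_integral_def)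
  define \<eta> where "\<eta> n i \<omega> = clip C (\<xi> n i \<omega>)" for n i \<omega>
  note clip = has_ito_integral_clip_in_prob[OF t Jm step D0 I0 C H, folded \<eta>_def]
  have \<eta>B: "norm (\<eta> n i \<omega>) \<le> ?B" for n i \<omega> unfolding \<eta>_def by (rule norm_clip[OF C(1)])
  define D where "D n \<omega> = (\<integral>\<^sup>+s\<in>{0..t}. ennreal ((norm (step_value (k n) (\<tau> n) (\<eta> n) s \<omega> - H s \<omega>))\<^sup>2) \<partial>lborel)" for n \<omega>
  define I where "I n = step_integral W (k n) (\<tau> n) (\<eta> n)" for n
  define \<phi> where "\<phi> n z = step_value (k n) (\<tau> n) (\<eta> n) (fst z) (snd z)" for n z
  define \<phi>' where "\<phi>' z = indicator {0<..t} (fst z) *\<^sub>R H (fst z) (snd z)" for z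
  have s: "simple (\<phi> n) (I n)" for n
    using step_simple[OF clip(1) t] unfolding \<phi>_def[abs_def] I_def .
  note [measurable] = simple_measurable(1,2)[OF s]
  have [measurable]: "D n \<in> borel_measurable M" for n using clip(4)[of n] unfolding D_def[abs_def] .
  have [measurable]: "\<phi>' \<in> borel_measurable P"
    unfolding \<phi>'_def[abs_def] using H by (simp add: case_prod_beta)
  \<comment> \<open>Two successive subsequences: the first yields almost sure convergence of the
    distance to \<open>H\<close>, the second that of the integrals.\<close>
  obtain r1 where r1: "strict_mono r1" "AE \<omega> in M. (\<lambda>n. D (r1 n) \<omega>) \<longlonglongrightarrow> 0"
    using tendsto_0_in_prob_AE_subseq[of D] clip(2) unfolding D_def[abs_def, symmetric] by auto
  have I1: "tendsto_0_in_prob M (\<lambda>n \<omega>. ennreal (norm (I (r1 n) \<omega> - J \<omega>)))"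
    using clip(3) LIMSEQ_subseq_LIMSEQ[OF _ r1(1)] unfolding I_def tendsto_0_in_prob_def comp_def by fast
  obtain r2 where r2: "strict_mono r2" "AE \<omega> in M. (\<lambda>n. ennreal (norm (I (r1 (r2 n)) \<omega> - J \<omega>))) \<longlonglongrightarrow> 0"
    using tendsto_0_in_prob_AE_subseq[OF I1] by auto
  define r where "r n = r1 (r2 n)" for n
  have rD: "AE \<omega> in M. (\<lambda>n. D (r n) \<omega>) \<longlonglongrightarrow> 0"
    using r1(2) by eventually_elim (use LIMSEQ_subseq_LIMSEQ[OF _ r2(1)] in \<open>fastforce simp: r_def comp_def\<close>)
  have rI: "AE \<omega> in M. (\<lambda>n. I (r n) \<omega>) \<longlonglongrightarrow> J \<omega>"
    using r2(2)
  proof eventually_elim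
    case (elim \<omega>)
    then have "(\<lambda>n. ennreal (norm (I (r n) \<omega> - J \<omega>))) \<longlonglongrightarrow> ennreal 0" by (simp add: r_def)
    then have "(\<lambda>n. norm (I (r n) \<omega> - J \<omega>)) \<longlonglongrightarrow> 0" by (subst (asm) tendsto_ennreal_iff) auto
    then show ?case using LIM_zero_cancel tendsto_norm_zero_iff by blast
  qed
  have nsqD: "nsq P (\<lambda>z. \<phi> n z - \<phi>' z) = (\<integral>\<^sup>+\<omega>. D n \<omega> \<partial>M)" for n
    unfolding \<phi>_def \<phi>'_def D_def by (rule nsq_P_step_diff[OF t clip(1) H])
  \<comment> \<open>Clipped process and \<open>H\<close> are both at most \<open>?B\<close> in norm.
    The resulting constant is the majorant that turns almost sure convergence of \<open>D\<close>
    into convergence of its expectation.\<close>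
  have Dbound: "D n \<omega> \<le> ennreal ((2 * ?B)\<^sup>2 * t)" if \<omega>: "\<omega> \<in> space M" for n \<omega>
  proof -
    have "D n \<omega> \<le> (\<integral>\<^sup>+s\<in>{0..t}. ennreal ((2 * ?B)\<^sup>2) \<partial>lborel)"
      unfolding D_def
    proof (intro nn_integral_mono)
      fix s
      have "norm (step_value (k n) (\<tau> n) (\<eta> n) s \<omega> - H s \<omega>) \<le> 2 * ?B" if "s \<in> {0..t}"
      proof -
        have "norm (H s \<omega>) \<le> ?B" using C(2) \<omega> t that by (intro norm_matrix_le_if_components_le) auto
        moreover have "norm (step_value (k n) (\<tau> n) (\<eta> n) s \<omega>) \<le> ?B"
        proof (cases "\<exists>i<k n. s \<in> {\<tau> n i<..\<tau> n (Suc i)}")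
          case True
          then obtain i where i: "i < k n" "s \<in> {\<tau> n i<..\<tau> n (Suc i)}" by blast
          have "step_value (k n) (\<tau> n) (\<eta> n) s \<omega> = \<eta> n i \<omega>"
            unfolding step_value_def by (rule step_sum_eq[OF clip(1) i])
          then show ?thesis using \<eta>B by simp
        next
          case False
          then have "step_value (k n) (\<tau> n) (\<eta> n) s \<omega> = 0"
            unfolding step_value_def by (intro sum.neutral) auto
          then show ?thesis using C(1) by simp
        qed
        ultimately show ?thesis by (intro order_trans[OF norm_triangle_ineq4]) simp
      qed
      then have "ennreal ((norm (step_value (k n) (\<tau> n) (\<eta> n) s \<omega> - H s \<omega>))\<^sup>2) \<le> ennreal ((2 * ?B)\<^sup>2)" if "s \<in> {0..t}"
        using that by (intro ennreal_leI power_mono) auto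
      then show "ennreal ((norm (step_value (k n) (\<tau> n) (\<eta> n) s \<omega> - H s \<omega>))\<^sup>2) * indicator {0..t} s \<le> ennreal ((2 * ?B)\<^sup>2) * indicator {0..t} s"
        by (cases "s \<in> {0..t}") (auto simp del: power_mult_distrib atLeastAtMost_iff)
    qed
    also have "\<dots> = ennreal ((2 * ?B)\<^sup>2 * t)"
      using t by (simp add: nn_integral_cmult_indicator ennreal_mult)
    finally show ?thesis .
  qed
  have "(\<lambda>n. \<integral>\<^sup>+\<omega>. D (r n) \<omega> \<partial>M) \<longlonglongrightarrow> (\<integral>\<^sup>+\<omega>. 0 \<partial>M)"
    by (rule nn_integral_dominated_convergence[where w="\<lambda>_. ennreal ((2 * ?B)\<^sup>2 * t)"])
      (use Dbound rD in \<open>auto simp: emeasure_space_1 ennreal_mult_less_top\<close>)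
  then have lim: "(\<lambda>n. nsq P (\<lambda>z. \<phi> (r n) z - \<phi>' z)) \<longlonglongrightarrow> 0" by (simp add: nsqD)
  define a where "a n = nsq P (\<lambda>z. \<phi> (r n) z - \<phi>' z)" for n
  have a: "a \<longlonglongrightarrow> 0" using lim by (simp add: a_def[abs_def])
  have "nsq M (\<lambda>\<omega>. I (r n) \<omega> - J \<omega>) \<le> 2 * a n" for n
  proof -
    have "nsq M (\<lambda>\<omega>. I (r n) \<omega> - J \<omega>) = (\<integral>\<^sup>+\<omega>. liminf (\<lambda>j. ennreal ((norm (I (r n) \<omega> - I (r j) \<omega>))\<^sup>2)) \<partial>M)"
      unfolding nsq_def
    proof (intro nn_integral_cong_AE)
      show "AE \<omega> in M. ennreal ((norm (I (r n) \<omega> - J \<omega>))\<^sup>2) = liminf (\<lambda>j. ennreal ((norm (I (r n) \<omega> - I (r j) \<omega>))\<^sup>2))"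
        using rI
      proof eventually_elim
        case (elim \<omega>)
        then have "(\<lambda>j. ennreal ((norm (I (r n) \<omega> - I (r j) \<omega>))\<^sup>2)) \<longlonglongrightarrow> ennreal ((norm (I (r n) \<omega> - J \<omega>))\<^sup>2)"
          by (intro tendsto_ennrealI tendsto_intros)
        then show ?case by (intro lim_imp_Liminf[symmetric]) auto
      qed
    qed
    also have "\<dots> \<le> liminf (\<lambda>j. nsq M (\<lambda>\<omega>. I (r n) \<omega> - I (r j) \<omega>))"
      unfolding nsq_def by (rule nn_integral_liminf) measurable
    also have "\<dots> \<le> liminf (\<lambda>j. 2 * a n + 2 * a j)"
    proof (intro Liminf_mono always_eventually allI)
      fix j
      have "nsq M (\<lambda>\<omega>. I (r n) \<omega> - I (r j) \<omega>) = nsq P (\<lambda>z. (\<phi> (r n) z - \<phi>' z) + (\<phi>' z - \<phi> (r j) z))"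
        using simple_isometry[OF simple_diff[OF s s]] by simp
      also have "\<dots> \<le> 2 * a n + 2 * nsq P (\<lambda>z. \<phi>' z - \<phi> (r j) z)"
        unfolding a_def by (intro nsq_add) measurable
      finally show "nsq M (\<lambda>\<omega>. I (r n) \<omega> - I (r j) \<omega>) \<le> 2 * a n + 2 * a j"
        by (simp add: a_def nsq_minus_commute[of P \<phi>'])
    qed
    also have "\<dots> = 2 * a n"
    proof (rule lim_imp_Liminf)
      show "(\<lambda>j. 2 * a n + 2 * a j) \<longlonglongrightarrow> 2 * a n"
        using tendsto_add[OF tendsto_const ennreal_tendsto_0_mult[OF a, of 2], of "2 * a n"] by simp
    qed simp
    finally show ?thesis .
  qed
  then have I: "(\<lambda>n. nsq M (\<lambda>\<omega>. I (r n) \<omega> - J \<omega>)) \<longlonglongrightarrow> 0"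
    by (rule ennreal_tendsto_0_le[OF _ ennreal_tendsto_0_mult[OF a]]) auto
  show "ito (\<lambda>z. indicator {0<..t} (fst z) *\<^sub>R H (fst z) (snd z)) J"
    unfolding ito_def \<phi>'_def[symmetric]
    using s lim I by (intro conjI exI[of _ "\<lambda>n. \<phi> (r n)"] exI[of _ "\<lambda>n. I (r n)"] allI) measurable
  \<comment> \<open>The \<open>n\<close>-th grid is subdivided into \<open>Suc n\<close> parts, so
    that the mesh tends to 0 along the sequence.\<close>
  define \<tau>' where "\<tau>' n = (\<lambda>m. \<tau> (r n) (m div Suc n) + real (m mod Suc n) / real (Suc n) * (\<tau> (r n) (Suc (m div Suc n)) - \<tau> (r n) (m div Suc n)))" for n
  define \<eta>' where "\<eta>' n = (\<lambda>m. \<eta> (r n) (m div Suc n))" for n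
  show "\<exists>k \<tau> \<xi>. (\<forall>n. step_process M \<F> t (k n) (\<tau> n) (\<xi> n)) \<and>
    (\<forall>n i \<omega>. norm (\<xi> n i \<omega>) \<le> ?B) \<and>
    (\<forall>n i. i < k n \<longrightarrow> \<tau> n (Suc i) - \<tau> n i \<le> t / real (Suc n)) \<and>
    (\<lambda>n. nsq P (\<lambda>z. step_value (k n) (\<tau> n) (\<xi> n) (fst z) (snd z) - indicator {0<..t} (fst z) *\<^sub>R H (fst z) (snd z))) \<longlonglongrightarrow> 0"
  proof (intro exI conjI allI impI)
    show "step_process M \<F> t (k (r n) * Suc n) (\<tau>' n) (\<eta>' n)" for n
      unfolding \<tau>'_def \<eta>'_def by (rule step_refine(1)[OF clip(1) zero_less_Suc t])
    show "norm (\<eta>' n i \<omega>) \<le> ?B" for n i \<omega> unfolding \<eta>'_def by (rule \<eta>B)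
    show "\<tau>' n (Suc i) - \<tau>' n i \<le> t / real (Suc n)" if "i < k (r n) * Suc n" for n i
      unfolding \<tau>'_def by (rule step_refine(4)[OF clip(1) zero_less_Suc t that])
    have "step_value (k (r n) * Suc n) (\<tau>' n) (\<eta>' n) = step_value (k (r n)) (\<tau> (r n)) (\<eta> (r n))" for n
      unfolding \<tau>'_def \<eta>'_def by (rule step_refine(2)[OF clip(1) zero_less_Suc t])
    then show "(\<lambda>n. nsq P (\<lambda>z. step_value (k (r n) * Suc n) (\<tau>' n) (\<eta>' n) (fst z) (snd z) - indicator {0<..t} (fst z) *\<^sub>R H (fst z) (snd z))) \<longlonglongrightarrow> 0"
      using lim unfolding \<phi>_def \<phi>'_def by simp
  qed
qed

end

section \<open>Riemann sums of increments\<close>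

lemma le_one_plus_square: "x \<le> 1 + x\<^sup>2" for x :: real
  using zero_le_power2[of "x - 1 / 2"] by (simp add: power2_eq_square algebra_simps)

context wiener
begin

text \<open>The error made on one grid interval is itself an Ito integral, namely of the
  approximation error of the integrand over that interval.\<close>

lemma increment_ito:
  fixes H :: "real \<Rightarrow> 'w \<Rightarrow> real^'n^'m"
  assumes step: "step_process M \<F> t k \<tau> \<xi>" and t: "t \<in> {0..T}" and i: "i < k"
    and J: "\<And>s. s \<in> {0..T} \<Longrightarrow> ito (\<lambda>z. indicator {0<..s} (fst z) *\<^sub>R H (fst z) (snd z)) (J s)"
  shows "ito (\<lambda>z. indicator {\<tau> i<..\<tau> (Suc i)} (fst z) *\<^sub>R (H (fst z) (snd z) - \<xi> i (snd z)))
    (\<lambda>\<omega>. J (\<tau> (Suc i)) \<omega> - J (\<tau> i) \<omega> - \<xi> i \<omega> *v (W (\<tau> (Suc i)) \<omega> - W (\<tau> i) \<omega>))"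
proof -
  have \<tau>: "0 \<le> \<tau> i" "\<tau> i \<le> \<tau> (Suc i)" "\<tau> (Suc i) \<le> T"
    using step_bounds[OF step, of i] step_bounds[OF step, of "Suc i"] i t step by (auto simp: step_process_def)
  have el: "ito (\<lambda>z. indicator {\<tau> i<..\<tau> (Suc i)} (fst z) *\<^sub>R \<xi> i (snd z)) (\<lambda>\<omega>. \<xi> i \<omega> *v (W (\<tau> (Suc i)) \<omega> - W (\<tau> i) \<omega>))"
    using step i by (intro simple_imp_ito simple.elem \<tau>) (auto simp: step_process_def)
  have "ito (\<lambda>z. indicator {0<..\<tau> (Suc i)} (fst z) *\<^sub>R H (fst z) (snd z) - indicator {0<..\<tau> i} (fst z) *\<^sub>R H (fst z) (snd z)
      - indicator {\<tau> i<..\<tau> (Suc i)} (fst z) *\<^sub>R \<xi> i (snd z))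
    (\<lambda>\<omega>. J (\<tau> (Suc i)) \<omega> - J (\<tau> i) \<omega> - \<xi> i \<omega> *v (W (\<tau> (Suc i)) \<omega> - W (\<tau> i) \<omega>))"
    using \<tau> by (intro ito_diff J el) auto
  moreover have "indicator {0<..\<tau> (Suc i)} r *\<^sub>R h - indicator {0<..\<tau> i} r *\<^sub>R h - indicator {\<tau> i<..\<tau> (Suc i)} r *\<^sub>R x =
    indicator {\<tau> i<..\<tau> (Suc i)} r *\<^sub>R (h - x)" for r and h x :: "real^'n^'m"
    using \<tau> by (auto simp: indicator_def)
  ultimately show ?thesis by simp
qed

text \<open>Weights known at the left end points are moved inside the integrals. The grid intervals
  being disjoint, the combined integrand is at most \<open>c\<close> times the approximation error
  at every time, so the bound does not grow with the number of intervals.\<close>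

lemma nsq_weighted_increments:
  fixes H :: "real \<Rightarrow> 'w \<Rightarrow> real^'n^'m"
  assumes step: "step_process M \<F> t k \<tau> \<xi>" and t: "t \<in> {0..T}"
    and H: "(\<lambda>(s, \<omega>). H s \<omega>) \<in> borel_measurable P"
    and J: "\<And>s. s \<in> {0..T} \<Longrightarrow> ito (\<lambda>z. indicator {0<..s} (fst z) *\<^sub>R H (fst z) (snd z)) (J s)"
    and \<theta>: "\<And>i. i < k \<Longrightarrow> \<theta> i \<in> borel_measurable (\<F> (\<tau> i))" "\<And>i \<omega>. i < k \<Longrightarrow> \<omega> \<in> space M \<Longrightarrow> norm (\<theta> i \<omega>) \<le> c" "0 \<le> c"
  shows "nsq M (\<lambda>\<omega>. \<Sum>i<k. \<theta> i \<omega> *v (J (\<tau> (Suc i)) \<omega> - J (\<tau> i) \<omega> - \<xi> i \<omega> *v (W (\<tau> (Suc i)) \<omega> - W (\<tau> i) \<omega>)))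
    \<le> 4 * (ennreal (c\<^sup>2) * nsq P (\<lambda>z. step_value k \<tau> \<xi> (fst z) (snd z) - indicator {0<..t} (fst z) *\<^sub>R H (fst z) (snd z)))"
proof -
  let ?f = "\<lambda>i z. indicator {\<tau> i<..\<tau> (Suc i)} (fst z) *\<^sub>R (H (fst z) (snd z) - \<xi> i (snd z))"
  have \<tau>: "0 \<le> \<tau> i" "\<tau> i \<le> \<tau> (Suc i)" "\<tau> (Suc i) \<le> T" if "i < k" for i
    using step_bounds[OF step, of i] step_bounds[OF step, of "Suc i"] that t step by (auto simp: step_process_def)
  have [measurable]: "(\<lambda>z. H (fst z) (snd z)) \<in> borel_measurable P" using H by (simp add: case_prod_beta)
  note [measurable] = simple_measurable(1)[OF step_simple[OF step t]]
  have "ito (\<lambda>z. \<Sum>i<k. \<theta> i (snd z) ** ?f i z)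
    (\<lambda>\<omega>. \<Sum>i<k. \<theta> i \<omega> *v (J (\<tau> (Suc i)) \<omega> - J (\<tau> i) \<omega> - \<xi> i \<omega> *v (W (\<tau> (Suc i)) \<omega> - W (\<tau> i) \<omega>)))"
  proof (intro ito_sum ito_restrict)
    fix i assume i: "i < k"
    show "ito (?f i) (\<lambda>\<omega>. J (\<tau> (Suc i)) \<omega> - J (\<tau> i) \<omega> - \<xi> i \<omega> *v (W (\<tau> (Suc i)) \<omega> - W (\<tau> i) \<omega>))"
      by (rule increment_ito[OF step t i J])
    show "bounded (\<theta> i ` space M)" using \<theta>(2)[OF i] unfolding bounded_iff by auto
    show "?f i z = 0" if "fst z \<notin> {\<tau> i<..\<tau> (Suc i)}" for z using that by simp
  qed (use \<tau> \<theta> in auto)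
  from ito_bound[OF this]
  have "nsq M (\<lambda>\<omega>. \<Sum>i<k. \<theta> i \<omega> *v (J (\<tau> (Suc i)) \<omega> - J (\<tau> i) \<omega> - \<xi> i \<omega> *v (W (\<tau> (Suc i)) \<omega> - W (\<tau> i) \<omega>))) \<le>
    4 * nsq P (\<lambda>z. \<Sum>i<k. \<theta> i (snd z) ** ?f i z)" .
  also have "nsq P (\<lambda>z. \<Sum>i<k. \<theta> i (snd z) ** ?f i z) \<le> ennreal (c\<^sup>2) * nsq P (\<lambda>z. step_value k \<tau> \<xi> (fst z) (snd z) - indicator {0<..t} (fst z) *\<^sub>R H (fst z) (snd z))"
  proof (rule nsq_mono_mult)
    fix z assume z: "z \<in> space P"
    obtain s \<omega> where sz: "z = (s, \<omega>)" "\<omega> \<in> space M" using z by (auto simp: space_P)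
    have scale: "\<theta> i \<omega> ** (a *\<^sub>R x) = a *\<^sub>R (\<theta> i \<omega> ** x)" for i a and x :: "real^'n^'m"
      by (simp add: matrix_matrix_mult_def vec_eq_iff sum_distrib_left mult_ac)
    show "norm (\<Sum>i<k. \<theta> i (snd z) ** ?f i z) \<le> c * norm (step_value k \<tau> \<xi> (fst z) (snd z) - indicator {0<..t} (fst z) *\<^sub>R H (fst z) (snd z))"
    proof (cases "\<exists>i<k. s \<in> {\<tau> i<..\<tau> (Suc i)}")
      case True
      then obtain i where i: "i < k" "s \<in> {\<tau> i<..\<tau> (Suc i)}" by blast
      have "s \<in> {0<..t}" using i step_bounds[OF step, of i] step_bounds[OF step, of "Suc i"] by auto
      moreover have "step_value k \<tau> \<xi> s \<omega> = \<xi> i \<omega>" unfolding step_value_def by (rule step_sum_eq[OF step i])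
      moreover have "(\<Sum>j<k. \<theta> j \<omega> ** ?f j z) = \<theta> i \<omega> ** (H s \<omega> - \<xi> i \<omega>)"
        using step_sum_eq[OF step i, of "\<lambda>j. \<theta> j \<omega> ** (H s \<omega> - \<xi> j \<omega>)"] by (simp add: sz scale)
      moreover have "norm (\<theta> i \<omega> ** (H s \<omega> - \<xi> i \<omega>)) \<le> c * norm (H s \<omega> - \<xi> i \<omega>)"
        using \<theta>(2)[OF i(1) sz(2)] by (intro order_trans[OF norm_matrix_matrix_le] mult_right_mono) auto
      ultimately show ?thesis by (simp add: sz norm_minus_commute)
    next
      case False
      then have "(\<Sum>j<k. \<theta> j \<omega> ** ?f j z) = 0" by (intro sum.neutral) (auto simp: sz scale)
      then show ?thesis using \<theta>(3) by (simp add: sz)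
    qed
  qed measurable
  finally show ?thesis by (simp add: mult_left_mono)
qed

text \<open>The sum of squares, as opposed to the square of a sum in
  \<open>nsq_weighted_increments\<close>; it disposes of the errors inside the second-order
  terms.\<close>

lemma sum_nsq_increments:
  fixes H :: "real \<Rightarrow> 'w \<Rightarrow> real^'n^'m"
  assumes step: "step_process M \<F> t k \<tau> \<xi>" and t: "t \<in> {0..T}"
    and H: "(\<lambda>(s, \<omega>). H s \<omega>) \<in> borel_measurable P"
    and J: "\<And>s. s \<in> {0..T} \<Longrightarrow> ito (\<lambda>z. indicator {0<..s} (fst z) *\<^sub>R H (fst z) (snd z)) (J s)"
  shows "(\<Sum>i<k. nsq M (\<lambda>\<omega>. J (\<tau> (Suc i)) \<omega> - J (\<tau> i) \<omega> - \<xi> i \<omega> *v (W (\<tau> (Suc i)) \<omega> - W (\<tau> i) \<omega>)))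
    \<le> 4 * nsq P (\<lambda>z. step_value k \<tau> \<xi> (fst z) (snd z) - indicator {0<..t} (fst z) *\<^sub>R H (fst z) (snd z))"
proof -
  let ?f = "\<lambda>i z. indicator {\<tau> i<..\<tau> (Suc i)} (fst z) *\<^sub>R (H (fst z) (snd z) - \<xi> i (snd z))"
  have m: "?f i \<in> borel_measurable P" if "i < k" for i
    using increment_ito[OF step t that J] by (simp add: ito_def)
  have "(\<Sum>i<k. nsq M (\<lambda>\<omega>. J (\<tau> (Suc i)) \<omega> - J (\<tau> i) \<omega> - \<xi> i \<omega> *v (W (\<tau> (Suc i)) \<omega> - W (\<tau> i) \<omega>))) \<le> (\<Sum>i<k. 4 * nsq P (?f i))"
    by (intro sum_mono ito_bound increment_ito[OF step t _ J]) auto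
  also have "\<dots> = 4 * (\<Sum>i<k. nsq P (?f i))" by (simp add: sum_distrib_left)
  also have "(\<Sum>i<k. nsq P (?f i)) = (\<integral>\<^sup>+z. (\<Sum>i<k. ennreal ((norm (?f i z))\<^sup>2)) \<partial>P)"
    unfolding nsq_def
  proof (rule nn_integral_sum[symmetric])
    fix i assume "i \<in> {..<k}"
    then have [measurable]: "?f i \<in> borel_measurable P" using m by simp
    show "(\<lambda>z. ennreal ((norm (?f i z))\<^sup>2)) \<in> borel_measurable P" by measurable
  qed
  also have "\<dots> \<le> nsq P (\<lambda>z. step_value k \<tau> \<xi> (fst z) (snd z) - indicator {0<..t} (fst z) *\<^sub>R H (fst z) (snd z))"
    unfolding nsq_def
  proof (intro nn_integral_mono)
    fix z assume z: "z \<in> space P"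
    obtain s \<omega> where sz: "z = (s, \<omega>)" using z by (auto simp: space_P)
    have eq: "(norm (?f i z))\<^sup>2 = indicator {\<tau> i<..\<tau> (Suc i)} s *\<^sub>R (norm (H s \<omega> - \<xi> i \<omega>))\<^sup>2" for i
      by (simp add: sz indicator_def)
    show "(\<Sum>i<k. ennreal ((norm (?f i z))\<^sup>2)) \<le> ennreal ((norm (step_value k \<tau> \<xi> (fst z) (snd z) - indicator {0<..t} (fst z) *\<^sub>R H (fst z) (snd z)))\<^sup>2)"
    proof (cases "\<exists>i<k. s \<in> {\<tau> i<..\<tau> (Suc i)}")
      case True
      then obtain i where i: "i < k" "s \<in> {\<tau> i<..\<tau> (Suc i)}" by blast
      have "s \<in> {0<..t}" using i step_bounds[OF step, of i] step_bounds[OF step, of "Suc i"] by auto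
      moreover have "step_value k \<tau> \<xi> s \<omega> = \<xi> i \<omega>" unfolding step_value_def by (rule step_sum_eq[OF step i])
      moreover have "(\<Sum>i<k. ennreal ((norm (?f i z))\<^sup>2)) = ennreal (\<Sum>i<k. (norm (?f i z))\<^sup>2)"
        by (rule sum_ennreal) auto
      moreover have "(\<Sum>i<k. (norm (?f i z))\<^sup>2) = (norm (H s \<omega> - \<xi> i \<omega>))\<^sup>2"
        unfolding eq by (rule step_sum_eq[OF step i])
      ultimately show ?thesis by (simp add: sz norm_minus_commute)
    next
      case False
      then have "(\<Sum>i<k. ennreal ((norm (?f i z))\<^sup>2)) = 0" unfolding eq by (intro sum.neutral) (auto simp: indicator_def)
      then show ?thesis by simp
    qed
  qed
  finally show ?thesis by (simp add: mult_left_mono)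
qed

text \<open>Product of two coordinate increments minus its expectation. Over successive intervals
  these are martingale differences.\<close>

definition qv :: "'n \<Rightarrow> 'n \<Rightarrow> real \<Rightarrow> real \<Rightarrow> 'w \<Rightarrow> real" where
  "qv p q s t \<omega> = (W t \<omega> - W s \<omega>) $ p * (W t \<omega> - W s \<omega>) $ q - (if p = q then t - s else 0)"

text \<open>The weights are known at the left end points and the compensated products have mean 0,
  so the summands are orthogonal and their second moments add up. The sum of squared interval
  lengths then makes everything vanish with the mesh.\<close>

lemma nsq_quadratic_variation:
  fixes \<theta> :: "nat \<Rightarrow> 'w \<Rightarrow> 'b::euclidean_space"
  assumes step: "step_process M \<F> t k \<tau> \<xi>" and t: "t \<in> {0..T}"
    and \<theta>: "\<And>i. i < k \<Longrightarrow> \<theta> i \<in> borel_measurable (\<F> (\<tau> i))" "\<And>i \<omega>. i < k \<Longrightarrow> \<omega> \<in> space M \<Longrightarrow> norm (\<theta> i \<omega>) \<le> c" "0 \<le> c"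
  shows "nsq M (\<lambda>\<omega>. \<Sum>i<k. qv p q (\<tau> i) (\<tau> (Suc i)) \<omega> *\<^sub>R \<theta> i \<omega>) \<le> ennreal (8 * c\<^sup>2 * (\<Sum>i<k. (\<tau> (Suc i) - \<tau> i)\<^sup>2))"
proof -
  define S where "S m \<omega> = (\<Sum>i<m. qv p q (\<tau> i) (\<tau> (Suc i)) \<omega> *\<^sub>R \<theta> i \<omega>)" for m \<omega>
  have \<tau>: "0 \<le> \<tau> i" "\<tau> i \<le> T" "\<tau> i \<in> {0..T}" if "i \<le> k" for i
    using step_bounds[OF step that] t by auto
  have \<tau>S: "\<tau> i \<le> \<tau> (Suc i)" if "i < k" for i using step that by (simp add: step_process_def)
  have Sm: "S m \<in> borel_measurable (\<F> (\<tau> m))" if "m \<le> k" for m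
    unfolding S_def[abs_def]
  proof (intro borel_measurable_sum)
    fix i assume "i \<in> {..<m}"
    then have i: "i < m" "i \<le> k" "Suc i \<le> k" "i < k" using that by auto
    have [measurable]: "W (\<tau> i) \<in> borel_measurable (\<F> (\<tau> m))" "W (\<tau> (Suc i)) \<in> borel_measurable (\<F> (\<tau> m))"
      using i that by (auto intro!: W_adapted_mono \<tau> step_mono[OF step])
    have [measurable]: "\<theta> i \<in> borel_measurable (\<F> (\<tau> m))"
      by (rule adapted_mono[OF \<tau>(3) \<tau>(3) step_mono[OF step] \<theta>(1)]) (use i that in auto)
    show "(\<lambda>\<omega>. qv p q (\<tau> i) (\<tau> (Suc i)) \<omega> *\<^sub>R \<theta> i \<omega>) \<in> borel_measurable (\<F> (\<tau> m))"
      unfolding qv_def by measurable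
  qed
  have "integrable M (\<lambda>\<omega>. (norm (S m \<omega>))\<^sup>2) \<and> expectation (\<lambda>\<omega>. (norm (S m \<omega>))\<^sup>2) \<le> 8 * c\<^sup>2 * (\<Sum>i<m. (\<tau> (Suc i) - \<tau> i)\<^sup>2)" if "m \<le> k" for m
    using that
  proof (induction m)
    case 0
    then show ?case by (simp add: S_def)
  next
    case (Suc m)
    then have m: "m < k" "m \<le> k" "Suc m \<le> k" by auto
    note IH = Suc.IH[OF m(2)]
    let ?q = "qv p q (\<tau> m) (\<tau> (Suc m))"
    note qm = quadratic_variation_moments[OF \<tau>(1)[OF m(2)] \<tau>S[OF m(1)] \<tau>(2)[OF m(3)], of p q, folded qv_def]
    have [measurable]: "S m \<in> borel_measurable (\<F> (\<tau> m))" "\<theta> m \<in> borel_measurable (\<F> (\<tau> m))"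
      using Sm[OF m(2)] \<theta>(1)[OF m(1)] by auto
    note M = adapted_measurable[OF \<tau>(3)[OF m(2)] Sm[OF m(2)]] adapted_measurable[OF \<tau>(3)[OF m(2)] \<theta>(1)[OF m(1)]]
    \<comment> \<open>The cross term of the square: known at \<open>\<tau> m\<close>, hence its
      product with the next compensated increment has expectation 0.\<close>
    define X where "X \<omega> = S m \<omega> \<bullet> \<theta> m \<omega>" for \<omega>
    have X: "X \<in> borel_measurable (\<F> (\<tau> m))" unfolding X_def by measurable
    have iX: "integrable M X"
    proof (rule Bochner_Integration.integrable_bound)
      \<comment> \<open>Only the second moment of \<open>S m\<close> is available from the
        induction; \<open>norm (S m \<omega>) \<le> 1 + (norm (S m \<omega>))^2\<close> reduces to
        it.\<close>
      show "integrable M (\<lambda>\<omega>. c * (1 + (norm (S m \<omega>))\<^sup>2))" using IH by simp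
      show "X \<in> borel_measurable M" by (rule adapted_measurable[OF \<tau>(3)[OF m(2)] X])
      show "AE \<omega> in M. norm (X \<omega>) \<le> norm (c * (1 + (norm (S m \<omega>))\<^sup>2))"
      proof (rule AE_I2)
        fix \<omega> assume \<omega>: "\<omega> \<in> space M"
        have "norm (X \<omega>) \<le> norm (S m \<omega>) * norm (\<theta> m \<omega>)" unfolding X_def using Cauchy_Schwarz_ineq2 by simp
        also have "\<dots> \<le> (1 + (norm (S m \<omega>))\<^sup>2) * c"
        proof (rule mult_mono)
          show "norm (S m \<omega>) \<le> 1 + (norm (S m \<omega>))\<^sup>2"
            by (rule le_one_plus_square)
        qed (use \<theta>(2)[OF m(1) \<omega>] in auto)
        finally show "norm (X \<omega>) \<le> norm (c * (1 + (norm (S m \<omega>))\<^sup>2))"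
          using \<theta>(3) by (simp add: mult.commute abs_mult)
      qed
    qed
    have f: "(\<lambda>x :: real^'n. x $ p * x $ q - (if p = q then \<tau> (Suc m) - \<tau> m else 0)) \<in> borel_measurable borel" by measurable
    note Xq = expectation_increment[OF \<tau>(1)[OF m(2)] \<tau>S[OF m(1)] \<tau>(2)[OF m(3)] X f iX, folded qv_def, OF qm(1)]
    have i3: "integrable M (\<lambda>\<omega>. (norm (\<theta> m \<omega>))\<^sup>2 * (?q \<omega>)\<^sup>2)"
    proof (rule Bochner_Integration.integrable_bound)
      show "integrable M (\<lambda>\<omega>. c\<^sup>2 * (?q \<omega>)\<^sup>2)" using qm(3) by simp
      show "(\<lambda>\<omega>. (norm (\<theta> m \<omega>))\<^sup>2 * (?q \<omega>)\<^sup>2) \<in> borel_measurable M"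
        using M(2) borel_measurable_integrable[OF qm(3)] by measurable
      show "AE \<omega> in M. norm ((norm (\<theta> m \<omega>))\<^sup>2 * (?q \<omega>)\<^sup>2) \<le> norm (c\<^sup>2 * (?q \<omega>)\<^sup>2)"
        using \<theta>(2)[OF m(1)] by (intro AE_I2) (auto simp: abs_mult intro!: mult_right_mono power_mono)
    qed
    have eq: "(norm (S (Suc m) \<omega>))\<^sup>2 = (norm (S m \<omega>))\<^sup>2 + 2 * (X \<omega> * ?q \<omega>) + (norm (\<theta> m \<omega>))\<^sup>2 * (?q \<omega>)\<^sup>2" for \<omega>
      unfolding power2_norm_eq_inner S_def X_def
      by (simp add: inner_add_left inner_add_right inner_commute power2_eq_square algebra_simps)
    have "integrable M (\<lambda>\<omega>. (norm (S (Suc m) \<omega>))\<^sup>2)"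
      unfolding eq using IH Xq(1) i3 by simp
    moreover have "expectation (\<lambda>\<omega>. (norm (S (Suc m) \<omega>))\<^sup>2) \<le> 8 * c\<^sup>2 * (\<Sum>i<Suc m. (\<tau> (Suc i) - \<tau> i)\<^sup>2)"
    proof -
      have "expectation (\<lambda>\<omega>. (norm (\<theta> m \<omega>))\<^sup>2 * (?q \<omega>)\<^sup>2) \<le> expectation (\<lambda>\<omega>. c\<^sup>2 * (?q \<omega>)\<^sup>2)"
        using \<theta>(2)[OF m(1)] i3 qm(3) by (intro integral_mono) (auto intro!: mult_right_mono power_mono)
      also have "\<dots> \<le> c\<^sup>2 * (8 * (\<tau> (Suc m) - \<tau> m)\<^sup>2)"
        using qm(3,4) by (simp add: mult_left_mono)
      finally have "expectation (\<lambda>\<omega>. (norm (\<theta> m \<omega>))\<^sup>2 * (?q \<omega>)\<^sup>2) \<le> 8 * c\<^sup>2 * (\<tau> (Suc m) - \<tau> m)\<^sup>2" by simp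
      moreover have "expectation (\<lambda>\<omega>. (norm (S (Suc m) \<omega>))\<^sup>2) = expectation (\<lambda>\<omega>. (norm (S m \<omega>))\<^sup>2) + expectation (\<lambda>\<omega>. (norm (\<theta> m \<omega>))\<^sup>2 * (?q \<omega>)\<^sup>2)"
        unfolding eq using IH Xq i3 qm(2) by simp
      ultimately show ?thesis using IH by (simp add: algebra_simps)
    qed
    ultimately show ?case by simp
  qed
  from this[OF order_refl]
  have "nsq M (S k) \<le> ennreal (8 * c\<^sup>2 * (\<Sum>i<k. (\<tau> (Suc i) - \<tau> i)\<^sup>2))"
    unfolding nsq_def by (subst nn_integral_eq_integral) (auto intro: ennreal_leI)
  then show ?thesis unfolding S_def[abs_def] .
qed

text \<open>All error quantities must vanish along the same subsequence and outside the same null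
  set, because the path computation uses them together. They are therefore added into one
  nonnegative variable whose expectation tends to 0.\<close>

lemma riemann_AE_subseq:
  fixes H :: "real \<Rightarrow> 'w \<Rightarrow> real^'n^'m" and \<theta> :: "nat \<Rightarrow> nat \<Rightarrow> 'w \<Rightarrow> real^'m^'l"
    and \<eta> :: "'n \<Rightarrow> 'n \<Rightarrow> nat \<Rightarrow> nat \<Rightarrow> 'w \<Rightarrow> 'b::euclidean_space"
  assumes t: "t \<in> {0..T}" and H: "(\<lambda>(s, \<omega>). H s \<omega>) \<in> borel_measurable P"
    and J: "\<And>s. s \<in> {0..T} \<Longrightarrow> ito (\<lambda>z. indicator {0<..s} (fst z) *\<^sub>R H (fst z) (snd z)) (J s)"
    and step: "\<And>n. step_process M \<F> t (k n) (\<tau> n) (\<xi> n)"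
    and gap: "\<And>n i. i < k n \<Longrightarrow> \<tau> n (Suc i) - \<tau> n i \<le> t / real (Suc n)"
    and lim: "(\<lambda>n. nsq P (\<lambda>z. step_value (k n) (\<tau> n) (\<xi> n) (fst z) (snd z) - indicator {0<..t} (fst z) *\<^sub>R H (fst z) (snd z))) \<longlonglongrightarrow> 0"
    and \<theta>: "\<And>n i. i < k n \<Longrightarrow> \<theta> n i \<in> borel_measurable (\<F> (\<tau> n i))" "\<And>n i \<omega>. i < k n \<Longrightarrow> \<omega> \<in> space M \<Longrightarrow> norm (\<theta> n i \<omega>) \<le> c" "0 \<le> c"
    and \<eta>: "\<And>p q n i. i < k n \<Longrightarrow> \<eta> p q n i \<in> borel_measurable (\<F> (\<tau> n i))" "\<And>p q n i \<omega>. i < k n \<Longrightarrow> \<omega> \<in> space M \<Longrightarrow> norm (\<eta> p q n i \<omega>) \<le> b" "0 \<le> b"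
  defines "\<epsilon> \<equiv> \<lambda>n i \<omega>. J (\<tau> n (Suc i)) \<omega> - J (\<tau> n i) \<omega> - \<xi> n i \<omega> *v (W (\<tau> n (Suc i)) \<omega> - W (\<tau> n i) \<omega>)"
  shows "\<exists>r::nat\<Rightarrow>nat. strict_mono r \<and> (AE \<omega> in M.
    (\<lambda>n. \<Sum>i<k (r n). \<theta> (r n) i \<omega> *v \<epsilon> (r n) i \<omega>) \<longlonglongrightarrow> 0 \<and>
    (\<lambda>n. \<Sum>i<k (r n). (norm (\<epsilon> (r n) i \<omega>))\<^sup>2) \<longlonglongrightarrow> 0 \<and>
    (\<forall>p q. (\<lambda>n. \<Sum>i<k (r n). qv p q (\<tau> (r n) i) (\<tau> (r n) (Suc i)) \<omega> *\<^sub>R \<eta> p q (r n) i \<omega>) \<longlonglongrightarrow> 0) \<and>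
    (\<forall>p. (\<lambda>n. \<Sum>i<k (r n). qv p p (\<tau> (r n) i) (\<tau> (r n) (Suc i)) \<omega>) \<longlonglongrightarrow> 0) \<and>
    (\<lambda>n. \<integral>\<^sup>+s\<in>{0..t}. ennreal ((norm (step_value (k (r n)) (\<tau> (r n)) (\<xi> (r n)) s \<omega> - H s \<omega>))\<^sup>2) \<partial>lborel) \<longlonglongrightarrow> 0)"
proof -
  define N where "N n = nsq P (\<lambda>z. step_value (k n) (\<tau> n) (\<xi> n) (fst z) (snd z) - indicator {0<..t} (fst z) *\<^sub>R H (fst z) (snd z))" for n
  have N: "N \<longlonglongrightarrow> 0" using lim unfolding N_def .
  have \<tau>: "\<tau> n i \<in> {0..T}" if "i \<le> k n" for n i
    using step_bounds[OF step that] t by auto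
  have JM: "J s \<in> borel_measurable M" if "s \<in> {0..T}" for s using J[OF that] by (simp add: ito_def)
  have \<epsilon>m: "\<epsilon> n i \<in> borel_measurable M" if "i < k n" for n i
  proof -
    have [measurable]: "J (\<tau> n (Suc i)) \<in> borel_measurable M" "J (\<tau> n i) \<in> borel_measurable M"
      "W (\<tau> n (Suc i)) \<in> borel_measurable M" "W (\<tau> n i) \<in> borel_measurable M"
      using that by (auto intro!: JM W_measurable \<tau>)
    have [measurable]: "\<xi> n i \<in> borel_measurable M"
    proof (rule adapted_measurable)
      show "\<tau> n i \<in> {0..T}" using \<tau> that by simp
      show "\<xi> n i \<in> borel_measurable (\<F> (\<tau> n i))" using step[of n] that by (simp add: step_process_def)
    qed
    show ?thesis unfolding \<epsilon>_def by measurable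
  qed
  have \<theta>m: "\<theta> n i \<in> borel_measurable M" "\<eta> p q n i \<in> borel_measurable M" "qv p q (\<tau> n i) (\<tau> n (Suc i)) \<in> borel_measurable M" if "i < k n" for n i p q
  proof -
    show "\<theta> n i \<in> borel_measurable M" "\<eta> p q n i \<in> borel_measurable M"
      using adapted_measurable[OF \<tau> \<theta>(1)] adapted_measurable[OF \<tau> \<eta>(1)] that by auto
    have [measurable]: "W (\<tau> n (Suc i)) \<in> borel_measurable M" "W (\<tau> n i) \<in> borel_measurable M"
      using that by (auto intro!: W_measurable \<tau>)
    show "qv p q (\<tau> n i) (\<tau> n (Suc i)) \<in> borel_measurable M" unfolding qv_def[abs_def] by measurable
  qed
  define A where "A n \<omega> = (\<Sum>i<k n. \<theta> n i \<omega> *v \<epsilon> n i \<omega>)" for n \<omega>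
  define Q where "Q p q n \<omega> = (\<Sum>i<k n. qv p q (\<tau> n i) (\<tau> n (Suc i)) \<omega> *\<^sub>R \<eta> p q n i \<omega>)" for p q n \<omega>
  \<comment> \<open>Weight 1 and equal indices: summed over the coordinates this later bounds the
    square sum of the increments of \<open>W\<close>.\<close>
  define R where "R p n \<omega> = (\<Sum>i<k n. qv p p (\<tau> n i) (\<tau> n (Suc i)) \<omega> *\<^sub>R (1 :: real))" for p n \<omega>
  define D where "D n \<omega> = (\<integral>\<^sup>+s\<in>{0..t}. ennreal ((norm (step_value (k n) (\<tau> n) (\<xi> n) s \<omega> - H s \<omega>))\<^sup>2) \<partial>lborel)" for n \<omega>
  have Am[measurable]: "A n \<in> borel_measurable M" for n
    unfolding A_def[abs_def] using \<theta>m(1) \<epsilon>m by (intro borel_measurable_sum borel_measurable_matrix_vector_mult) auto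
  have Qm[measurable]: "Q p q n \<in> borel_measurable M" for p q n
    unfolding Q_def[abs_def] using \<theta>m by (intro borel_measurable_sum borel_measurable_scaleR) auto
  have Rm[measurable]: "R p n \<in> borel_measurable M" for p n
    unfolding R_def[abs_def] using \<theta>m by (intro borel_measurable_sum borel_measurable_scaleR) auto
  have Dm[measurable]: "D n \<in> borel_measurable M" for n
  proof -
    note [measurable] = simple_measurable(1)[OF step_simple[OF step[of n] t]] H
    have "(\<lambda>\<omega>. \<integral>\<^sup>+s. ennreal ((norm (step_value (k n) (\<tau> n) (\<xi> n) s \<omega> - H s \<omega>))\<^sup>2) * indicator {0..t} s \<partial>time_measure T) \<in> borel_measurable M"
    proof (rule time.borel_measurable_nn_integral)
      have "(\<lambda>(\<omega>, s). ennreal ((norm (step_value (k n) (\<tau> n) (\<xi> n) (fst (s, \<omega>)) (snd (s, \<omega>)) - (case (s, \<omega>) of (s, \<omega>) \<Rightarrow> H s \<omega>)))\<^sup>2) * indicator {0..t} s) \<in> borel_measurable (M \<Otimes>\<^sub>M time_measure T)"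
        by measurable
      then show "(\<lambda>(\<omega>, s). ennreal ((norm (step_value (k n) (\<tau> n) (\<xi> n) s \<omega> - H s \<omega>))\<^sup>2) * indicator {0..t} s) \<in> borel_measurable (M \<Otimes>\<^sub>M time_measure T)"
        by simp
    qed
    moreover have "(\<integral>\<^sup>+s. ennreal ((norm (step_value (k n) (\<tau> n) (\<xi> n) s \<omega> - H s \<omega>))\<^sup>2) * indicator {0..t} s \<partial>time_measure T) = D n \<omega>" for \<omega>
      unfolding nn_integral_time_measure D_def using t by (intro nn_integral_cong) (auto simp: indicator_def)
    ultimately show ?thesis by (simp cong: measurable_cong)
  qed
  \<comment> \<open>One factor of each square is bounded by the mesh; the other factors telescope to
    \<open>t\<close>.\<close>
  have gaps: "(\<Sum>i<k n. (\<tau> n (Suc i) - \<tau> n i)\<^sup>2) \<le> t\<^sup>2 / real (Suc n)" for n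
  proof -
    have "(\<Sum>i<k n. (\<tau> n (Suc i) - \<tau> n i)\<^sup>2) \<le> (\<Sum>i<k n. t / real (Suc n) * (\<tau> n (Suc i) - \<tau> n i))"
      unfolding power2_eq_square using gap step[of n] by (intro sum_mono mult_right_mono) (auto simp: step_process_def)
    also have "\<dots> = t / real (Suc n) * (\<tau> n (k n) - \<tau> n 0)"
      by (simp only: sum_distrib_left[symmetric] sum_lessThan_telescope)
    also have "\<dots> = t\<^sup>2 / real (Suc n)" using step[of n] by (simp add: step_process_def power2_eq_square)
    finally show ?thesis .
  qed
  have gap_lim: "(\<lambda>n. ennreal (8 * a * (t\<^sup>2 / real (Suc n)))) \<longlonglongrightarrow> 0" for a
  proof -
    have "(\<lambda>n. 8 * a * t\<^sup>2 * (1 / real (Suc n))) \<longlonglongrightarrow> 8 * a * t\<^sup>2 * 0"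
      by (intro tendsto_mult tendsto_const lim_1_over_n LIMSEQ_Suc)
    from tendsto_ennrealI[OF this] show ?thesis by simp
  qed
  have Alim: "(\<lambda>n. nsq M (A n)) \<longlonglongrightarrow> 0"
  proof (rule ennreal_tendsto_0_le)
    show "nsq M (A n) \<le> 4 * (ennreal (c\<^sup>2) * N n)" for n
      unfolding A_def[abs_def] \<epsilon>_def N_def by (rule nsq_weighted_increments[OF step t H J \<theta>])
    show "(\<lambda>n. 4 * (ennreal (c\<^sup>2) * N n)) \<longlonglongrightarrow> 0" by (intro ennreal_tendsto_0_mult N) auto
  qed
  have Elim: "(\<lambda>n. \<Sum>i<k n. nsq M (\<epsilon> n i)) \<longlonglongrightarrow> 0"
  proof (rule ennreal_tendsto_0_le)
    show "(\<Sum>i<k n. nsq M (\<epsilon> n i)) \<le> 4 * N n" for n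
      unfolding \<epsilon>_def N_def by (rule sum_nsq_increments[OF step t H J])
    show "(\<lambda>n. 4 * N n) \<longlonglongrightarrow> 0" by (intro ennreal_tendsto_0_mult N) auto
  qed
  have Qlim: "(\<lambda>n. nsq M (Q p q n)) \<longlonglongrightarrow> 0" for p q
  proof (rule ennreal_tendsto_0_le[OF _ gap_lim])
    fix n
    have "nsq M (Q p q n) \<le> ennreal (8 * b\<^sup>2 * (\<Sum>i<k n. (\<tau> n (Suc i) - \<tau> n i)\<^sup>2))"
      unfolding Q_def[abs_def] by (rule nsq_quadratic_variation[OF step t \<eta>])
    also have "\<dots> \<le> ennreal (8 * b\<^sup>2 * (t\<^sup>2 / real (Suc n)))"
      by (intro ennreal_leI mult_left_mono gaps) auto
    finally show "nsq M (Q p q n) \<le> ennreal (8 * b\<^sup>2 * (t\<^sup>2 / real (Suc n)))" .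
  qed
  have Rlim: "(\<lambda>n. nsq M (R p n)) \<longlonglongrightarrow> 0" for p
  proof (rule ennreal_tendsto_0_le[OF _ gap_lim])
    fix n
    have "nsq M (R p n) \<le> ennreal (8 * 1\<^sup>2 * (\<Sum>i<k n. (\<tau> n (Suc i) - \<tau> n i)\<^sup>2))"
      unfolding R_def[abs_def] by (rule nsq_quadratic_variation[OF step t]) auto
    also have "\<dots> \<le> ennreal (8 * 1\<^sup>2 * (t\<^sup>2 / real (Suc n)))"
      by (intro ennreal_leI mult_left_mono gaps) auto
    finally show "nsq M (R p n) \<le> ennreal (8 * 1\<^sup>2 * (t\<^sup>2 / real (Suc n)))" .
  qed
  have Dlim: "(\<lambda>n. \<integral>\<^sup>+\<omega>. D n \<omega> \<partial>M) \<longlonglongrightarrow> 0"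
    using N unfolding N_def D_def by (simp only: nsq_P_step_diff[OF t step H])
  \<comment> \<open>Every summand is nonnegative, so each is dominated by \<open>Z\<close> and
    inherits its almost sure convergence.\<close>
  define Z where "Z n \<omega> = ennreal ((norm (A n \<omega>))\<^sup>2) + (\<Sum>i<k n. ennreal ((norm (\<epsilon> n i \<omega>))\<^sup>2)) +
    (\<Sum>p\<in>UNIV. \<Sum>q\<in>UNIV. ennreal ((norm (Q p q n \<omega>))\<^sup>2)) + (\<Sum>p\<in>UNIV. ennreal ((norm (R p n \<omega>))\<^sup>2)) + D n \<omega>" for n \<omega>
  have em: "(\<lambda>\<omega>. \<Sum>i<k n. ennreal ((norm (\<epsilon> n i \<omega>))\<^sup>2)) \<in> borel_measurable M" for n
    using \<epsilon>m by (intro borel_measurable_sum) (auto intro!: measurable_compose[OF _ measurable_ennreal] borel_measurable_power borel_measurable_norm)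
  have eint: "(\<integral>\<^sup>+\<omega>. (\<Sum>i<k n. ennreal ((norm (\<epsilon> n i \<omega>))\<^sup>2)) \<partial>M) = (\<Sum>i<k n. nsq M (\<epsilon> n i))" for n
    unfolding nsq_def using \<epsilon>m by (intro nn_integral_sum) (auto intro!: measurable_compose[OF _ measurable_ennreal] borel_measurable_power borel_measurable_norm)
  have Zm: "Z n \<in> borel_measurable M" for n
    unfolding Z_def[abs_def] using em by measurable
  have Zint: "(\<integral>\<^sup>+\<omega>. Z n \<omega> \<partial>M) = nsq M (A n) + (\<Sum>i<k n. nsq M (\<epsilon> n i)) + (\<Sum>p\<in>UNIV. \<Sum>q\<in>UNIV. nsq M (Q p q n)) + (\<Sum>p\<in>UNIV. nsq M (R p n)) + (\<integral>\<^sup>+\<omega>. D n \<omega> \<partial>M)" for n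
    unfolding Z_def eint[symmetric] unfolding nsq_def using em by (simp add: nn_integral_add nn_integral_sum del: sum_ennreal)
  have "(\<lambda>n. \<integral>\<^sup>+\<omega>. Z n \<omega> \<partial>M) \<longlonglongrightarrow> 0 + 0 + (\<Sum>p\<in>(UNIV::'n set). \<Sum>q\<in>(UNIV::'n set). 0) + (\<Sum>p\<in>(UNIV::'n set). 0) + 0"
    unfolding Zint by (intro tendsto_add tendsto_sum Alim Elim Qlim Rlim Dlim)
  then have Zlim: "(\<lambda>n. \<integral>\<^sup>+\<omega>. Z n \<omega> \<partial>M) \<longlonglongrightarrow> 0" by simp
  obtain r where r: "strict_mono r" "AE \<omega> in M. (\<lambda>n. Z (r n) \<omega>) \<longlonglongrightarrow> 0"
    using nn_integral_tendsto_0_AE_subseq[of Z, OF Zm Zlim] by blast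
  have sq: "(\<lambda>n. x n) \<longlonglongrightarrow> 0" if "(\<lambda>n. ennreal ((norm (x n))\<^sup>2)) \<longlonglongrightarrow> 0" for x :: "nat \<Rightarrow> 'z::real_normed_vector"
  proof -
    have "(\<lambda>n. ennreal ((norm (x n))\<^sup>2)) \<longlonglongrightarrow> ennreal 0" using that by simp
    then have "(\<lambda>n. (norm (x n))\<^sup>2) \<longlonglongrightarrow> 0" by (subst (asm) tendsto_ennreal_iff) auto
    from tendsto_real_sqrt[OF this] have "(\<lambda>n. norm (x n)) \<longlonglongrightarrow> 0" by simp
    then show ?thesis by (rule tendsto_norm_zero_cancel)
  qed
  show ?thesis
  proof (intro exI[of _ r] conjI r(1))
    show "AE \<omega> in M.
      (\<lambda>n. \<Sum>i<k (r n). \<theta> (r n) i \<omega> *v \<epsilon> (r n) i \<omega>) \<longlonglongrightarrow> 0 \<and>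
      (\<lambda>n. \<Sum>i<k (r n). (norm (\<epsilon> (r n) i \<omega>))\<^sup>2) \<longlonglongrightarrow> 0 \<and>
      (\<forall>p q. (\<lambda>n. \<Sum>i<k (r n). qv p q (\<tau> (r n) i) (\<tau> (r n) (Suc i)) \<omega> *\<^sub>R \<eta> p q (r n) i \<omega>) \<longlonglongrightarrow> 0) \<and>
      (\<forall>p. (\<lambda>n. \<Sum>i<k (r n). qv p p (\<tau> (r n) i) (\<tau> (r n) (Suc i)) \<omega>) \<longlonglongrightarrow> 0) \<and>
      (\<lambda>n. \<integral>\<^sup>+s\<in>{0..t}. ennreal ((norm (step_value (k (r n)) (\<tau> (r n)) (\<xi> (r n)) s \<omega> - H s \<omega>))\<^sup>2) \<partial>lborel) \<longlonglongrightarrow> 0"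
      using r(2)
    proof eventually_elim
      case (elim \<omega>)
      have "ennreal ((norm (A n \<omega>))\<^sup>2) \<le> Z n \<omega>" for n unfolding Z_def by (simp add: add.assoc)
      from sq[OF ennreal_tendsto_0_le[OF this elim]] have 1: "(\<lambda>n. A (r n) \<omega>) \<longlonglongrightarrow> 0" .
      have "ennreal (\<Sum>i<k n. (norm (\<epsilon> n i \<omega>))\<^sup>2) \<le> Z n \<omega>" for n
      proof -
        have "(\<Sum>i<k n. ennreal ((norm (\<epsilon> n i \<omega>))\<^sup>2)) = ennreal (\<Sum>i<k n. (norm (\<epsilon> n i \<omega>))\<^sup>2)"
          by (rule sum_ennreal) auto
        then show ?thesis unfolding Z_def by (auto intro: add_increasing2 add_increasing simp del: sum_ennreal)
      qed
      from ennreal_tendsto_0_le[OF this elim]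
      have "(\<lambda>n. ennreal (\<Sum>i<k (r n). (norm (\<epsilon> (r n) i \<omega>))\<^sup>2)) \<longlonglongrightarrow> ennreal 0" by simp
      then have 2: "(\<lambda>n. \<Sum>i<k (r n). (norm (\<epsilon> (r n) i \<omega>))\<^sup>2) \<longlonglongrightarrow> 0"
        by (subst (asm) tendsto_ennreal_iff) (auto intro!: always_eventually sum_nonneg)
      have "ennreal ((norm (Q p q n \<omega>))\<^sup>2) \<le> Z n \<omega>" for p q n
      proof -
        have "ennreal ((norm (Q p q n \<omega>))\<^sup>2) \<le> (\<Sum>q\<in>UNIV. ennreal ((norm (Q p q n \<omega>))\<^sup>2))"
          by (rule member_le_sum) auto
        also have "\<dots> \<le> (\<Sum>p\<in>UNIV. \<Sum>q\<in>UNIV. ennreal ((norm (Q p q n \<omega>))\<^sup>2))"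
          by (rule member_le_sum[where f="\<lambda>p. \<Sum>q\<in>UNIV. ennreal ((norm (Q p q n \<omega>))\<^sup>2)"]) auto
        also have "\<dots> \<le> Z n \<omega>" unfolding Z_def by (auto intro: add_increasing2 add_increasing simp del: sum_ennreal)
        finally show ?thesis .
      qed
      from sq[OF ennreal_tendsto_0_le[OF this elim]] have 3: "(\<lambda>n. Q p q (r n) \<omega>) \<longlonglongrightarrow> 0" for p q .
      have "ennreal ((norm (R p n \<omega>))\<^sup>2) \<le> Z n \<omega>" for p n
      proof -
        have "ennreal ((norm (R p n \<omega>))\<^sup>2) \<le> (\<Sum>p\<in>UNIV. ennreal ((norm (R p n \<omega>))\<^sup>2))"
          by (rule member_le_sum) auto
        also have "\<dots> \<le> Z n \<omega>" unfolding Z_def by (auto intro: add_increasing2 add_increasing simp del: sum_ennreal)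
        finally show ?thesis .
      qed
      from sq[OF ennreal_tendsto_0_le[OF this elim]] have 4: "(\<lambda>n. R p (r n) \<omega>) \<longlonglongrightarrow> 0" for p .
      have "D n \<omega> \<le> Z n \<omega>" for n unfolding Z_def by (auto intro: add_increasing2 add_increasing simp del: sum_ennreal)
      from ennreal_tendsto_0_le[OF this elim] have 5: "(\<lambda>n. D (r n) \<omega>) \<longlonglongrightarrow> 0" .
      show ?case using 1 2 3 4 5 by (simp add: A_def Q_def R_def D_def)
    qed
  qed
qed

end

section \<open>The transformation along a single path\<close>

lemma set_integral_Icc_diff:
  fixes f :: "real \<Rightarrow> 'a::euclidean_space"
  assumes f: "set_integrable lborel {0..t} f" and ab: "0 \<le> a" "a \<le> b" "b \<le> t"
  shows "set_integrable lborel {a<..b} f" "(LINT s:{a<..b}|lborel. f s) = (LINT s:{0..b}|lborel. f s) - (LINT s:{0..a}|lborel. f s)"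
proof -
  show i: "set_integrable lborel {a<..b} f"
    by (rule set_integrable_subset[OF f]) (use ab in auto)
  have i': "set_integrable lborel {0..a} f"
    by (rule set_integrable_subset[OF f]) (use ab in auto)
  have "{0..b} = {0..a} \<union> {a<..b}" "{0..a} \<inter> {a<..b} = {}" using ab by auto
  then show "(LINT s:{a<..b}|lborel. f s) = (LINT s:{0..b}|lborel. f s) - (LINT s:{0..a}|lborel. f s)"
    using set_integral_Un[OF _ i' i] by simp
qed

lemma set_integral_norm_le:
  fixes f :: "real \<Rightarrow> 'a::euclidean_space"
  assumes "set_integrable lborel {a<..b} f" "a \<le> b" "\<And>s. s \<in> {a<..b} \<Longrightarrow> norm (f s) \<le> C"
  shows "norm (LINT s:{a<..b}|lborel. f s) \<le> C * (b - a)"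
proof -
  have c: "set_integrable lborel {a<..b} (\<lambda>s. C)"
    unfolding set_integrable_def by (intro integrable_scaleR_left integrable_real_indicator) (use assms(2) in auto)
  have "norm (LINT s:{a<..b}|lborel. f s) \<le> (LINT s:{a<..b}|lborel. norm (f s))"
    by (rule set_integral_norm_bound[OF assms(1)])
  also have "\<dots> \<le> (LINT s:{a<..b}|lborel. C)"
    by (intro set_integral_mono set_integrable_norm assms c)
  also have "\<dots> = C * (b - a)"
    using assms(2) by (simp add: set_lebesgue_integral_def)
  finally show ?thesis .
qed

lemma set_integrable_continuous_Icc:
  fixes f :: "real \<Rightarrow> 'a::euclidean_space"
  assumes "continuous_on {a..b} f" shows "set_integrable lborel {a..b} f"
  unfolding set_integrable_def by (rule borel_integrable_compact) (use assms in auto)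

lemma sum_set_integral:
  fixes f :: "real \<Rightarrow> 'a::euclidean_space"
  assumes f: "set_integrable lborel {0..t} f" and \<tau>: "\<tau> 0 = 0" "\<tau> k = t" "\<And>i. i < k \<Longrightarrow> \<tau> i \<le> \<tau> (Suc i)"
  shows "(\<Sum>i<k. LINT s:{\<tau> i<..\<tau> (Suc i)}|lborel. f s) = (LINT s:{0..t}|lborel. f s)"
proof -
  have mono: "\<tau> i \<le> \<tau> j" if "i \<le> j" "j \<le> k" for i j
    using that
  proof (induction j rule: dec_induct)
    case (step n)
    then have "\<tau> i \<le> \<tau> n" "\<tau> n \<le> \<tau> (Suc n)" using \<tau>(3)[of n] by auto
    then show ?case by simp
  qed simp
  have "(\<Sum>i<k. LINT s:{\<tau> i<..\<tau> (Suc i)}|lborel. f s) =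
    (\<Sum>i<k. (LINT s:{0..\<tau> (Suc i)}|lborel. f s) - (LINT s:{0..\<tau> i}|lborel. f s))"
  proof (intro sum.cong refl set_integral_Icc_diff(2)[OF f])
    fix i assume "i \<in> {..<k}"
    then show "0 \<le> \<tau> i" "\<tau> i \<le> \<tau> (Suc i)" "\<tau> (Suc i) \<le> t"
      using mono[of 0 i] mono[of "Suc i" k] \<tau> by auto
  qed
  also have "\<dots> = (LINT s:{0..\<tau> k}|lborel. f s) - (LINT s:{0..\<tau> 0}|lborel. f s)"
    by (rule sum_lessThan_telescope)
  also have "(LINT s:{0..\<tau> 0}|lborel. f s) = 0"
    unfolding \<tau>(1) set_lebesgue_integral_def
    by (rule integral_eq_zero_AE, rule AE_mp[OF AE_lborel_singleton[of 0]]) (auto simp: indicator_def)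
  finally show ?thesis by (simp add: \<tau>)
qed

lemma sum_mult_le_sqrt:
  fixes a b :: "nat \<Rightarrow> real"
  assumes "\<And>i. i < k \<Longrightarrow> 0 \<le> a i" "\<And>i. i < k \<Longrightarrow> 0 \<le> b i"
  shows "(\<Sum>i<k. a i * b i) \<le> sqrt (\<Sum>i<k. (a i)\<^sup>2) * sqrt (\<Sum>i<k. (b i)\<^sup>2)"
  using L2_set_mult_ineq[of a b "{..<k}"] assms unfolding L2_set_def by simp

lemma linear_basis_bound:
  fixes f :: "'a::euclidean_space \<Rightarrow> 'b::real_normed_vector"
  assumes "linear f" "\<And>b. b \<in> Basis \<Longrightarrow> norm (f b) \<le> e"
  shows "norm (f h) \<le> real DIM('a) * e * norm h"
proof -
  have "f h = f (\<Sum>b\<in>Basis. (h \<bullet> b) *\<^sub>R b)" by (simp add: euclidean_representation)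
  also have "\<dots> = (\<Sum>b\<in>Basis. (h \<bullet> b) *\<^sub>R f b)"
    by (simp add: linear_sum[OF assms(1)] linear_scale[OF assms(1)])
  also have "norm \<dots> \<le> (\<Sum>b\<in>(Basis :: 'a set). norm h * e)"
  proof (rule order_trans[OF norm_sum], rule sum_mono)
    fix b :: 'a assume "b \<in> Basis"
    then show "norm ((h \<bullet> b) *\<^sub>R f b) \<le> norm h * e"
      using Basis_le_norm[of b h] assms(2)[of b] by (auto intro!: mult_mono)
  qed
  finally show ?thesis by (simp add: mult_ac)
qed

section \<open>Continuity of the coefficients along a path\<close>

context smooth_flow
begin

text \<open>Joint continuity of \<open>w\<close> is known for a fixed vector only; expanding the
  argument in the basis extends it to vectors that vary with time and space.\<close>

lemma w_combine_cont:
  assumes h: "continuous_on ({0..T} \<times> UNIV) (\<lambda>(t, x). h t x)"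
  shows "continuous_on ({0..T} \<times> UNIV) (\<lambda>(t, x). w t x (h t x))"
proof -
  have "w t x (h t x) = (\<Sum>b\<in>Basis. (h t x \<bullet> b) *\<^sub>R w t x b)" if "t \<in> {0..T}" for t x
  proof -
    have "w t x (h t x) = w t x (\<Sum>b\<in>Basis. (h t x \<bullet> b) *\<^sub>R b)" by (simp add: euclidean_representation)
    then show ?thesis by (simp only: linear_sum[OF w_linear[OF that]] linear_scale[OF w_linear[OF that]])
  qed
  moreover have "continuous_on ({0..T} \<times> UNIV) (\<lambda>p. \<Sum>b\<in>Basis. ((\<lambda>(t, x). h t x) p \<bullet> b) *\<^sub>R (\<lambda>(t, x). w t x b) p)"
    by (intro continuous_intros h w_cont)
  ultimately show ?thesis
    by (subst continuous_on_cong[OF refl, where g="\<lambda>p. \<Sum>b\<in>Basis. ((\<lambda>(t, x). h t x) p \<bullet> b) *\<^sub>R (\<lambda>(t, x). w t x b) p"]) auto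
qed

lemma u_combine_cont:
  assumes h: "continuous_on ({0..T} \<times> UNIV) (\<lambda>(t, x). h t x)" and k: "continuous_on ({0..T} \<times> UNIV) (\<lambda>(t, x). k t x)"
  shows "continuous_on ({0..T} \<times> UNIV) (\<lambda>(t, x). u t x (h t x) (k t x))"
proof -
  have "u t x (h t x) (k t x) = (\<Sum>b\<in>Basis. \<Sum>c\<in>Basis. (h t x \<bullet> b) *\<^sub>R (k t x \<bullet> c) *\<^sub>R u t x b c)" if "t \<in> {0..T}" for t x
  proof -
    have 1: "u t x b (k t x) = (\<Sum>c\<in>Basis. (k t x \<bullet> c) *\<^sub>R u t x b c)" for b
    proof -
      have "u t x b (k t x) = u t x b (\<Sum>c\<in>Basis. (k t x \<bullet> c) *\<^sub>R c)" by (simp add: euclidean_representation)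
      then show ?thesis by (simp only: linear_sum[OF u_linear2[OF that]] linear_scale[OF u_linear2[OF that]])
    qed
    have "u t x (h t x) (k t x) = u t x (\<Sum>b\<in>Basis. (h t x \<bullet> b) *\<^sub>R b) (k t x)" by (simp add: euclidean_representation)
    also have "\<dots> = (\<Sum>b\<in>Basis. (h t x \<bullet> b) *\<^sub>R u t x b (k t x))"
      by (simp only: linear_sum[OF u_linear1[OF that]] linear_scale[OF u_linear1[OF that]])
    finally show ?thesis by (simp only: 1 scaleR_sum_right)
  qed
  moreover have "continuous_on ({0..T} \<times> UNIV) (\<lambda>p. \<Sum>b\<in>Basis. \<Sum>c\<in>Basis. ((\<lambda>(t, x). h t x) p \<bullet> b) *\<^sub>R ((\<lambda>(t, x). k t x) p \<bullet> c) *\<^sub>R (\<lambda>(t, x). u t x b c) p)"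
    by (intro continuous_intros h k u_cont)
  ultimately show ?thesis
    by (subst continuous_on_cong[OF refl, where g="\<lambda>p. \<Sum>b\<in>Basis. \<Sum>c\<in>Basis. ((\<lambda>(t, x). h t x) p \<bullet> b) *\<^sub>R ((\<lambda>(t, x). k t x) p \<bullet> c) *\<^sub>R (\<lambda>(t, x). u t x b c) p"]) auto
qed

lemma q_cont: "continuous_on ({0..T} \<times> UNIV) (\<lambda>(t, x). q t x h k)"
  unfolding q_def by (intro w_combine_cont u_combine_cont w_cont)

lemma q_expand:
  assumes "s \<in> {0..T}"
  shows "q s z h k = (\<Sum>b\<in>Basis. \<Sum>c\<in>Basis. ((h \<bullet> b) * (k \<bullet> c)) *\<^sub>R q s z b c)"
proof -
  have 1: "q s z b k = (\<Sum>c\<in>Basis. (k \<bullet> c) *\<^sub>R q s z b c)" for b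
  proof -
    have "q s z b k = q s z b (\<Sum>c\<in>Basis. (k \<bullet> c) *\<^sub>R c)" by (simp add: euclidean_representation)
    then show ?thesis by (simp only: linear_sum[OF q_linear2[OF assms]] linear_scale[OF q_linear2[OF assms]])
  qed
  have "q s z h k = q s z (\<Sum>b\<in>Basis. (h \<bullet> b) *\<^sub>R b) k" by (simp add: euclidean_representation)
  also have "\<dots> = (\<Sum>b\<in>Basis. (h \<bullet> b) *\<^sub>R q s z b k)"
    by (simp only: linear_sum[OF q_linear1[OF assms]] linear_scale[OF q_linear1[OF assms]])
  finally show ?thesis by (simp only: 1 scaleR_sum_right scaleR_scaleR)
qed

end

text \<open>One deterministic trajectory; it is instantiated with
  \<open>\<lambda>t. Y t \<omega>\<close> for each \<open>\<omega>\<close> separately.\<close>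

locale flow_path = smooth_flow +
  fixes y :: "real \<Rightarrow> 'a"
  assumes y_cont: "continuous_on {0..T} y"
begin

definition x :: "real \<Rightarrow> 'a" where "x s = inv (g s) (y s)"

lemma g_x: "s \<in> {0..T} \<Longrightarrow> g s (x s) = y s"
  by (simp add: x_def)

lemma x_cont: "continuous_on {0..T} x"
proof -
  have "continuous_on {0..T} (\<lambda>s. (\<lambda>(t, y). inv (g t) y) (s, y s))"
    by (rule continuous_on_compose2[OF inv_g_cont]) (auto intro!: continuous_intros y_cont)
  then show ?thesis by (simp add: x_def[abs_def])
qed

text \<open>
  The grid values \<open>f b (x a)\<close>, with the space variable frozen at the left end point \<open>a\<close> of a grid
  interval and the time at the right one, approximate \<open>f s (x s)\<close>.
\<close>

lemma frozen_unif:
  fixes f :: "real \<Rightarrow> 'a \<Rightarrow> 'c::metric_space"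
  assumes f: "continuous_on ({0..T} \<times> UNIV) (\<lambda>(t, x). f t x)" and e: "0 < e"
  shows "\<exists>d>0. \<forall>a s b s'. a \<in> {0..T} \<and> b \<in> {0..T} \<and> s \<in> {0..T} \<and> s' \<in> {0..T} \<and> \<bar>b - s\<bar> < d \<and> \<bar>a - s'\<bar> < d \<longrightarrow> dist (f b (x a)) (f s (x s')) < e"
proof -
  have "continuous_on ({0..T} \<times> {0..T}) (\<lambda>p. (\<lambda>(t, x). f t x) (fst p, x (snd p)))"
    by (rule continuous_on_compose2[OF f]) (auto intro!: continuous_intros continuous_on_compose2[OF x_cont])
  then have "uniformly_continuous_on ({0..T} \<times> {0..T}) (\<lambda>p. f (fst p) (x (snd p)))"
    by (intro compact_uniformly_continuous compact_Times) auto
  from uniformly_continuous_onE[OF this e] obtain d where d: "0 < d"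
    "\<And>p p'. p \<in> {0..T} \<times> {0..T} \<Longrightarrow> p' \<in> {0..T} \<times> {0..T} \<Longrightarrow> dist p' p < d \<Longrightarrow> dist (f (fst p') (x (snd p'))) (f (fst p) (x (snd p))) < e"
    by metis
  show ?thesis
  proof (intro exI[of _ "d / 2"] conjI allI impI)
    fix a s b s' assume *: "a \<in> {0..T} \<and> b \<in> {0..T} \<and> s \<in> {0..T} \<and> s' \<in> {0..T} \<and> \<bar>b - s\<bar> < d / 2 \<and> \<bar>a - s'\<bar> < d / 2"
    have "dist (b, a) (s, s') \<le> dist b s + dist a s'"
      unfolding dist_Pair_Pair by (rule sqrt_sum_squares_le_sum) auto
    also have "\<dots> < d" using * by (simp add: dist_real_def)
    finally show "dist (f b (x a)) (f s (x s')) < e"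
      using d(2)[of "(s, s')" "(b, a)"] * by auto
  qed (use d in auto)
qed

text \<open>By linearity, uniformity in the direction \<open>h\<close> follows from the finitely
  many basis vectors: the least of their radii works, with the error divided by the
  dimension.\<close>

lemma frozen_linear:
  fixes f :: "real \<Rightarrow> 'a \<Rightarrow> 'b::euclidean_space \<Rightarrow> 'c::real_normed_vector"
  assumes f: "\<And>h. continuous_on ({0..T} \<times> UNIV) (\<lambda>(t, x). f t x h)" and lin: "\<And>t x. t \<in> {0..T} \<Longrightarrow> linear (f t x)" and e: "0 < e"
  shows "\<exists>d>0. \<forall>a s b s' h. a \<in> {0..T} \<and> b \<in> {0..T} \<and> s \<in> {0..T} \<and> s' \<in> {0..T} \<and> \<bar>b - s\<bar> < d \<and> \<bar>a - s'\<bar> < d \<longrightarrow> norm (f b (x a) h - f s (x s') h) \<le> e * norm h"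
proof -
  define e' where "e' = e / real DIM('b)"
  have e': "0 < e'" using e by (simp add: e'_def)
  have "\<forall>h. \<exists>d>0. \<forall>a s b s'. a \<in> {0..T} \<and> b \<in> {0..T} \<and> s \<in> {0..T} \<and> s' \<in> {0..T} \<and> \<bar>b - s\<bar> < d \<and> \<bar>a - s'\<bar> < d \<longrightarrow> dist (f b (x a) h) (f s (x s') h) < e'"
    using frozen_unif[OF f e'] by blast
  from choice[OF this] obtain d where d: "\<And>h. 0 < d h" "\<And>h a s b s'. a \<in> {0..T} \<Longrightarrow> b \<in> {0..T} \<Longrightarrow> s \<in> {0..T} \<Longrightarrow> s' \<in> {0..T} \<Longrightarrow>
    \<bar>b - s\<bar> < d h \<Longrightarrow> \<bar>a - s'\<bar> < d h \<Longrightarrow> dist (f b (x a) h) (f s (x s') h) < e'"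
    by blast
  show ?thesis
  proof (intro exI[of _ "Min (d ` Basis)"] conjI allI impI)
    show "0 < Min (d ` Basis)" using d(1) by simp
    fix a s b s' h assume *: "a \<in> {0..T} \<and> b \<in> {0..T} \<and> s \<in> {0..T} \<and> s' \<in> {0..T} \<and> \<bar>b - s\<bar> < Min (d ` Basis) \<and> \<bar>a - s'\<bar> < Min (d ` Basis)"
    have "norm (f b (x a) h - f s (x s') h) \<le> real DIM('b) * e' * norm h"
    proof (rule linear_basis_bound[of "\<lambda>h. f b (x a) h - f s (x s') h"])
      show "linear (\<lambda>h. f b (x a) h - f s (x s') h)" using lin * by (intro linear_compose_sub) auto
      fix i :: 'b assume i: "i \<in> Basis"
      then have "dist (f b (x a) i) (f s (x s') i) < e'"
        using * by (intro d(2)) (auto simp: Min_gr_iff)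
      then show "norm (f b (x a) i - f s (x s') i) \<le> e'" by (simp add: dist_norm)
    qed
    also have "\<dots> = e * norm h" by (simp add: e'_def)
    finally show "norm (f b (x a) h - f s (x s') h) \<le> e * norm h" .
  qed
qed

lemma frozen_w:
  "0 < e \<Longrightarrow> \<exists>d>0. \<forall>a s b s' h. a \<in> {0..T} \<and> b \<in> {0..T} \<and> s \<in> {0..T} \<and> s' \<in> {0..T} \<and> \<bar>b - s\<bar> < d \<and> \<bar>a - s'\<bar> < d \<longrightarrow> norm (w b (x a) h - w s (x s') h) \<le> e * norm h"
  by (rule frozen_linear[OF w_cont w_linear])

lemma x_bounded: obtains R where "0 \<le> R" "\<And>s. s \<in> {0..T} \<Longrightarrow> x s \<in> cball 0 R"
proof -
  have "bounded (x ` {0..T})" by (intro compact_imp_bounded compact_continuous_image x_cont) auto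
  from bounded_imageE[OF this] obtain C where "0 \<le> C" "\<And>s. s \<in> {0..T} \<Longrightarrow> norm (x s) \<le> C" by metis
  then show ?thesis by (intro that[of C]) auto
qed

end

lemma sum_power2_norm_add_le:
  fixes a b :: "nat \<Rightarrow> 'b::real_normed_vector"
  shows "(\<Sum>i<k. (norm (a i + b i))\<^sup>2) \<le> 2 * (\<Sum>i<k. (norm (a i))\<^sup>2) + 2 * (\<Sum>i<k. (norm (b i))\<^sup>2)"
  unfolding sum_distrib_left sum.distrib[symmetric] by (intro sum_mono power2_norm_add_le)

lemma tendsto_0_if_eventually_le:
  fixes f :: "nat \<Rightarrow> 'b::real_normed_vector"
  assumes "0 \<le> C" "\<And>e. 0 < e \<Longrightarrow> \<forall>\<^sub>F n in sequentially. norm (f n) \<le> C * e"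
  shows "f \<longlonglongrightarrow> 0"
proof (rule tendstoI)
  fix e :: real assume e: "0 < e"
  have "\<forall>\<^sub>F n in sequentially. norm (f n) \<le> C * (e / (C + 1))"
    using assms e by (intro assms(2)) (auto intro!: divide_pos_pos add_nonneg_pos)
  then show "\<forall>\<^sub>F n in sequentially. dist (f n) 0 < e"
  proof eventually_elim
    case (elim n)
    have "C * e < (C + 1) * e" using e by simp
    then have "C * (e / (C + 1)) < e" using assms(1) by (simp add: field_simps)
    with elim show ?case by simp
  qed
qed

lemma set_integral_linear:
  fixes f :: "real \<Rightarrow> 'a::euclidean_space" and h :: "'a \<Rightarrow> 'b::euclidean_space"
  assumes "linear h" "set_integrable lborel A f"
  shows "set_integrable lborel A (\<lambda>s. h (f s))" "(LINT s:A|lborel. h (f s)) = h (LINT s:A|lborel. f s)"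
proof -
  have h: "bounded_linear h" using assms(1) linear_conv_bounded_linear by blast
  have eq: "indicator A s *\<^sub>R h (f s) = h (indicator A s *\<^sub>R f s)" for s
    by (simp add: linear_scale[OF assms(1)])
  show "set_integrable lborel A (\<lambda>s. h (f s))"
    using integrable_bounded_linear[OF h assms(2)[unfolded set_integrable_def]] unfolding set_integrable_def eq .
  show "(LINT s:A|lborel. h (f s)) = h (LINT s:A|lborel. f s)"
    unfolding set_lebesgue_integral_def eq by (rule integral_bounded_linear[OF h assms(2)[unfolded set_integrable_def]])
qed

section \<open>The second-order expansion summed over a grid\<close>

context flow_path
begin

lemma flow_increment:
  assumes ab: "0 \<le> a" "a \<le> b" "b \<le> T"
  shows "g b z - g a z = (LINT s:{a<..b}|lborel. F s (g s z))"
proof -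
  have c: "continuous_on {0..T} (\<lambda>s. F s (g s z))" by (rule comp_g_cont[OF contF])
  have i: "set_integrable lborel {0..T} (\<lambda>s. F s (g s z))" by (rule set_integrable_continuous_Icc[OF c])
  have "(LINT s:{0..r}|lborel. F s (g s z)) = g r z - g 0 z" if r: "0 \<le> r" "r \<le> T" for r
  proof -
    have "set_integrable lborel {0..r} (\<lambda>s. F s (g s z))"
      by (rule set_integrable_continuous_Icc[OF continuous_on_subset[OF c]]) (use r in auto)
    then have "(LINT s:{0..r}|lborel. F s (g s z)) = integral {0..r} (\<lambda>s. F s (g s z))"
      by (rule set_borel_integral_eq_integral(2))
    also have "\<dots> = g r z - g 0 z"
      by (rule integral_unique, rule fundamental_theorem_of_calculus)
        (use r in \<open>auto intro: has_vector_derivative_within_subset[OF g_deriv]\<close>)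
    finally show ?thesis .
  qed
  then show ?thesis using set_integral_Icc_diff(2)[OF i ab] ab by simp
qed

lemma comp_path_cont:
  assumes "continuous_on ({0..T} \<times> UNIV) (\<lambda>(t, x). f t x)" "continuous_on {0..T} z"
  shows "continuous_on {0..T} (\<lambda>t. f t (z t))"
  using continuous_on_compose2[OF assms(1) continuous_on_Pair[OF continuous_on_id assms(2)]] by fastforce

lemma w_path_cont: "continuous_on {0..T} \<mu> \<Longrightarrow> continuous_on {0..T} (\<lambda>s. w s (x s) (\<mu> s))"
proof -
  assume \<mu>: "continuous_on {0..T} \<mu>"
  have "w s (x s) (\<mu> s) = (\<Sum>b\<in>Basis. (\<mu> s \<bullet> b) *\<^sub>R w s (x s) b)" if "s \<in> {0..T}" for s
  proof -
    have "w s (x s) (\<mu> s) = w s (x s) (\<Sum>b\<in>Basis. (\<mu> s \<bullet> b) *\<^sub>R b)" by (simp add: euclidean_representation)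
    then show ?thesis by (simp only: linear_sum[OF w_linear[OF that]] linear_scale[OF w_linear[OF that]])
  qed
  note eq = this
  have "continuous_on {0..T} (\<lambda>s. \<Sum>b\<in>Basis. (\<mu> s \<bullet> b) *\<^sub>R w s (x s) b)"
    by (intro continuous_intros \<mu> comp_path_cont[OF w_cont x_cont])
  then show ?thesis by (rule continuous_on_eq) (rule eq[symmetric])
qed

text \<open>An Ito formula for a single path. The increments of \<open>y\<close> consist of a drift,
  errors \<open>\<epsilon>\<close> and a rough part \<open>\<beta>\<close> of which only the square
  sum is bounded. The errors enter twice: linearly, where smallness of the weighted sum is assumed
  directly because absolute sums are out of control, and quadratically, where small square sums
  suffice by Cauchy-Schwarz. Up to vanishing terms only the linear and quadratic sums in
  \<open>\<beta>\<close> remain.\<close>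

lemma pathwise_ito:
  fixes \<mu> :: "real \<Rightarrow> 'a" and \<epsilon> \<beta> :: "nat \<Rightarrow> nat \<Rightarrow> 'a"
  assumes t: "t \<in> {0..T}" and \<mu>: "continuous_on {0..T} \<mu>"
    and \<tau>: "\<And>n. \<tau> n 0 = 0" "\<And>n. \<tau> n (k n) = t" "\<And>n i. i < k n \<Longrightarrow> \<tau> n i \<le> \<tau> n (Suc i)"
    and mesh: "\<And>n i. i < k n \<Longrightarrow> \<tau> n (Suc i) - \<tau> n i \<le> \<delta> n" "\<delta> \<longlonglongrightarrow> 0"
    and incr: "\<And>n i. i < k n \<Longrightarrow> y (\<tau> n (Suc i)) - y (\<tau> n i) = (LINT s:{\<tau> n i<..\<tau> n (Suc i)}|lborel. F s (y s) + \<mu> s) + \<epsilon> n i + \<beta> n i"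
    and \<epsilon>1: "(\<lambda>n. \<Sum>i<k n. w (\<tau> n (Suc i)) (x (\<tau> n i)) (\<epsilon> n i)) \<longlonglongrightarrow> 0"
    and \<epsilon>2: "(\<lambda>n. \<Sum>i<k n. (norm (\<epsilon> n i))\<^sup>2) \<longlonglongrightarrow> 0"
    and \<beta>: "\<And>n. (\<Sum>i<k n. (norm (\<beta> n i))\<^sup>2) \<le> b"
  shows "(\<lambda>n. (\<Sum>i<k n. w (\<tau> n (Suc i)) (x (\<tau> n i)) (\<beta> n i)) - (1 / 2) *\<^sub>R (\<Sum>i<k n. q (\<tau> n (Suc i)) (x (\<tau> n i)) (\<beta> n i) (\<beta> n i)))
    \<longlonglongrightarrow> x t - x 0 - (LINT s:{0..t}|lborel. w s (x s) (\<mu> s))"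
proof -
  have mono: "\<tau> n i \<le> \<tau> n j" if "i \<le> j" "j \<le> k n" for n i j
    using that
  proof (induction j rule: dec_induct)
    case (step m)
    then have "\<tau> n i \<le> \<tau> n m" "\<tau> n m \<le> \<tau> n (Suc m)" using \<tau>(3)[of m n] by auto
    then show ?case by simp
  qed simp
  have \<tau>T: "\<tau> n i \<in> {0..T}" "\<tau> n (Suc i) \<in> {0..T}" "0 \<le> \<tau> n i" "\<tau> n (Suc i) \<le> T" "\<tau> n i \<le> \<tau> n (Suc i)" if "i < k n" for n i
  proof -
    have "0 \<le> \<tau> n i" "\<tau> n (Suc i) \<le> t" using mono[of 0 i n] mono[of "Suc i" "k n" n] that \<tau>(1,2)[of n] by auto
    then show "\<tau> n i \<in> {0..T}" "\<tau> n (Suc i) \<in> {0..T}" "0 \<le> \<tau> n i" "\<tau> n (Suc i) \<le> T" "\<tau> n i \<le> \<tau> n (Suc i)"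
      using \<tau>(3)[OF that] t by auto
  qed
  have len: "(\<Sum>i<k n. \<tau> n (Suc i) - \<tau> n i) = t" for n
    using \<tau>(1,2)[of n] by (simp only: sum_lessThan_telescope)
  have b0: "0 \<le> b" by (rule order_trans[OF sum_nonneg \<beta>]) auto
  have small: "\<forall>\<^sub>F n in sequentially. \<forall>i<k n. \<tau> n (Suc i) - \<tau> n i < d" if "0 < d" for d
    using order_tendstoD(2)[OF mesh(2) that] by eventually_elim (use mesh(1) in \<open>auto intro: order.strict_trans1\<close>)
  obtain Cm where Cm: "0 \<le> Cm" "\<And>s. s \<in> {0..T} \<Longrightarrow> norm (\<mu> s) \<le> Cm"
    using bounded_imageE[OF compact_imp_bounded[OF compact_continuous_image[OF \<mu> compact_Icc]]] by metis
  obtain R where R: "0 \<le> R" "\<And>s. s \<in> {0..T} \<Longrightarrow> x s \<in> cball 0 R" using x_bounded by blast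
  have close: "\<forall>\<^sub>F n in sequentially. \<forall>i<k n. \<forall>s\<in>{\<tau> n i..\<tau> n (Suc i)}. norm (y s - g s (x (\<tau> n i))) \<le> e" if "0 < e" for e
  proof -
    obtain d where d: "0 < d" "\<And>a s b s'. a \<in> {0..T} \<and> b \<in> {0..T} \<and> s \<in> {0..T} \<and> s' \<in> {0..T} \<and> \<bar>b - s\<bar> < d \<and> \<bar>a - s'\<bar> < d \<Longrightarrow> dist (g b (x a)) (g s (x s')) < e"
      using frozen_unif[OF g_cont \<open>0 < e\<close>] by blast
    show ?thesis
      using small[OF d(1)]
    proof eventually_elim
      case (elim n)
      show ?case
      proof (intro allI impI ballI)
        fix i s assume i: "i < k n" and s: "s \<in> {\<tau> n i..\<tau> n (Suc i)}"
        have "dist (g s (x (\<tau> n i))) (g s (x s)) < e"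
          using elim i s \<tau>T[OF i] d(1) by (intro d(2)) auto
        then show "norm (y s - g s (x (\<tau> n i))) \<le> e"
          using g_x[of s] s \<tau>T[OF i] by (simp add: dist_norm norm_minus_commute)
      qed
    qed
  qed
  define D where "D n i = (LINT s:{\<tau> n i<..\<tau> n (Suc i)}|lborel. F s (y s) - F s (g s (x (\<tau> n i))) + \<mu> s)" for n i
  define dl where "dl n i = y (\<tau> n (Suc i)) - g (\<tau> n (Suc i)) (x (\<tau> n i))" for n i
  have Fy: "continuous_on {0..T} (\<lambda>s. F s (y s))" by (rule comp_path_cont[OF contF y_cont])
  have Fg: "continuous_on {0..T} (\<lambda>s. F s (g s z))" for z by (rule comp_g_cont[OF contF])
  have int: "set_integrable lborel {\<tau> n i<..\<tau> n (Suc i)} f" if "i < k n" "continuous_on {0..T} f" for n i and f :: "real \<Rightarrow> 'a"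
    by (rule set_integrable_subset[OF set_integrable_continuous_Icc[OF that(2)]]) (use \<tau>T[OF that(1)] in auto)
  have dl: "dl n i = D n i + \<epsilon> n i + \<beta> n i" if i: "i < k n" for n i
  proof -
    have "g (\<tau> n (Suc i)) (x (\<tau> n i)) - y (\<tau> n i) = (LINT s:{\<tau> n i<..\<tau> n (Suc i)}|lborel. F s (g s (x (\<tau> n i))))"
      using flow_increment[OF \<tau>T(3)[OF i] \<tau>T(5)[OF i] \<tau>T(4)[OF i], of "x (\<tau> n i)"] g_x[OF \<tau>T(1)[OF i]] by simp
    moreover have "D n i = (LINT s:{\<tau> n i<..\<tau> n (Suc i)}|lborel. F s (y s) + \<mu> s) - (LINT s:{\<tau> n i<..\<tau> n (Suc i)}|lborel. F s (g s (x (\<tau> n i))))"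
      unfolding D_def using set_integral_diff(2)[OF int[OF i continuous_on_add[OF Fy \<mu>]] int[OF i Fg]] by (simp add: algebra_simps)
    moreover have "dl n i = (y (\<tau> n (Suc i)) - y (\<tau> n i)) - (g (\<tau> n (Suc i)) (x (\<tau> n i)) - y (\<tau> n i))"
      by (simp add: dl_def)
    ultimately show ?thesis unfolding incr[OF i] by simp
  qed
  \<comment> \<open>Mere proportionality to the interval length is wanted here, so closeness with
    tolerance 1 is enough; the squares of \<open>D\<close> then sum to something of the order of the
    mesh.\<close>
  have D_bound: "\<forall>\<^sub>F n in sequentially. \<forall>i<k n. norm (D n i) \<le> (L + Cm) * (\<tau> n (Suc i) - \<tau> n i)"
    using close[of 1, OF zero_less_one]
  proof eventually_elim
    case (elim n)
    show ?case
    proof (intro allI impI)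
      fix i assume i: "i < k n"
      show "norm (D n i) \<le> (L + Cm) * (\<tau> n (Suc i) - \<tau> n i)"
        unfolding D_def
      proof (rule set_integral_norm_le)
        show "set_integrable lborel {\<tau> n i<..\<tau> n (Suc i)} (\<lambda>s. F s (y s) - F s (g s (x (\<tau> n i))) + \<mu> s)"
          by (intro int[OF i] continuous_intros Fy Fg \<mu>)
        show "\<tau> n i \<le> \<tau> n (Suc i)" using \<tau>T[OF i] by simp
        fix s assume s: "s \<in> {\<tau> n i<..\<tau> n (Suc i)}"
        then have sT: "s \<in> {0..T}" using \<tau>T[OF i] by auto
        have "norm (F s (y s) - F s (g s (x (\<tau> n i)))) \<le> L * 1"
          using elim i s L by (intro order_trans[OF lipF[OF sT]] mult_left_mono) auto
        then show "norm (F s (y s) - F s (g s (x (\<tau> n i))) + \<mu> s) \<le> L + Cm"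
          using Cm(2)[OF sT] by (intro norm_triangle_mono) auto
      qed
    qed
  qed
  have D2: "(\<lambda>n. \<Sum>i<k n. (norm (D n i))\<^sup>2) \<longlonglongrightarrow> 0"
  proof (rule tendsto_sandwich[OF always_eventually _ tendsto_const])
    show "(\<lambda>n. (L + Cm)\<^sup>2 * \<delta> n * t) \<longlonglongrightarrow> 0"
      using tendsto_mult[OF tendsto_mult[OF tendsto_const mesh(2)] tendsto_const, of "(L + Cm)\<^sup>2" t] by simp
    show "\<forall>\<^sub>F n in sequentially. (\<Sum>i<k n. (norm (D n i))\<^sup>2) \<le> (L + Cm)\<^sup>2 * \<delta> n * t"
      using D_bound
    proof eventually_elim
      case (elim n)
      have "(\<Sum>i<k n. (norm (D n i))\<^sup>2) \<le> (\<Sum>i<k n. (L + Cm)\<^sup>2 * \<delta> n * (\<tau> n (Suc i) - \<tau> n i))"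
      proof (rule sum_mono)
        fix i assume "i \<in> {..<k n}" then have i: "i < k n" by simp
        have "(norm (D n i))\<^sup>2 \<le> ((L + Cm) * (\<tau> n (Suc i) - \<tau> n i))\<^sup>2" using elim i by (intro power_mono) auto
        also have "\<dots> = (L + Cm)\<^sup>2 * ((\<tau> n (Suc i) - \<tau> n i) * (\<tau> n (Suc i) - \<tau> n i))" by (simp add: power2_eq_square)
        also have "\<dots> \<le> (L + Cm)\<^sup>2 * (\<delta> n * (\<tau> n (Suc i) - \<tau> n i))"
          using mesh(1)[OF i] \<tau>T[OF i] by (intro mult_left_mono mult_right_mono) auto
        finally show "(norm (D n i))\<^sup>2 \<le> (L + Cm)\<^sup>2 * \<delta> n * (\<tau> n (Suc i) - \<tau> n i)" by simp
      qed
      then show ?case by (simp only: sum_distrib_left[symmetric] len)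
    qed
  qed (auto intro: sum_nonneg)
  \<comment> \<open>The negligible part of the displacement \<open>dl\<close>: its square sum
    vanishes, in contrast to that of \<open>\<beta>\<close>.\<close>
  define a where "a n i = D n i + \<epsilon> n i" for n i
  have a2: "(\<lambda>n. \<Sum>i<k n. (norm (a n i))\<^sup>2) \<longlonglongrightarrow> 0"
  proof (rule tendsto_sandwich[OF always_eventually always_eventually tendsto_const])
    show "(\<lambda>n. 2 * (\<Sum>i<k n. (norm (D n i))\<^sup>2) + 2 * (\<Sum>i<k n. (norm (\<epsilon> n i))\<^sup>2)) \<longlonglongrightarrow> 0"
      using tendsto_add[OF tendsto_mult[OF tendsto_const D2] tendsto_mult[OF tendsto_const \<epsilon>2], of 2 2] by simp
    show "\<forall>n. (\<Sum>i<k n. (norm (a n i))\<^sup>2) \<le> 2 * (\<Sum>i<k n. (norm (D n i))\<^sup>2) + 2 * (\<Sum>i<k n. (norm (\<epsilon> n i))\<^sup>2)"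
      unfolding a_def using sum_power2_norm_add_le by blast
  qed (auto intro: sum_nonneg)
  have dla: "dl n i = a n i + \<beta> n i" if "i < k n" for n i using dl[OF that] by (simp add: a_def)
  \<comment> \<open>Separate errors: \<open>s1\<close> replaces the linear drift sum by its
    integral, \<open>s3\<close> replaces \<open>dl\<close> by \<open>\<beta>\<close> in the
    quadratic terms, \<open>r\<close> is the Taylor remainder of the inverse flow. The linear error
    sum \<open>s2\<close>, small by assumption, is added below.\<close>
  define s1 where "s1 n = (\<Sum>i<k n. w (\<tau> n (Suc i)) (x (\<tau> n i)) (D n i)) - (LINT s:{0..t}|lborel. w s (x s) (\<mu> s))" for n
  define s3 where "s3 n = (\<Sum>i<k n. q (\<tau> n (Suc i)) (x (\<tau> n i)) (dl n i) (dl n i) - q (\<tau> n (Suc i)) (x (\<tau> n i)) (\<beta> n i) (\<beta> n i))" for n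
  define r where "r n i = x (\<tau> n (Suc i)) - x (\<tau> n i) - w (\<tau> n (Suc i)) (x (\<tau> n i)) (dl n i) + (1 / 2) *\<^sub>R q (\<tau> n (Suc i)) (x (\<tau> n i)) (dl n i) (dl n i)" for n i
  have s1: "s1 \<longlonglongrightarrow> 0"
  proof (rule tendsto_0_if_eventually_le)
    show "0 \<le> (E * L + Cm) * t" using E L Cm t by auto
    fix e :: real assume e: "0 < e"
    obtain d where d: "0 < d" "\<And>a s b s' h. a \<in> {0..T} \<and> b \<in> {0..T} \<and> s \<in> {0..T} \<and> s' \<in> {0..T} \<and> \<bar>b - s\<bar> < d \<and> \<bar>a - s'\<bar> < d \<Longrightarrow> norm (w b (x a) h - w s (x s') h) \<le> e * norm h"
      using frozen_w[OF e] by blast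
    show "\<forall>\<^sub>F n in sequentially. norm (s1 n) \<le> (E * L + Cm) * t * e"
      using small[OF d(1)] close[OF e]
    proof eventually_elim
      case (elim n)
      have wc: "continuous_on {0..T} (\<lambda>s. w s (x s) (\<mu> s))" by (rule w_path_cont[OF \<mu>])
      have wt: "set_integrable lborel {0..t} (\<lambda>s. w s (x s) (\<mu> s))"
        by (rule set_integrable_continuous_Icc[OF continuous_on_subset[OF wc]]) (use t in auto)
      have s1_eq: "s1 n = (\<Sum>i<k n. w (\<tau> n (Suc i)) (x (\<tau> n i)) (D n i) - (LINT s:{\<tau> n i<..\<tau> n (Suc i)}|lborel. w s (x s) (\<mu> s)))"
        unfolding s1_def sum_subtractf using sum_set_integral[OF wt, of "\<tau> n" "k n", OF \<tau>] by simp
      have "norm (s1 n) \<le> (\<Sum>i<k n. ((E * L + Cm) * e) * (\<tau> n (Suc i) - \<tau> n i))"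
        unfolding s1_eq
      proof (rule order_trans[OF norm_sum], rule sum_mono)
        fix i assume "i \<in> {..<k n}" then have i: "i < k n" by simp
        let ?w = "w (\<tau> n (Suc i)) (x (\<tau> n i))"
        note lin = w_linear[OF \<tau>T(2)[OF i], of "x (\<tau> n i)"]
        have Dint: "set_integrable lborel {\<tau> n i<..\<tau> n (Suc i)} (\<lambda>s. F s (y s) - F s (g s (x (\<tau> n i))) + \<mu> s)"
          by (intro int[OF i] continuous_intros Fy Fg \<mu>)
        note sl = set_integral_linear[OF lin Dint]
        have "?w (D n i) - (LINT s:{\<tau> n i<..\<tau> n (Suc i)}|lborel. w s (x s) (\<mu> s)) =
          (LINT s:{\<tau> n i<..\<tau> n (Suc i)}|lborel. ?w (F s (y s) - F s (g s (x (\<tau> n i))) + \<mu> s) - w s (x s) (\<mu> s))"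
          unfolding D_def sl(2)[symmetric] by (rule set_integral_diff(2)[OF sl(1) int[OF i wc], symmetric])
        also have "norm \<dots> \<le> ((E * L + Cm) * e) * (\<tau> n (Suc i) - \<tau> n i)"
        proof (rule set_integral_norm_le)
          show "set_integrable lborel {\<tau> n i<..\<tau> n (Suc i)} (\<lambda>s. ?w (F s (y s) - F s (g s (x (\<tau> n i))) + \<mu> s) - w s (x s) (\<mu> s))"
            by (rule set_integral_diff(1)[OF sl(1) int[OF i wc]])
          show "\<tau> n i \<le> \<tau> n (Suc i)" using \<tau>T[OF i] by simp
          fix s assume s: "s \<in> {\<tau> n i<..\<tau> n (Suc i)}"
          then have sT: "s \<in> {0..T}" using \<tau>T[OF i] by auto
          have 1: "norm (?w (F s (y s) - F s (g s (x (\<tau> n i))))) \<le> E * (L * e)"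
            using elim(2) i s L E by (intro order_trans[OF w_bound[OF \<tau>T(2)[OF i]]] mult_left_mono order_trans[OF lipF[OF sT]]) auto
          have "norm (?w (\<mu> s) - w s (x s) (\<mu> s)) \<le> e * norm (\<mu> s)"
            using elim(1) i s \<tau>T[OF i] sT by (intro d(2)) auto
          also have "\<dots> \<le> e * Cm" using e Cm(2)[OF sT] by simp
          finally have 2: "norm (?w (\<mu> s) - w s (x s) (\<mu> s)) \<le> e * Cm" .
          have "?w (F s (y s) - F s (g s (x (\<tau> n i))) + \<mu> s) - w s (x s) (\<mu> s) = ?w (F s (y s) - F s (g s (x (\<tau> n i)))) + (?w (\<mu> s) - w s (x s) (\<mu> s))"
            by (simp add: linear_add[OF lin])
          also have "norm \<dots> \<le> E * (L * e) + e * Cm" by (intro norm_triangle_mono 1 2)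
          also have "\<dots> = (E * L + Cm) * e" by (simp add: algebra_simps)
          finally show "norm (?w (F s (y s) - F s (g s (x (\<tau> n i))) + \<mu> s) - w s (x s) (\<mu> s)) \<le> (E * L + Cm) * e" .
        qed
        finally show "norm (?w (D n i) - (LINT s:{\<tau> n i<..\<tau> n (Suc i)}|lborel. w s (x s) (\<mu> s))) \<le> ((E * L + Cm) * e) * (\<tau> n (Suc i) - \<tau> n i)" .
      qed
      moreover have "(\<Sum>i<k n. ((E * L + Cm) * e) * (\<tau> n (Suc i) - \<tau> n i)) = (E * L + Cm) * t * e"
        using sum_distrib_left[of "(E * L + Cm) * e" "\<lambda>i. \<tau> n (Suc i) - \<tau> n i" "{..<k n}"] len[of n] by (metis (no_types, lifting) mult.assoc mult.commute)
      ultimately show ?case by (rule ord_le_eq_trans)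
    qed
  qed
  have s3: "s3 \<longlonglongrightarrow> 0"
  proof (rule Lim_null_comparison[OF always_eventually])
    show "\<forall>n. norm (s3 n) \<le> Q * ((\<Sum>i<k n. (norm (a n i))\<^sup>2) + 2 * (sqrt (\<Sum>i<k n. (norm (a n i))\<^sup>2) * sqrt b))"
    proof
      fix n
      have "norm (s3 n) \<le> (\<Sum>i<k n. Q * ((norm (a n i))\<^sup>2 + 2 * (norm (a n i) * norm (\<beta> n i))))"
        unfolding s3_def
      proof (rule order_trans[OF norm_sum], rule sum_mono)
        fix i assume "i \<in> {..<k n}" then have i: "i < k n" by simp
        let ?q = "q (\<tau> n (Suc i)) (x (\<tau> n i))"
        note l = q_linear1[OF \<tau>T(2)[OF i], of "x (\<tau> n i)"] q_linear2[OF \<tau>T(2)[OF i], of "x (\<tau> n i)"]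
        \<comment> \<open>By bilinearity every term of the difference contains a factor
          \<open>a n i\<close>. The mixed terms are summed with Cauchy-Schwarz, a vanishing square
          sum against a bounded one.\<close>
        have "?q (dl n i) (dl n i) - ?q (\<beta> n i) (\<beta> n i) = ?q (a n i) (a n i) + (?q (a n i) (\<beta> n i) + ?q (\<beta> n i) (a n i))"
          unfolding dla[OF i] by (simp add: linear_add[OF l(1)] linear_add[OF l(2)])
        also have "norm \<dots> \<le> Q * norm (a n i) * norm (a n i) + (Q * norm (a n i) * norm (\<beta> n i) + Q * norm (\<beta> n i) * norm (a n i))"
          by (intro norm_triangle_mono q_bound \<tau>T(2)[OF i])
        finally show "norm (?q (dl n i) (dl n i) - ?q (\<beta> n i) (\<beta> n i)) \<le> Q * ((norm (a n i))\<^sup>2 + 2 * (norm (a n i) * norm (\<beta> n i)))"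
          by (simp add: algebra_simps power2_eq_square)
      qed
      also have "\<dots> = Q * ((\<Sum>i<k n. (norm (a n i))\<^sup>2) + 2 * (\<Sum>i<k n. norm (a n i) * norm (\<beta> n i)))"
        by (simp add: sum.distrib flip: sum_distrib_left)
      also have "\<dots> \<le> Q * ((\<Sum>i<k n. (norm (a n i))\<^sup>2) + 2 * (sqrt (\<Sum>i<k n. (norm (a n i))\<^sup>2) * sqrt b))"
      proof (intro mult_left_mono add_left_mono Q)
        have "(\<Sum>i<k n. norm (a n i) * norm (\<beta> n i)) \<le> sqrt (\<Sum>i<k n. (norm (a n i))\<^sup>2) * sqrt (\<Sum>i<k n. (norm (\<beta> n i))\<^sup>2)"
          by (rule sum_mult_le_sqrt) auto
        also have "\<dots> \<le> sqrt (\<Sum>i<k n. (norm (a n i))\<^sup>2) * sqrt b"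
          using \<beta>[of n] by (intro mult_left_mono real_sqrt_le_mono) (auto intro: sum_nonneg)
        finally show "(\<Sum>i<k n. norm (a n i) * norm (\<beta> n i)) \<le> sqrt (\<Sum>i<k n. (norm (a n i))\<^sup>2) * sqrt b" .
      qed auto
      finally show "norm (s3 n) \<le> Q * ((\<Sum>i<k n. (norm (a n i))\<^sup>2) + 2 * (sqrt (\<Sum>i<k n. (norm (a n i))\<^sup>2) * sqrt b))" .
    qed
    have "(\<lambda>n. Q * ((\<Sum>i<k n. (norm (a n i))\<^sup>2) + 2 * (sqrt (\<Sum>i<k n. (norm (a n i))\<^sup>2) * sqrt b))) \<longlonglongrightarrow> Q * (0 + 2 * (sqrt 0 * sqrt b))"
      by (intro tendsto_intros a2)
    then show "(\<lambda>n. Q * ((\<Sum>i<k n. (norm (a n i))\<^sup>2) + 2 * (sqrt (\<Sum>i<k n. (norm (a n i))\<^sup>2) * sqrt b))) \<longlonglongrightarrow> 0" by simp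
  qed
  have dl2: "\<forall>\<^sub>F n in sequentially. (\<Sum>i<k n. (norm (dl n i))\<^sup>2) \<le> 2 * 1 + 2 * b"
    using order_tendstoD(2)[OF a2 zero_less_one]
  proof eventually_elim
    case (elim n)
    have "(\<Sum>i<k n. (norm (dl n i))\<^sup>2) = (\<Sum>i<k n. (norm (a n i + \<beta> n i))\<^sup>2)" using dla by (intro sum.cong) auto
    also have "\<dots> \<le> 2 * (\<Sum>i<k n. (norm (a n i))\<^sup>2) + 2 * (\<Sum>i<k n. (norm (\<beta> n i))\<^sup>2)" by (rule sum_power2_norm_add_le)
    also have "\<dots> \<le> 2 * 1 + 2 * b" using elim \<beta>[of n] by (intro add_mono mult_left_mono) auto
    finally show ?case .
  qed
  have s4: "(\<lambda>n. \<Sum>i<k n. r n i) \<longlonglongrightarrow> 0"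
  proof (rule tendsto_0_if_eventually_le)
    show "0 \<le> 2 * 1 + 2 * b" using b0 by simp
    fix e :: real assume e: "0 < e"
    obtain d where d: "0 < d" "\<And>t z y. t \<in> {0..T} \<Longrightarrow> z \<in> cball 0 R \<Longrightarrow> norm (g t y - g t z) < d \<Longrightarrow>
      norm (y - z - w t z (g t y - g t z) + (1 / 2) *\<^sub>R q t z (g t y - g t z) (g t y - g t z)) \<le> e * (norm (g t y - g t z))\<^sup>2"
      using inverse_taylor2[OF e, of R] by blast
    \<comment> \<open>The closeness statement yields a weak inequality while the Taylor expansion
      asks for a strict one, hence half of \<open>d\<close>.\<close>
    have "0 < d / 2" using d by simp
    from close[OF this] dl2
    show "\<forall>\<^sub>F n in sequentially. norm (\<Sum>i<k n. r n i) \<le> (2 * 1 + 2 * b) * e"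
    proof eventually_elim
      case (elim n)
      have "norm (\<Sum>i<k n. r n i) \<le> (\<Sum>i<k n. e * (norm (dl n i))\<^sup>2)"
      proof (rule order_trans[OF norm_sum], rule sum_mono)
        fix i assume "i \<in> {..<k n}" then have i: "i < k n" by simp
        have dl_eq: "dl n i = g (\<tau> n (Suc i)) (x (\<tau> n (Suc i))) - g (\<tau> n (Suc i)) (x (\<tau> n i))"
          unfolding dl_def g_x[OF \<tau>T(2)[OF i]] ..
        have "norm (dl n i) \<le> d / 2" unfolding dl_def using elim(1) i \<tau>T[OF i] by auto
        then have "norm (dl n i) < d" using d(1) by simp
        then show "norm (r n i) \<le> e * (norm (dl n i))\<^sup>2"
          unfolding r_def dl_eq by (intro d(2) \<tau>T(2)[OF i] R(2) \<tau>T(1)[OF i])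
      qed
      also have "\<dots> = e * (\<Sum>i<k n. (norm (dl n i))\<^sup>2)" by (simp add: sum_distrib_left)
      also have "\<dots> \<le> e * (2 * 1 + 2 * b)" using elim(2) e by (intro mult_left_mono) auto
      finally show ?case by (simp add: mult.commute)
    qed
  qed
  define s2 where "s2 n = (\<Sum>i<k n. w (\<tau> n (Suc i)) (x (\<tau> n i)) (\<epsilon> n i))" for n
  have s2: "s2 \<longlonglongrightarrow> 0" using \<epsilon>1 unfolding s2_def .
  have eq: "(\<Sum>i<k n. w (\<tau> n (Suc i)) (x (\<tau> n i)) (\<beta> n i)) - (1 / 2) *\<^sub>R (\<Sum>i<k n. q (\<tau> n (Suc i)) (x (\<tau> n i)) (\<beta> n i) (\<beta> n i)) =
    x t - x 0 - (LINT s:{0..t}|lborel. w s (x s) (\<mu> s)) - s1 n - s2 n + (1 / 2) *\<^sub>R s3 n - (\<Sum>i<k n. r n i)" for n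
  proof -
    have "x t - x 0 = (\<Sum>i<k n. x (\<tau> n (Suc i)) - x (\<tau> n i))"
      using \<tau>(1,2)[of n] by (simp only: sum_lessThan_telescope[of "\<lambda>i. x (\<tau> n i)"])
    also have "\<dots> = (\<Sum>i<k n. w (\<tau> n (Suc i)) (x (\<tau> n i)) (D n i) + w (\<tau> n (Suc i)) (x (\<tau> n i)) (\<epsilon> n i) + w (\<tau> n (Suc i)) (x (\<tau> n i)) (\<beta> n i)
      - (1 / 2) *\<^sub>R q (\<tau> n (Suc i)) (x (\<tau> n i)) (dl n i) (dl n i) + r n i)"
    proof (intro sum.cong refl)
      fix i assume "i \<in> {..<k n}" then have i: "i < k n" by simp
      show "x (\<tau> n (Suc i)) - x (\<tau> n i) = w (\<tau> n (Suc i)) (x (\<tau> n i)) (D n i) + w (\<tau> n (Suc i)) (x (\<tau> n i)) (\<epsilon> n i) + w (\<tau> n (Suc i)) (x (\<tau> n i)) (\<beta> n i)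
      - (1 / 2) *\<^sub>R q (\<tau> n (Suc i)) (x (\<tau> n i)) (dl n i) (dl n i) + r n i"
        \<comment> \<open>The displacement is decomposed in the linear term only; in the quadratic
          term it stays whole, that replacement being accounted for by \<open>s3\<close>.\<close>
        unfolding r_def by (subst (2) dl[OF i]) (simp add: linear_add[OF w_linear[OF \<tau>T(2)[OF i]]])
    qed
    also have "\<dots> = (\<Sum>i<k n. w (\<tau> n (Suc i)) (x (\<tau> n i)) (D n i)) + s2 n + (\<Sum>i<k n. w (\<tau> n (Suc i)) (x (\<tau> n i)) (\<beta> n i))
      - (1 / 2) *\<^sub>R (\<Sum>i<k n. q (\<tau> n (Suc i)) (x (\<tau> n i)) (dl n i) (dl n i)) + (\<Sum>i<k n. r n i)"
      by (simp add: sum.distrib sum_subtractf s2_def scaleR_sum_right)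
    finally show ?thesis
      unfolding s1_def s3_def sum_subtractf by (simp add: algebra_simps)
  qed
  have "(\<lambda>n. x t - x 0 - (LINT s:{0..t}|lborel. w s (x s) (\<mu> s)) - s1 n - s2 n + (1 / 2) *\<^sub>R s3 n - (\<Sum>i<k n. r n i)) \<longlonglongrightarrow>
    x t - x 0 - (LINT s:{0..t}|lborel. w s (x s) (\<mu> s)) - 0 - 0 + (1 / 2) *\<^sub>R 0 - 0"
    by (intro tendsto_intros s1 s2 s3 s4)
  then show ?thesis unfolding eq by simp
qed

end

lemma set_integrable_const_Icc: "set_integrable lborel {a..b :: real} (\<lambda>s. v)" for v :: "'b::euclidean_space"
  by (rule set_integrable_continuous_Icc) (rule continuous_on_const)

section \<open>Riemann sums of the second-order terms\<close>

context flow_path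
begin

text \<open>The linear case applied twice, first in the second argument for each basis vector and
  then in the first argument.\<close>

lemma frozen_q:
  assumes e: "0 < e"
  shows "\<exists>d>0. \<forall>a s b s' h k. a \<in> {0..T} \<and> b \<in> {0..T} \<and> s \<in> {0..T} \<and> s' \<in> {0..T} \<and> \<bar>b - s\<bar> < d \<and> \<bar>a - s'\<bar> < d \<longrightarrow>
    norm (q b (x a) h k - q s (x s') h k) \<le> e * norm h * norm k"
proof -
  define e' where "e' = e / real DIM('a)"
  have e': "0 < e'" using e by (simp add: e'_def)
  have "\<forall>h. \<exists>d>0. \<forall>a s b s' k. a \<in> {0..T} \<and> b \<in> {0..T} \<and> s \<in> {0..T} \<and> s' \<in> {0..T} \<and> \<bar>b - s\<bar> < d \<and> \<bar>a - s'\<bar> < d \<longrightarrow> norm (q b (x a) h k - q s (x s') h k) \<le> e' * norm k"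
    using frozen_linear[OF q_cont q_linear2 e'] by blast
  from choice[OF this] obtain d where d: "\<And>h. 0 < d h" "\<And>h a s b s' k. a \<in> {0..T} \<Longrightarrow> b \<in> {0..T} \<Longrightarrow> s \<in> {0..T} \<Longrightarrow> s' \<in> {0..T} \<Longrightarrow>
    \<bar>b - s\<bar> < d h \<Longrightarrow> \<bar>a - s'\<bar> < d h \<Longrightarrow> norm (q b (x a) h k - q s (x s') h k) \<le> e' * norm k"
    by blast
  show ?thesis
  proof (intro exI[of _ "Min (d ` Basis)"] conjI allI impI)
    show "0 < Min (d ` Basis)" using d(1) by simp
    fix a s b s' h k assume *: "a \<in> {0..T} \<and> b \<in> {0..T} \<and> s \<in> {0..T} \<and> s' \<in> {0..T} \<and> \<bar>b - s\<bar> < Min (d ` Basis) \<and> \<bar>a - s'\<bar> < Min (d ` Basis)"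
    have "norm (q b (x a) h k - q s (x s') h k) \<le> real DIM('a) * (e' * norm k) * norm h"
    proof (rule linear_basis_bound[of "\<lambda>h. q b (x a) h k - q s (x s') h k"])
      show "linear (\<lambda>h. q b (x a) h k - q s (x s') h k)" using q_linear1 * by (intro linear_compose_sub) auto
      fix i :: 'a assume i: "i \<in> Basis"
      then show "norm (q b (x a) i k - q s (x s') i k) \<le> e' * norm k"
        using * by (intro d(2)) (auto simp: Min_gr_iff)
    qed
    also have "\<dots> = e * norm h * norm k" by (simp add: e'_def)
    finally show "norm (q b (x a) h k - q s (x s') h k) \<le> e * norm h * norm k" .
  qed
qed

text \<open>The integrand \<open>\<alpha>\<close> is only measurable in time. Expanding
  \<open>q\<close> over the basis gives finite sums of products of measurable coefficients and
  continuous functions; boundedness supplies integrability.\<close>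

lemma q_path_integrable:
  assumes t: "t \<in> {0..T}" and \<alpha>: "(\<lambda>s. indicator {0..t} s *\<^sub>R \<alpha> s) \<in> borel_measurable lborel"
    and c: "\<And>s. s \<in> {0..t} \<Longrightarrow> norm (\<alpha> s) \<le> c" "0 \<le> c"
  shows "set_integrable lborel {0..t} (\<lambda>s. q s (x s) (\<alpha> s) (\<alpha> s))"
  unfolding set_integrable_def
proof (rule integrableI_bounded_set[of "{0..t}" _ _ "Q * c * c"])
  define A where "A s = indicator {0..t} s *\<^sub>R \<alpha> s" for s :: real
  define B where "B b c s = indicator {0..t} s *\<^sub>R q s (x s) b c" for b c and s :: real
  have [measurable]: "A \<in> borel_measurable borel" using \<alpha> unfolding A_def[abs_def] by simp
  have eq: "indicator {0..t} s *\<^sub>R q s (x s) (\<alpha> s) (\<alpha> s) = (\<Sum>b\<in>Basis. \<Sum>c\<in>Basis. ((A s \<bullet> b) * (A s \<bullet> c)) *\<^sub>R B b c s)" for s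
  proof (cases "s \<in> {0..t}")
    case True
    then have "s \<in> {0..T}" using t by auto
    from q_expand[OF this, of "x s" "\<alpha> s" "\<alpha> s"] True show ?thesis by (simp add: A_def B_def)
  qed (simp add: A_def B_def)
  have [measurable]: "B b c \<in> borel_measurable borel" for b c
  proof -
    have "continuous_on {0..t} (\<lambda>s. q s (x s) b c)"
      by (rule continuous_on_subset[OF comp_path_cont[OF q_cont x_cont]]) (use t in auto)
    from borel_measurable_integrable[OF set_integrable_continuous_Icc[OF this, unfolded set_integrable_def]]
    show ?thesis unfolding B_def[abs_def] by simp
  qed
  show "(\<lambda>s. indicator {0..t} s *\<^sub>R q s (x s) (\<alpha> s) (\<alpha> s)) \<in> borel_measurable lborel"
    unfolding eq by simp
  show "AE s in lborel. s \<in> {0..t} \<longrightarrow> norm (indicator {0..t} s *\<^sub>R q s (x s) (\<alpha> s) (\<alpha> s)) \<le> Q * c * c"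
  proof (intro AE_I2 impI)
    fix s
    show "norm (indicator {0..t} s *\<^sub>R q s (x s) (\<alpha> s) (\<alpha> s)) \<le> Q * c * c"
    proof (cases "s \<in> {0..t}")
      case True
      then have "s \<in> {0..T}" using t by auto
      from q_bound[OF this, of "x s" "\<alpha> s" "\<alpha> s"] have "norm (q s (x s) (\<alpha> s) (\<alpha> s)) \<le> Q * norm (\<alpha> s) * norm (\<alpha> s)" .
      also have "\<dots> \<le> Q * c * c" using c True Q by (intro mult_mono) auto
      finally show ?thesis using True by simp
    qed (use Q c in simp)
  qed
qed (auto simp: indicator_def emeasure_lborel_Icc_eq)

text \<open>Since \<open>\<alpha>\<close> is only measurable, this is not a classical Riemann sum:
  the values \<open>z\<close> approximate it in mean square over time. Freezing \<open>q\<close>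
  costs a uniformly small amount; replacing \<open>z\<close> by \<open>\<alpha>\<close> costs an
  amount linear in their distance, which boundedness and mean square convergence control.\<close>

lemma pathwise_quadratic:
  fixes \<alpha> :: "real \<Rightarrow> 'a" and z :: "nat \<Rightarrow> nat \<Rightarrow> 'a"
  assumes t: "t \<in> {0..T}"
    and \<tau>: "\<And>n. \<tau> n 0 = 0" "\<And>n. \<tau> n (k n) = t" "\<And>n i. i < k n \<Longrightarrow> \<tau> n i \<le> \<tau> n (Suc i)"
    and mesh: "\<And>n i. i < k n \<Longrightarrow> \<tau> n (Suc i) - \<tau> n i \<le> \<delta> n" "\<delta> \<longlonglongrightarrow> 0"
    and \<alpha>: "(\<lambda>s. indicator {0..t} s *\<^sub>R \<alpha> s) \<in> borel_measurable lborel"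
    and c: "\<And>s. s \<in> {0..t} \<Longrightarrow> norm (\<alpha> s) \<le> c" "\<And>n i. norm (z n i) \<le> c" "0 \<le> c"
    and lim: "(\<lambda>n. \<integral>\<^sup>+s\<in>{0..t}. ennreal ((norm ((\<Sum>i<k n. indicator {\<tau> n i<..\<tau> n (Suc i)} s *\<^sub>R z n i) - \<alpha> s))\<^sup>2) \<partial>lborel) \<longlonglongrightarrow> 0"
  shows "(\<lambda>n. \<Sum>i<k n. (\<tau> n (Suc i) - \<tau> n i) *\<^sub>R q (\<tau> n (Suc i)) (x (\<tau> n i)) (z n i) (z n i)) \<longlonglongrightarrow>
    (LINT s:{0..t}|lborel. q s (x s) (\<alpha> s) (\<alpha> s))"
proof -
  have mono: "\<tau> n i \<le> \<tau> n j" if "i \<le> j" "j \<le> k n" for n i j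
    using that
  proof (induction j rule: dec_induct)
    case (step m)
    then have "\<tau> n i \<le> \<tau> n m" "\<tau> n m \<le> \<tau> n (Suc m)" using \<tau>(3)[of m n] by auto
    then show ?case by simp
  qed simp
  have \<tau>T: "\<tau> n i \<in> {0..T}" "\<tau> n (Suc i) \<in> {0..T}" "0 \<le> \<tau> n i" "\<tau> n (Suc i) \<le> t" "\<tau> n i \<le> \<tau> n (Suc i)" if "i < k n" for n i
  proof -
    have "0 \<le> \<tau> n i" "\<tau> n (Suc i) \<le> t" using mono[of 0 i n] mono[of "Suc i" "k n" n] that \<tau>(1,2)[of n] by auto
    then show "\<tau> n i \<in> {0..T}" "\<tau> n (Suc i) \<in> {0..T}" "0 \<le> \<tau> n i" "\<tau> n (Suc i) \<le> t" "\<tau> n i \<le> \<tau> n (Suc i)"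
      using \<tau>(3)[OF that] t by auto
  qed
  have small: "\<forall>\<^sub>F n in sequentially. \<forall>i<k n. \<tau> n (Suc i) - \<tau> n i < d" if "0 < d" for d
    using order_tendstoD(2)[OF mesh(2) that] by eventually_elim (use mesh(1) in \<open>auto intro: order.strict_trans1\<close>)
  define S where "S n s = (\<Sum>i<k n. indicator {\<tau> n i<..\<tau> n (Suc i)} s *\<^sub>R z n i)" for n s
  have S: "S n s = z n i" if "i < k n" "s \<in> {\<tau> n i<..\<tau> n (Suc i)}" for n i s
    unfolding S_def by (rule interval_sum_eq[OF \<tau>(3) that])
  have S_bound: "norm (S n s) \<le> c" for n s
  proof (cases "\<exists>i<k n. s \<in> {\<tau> n i<..\<tau> n (Suc i)}")
    case True
    then show ?thesis using S c(2) by metis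
  next
    case False
    then have "S n s = 0" unfolding S_def by (intro sum.neutral) auto
    then show ?thesis using c(3) by simp
  qed
  have int2: "set_integrable lborel {0..t} (\<lambda>s. (norm (S n s - \<alpha> s))\<^sup>2)" for n
    unfolding set_integrable_def
  proof (rule integrableI_bounded_set[of "{0..t}" _ _ "(2 * c)\<^sup>2"])
    define A where "A s = indicator {0..t} s *\<^sub>R \<alpha> s" for s :: real
    have [measurable]: "A \<in> borel_measurable borel" using \<alpha> unfolding A_def[abs_def] by simp
    have eq: "indicator {0..t} s *\<^sub>R (norm (S n s - \<alpha> s))\<^sup>2 = (norm (indicator {0..t} s *\<^sub>R S n s - A s))\<^sup>2" for s
      by (simp add: indicator_def A_def)
    have [measurable]: "S n \<in> borel_measurable borel" unfolding S_def[abs_def] by measurable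
    show "(\<lambda>s. indicator {0..t} s *\<^sub>R (norm (S n s - \<alpha> s))\<^sup>2) \<in> borel_measurable lborel"
      unfolding eq by simp
    show "AE s in lborel. s \<in> {0..t} \<longrightarrow> norm (indicator {0..t} s *\<^sub>R (norm (S n s - \<alpha> s))\<^sup>2) \<le> (2 * c)\<^sup>2"
    proof (intro AE_I2 impI)
      fix s assume s: "s \<in> {0..t}"
      have "norm (S n s - \<alpha> s) \<le> 2 * c"
        using S_bound[of n s] c(1)[OF s] by (intro order_trans[OF norm_triangle_ineq4]) simp
      from power_mono[OF this norm_ge_zero, of 2] s
      show "norm (indicator {0..t} s *\<^sub>R (norm (S n s - \<alpha> s))\<^sup>2) \<le> (2 * c)\<^sup>2" by simp
    qed
  qed (auto simp: indicator_def emeasure_lborel_Icc_eq)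
  define r where "r n = (LINT s:{0..t}|lborel. (norm (S n s - \<alpha> s))\<^sup>2)" for n
  have r: "r \<longlonglongrightarrow> 0"
  proof -
    have "(\<integral>\<^sup>+s\<in>{0..t}. ennreal ((norm (S n s - \<alpha> s))\<^sup>2) \<partial>lborel) = ennreal (r n)" for n
    proof -
      have "(\<integral>\<^sup>+s\<in>{0..t}. ennreal ((norm (S n s - \<alpha> s))\<^sup>2) \<partial>lborel) = (\<integral>\<^sup>+s. ennreal (indicator {0..t} s *\<^sub>R (norm (S n s - \<alpha> s))\<^sup>2) \<partial>lborel)"
        by (intro nn_integral_cong) (auto simp: indicator_def)
      also have "\<dots> = ennreal (r n)"
        unfolding r_def set_lebesgue_integral_def
        by (rule nn_integral_eq_integral[OF int2[unfolded set_integrable_def]]) auto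
      finally show ?thesis .
    qed
    with lim have "(\<lambda>n. ennreal (r n)) \<longlonglongrightarrow> ennreal 0" unfolding S_def by simp
    then show ?thesis
      by (subst (asm) tendsto_ennreal_iff) (auto intro!: always_eventually integral_nonneg_AE simp: r_def set_lebesgue_integral_def)
  qed
  have Qi: "set_integrable lborel {0..t} (\<lambda>s. q s (x s) (\<alpha> s) (\<alpha> s))"
    by (rule q_path_integrable[OF t \<alpha> c(1,3)])
  have "(\<lambda>n. (\<Sum>i<k n. (\<tau> n (Suc i) - \<tau> n i) *\<^sub>R q (\<tau> n (Suc i)) (x (\<tau> n i)) (z n i) (z n i)) - (LINT s:{0..t}|lborel. q s (x s) (\<alpha> s) (\<alpha> s))) \<longlonglongrightarrow> 0"
  proof (rule tendsto_0_if_eventually_le)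
    show "0 \<le> c * c * t + 2 * Q * c * t + 2 * Q * c" using Q c t by auto
    fix e :: real assume e: "0 < e"
    obtain d where d: "0 < d" "\<And>a s b s' h k. a \<in> {0..T} \<and> b \<in> {0..T} \<and> s \<in> {0..T} \<and> s' \<in> {0..T} \<and> \<bar>b - s\<bar> < d \<and> \<bar>a - s'\<bar> < d \<Longrightarrow>
      norm (q b (x a) h k - q s (x s') h k) \<le> e * norm h * norm k"
      using frozen_q[OF e] by blast
    \<comment> \<open>The mean square distance is brought below \<open>e * e\<close> because it will
      be multiplied by a factor of order \<open>1 / e\<close>.\<close>
    have e2: "0 < e * e" using e by simp
    show "\<forall>\<^sub>F n in sequentially. norm ((\<Sum>i<k n. (\<tau> n (Suc i) - \<tau> n i) *\<^sub>R q (\<tau> n (Suc i)) (x (\<tau> n i)) (z n i) (z n i)) - (LINT s:{0..t}|lborel. q s (x s) (\<alpha> s) (\<alpha> s)))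
      \<le> (c * c * t + 2 * Q * c * t + 2 * Q * c) * e"
      using small[OF d(1)] order_tendstoD(2)[OF r e2]
    proof eventually_elim
      case (elim n)
      \<comment> \<open>Majorant of the pointwise error: freezing error plus replacement error, the
        latter made quadratic by \<open>v \<le> e + v^2 / e\<close> for the distance
        \<open>v\<close>. Its integral is computable from \<open>r n\<close>.\<close>
      define h where "h s = (e * c * c + 2 * Q * c * e) + (2 * Q * c / e) * (norm (S n s - \<alpha> s))\<^sup>2" for s
      note const = set_integrable_const_Icc
      have hi: "set_integrable lborel {0..t} h"
        unfolding h_def by (intro set_integral_add(1) const set_integrable_mult_right int2)
      have eq: "(\<Sum>i<k n. (\<tau> n (Suc i) - \<tau> n i) *\<^sub>R q (\<tau> n (Suc i)) (x (\<tau> n i)) (z n i) (z n i)) - (LINT s:{0..t}|lborel. q s (x s) (\<alpha> s) (\<alpha> s)) =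
        (\<Sum>i<k n. (\<tau> n (Suc i) - \<tau> n i) *\<^sub>R q (\<tau> n (Suc i)) (x (\<tau> n i)) (z n i) (z n i) - (LINT s:{\<tau> n i<..\<tau> n (Suc i)}|lborel. q s (x s) (\<alpha> s) (\<alpha> s)))"
        unfolding sum_subtractf using sum_set_integral[OF Qi, of "\<tau> n" "k n", OF \<tau>] by simp
      have "norm (\<Sum>i<k n. (\<tau> n (Suc i) - \<tau> n i) *\<^sub>R q (\<tau> n (Suc i)) (x (\<tau> n i)) (z n i) (z n i) - (LINT s:{\<tau> n i<..\<tau> n (Suc i)}|lborel. q s (x s) (\<alpha> s) (\<alpha> s)))
        \<le> (\<Sum>i<k n. LINT s:{\<tau> n i<..\<tau> n (Suc i)}|lborel. h s)"
      proof (rule order_trans[OF norm_sum], rule sum_mono)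
        fix i assume "i \<in> {..<k n}" then have i: "i < k n" by simp
        let ?v = "q (\<tau> n (Suc i)) (x (\<tau> n i)) (z n i) (z n i)"
        have sub: "{\<tau> n i<..\<tau> n (Suc i)} \<subseteq> {0..t}" "{\<tau> n i<..\<tau> n (Suc i)} \<in> sets lborel" using \<tau>T[OF i] by auto
        have Qi': "set_integrable lborel {\<tau> n i<..\<tau> n (Suc i)} (\<lambda>s. q s (x s) (\<alpha> s) (\<alpha> s))"
          by (rule set_integrable_subset[OF Qi sub(2,1)])
        have hi': "set_integrable lborel {\<tau> n i<..\<tau> n (Suc i)} h"
          by (rule set_integrable_subset[OF hi sub(2,1)])
        have vi: "set_integrable lborel {\<tau> n i<..\<tau> n (Suc i)} (\<lambda>s. ?v)"
          by (rule set_integrable_subset[OF const[of 0 t] sub(2,1)])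
        have "(LINT s:{\<tau> n i<..\<tau> n (Suc i)}|lborel. ?v) = (\<tau> n (Suc i) - \<tau> n i) *\<^sub>R ?v"
          using \<tau>T[OF i] by (simp add: set_lebesgue_integral_def)
        then have "(\<tau> n (Suc i) - \<tau> n i) *\<^sub>R ?v - (LINT s:{\<tau> n i<..\<tau> n (Suc i)}|lborel. q s (x s) (\<alpha> s) (\<alpha> s)) =
          (LINT s:{\<tau> n i<..\<tau> n (Suc i)}|lborel. ?v - q s (x s) (\<alpha> s) (\<alpha> s))"
          using set_integral_diff(2)[OF vi Qi'] by simp
        moreover have "norm (LINT s:{\<tau> n i<..\<tau> n (Suc i)}|lborel. ?v - q s (x s) (\<alpha> s) (\<alpha> s)) \<le> (LINT s:{\<tau> n i<..\<tau> n (Suc i)}|lborel. norm (?v - q s (x s) (\<alpha> s) (\<alpha> s)))"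
          by (rule set_integral_norm_bound[OF set_integral_diff(1)[OF vi Qi']])
        moreover have "(LINT s:{\<tau> n i<..\<tau> n (Suc i)}|lborel. norm (?v - q s (x s) (\<alpha> s) (\<alpha> s))) \<le> (LINT s:{\<tau> n i<..\<tau> n (Suc i)}|lborel. h s)"
        proof (rule set_integral_mono[OF set_integrable_norm[OF set_integral_diff(1)[OF vi Qi']] hi'])
          fix s assume s: "s \<in> {\<tau> n i<..\<tau> n (Suc i)}"
          then have sT: "s \<in> {0..T}" and st: "s \<in> {0..t}" using \<tau>T[OF i] sub by auto
          have 1: "norm (?v - q s (x s) (z n i) (z n i)) \<le> e * c * c"
          proof -
            have "norm (?v - q s (x s) (z n i) (z n i)) \<le> e * norm (z n i) * norm (z n i)"
              using elim(1) i s \<tau>T[OF i] sT d(1) by (intro d(2)) auto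
            also have "\<dots> \<le> e * c * c" using e c by (intro mult_mono) auto
            finally show ?thesis .
          qed
          define v where "v = norm (S n s - \<alpha> s)"
          have "q s (x s) (z n i) (z n i) - q s (x s) (\<alpha> s) (\<alpha> s) = q s (x s) (z n i - \<alpha> s) (z n i) + q s (x s) (\<alpha> s) (z n i - \<alpha> s)"
            by (simp add: linear_diff[OF q_linear1[OF sT]] linear_diff[OF q_linear2[OF sT]])
          then have "norm (q s (x s) (z n i) (z n i) - q s (x s) (\<alpha> s) (\<alpha> s)) \<le> Q * norm (z n i - \<alpha> s) * norm (z n i) + Q * norm (\<alpha> s) * norm (z n i - \<alpha> s)"
            by (simp only:) (intro norm_triangle_mono q_bound sT)
          also have "\<dots> \<le> Q * norm (z n i - \<alpha> s) * c + Q * c * norm (z n i - \<alpha> s)"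
            using Q c(1)[OF st] c(2,3) by (intro add_mono mult_left_mono mult_right_mono) auto
          also have "\<dots> = (2 * Q * c) * v" unfolding v_def S[OF i s] by (simp add: algebra_simps)
          also have "\<dots> \<le> (2 * Q * c) * (e + v\<^sup>2 / e)"
          proof (rule mult_left_mono)
            have "v * e \<le> e * e + v\<^sup>2" using zero_le_power2[of "v - e / 2"] e2 by (simp add: power2_eq_square algebra_simps)
            then show "v \<le> e + v\<^sup>2 / e" using e by (simp add: field_simps)
          qed (use Q c in auto)
          also have "\<dots> = 2 * Q * c * e + (2 * Q * c / e) * v\<^sup>2" by (simp add: field_simps)
          finally have 2: "norm (q s (x s) (z n i) (z n i) - q s (x s) (\<alpha> s) (\<alpha> s)) \<le> 2 * Q * c * e + (2 * Q * c / e) * v\<^sup>2" .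
          have "norm (?v - q s (x s) (\<alpha> s) (\<alpha> s)) \<le> norm (?v - q s (x s) (z n i) (z n i)) + norm (q s (x s) (z n i) (z n i) - q s (x s) (\<alpha> s) (\<alpha> s))"
            using norm_triangle_ineq[of "?v - q s (x s) (z n i) (z n i)" "q s (x s) (z n i) (z n i) - q s (x s) (\<alpha> s) (\<alpha> s)"] by simp
          also have "\<dots> \<le> e * c * c + (2 * Q * c * e + (2 * Q * c / e) * v\<^sup>2)" by (intro add_mono 1 2)
          finally show "norm (?v - q s (x s) (\<alpha> s) (\<alpha> s)) \<le> h s" by (simp add: h_def v_def)
        qed
        ultimately show "norm ((\<tau> n (Suc i) - \<tau> n i) *\<^sub>R ?v - (LINT s:{\<tau> n i<..\<tau> n (Suc i)}|lborel. q s (x s) (\<alpha> s) (\<alpha> s))) \<le> (LINT s:{\<tau> n i<..\<tau> n (Suc i)}|lborel. h s)"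
          by (simp only:)
      qed
      also have "(\<Sum>i<k n. LINT s:{\<tau> n i<..\<tau> n (Suc i)}|lborel. h s) = (LINT s:{0..t}|lborel. h s)"
        by (rule sum_set_integral[OF hi \<tau>])
      also have "\<dots> = (LINT s:{0..t}|lborel. e * c * c + 2 * Q * c * e) + (LINT s:{0..t}|lborel. (2 * Q * c / e) * (norm (S n s - \<alpha> s))\<^sup>2)"
        unfolding h_def by (intro set_integral_add(2) const set_integrable_mult_right int2)
      also have "\<dots> = (e * c * c + 2 * Q * c * e) * t + (2 * Q * c / e) * r n"
        using t by (simp add: r_def set_integral_mult_right) (simp add: set_lebesgue_integral_def)
      also have "\<dots> \<le> (e * c * c + 2 * Q * c * e) * t + (2 * Q * c / e) * (e * e)"
        using elim(2) Q c e by (intro add_left_mono mult_left_mono) auto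
      also have "\<dots> = (c * c * t + 2 * Q * c * t + 2 * Q * c) * e" using e by (simp add: field_simps)
      finally show ?case unfolding eq .
    qed
  qed
  then show ?thesis by (rule LIM_zero_cancel)
qed

end

section \<open>The transformed equation\<close>

lemma partial_deriv_eq:
  assumes "(f has_derivative f') (at x)"
  shows "partial_deriv k f x = f' (axis k 1)"
proof -
  have "((\<lambda>h. f (x + h *\<^sub>R axis k 1)) has_derivative (\<lambda>h. f' (h *\<^sub>R axis k 1))) (at 0)"
    by (rule has_derivative_compose[of "\<lambda>h. x + h *\<^sub>R axis k 1" "\<lambda>h. h *\<^sub>R axis k 1"])
      (use assms in \<open>auto intro!: derivative_eq_intros\<close>)
  then have "((\<lambda>h. f (x + h *\<^sub>R axis k 1)) has_vector_derivative f' (axis k 1)) (at 0)"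
    unfolding has_vector_derivative_def using linear_scale[OF has_derivative_linear[OF assms]] by simp
  then show ?thesis unfolding partial_deriv_def by (rule vector_derivative_at)
qed

lemma norm_le_if_axis_le:
  fixes f :: "real^'d \<Rightarrow> 'b::real_normed_vector"
  assumes "linear f" "\<And>i. norm (f (axis i 1)) \<le> e"
  shows "norm (f h) \<le> real CARD('d) * e * norm h"
proof -
  have "norm (f b) \<le> e" if "b \<in> Basis" for b
    using that assms(2) by (auto simp: Basis_vec_def)
  from linear_basis_bound[OF assms(1) this, of h] show ?thesis by simp
qed

text \<open>The smoothness assumption is about derivatives in \<open>(t, x)\<close> jointly and its
  bounds about partial derivatives. The spatial derivatives arise by composition with the embedding
  of space, the operator norms from the partial derivatives through factors of the
  dimension.\<close>

lemma smooth_drift_imp_smooth_flow: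
  fixes F :: "real \<Rightarrow> real^'d \<Rightarrow> real^'d"
  assumes T: "0 \<le> T" and F: "smooth_drift T F"
  shows "\<exists>L A B. smooth_flow T L F A B"
proof -
  let ?S = "{0..T} \<times> (UNIV :: (real^'d) set)"
  obtain M0 where M0: "\<And>t x i j. t \<in> {0..T} \<Longrightarrow> norm (partial_deriv i (F t) x) \<le> M0 \<and> norm (partial_deriv j (partial_deriv i (F t)) x) \<le> M0"
    using F unfolding smooth_drift_def by blast
  have M0_nonneg: "0 \<le> M0" using M0[of 0] T norm_ge_zero order_trans by (metis atLeastAtMost_iff order_refl)
  obtain f' f'' where f': "\<And>z. z \<in> ?S \<Longrightarrow> ((\<lambda>(t, x). F t x) has_derivative blinfun_apply (f' z)) (at z within ?S)"
    and f'': "\<And>z. z \<in> ?S \<Longrightarrow> (f' has_derivative blinfun_apply (f'' z)) (at z within ?S)"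
    and contf'': "continuous_on ?S f''"
    using F unfolding smooth_drift_def C2_on_def by blast
  define emb :: "(real^'d) \<Rightarrow>\<^sub>L (real \<times> (real^'d))" where "emb = Blinfun (\<lambda>h. (0, h))"
  have emb: "blinfun_apply emb h = (0, h)" for h
    unfolding emb_def by (subst bounded_linear_Blinfun_apply) (auto intro!: bounded_linear_Pair bounded_linear_zero bounded_linear_ident)
  \<comment> \<open>Restriction to spatial directions as a bounded linear map, so that
    differentiating \<open>A\<close> is the chain rule with a linear outer map.\<close>
  define R :: "((real \<times> (real^'d)) \<Rightarrow>\<^sub>L (real^'d)) \<Rightarrow>\<^sub>L ((real^'d) \<Rightarrow>\<^sub>L (real^'d))" where "R = Blinfun (\<lambda>l. l o\<^sub>L emb)"
  have R: "blinfun_apply R l = l o\<^sub>L emb" for l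
    unfolding R_def by (subst bounded_linear_Blinfun_apply) (auto intro!: bounded_bilinear.bounded_linear_left[OF bounded_bilinear_blinfun_compose])
  define A where "A t x = R (f' (t, x))" for t x
  define B where "B t x = R o\<^sub>L (f'' (t, x) o\<^sub>L emb)" for t x
  have contf: "continuous_on ?S (\<lambda>(t, x). F t x)" using f' by (meson has_derivative_continuous continuous_on_eq_continuous_within)
  have contf': "continuous_on ?S f'" using f'' by (meson has_derivative_continuous continuous_on_eq_continuous_within)
  \<comment> \<open>For fixed \<open>t\<close> the whole slice lies in the strip. Thus derivatives
    within the strip restrict to full spatial derivatives, at the end points of the time interval
    too.\<close>
  have pair: "((\<lambda>x. (t, x)) has_derivative (\<lambda>h. (0, h))) (at x within UNIV)" for t :: real and x :: "real^'d"
    by (auto intro!: derivative_eq_intros)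
  have derF: "(F t has_derivative blinfun_apply (A t x)) (at x)" if t: "t \<in> {0..T}" for t x
  proof -
    have "((\<lambda>x. (\<lambda>(t, x). F t x) (t, x)) has_derivative (\<lambda>h. blinfun_apply (f' (t, x)) (0, h))) (at x within UNIV)"
      by (rule has_derivative_in_compose2[OF f' _ _ pair]) (use t in auto)
    then show ?thesis by (simp add: A_def R emb blinfun_compose.rep_eq o_def)
  qed
  have derA: "(A t has_derivative blinfun_apply (B t x)) (at x)" if t: "t \<in> {0..T}" for t x
  proof -
    have "((\<lambda>x. f' (t, x)) has_derivative (\<lambda>h. blinfun_apply (f'' (t, x)) (0, h))) (at x within UNIV)"
      by (rule has_derivative_in_compose2[OF f'' _ _ pair]) (use t in auto)
    then have "((\<lambda>x. R (f' (t, x))) has_derivative (\<lambda>h. R (blinfun_apply (f'' (t, x)) (0, h)))) (at x)"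
      by (intro bounded_linear.has_derivative[OF blinfun.bounded_linear_right]) simp
    then show ?thesis by (simp add: A_def[abs_def] B_def emb blinfun_compose.rep_eq o_def)
  qed
  have pd: "partial_deriv i (F t) x = A t x (axis i 1)" if "t \<in> {0..T}" for t i x
    by (rule partial_deriv_eq[OF derF[OF that]])
  have pd2: "partial_deriv j (partial_deriv i (F t)) x = B t x (axis j 1) (axis i 1)" if t: "t \<in> {0..T}" for t i j x
  proof -
    have "((\<lambda>x. A t x (axis i 1)) has_derivative (\<lambda>h. B t x h (axis i 1))) (at x)"
      by (intro bounded_linear.has_derivative[OF blinfun.bounded_linear_left derA[OF t]])
    moreover have "partial_deriv i (F t) = (\<lambda>x. A t x (axis i 1))" using pd[OF t] by auto
    ultimately show ?thesis by (simp add: partial_deriv_eq)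
  qed
  define D where "D = real CARD('d)"
  have D: "1 \<le> D" by (simp add: D_def Suc_leI)
  \<comment> \<open>One dimension factor passes from partial derivatives to the norm of
    \<open>A\<close>, two to the norm of the bilinear \<open>B\<close>; as \<open>D\<close> is at
    least 1, the larger constant serves both.\<close>
  define L where "L = D * (D * M0)"
  have L: "0 \<le> L" "D * M0 \<le> L"
    using D M0_nonneg mult_right_mono[of 1 D "D * M0"] by (auto simp: L_def)
  have lin: "linear (blinfun_apply l)" for l :: "(real^'d) \<Rightarrow>\<^sub>L 'z::real_normed_vector"
    using blinfun.bounded_linear_right bounded_linear.linear by blast
  have "smooth_flow T L F A B"
  proof
    show "continuous_on ?S (\<lambda>(t, x). F t x)" by (rule contf)
    have "continuous_on ?S (\<lambda>z. R (f' z))" by (intro continuous_intros contf')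
    then show "continuous_on ?S (\<lambda>(t, x). A t x)" by (simp add: A_def case_prod_beta)
    have "continuous_on ?S (\<lambda>z. R o\<^sub>L (f'' z o\<^sub>L emb))"
      by (intro bounded_bilinear.continuous_on[OF bounded_bilinear_blinfun_compose] continuous_on_const contf'')
    then show "continuous_on ?S (\<lambda>(t, x). B t x)" by (simp add: B_def case_prod_beta)
    show "norm (A t x) \<le> L" if t: "t \<in> {0..T}" for t x
    proof (rule order_trans[OF norm_blinfun_bound L(2)])
      show "norm (A t x h) \<le> D * M0 * norm h" for h
        unfolding D_def by (rule norm_le_if_axis_le[OF lin]) (use M0[OF t] pd[OF t] in metis)
    qed (use D M0_nonneg in auto)
    show "norm (B t x) \<le> L" if t: "t \<in> {0..T}" for t x
    proof (rule norm_blinfun_bound)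
      fix h
      show "norm (B t x h) \<le> L * norm h"
      proof (rule norm_blinfun_bound)
        fix k
        have "norm (B t x h k) \<le> D * (D * M0 * norm h) * norm k"
          unfolding D_def
        proof (rule norm_le_if_axis_le[OF lin])
          fix i
          have "linear (\<lambda>h. B t x h (axis i 1))"
            by (simp add: linear_iff blinfun.add_left blinfun.scaleR_left blinfun.add_right blinfun.scaleR_right)
          then show "norm (B t x h (axis i 1)) \<le> real CARD('d) * M0 * norm h"
            by (rule norm_le_if_axis_le) (use M0[OF t] pd2[OF t] in metis)
        qed
        then show "norm (B t x h k) \<le> L * norm h * norm k" by (simp add: L_def mult_ac)
      qed (use L in auto)
    qed (use L in auto)
  qed (use T L derF derA in auto)
  then show ?thesis by blast
qed

text \<open>Testing the upper ellipticity bound with a coordinate vector gives the sum of squares of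
  one row of \<open>\<sigma>\<close>, which dominates every entry of that row.\<close>

lemma uniformly_elliptic_bound:
  fixes \<sigma> :: "real \<Rightarrow> real^'d \<Rightarrow> real^'d^'d"
  assumes "uniformly_elliptic T \<sigma>"
  obtains C where "0 \<le> C" "\<And>t x i j. t \<in> {0..T} \<Longrightarrow> \<bar>\<sigma> t x $ i $ j\<bar> \<le> C"
proof -
  obtain \<Lambda> where \<Lambda>: "1 \<le> \<Lambda>" "\<And>t x \<xi>. t \<in> {0..T} \<Longrightarrow> ((\<sigma> t x ** transpose (\<sigma> t x)) *v \<xi>) \<bullet> \<xi> \<le> \<Lambda> * (norm \<xi>)\<^sup>2"
    using assms unfolding uniformly_elliptic_def by blast
  show ?thesis
  proof (rule that[of "sqrt \<Lambda>"])
    fix t x i j assume t: "t \<in> {0..T}"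
    let ?A = "\<sigma> t x"
    have "((?A ** transpose ?A) *v axis i 1) \<bullet> axis i 1 = (\<Sum>p\<in>UNIV. ?A $ i $ p * ?A $ i $ p)"
      by (simp add: inner_axis matrix_vector_mult_basis column_def matrix_matrix_mult_def transpose_def)
    then have "(\<Sum>p\<in>UNIV. (?A $ i $ p)\<^sup>2) \<le> \<Lambda>" using \<Lambda>(2)[OF t, of x "axis i 1"] by (simp add: power2_eq_square)
    moreover have "(?A $ i $ j)\<^sup>2 \<le> (\<Sum>p\<in>UNIV. (?A $ i $ p)\<^sup>2)" by (rule member_le_sum) auto
    ultimately have "(?A $ i $ j)\<^sup>2 \<le> \<Lambda>" by simp
    then show "\<bar>?A $ i $ j\<bar> \<le> sqrt \<Lambda>" using real_sqrt_le_mono by fastforce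
  qed (use \<Lambda> in simp)
qed

text \<open>For each time \<open>J t\<close> is a separately chosen version of the integral, and the
  equation for \<open>Y\<close> holds outside a null set depending on that time. This is enough,
  because it will be evaluated at countably many grid points only.\<close>

locale transformed_sde = wiener M T \<F> W + smooth_flow T L F A B
  for M :: "'w measure" and T \<F> and W :: "real \<Rightarrow> 'w \<Rightarrow> real^'d" and L and F :: "real \<Rightarrow> real^'d \<Rightarrow> real^'d" and A B +
  fixes m :: "real \<Rightarrow> real^'d \<Rightarrow> real^'d" and \<sigma> :: "real \<Rightarrow> real^'d \<Rightarrow> real^'d^'d"
    and x0 :: "real^'d" and Y :: "real \<Rightarrow> 'w \<Rightarrow> real^'d" and J :: "real \<Rightarrow> 'w \<Rightarrow> real^'d" and C Cm :: real
  assumes C: "0 \<le> C" and \<sigma>_bound: "t \<in> {0..T} \<Longrightarrow> \<bar>\<sigma> t z $ i $ j\<bar> \<le> C"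
    and m_cont: "continuous_on ({0..T} \<times> UNIV) (\<lambda>(t, x). m t x)"
    and m_bound: "t \<in> {0..T} \<Longrightarrow> norm (m t z) \<le> Cm"
    and Y_adapted: "t \<in> {0..T} \<Longrightarrow> Y t \<in> borel_measurable (\<F> t)"
    and Y_cont: "\<omega> \<in> space M \<Longrightarrow> continuous_on {0..T} (\<lambda>t. Y t \<omega>)"
    and Y_0: "AE \<omega> in M. Y 0 \<omega> = x0"
    and J: "t \<in> {0..T} \<Longrightarrow> has_ito_integral M \<F> W t (\<lambda>s \<omega>. \<sigma> s (Y s \<omega>)) (J t)"
    and Y_eq: "t \<in> {0..T} \<Longrightarrow> AE \<omega> in M. Y t \<omega> = x0 + (LINT s:{0..t}|lborel. F s (Y s \<omega>) + m s (Y s \<omega>)) + J t \<omega>"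
begin

section \<open>The transformed coefficients in terms of the derivatives of the flow\<close>

lemma solves_ode_iff: "solves_ode F T z y \<longleftrightarrow> is_sol F z y"
  by (simp add: solves_ode_def is_sol_def)

lemma ode_flow_eq: "t \<in> {0..T} \<Longrightarrow> ode_flow F T t = g t"
proof
  fix z assume t: "t \<in> {0..T}"
  show "ode_flow F T t z = g t z"
    unfolding ode_flow_def solves_ode_iff
    by (rule the_equality) (use g_is_sol g_unique[OF _ t] in auto)
qed

lemma inverse_flow_eq: "t \<in> {0..T} \<Longrightarrow> inverse_flow F T t = inv (g t)"
  by (simp add: inverse_flow_def ode_flow_eq)

lemma flow_jacobian_eq:
  assumes t: "t \<in> {0..T}" shows "flow_jacobian F T t z = matrix (v t z)"
proof -
  have "((\<lambda>y. g t y $ i) has_derivative (\<lambda>h. v t z h $ i)) (at z)" for i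
    by (rule bounded_linear.has_derivative[OF bounded_linear_vec_nth g_has_derivative[OF t]])
  from partial_deriv_eq[OF this] show ?thesis
    unfolding flow_jacobian_def matrix_def ode_flow_eq[OF t] by simp
qed

lemma flow_jacobian_inv_eq:
  assumes t: "t \<in> {0..T}" shows "flow_jacobian_inv F T t z = matrix (w t z)"
proof -
  have 1: "matrix (v t z) ** matrix (w t z) = mat 1" "matrix (w t z) ** matrix (v t z) = mat 1"
    using matrix_compose[OF w_linear[OF t] v_linear[OF t], of z z] matrix_compose[OF v_linear[OF t] w_linear[OF t], of z z] t
    by (simp_all add: o_def matrix_id_mat_1[unfolded id_def])
  have "matrix_inv (matrix (v t z)) = matrix (w t z)"
    unfolding matrix_inv_def
  proof (rule some_equality)
    fix D assume "matrix (v t z) ** D = mat 1 \<and> D ** matrix (v t z) = mat 1"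
    then show "D = matrix (w t z)" using 1 by (metis matrix_mul_assoc matrix_mul_lid)
  qed (use 1 in simp)
  then show ?thesis by (simp add: flow_jacobian_inv_def flow_jacobian_eq[OF t])
qed

lemma matrix_w: "t \<in> {0..T} \<Longrightarrow> matrix (w t z) *v h = w t z h"
  by (simp add: matrix_works w_linear)

text \<open>The derivatives of the entries of the Jacobian are the components of \<open>u\<close> on
  coordinate vectors; contracting them with two columns of the inverse Jacobian evaluates
  \<open>u\<close> at these columns.\<close>

lemma flow_c_eq:
  assumes t: "t \<in> {0..T}"
  shows "flow_c F T j k t z = u t z (w t z (axis j 1)) (w t z (axis k 1))"
proof -
  have d: "partial_deriv p (\<lambda>y. flow_jacobian F T t y $ i $ l) z = u t z (axis p 1) (axis l 1) $ i" for p i l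
  proof -
    have "((\<lambda>y. v t y (axis l 1) $ i) has_derivative (\<lambda>h. u t z h (axis l 1) $ i)) (at z)"
      by (rule bounded_linear.has_derivative[OF bounded_linear_vec_nth v_has_derivative[OF t]])
    then show ?thesis by (simp add: flow_jacobian_eq[OF t] matrix_def partial_deriv_eq)
  qed
  have ax: "h = (\<Sum>p\<in>UNIV. h $ p *\<^sub>R axis p 1)" for h :: "real^'d"
    by (simp add: basis_expansion scalar_mult_eq_scaleR[symmetric])
  have u1: "u t z h k = (\<Sum>p\<in>UNIV. h $ p *\<^sub>R u t z (axis p 1) k)" for h k
    by (subst ax[of h]) (simp only: linear_sum[OF u_linear1[OF t]] linear_scale[OF u_linear1[OF t]])
  have u2: "u t z h k = (\<Sum>l\<in>UNIV. k $ l *\<^sub>R u t z h (axis l 1))" for h k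
    by (subst ax[of k]) (simp only: linear_sum[OF u_linear2[OF t]] linear_scale[OF u_linear2[OF t]])
  have e: "u t z h k $ i = (\<Sum>l\<in>UNIV. \<Sum>p\<in>UNIV. u t z (axis p 1) (axis l 1) $ i * h $ p * k $ l)" for h k i
    by (subst u2, subst u1) (simp add: sum_distrib_left mult_ac)
  have f: "flow_jacobian_inv F T t z $ p $ j = w t z (axis j 1) $ p" for p j
    by (simp add: flow_jacobian_inv_eq[OF t] matrix_def)
  show ?thesis
    unfolding flow_c_def d f by (rule iffD2[OF vec_eq_iff], rule allI, subst e) simp
qed

text \<open>The matrix with entries \<open>\<Sum>p. \<sigma>_ip * \<sigma>_jp\<close> is a sum over
  the columns of \<open>\<sigma>\<close>. So the double sum collapses to values of \<open>q\<close>
  on the diagonal, one for each column, which is the form that the quadratic increments of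
  \<open>W\<close> produce.\<close>

lemma transformed_drift_eq:
  assumes t: "t \<in> {0..T}"
  shows "transformed_drift F m \<sigma> T t z =
    w t z (m t (g t z)) - (1 / 2) *\<^sub>R (\<Sum>p\<in>UNIV. q t z (\<sigma> t (g t z) *v axis p 1) (\<sigma> t (g t z) *v axis p 1))"
proof -
  let ?S = "\<sigma> t (g t z)"
  have ax: "?S *v axis p 1 = (\<Sum>i\<in>UNIV. ?S $ i $ p *\<^sub>R axis i 1)" for p
    using basis_expansion[of "column p ?S"] by (simp add: matrix_vector_mult_basis column_def scalar_mult_eq_scaleR)
  have q1: "q t z (?S *v axis p 1) (?S *v axis p 1) = (\<Sum>i\<in>UNIV. \<Sum>j\<in>UNIV. (?S $ i $ p * ?S $ j $ p) *\<^sub>R q t z (axis i 1) (axis j 1))" for p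
    unfolding ax by (simp only: linear_sum[OF q_linear1[OF t]] linear_scale[OF q_linear1[OF t]]
      linear_sum[OF q_linear2[OF t]] linear_scale[OF q_linear2[OF t]] scaleR_sum_right scaleR_scaleR) (subst sum.swap, simp add: mult.commute)
  have "(\<Sum>p\<in>UNIV. q t z (?S *v axis p 1) (?S *v axis p 1)) =
    (\<Sum>i\<in>UNIV. \<Sum>j\<in>UNIV. (\<Sum>p\<in>UNIV. ?S $ i $ p * ?S $ j $ p) *\<^sub>R q t z (axis i 1) (axis j 1))"
    unfolding q1 scaleR_left.sum by (subst sum.swap, intro sum.cong refl sum.swap)
  also have "\<dots> = w t z (\<Sum>i\<in>UNIV. \<Sum>j\<in>UNIV. (\<Sum>p\<in>UNIV. ?S $ i $ p * ?S $ j $ p) *\<^sub>R flow_c F T i j t z)"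
    unfolding q_def flow_c_eq[OF t] by (simp only: linear_sum[OF w_linear[OF t]] linear_scale[OF w_linear[OF t]])
  finally show ?thesis
    unfolding transformed_drift_def flow_jacobian_inv_eq[OF t] matrix_w[OF t] ode_flow_eq[OF t]
    by (simp only: linear_diff[OF w_linear[OF t]] linear_scale[OF w_linear[OF t]])
qed

lemma transformed_diffusion_eq: "t \<in> {0..T} \<Longrightarrow> transformed_diffusion F \<sigma> T t z = matrix (w t z) ** \<sigma> t (g t z)"
  by (simp add: transformed_diffusion_def flow_jacobian_inv_eq ode_flow_eq)

end

text \<open>The process is the limit of its values at times rounded down to multiples of
  \<open>1 / Suc n\<close>. Rounded times take countably many values and stay inside the
  interval.\<close>

lemma progressive_if_continuous:
  fixes Z :: "real \<Rightarrow> 'w \<Rightarrow> 'b::metric_space"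
  assumes s: "0 \<le> s" and Z: "\<And>r. r \<in> {0..s} \<Longrightarrow> Z r \<in> borel_measurable N"
    and cont: "\<And>\<omega>. \<omega> \<in> space N \<Longrightarrow> continuous_on {0..s} (\<lambda>r. Z r \<omega>)"
  shows "(\<lambda>(r, \<omega>). Z r \<omega>) \<in> borel_measurable (restrict_space borel {0..s} \<Otimes>\<^sub>M N)"
proof (rule borel_measurable_LIMSEQ_metric)
  let ?N = "restrict_space borel {0..s} \<Otimes>\<^sub>M N"
  let ?c = "\<lambda>n r. real (nat \<lfloor>r * real (Suc n)\<rfloor>) / real (Suc n)"
  have sp: "space ?N = {0..s} \<times> space N" by (simp add: space_pair_measure space_restrict_space)
  have c: "?c n r \<in> {0..s} \<and> \<bar>?c n r - r\<bar> \<le> 1 / real (Suc n)" if r: "r \<in> {0..s}" for n r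
  proof -
    define N a where "N = real (Suc n)" and "a = real (nat \<lfloor>r * N\<rfloor>)"
    have N: "0 < N" by (simp add: N_def)
    have "a = of_int \<lfloor>r * N\<rfloor>" using r N by (simp add: a_def)
    then have a: "a \<le> r * N" "r * N - 1 \<le> a" by linarith+
    have "0 \<le> a" by (simp add: a_def)
    have "a / N \<le> r" "0 \<le> a / N"
      using a N \<open>0 \<le> a\<close> by (simp_all add: field_simps)
    moreover have "r - 1 / N \<le> a / N" using divide_right_mono[OF a(2), of N] N by (simp add: diff_divide_distrib)
    ultimately show ?thesis unfolding N_def[symmetric] a_def[symmetric] using r by (simp add: abs_le_iff)
  qed
  \<comment> \<open>Measurability is required for every index of the countable family, also where
    the grid point exceeds \<open>s\<close>; \<open>min s\<close> brings it back and changes nothing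
    at the rounded times themselves.\<close>
  show "(\<lambda>p. Z (min s (?c n (fst p))) (snd p)) \<in> borel_measurable ?N" for n
  proof (rule measurable_compose_countable[where g = "\<lambda>p. nat \<lfloor>fst p * real (Suc n)\<rfloor>" and f = "\<lambda>i p. Z (min s (real i / real (Suc n))) (snd p)"])
    show "(\<lambda>p. Z (min s (real i / real (Suc n))) (snd p)) \<in> borel_measurable ?N" for i :: nat
      by (rule measurable_compose[OF measurable_snd Z]) (use s in auto)
    have [measurable]: "fst \<in> borel_measurable ?N"
      using measurable_compose[OF measurable_fst measurable_restrict_space1[of "\<lambda>x. x" borel borel]] by simp
    show "(\<lambda>p. nat \<lfloor>fst p * real (Suc n)\<rfloor>) \<in> measurable ?N (count_space UNIV)" by measurable
  qed
  fix p assume "p \<in> space ?N"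
  then obtain r \<omega> where p: "p = (r, \<omega>)" "r \<in> {0..s}" "\<omega> \<in> space N" using sp by auto
  have "(\<lambda>n. ?c n r - r) \<longlonglongrightarrow> 0"
    by (rule tendsto_rabs_zero_cancel, rule Lim_null_comparison[OF _ LIMSEQ_inverse_real_of_nat])
      (use c[OF p(2)] in \<open>auto simp: inverse_eq_divide\<close>)
  then have "(\<lambda>n. ?c n r) \<longlonglongrightarrow> r" by (simp only: LIM_zero_iff)
  then have "(\<lambda>n. Z (?c n r) \<omega>) \<longlonglongrightarrow> Z r \<omega>"
    by (rule continuous_on_tendsto_compose[OF cont[OF p(3)] _ p(2)]) (use c[OF p(2)] in auto)
  moreover have "min s (?c n r) = ?c n r" for n using c[OF p(2), of n] by auto
  ultimately show "(\<lambda>n. Z (min s (?c n (fst p))) (snd p)) \<longlonglongrightarrow> (\<lambda>(r, \<omega>). Z r \<omega>) p" using p by simp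
qed

lemma norm_mult_axis: "norm (A *v axis p 1) \<le> norm A" for A :: "real^'n^'m"
  using norm_matrix_vector_le[of A "axis p 1"] by simp

section \<open>Measurability and bounds of the transformed coefficients along the process\<close>

context transformed_sde begin

definition X :: "real \<Rightarrow> 'w \<Rightarrow> real^'d" where "X t \<omega> = inv (g t) (Y t \<omega>)"

definition H :: "real \<Rightarrow> 'w \<Rightarrow> real^'d^'d" where "H t \<omega> = \<sigma> t (Y t \<omega>)"

lemma g_X: "t \<in> {0..T} \<Longrightarrow> g t (X t \<omega>) = Y t \<omega>"
  by (simp add: X_def)

lemma flow_path_Y: "\<omega> \<in> space M \<Longrightarrow> flow_path T L F A B (\<lambda>t. Y t \<omega>)"
  by unfold_locales (rule Y_cont)

lemma X_eq: "\<omega> \<in> space M \<Longrightarrow> flow_path.x T F (\<lambda>t. Y t \<omega>) = (\<lambda>t. X t \<omega>)"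
  using flow_path.x_def[OF flow_path_Y] by (auto simp: X_def)

lemma X_cont: "\<omega> \<in> space M \<Longrightarrow> continuous_on {0..T} (\<lambda>t. X t \<omega>)"
  using flow_path.x_cont[OF flow_path_Y] X_eq by simp

lemma X_adapted: assumes t: "t \<in> {0..T}" shows "X t \<in> borel_measurable (\<F> t)"
proof -
  have "continuous_on UNIV (\<lambda>z. (\<lambda>(t, y). inv (g t) y) (t, z))"
    by (rule continuous_on_compose2[OF inv_g_cont]) (use t in \<open>auto intro!: continuous_intros\<close>)
  then have "inv (g t) \<in> borel_measurable borel" by (simp add: borel_measurable_continuous_onI)
  from measurable_compose[OF Y_adapted[OF t] this] show ?thesis by (simp add: X_def[abs_def])
qed

lemma matrix_w_cont: "continuous_on ({0..T} \<times> UNIV) (\<lambda>(t, x). matrix (w t x))"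
proof -
  have "continuous_on ({0..T} \<times> UNIV) (\<lambda>z. w (fst z) (snd z) (axis j 1))" for j
    using w_cont[of "axis j 1"] by (simp add: case_prod_beta)
  then show ?thesis unfolding matrix_def case_prod_beta by (intro continuous_intros)
qed

lemma comp_adapted:
  fixes f :: "real \<Rightarrow> real^'d \<Rightarrow> 'b::metric_space"
  assumes f: "continuous_on ({0..T} \<times> UNIV) (\<lambda>(t, x). f t x)"
    and t: "t \<in> {0..T}" and s: "s \<in> {0..t}" and U: "U \<in> borel_measurable (\<F> s)"
  shows "(\<lambda>\<omega>. f t (U \<omega>)) \<in> borel_measurable (\<F> s)"
proof -
  have "continuous_on UNIV (\<lambda>z. (\<lambda>(t, y). f t y) (t, z))"
    by (rule continuous_on_compose2[OF f]) (use t in \<open>auto intro!: continuous_intros\<close>)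
  then have "f t \<in> borel_measurable borel" by (simp add: borel_measurable_continuous_onI)
  from measurable_compose[OF U this] show ?thesis .
qed

lemma comp_progressive:
  fixes f :: "real \<Rightarrow> real^'d \<Rightarrow> 'b::metric_space"
  assumes f: "continuous_on ({0..T} \<times> UNIV) (\<lambda>(t, x). f t x)"
    and U: "\<And>s. s \<in> {0..T} \<Longrightarrow> U s \<in> borel_measurable (\<F> s)"
    and cont: "\<And>\<omega>. \<omega> \<in> space M \<Longrightarrow> continuous_on {0..T} (\<lambda>t. U t \<omega>)"
    and t: "t \<in> {0..T}"
  shows "(\<lambda>(s, \<omega>). f s (U s \<omega>)) \<in> borel_measurable (restrict_space borel {0..t} \<Otimes>\<^sub>M \<F> t)"
proof (rule progressive_if_continuous)
  show "(\<lambda>\<omega>. f s (U s \<omega>)) \<in> borel_measurable (\<F> t)" if "s \<in> {0..t}" for s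
    by (rule adapted_mono[OF _ t _ comp_adapted[OF f _ _ U]]) (use that t in auto)
  show "continuous_on {0..t} (\<lambda>s. f s (U s \<omega>))" if "\<omega> \<in> space (\<F> t)" for \<omega>
  proof -
    have "continuous_on {0..T} (\<lambda>t. (t, U t \<omega>))"
      by (intro continuous_on_Pair continuous_on_id cont) (use that space_F t in auto)
    then have "continuous_on {0..T} (\<lambda>t. (\<lambda>(t, x). f t x) (t, U t \<omega>))"
      by (rule continuous_on_compose2[OF f]) auto
    then show ?thesis using t by (auto elim!: continuous_on_subset)
  qed
qed (use t in auto)

text \<open>The source is the integrand condition contained in \<open>has_ito_integral\<close>, as
  no continuity of \<open>\<sigma>\<close> is at hand.\<close>

lemma H_progressive: "t \<in> {0..T} \<Longrightarrow> (\<lambda>(s, \<omega>). H s \<omega>) \<in> borel_measurable (restrict_space borel {0..t} \<Otimes>\<^sub>M \<F> t)"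
  using J[of t] by (auto simp: has_ito_integral_def ito_integrand_def progressive_upto_def H_def)

abbreviation "tdrift s \<omega> \<equiv> transformed_drift F m \<sigma> T s (X s \<omega>)"

abbreviation "tdiffusion s \<omega> \<equiv> transformed_diffusion F \<sigma> T s (X s \<omega>)"

lemma tdiffusion_eq: "s \<in> {0..T} \<Longrightarrow> tdiffusion s \<omega> = matrix (w s (X s \<omega>)) ** H s \<omega>"
  by (simp add: transformed_diffusion_eq g_X H_def)

lemma tdrift_eq: "s \<in> {0..T} \<Longrightarrow> tdrift s \<omega> =
    w s (X s \<omega>) (m s (Y s \<omega>)) - (1 / 2) *\<^sub>R (\<Sum>p\<in>UNIV. q s (X s \<omega>) (H s \<omega> *v axis p 1) (H s \<omega> *v axis p 1))"
  by (simp add: transformed_drift_eq g_X H_def)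

lemma measurable_restrict_cong:
  assumes "t \<in> {0..T}" "\<And>s \<omega>. s \<in> {0..t} \<Longrightarrow> f s \<omega> = f' s \<omega>"
    "(\<lambda>p. f' (fst p) (snd p)) \<in> borel_measurable (restrict_space borel {0..t} \<Otimes>\<^sub>M N)"
  shows "(\<lambda>(s, \<omega>). f s \<omega>) \<in> borel_measurable (restrict_space borel {0..t} \<Otimes>\<^sub>M N)"
  using assms(3) by (rule measurable_cong[THEN iffD2, rotated])
    (use assms(2) in \<open>auto simp: space_pair_measure space_restrict_space\<close>)

lemma tdiffusion_progressive:
  assumes t: "t \<in> {0..T}"
  shows "(\<lambda>(s, \<omega>). tdiffusion s \<omega>) \<in> borel_measurable (restrict_space borel {0..t} \<Otimes>\<^sub>M \<F> t)"
proof (rule measurable_restrict_cong[OF t tdiffusion_eq])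
  have [measurable]: "(\<lambda>p. matrix (w (fst p) (X (fst p) (snd p)))) \<in> borel_measurable (restrict_space borel {0..t} \<Otimes>\<^sub>M \<F> t)"
    using comp_progressive[OF matrix_w_cont X_adapted X_cont t] by (simp add: case_prod_beta)
  have [measurable]: "(\<lambda>p. H (fst p) (snd p)) \<in> borel_measurable (restrict_space borel {0..t} \<Otimes>\<^sub>M \<F> t)"
    using H_progressive[OF t] by (simp add: case_prod_beta)
  show "(\<lambda>p. matrix (w (fst p) (X (fst p) (snd p))) ** H (fst p) (snd p)) \<in> borel_measurable (restrict_space borel {0..t} \<Otimes>\<^sub>M \<F> t)"
    by measurable
qed (use t in auto)

lemma tdrift_progressive:
  assumes t: "t \<in> {0..T}"
  shows "(\<lambda>(s, \<omega>). tdrift s \<omega>) \<in> borel_measurable (restrict_space borel {0..t} \<Otimes>\<^sub>M \<F> t)"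
proof (rule measurable_restrict_cong[OF t])
  let ?N = "restrict_space borel {0..t} \<Otimes>\<^sub>M \<F> t"
  \<comment> \<open>With the inverse Jacobian as a matrix and \<open>q\<close> expanded over the
    basis, all ingredients depend on space only through \<open>X\<close> or \<open>Y\<close> at
    fixed vectors, where joint continuity gives measurability.\<close>
  let ?f = "\<lambda>s \<omega>. matrix (w s (X s \<omega>)) *v m s (Y s \<omega>) - (1 / 2) *\<^sub>R (\<Sum>p\<in>UNIV. \<Sum>b\<in>Basis. \<Sum>c\<in>Basis.
    (((H s \<omega> *v axis p 1) \<bullet> b) * ((H s \<omega> *v axis p 1) \<bullet> c)) *\<^sub>R q s (X s \<omega>) b c)"
  have [measurable]: "(\<lambda>p. matrix (w (fst p) (X (fst p) (snd p)))) \<in> borel_measurable ?N"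
    using comp_progressive[OF matrix_w_cont X_adapted X_cont t] by (simp add: case_prod_beta)
  have [measurable]: "(\<lambda>p. H (fst p) (snd p)) \<in> borel_measurable ?N"
    using H_progressive[OF t] by (simp add: case_prod_beta)
  have [measurable]: "(\<lambda>p. m (fst p) (Y (fst p) (snd p))) \<in> borel_measurable ?N"
    using comp_progressive[OF m_cont Y_adapted Y_cont t] by (simp add: case_prod_beta)
  have [measurable]: "(\<lambda>p. q (fst p) (X (fst p) (snd p)) b c) \<in> borel_measurable ?N" for b c
    using comp_progressive[OF q_cont X_adapted X_cont t] by (simp add: case_prod_beta)
  show "(\<lambda>p. ?f (fst p) (snd p)) \<in> borel_measurable ?N" by measurable
  fix s \<omega> assume "s \<in> {0..t}"
  then have s: "s \<in> {0..T}" using t by auto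
  show "tdrift s \<omega> = ?f s \<omega>"
    unfolding tdrift_eq[OF s] matrix_w[OF s] by (subst q_expand[OF s]) (rule refl)
qed

lemma progressive_imp_P_measurable:
  assumes "(\<lambda>(s, \<omega>). f s \<omega>) \<in> borel_measurable (restrict_space borel {0..T} \<Otimes>\<^sub>M \<F> T)"
  shows "(\<lambda>(s, \<omega>). f s \<omega>) \<in> borel_measurable P"
proof -
  have "fst \<in> measurable P (restrict_space borel {0..T})"
    using measurable_fst[of "time_measure T" M] by (simp cong: measurable_cong_sets add: sets_time_measure)
  moreover have "snd \<in> measurable P (\<F> T)"
  proof -
    have "(\<lambda>\<omega>. \<omega>) \<in> measurable M (\<F> T)" using subalg[of T] T by (intro adapted_measurable) auto
    then show ?thesis using measurable_compose[OF measurable_snd[of "time_measure T" M]] by simp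
  qed
  ultimately have "(\<lambda>p. (fst p, snd p)) \<in> measurable P (restrict_space borel {0..T} \<Otimes>\<^sub>M \<F> T)" by measurable
  from measurable_compose[OF this assms] show ?thesis by simp
qed

lemma H_P: "(\<lambda>(s, \<omega>). H s \<omega>) \<in> borel_measurable P"
  using T by (intro progressive_imp_P_measurable H_progressive) auto

definition sigma_bound :: real where "sigma_bound = real CARD('d) * (real CARD('d) * C)"

lemma sigma_bound_nonneg: "0 \<le> sigma_bound" using C by (simp add: sigma_bound_def)

lemma norm_sigma: "t \<in> {0..T} \<Longrightarrow> norm (\<sigma> t z) \<le> sigma_bound"
  unfolding sigma_bound_def by (rule norm_matrix_le_if_components_le) (rule \<sigma>_bound)

lemma norm_H: "t \<in> {0..T} \<Longrightarrow> norm (H t \<omega>) \<le> sigma_bound"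
  by (simp add: H_def norm_sigma)

lemma norm_matrix_w: "t \<in> {0..T} \<Longrightarrow> norm (matrix (w t z)) \<le> real CARD('d) * (real CARD('d) * E)"
proof (rule norm_matrix_le_if_components_le)
  fix i j assume t: "t \<in> {0..T}"
  have "\<bar>w t z (axis j 1) $ i\<bar> \<le> norm (w t z (axis j 1))" by (rule component_le_norm_cart)
  also have "\<dots> \<le> E" using w_bound[OF t, of z "axis j 1"] by simp
  finally show "\<bar>matrix (w t z) $ i $ j\<bar> \<le> E" by (simp add: matrix_def)
qed

definition tdrift_bound :: real where "tdrift_bound = E * Cm + (1 / 2) * (real CARD('d) * (Q * sigma_bound * sigma_bound))"

lemma norm_transformed_drift:
  assumes t: "t \<in> {0..T}" shows "norm (transformed_drift F m \<sigma> T t z) \<le> tdrift_bound"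
proof -
  let ?S = "\<sigma> t (g t z)"
  have "norm (w t z (m t (g t z))) \<le> E * Cm"
    by (rule order_trans[OF w_bound[OF t] mult_left_mono[OF m_bound[OF t] E(2)]])
  moreover have "norm (\<Sum>p\<in>UNIV. q t z (?S *v axis p 1) (?S *v axis p 1)) \<le> (\<Sum>p\<in>(UNIV::'d set). Q * sigma_bound * sigma_bound)"
  proof (rule sum_norm_le)
    fix p :: 'd
    have "norm (?S *v axis p 1) \<le> sigma_bound" by (rule order_trans[OF norm_mult_axis norm_sigma[OF t]])
    then have "Q * norm (?S *v axis p 1) * norm (?S *v axis p 1) \<le> Q * sigma_bound * sigma_bound"
      using Q sigma_bound_nonneg by (intro mult_mono) auto
    then show "norm (q t z (?S *v axis p 1) (?S *v axis p 1)) \<le> Q * sigma_bound * sigma_bound" using q_bound[OF t] order_trans by blast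
  qed
  ultimately show ?thesis
    unfolding transformed_drift_eq[OF t] tdrift_bound_def by (intro order_trans[OF norm_triangle_ineq4] add_mono) auto
qed

definition tdiffusion_bound :: real where "tdiffusion_bound = real CARD('d) * (real CARD('d) * E) * sigma_bound"

lemma norm_transformed_diffusion:
  assumes t: "t \<in> {0..T}" shows "norm (transformed_diffusion F \<sigma> T t z) \<le> tdiffusion_bound"
  unfolding transformed_diffusion_eq[OF t] tdiffusion_bound_def
  by (rule order_trans[OF norm_matrix_matrix_le mult_mono[OF norm_matrix_w[OF t] norm_sigma[OF t]]])
    (use sigma_bound_nonneg E in auto)

lemma bounded_transformed:
  "bounded ((\<lambda>(t, x). transformed_drift F m \<sigma> T t x) ` ({0..T} \<times> UNIV))"
  "bounded ((\<lambda>(t, x). transformed_diffusion F \<sigma> T t x) ` ({0..T} \<times> UNIV))"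
  using norm_transformed_drift norm_transformed_diffusion by (fastforce intro: boundedI)+

lemma tdrift_P: "(\<lambda>(s, \<omega>). tdrift s \<omega>) \<in> borel_measurable P"
  using T by (intro progressive_imp_P_measurable tdrift_progressive) auto

lemma tdrift_integrable:
  assumes "\<omega> \<in> space M" shows "set_integrable lborel {0..T} (\<lambda>s. tdrift s \<omega>)"
proof -
  have "integrable (time_measure T) (\<lambda>s. tdrift s \<omega>)"
  proof (rule finite_measure.integrable_const_bound[OF finite_time_measure])
    show "AE s in time_measure T. norm (tdrift s \<omega>) \<le> tdrift_bound"
      by (rule AE_I2) (simp add: norm_transformed_drift)
    show "(\<lambda>s. tdrift s \<omega>) \<in> borel_measurable (time_measure T)"
      using measurable_compose[OF measurable_Pair2'[OF assms] tdrift_P] by simp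
  qed
  then show ?thesis unfolding time_measure_def set_integrable_def by (subst (asm) integrable_restrict_space) auto
qed

lemma drift_integral_measurable:
  assumes t: "t \<in> {0..T}" shows "(\<lambda>\<omega>. LINT s:{0..t}|lborel. tdrift s \<omega>) \<in> borel_measurable M"
proof -
  have eq: "(LINT s:{0..t}|lborel. tdrift s \<omega>) = (LINT s|time_measure T. indicator {0..t} s *\<^sub>R tdrift s \<omega>)" for \<omega>
    unfolding time_measure_def set_lebesgue_integral_def
    by (subst integral_restrict_space) (use t in \<open>auto intro!: Bochner_Integration.integral_cong simp: indicator_def\<close>)
  have [measurable]: "(\<lambda>p. tdrift (snd p) (fst p)) \<in> borel_measurable (M \<Otimes>\<^sub>M time_measure T)"
    using measurable_compose[OF measurable_pair_swap' tdrift_P] by (simp add: case_prod_beta)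
  show ?thesis unfolding eq by (rule sigma_finite_measure.borel_measurable_lebesgue_integral[OF finite_measure.axioms(1)[OF finite_time_measure]]) (simp add: case_prod_beta)
qed

lemma tdiffusion_integrand:
  assumes t: "t \<in> {0..T}" shows "ito_integrand M \<F> t tdiffusion"
  unfolding ito_integrand_def progressive_upto_def
proof (intro conjI ballI AE_I2)
  show "(\<lambda>(r, \<omega>). tdiffusion r \<omega>) \<in> borel_measurable (restrict_space borel {0..s} \<Otimes>\<^sub>M \<F> s)" if "s \<in> {0..t}" for s
    by (rule tdiffusion_progressive) (use t that in auto)
  fix \<omega>
  have "(\<integral>\<^sup>+s\<in>{0..t}. ennreal ((norm (tdiffusion s \<omega>))\<^sup>2) \<partial>lborel) \<le> (\<integral>\<^sup>+s. ennreal (tdiffusion_bound\<^sup>2) * indicator {0..t} s \<partial>lborel)"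
    by (rule nn_integral_mono) (use t in \<open>auto simp: indicator_def intro!: ennreal_leI power_mono norm_transformed_diffusion\<close>)
  also have "\<dots> < \<infinity>" using t by (simp add: nn_integral_cmult_indicator ennreal_mult_less_top emeasure_lborel_Icc_eq)
  finally show "(\<integral>\<^sup>+s\<in>{0..t}. ennreal ((norm (tdiffusion s \<omega>))\<^sup>2) \<partial>lborel) < \<infinity>" .
qed

end

lemma interval_cover:
  fixes \<tau> :: "nat \<Rightarrow> real"
  assumes "\<tau> 0 < s" "s \<le> \<tau> k"
  obtains i where "i < k" "s \<in> {\<tau> i<..\<tau> (Suc i)}"
proof -
  define j where "j = (LEAST j. s \<le> \<tau> j)"
  have j: "s \<le> \<tau> j" "j \<le> k" unfolding j_def by (rule LeastI[of _ k], fact, rule Least_le, fact)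
  have "j \<noteq> 0" using assms j by (metis not_le)
  then obtain i where i: "j = Suc i" using not0_implies_Suc by blast
  have "\<not> s \<le> \<tau> i" by (rule not_less_Least) (use i j_def in simp)
  then show ?thesis using i j by (intro that[of i]) auto
qed

lemma ennreal_tendsto_0_if_eventually_le:
  fixes f g :: "nat \<Rightarrow> ennreal"
  assumes g: "g \<longlonglongrightarrow> 0" and D: "0 \<le> D" and le: "\<And>e. 0 < e \<Longrightarrow> \<forall>\<^sub>F n in sequentially. f n \<le> g n + ennreal (D * e)"
  shows "f \<longlonglongrightarrow> 0"
proof (rule order_tendstoI)
  fix a :: ennreal assume a: "0 < a"
  obtain b where b: "0 < b" "ennreal b < a"
  proof -
    from dense[OF a] obtain c where c: "0 < c" "c < a" by blast
    then have "c \<noteq> \<top>" by auto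
    then obtain b where "c = ennreal b" "0 \<le> b" by (cases c) auto
    then show ?thesis using c that[of b] by auto
  qed
  have "0 < b / (2 * (D + 1))" using b D by simp
  from le[OF this] order_tendstoD(2)[OF g, of "ennreal (b / 2)"] b
  have "\<forall>\<^sub>F n in sequentially. f n \<le> g n + ennreal (D * (b / (2 * (D + 1)))) \<and> g n < ennreal (b / 2)"
    by (auto intro: eventually_conj)
  then show "\<forall>\<^sub>F n in sequentially. f n < a"
  proof eventually_elim
    case (elim n)
    have "D * (b / (2 * (D + 1))) \<le> b / 2" using b D by (simp add: field_simps)
    then have "f n \<le> ennreal (b / 2) + ennreal (b / 2)"
      using elim by (intro order_trans[OF conjunct1[OF elim]] add_mono ennreal_leI) auto
    also have "\<dots> = ennreal b" using b by (simp add: ennreal_plus[symmetric] del: ennreal_plus)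
    finally show ?case using b by simp
  qed
qed simp

lemma matrix_matrix_mult_diff_left: "(A - B) ** C = A ** C - B ** C" for A :: "real^'n^'m"
  by (simp add: matrix_matrix_mult_def vec_eq_iff left_diff_distrib sum_subtractf)

context prob_space begin

lemma AE_imp_tendsto_0_in_prob:
  assumes [measurable]: "\<And>n. Z n \<in> borel_measurable M" and AE: "AE \<omega> in M. (\<lambda>n. Z n \<omega>) \<longlonglongrightarrow> 0"
  shows "tendsto_0_in_prob M Z"
  unfolding tendsto_0_in_prob_def
proof (intro allI impI)
  fix \<epsilon> :: real assume e: "0 < \<epsilon>"
  let ?A = "\<lambda>n. {\<omega> \<in> space M. ennreal \<epsilon> < Z n \<omega>}"
  have "(\<lambda>n. \<integral>\<omega>. indicator (?A n) \<omega> \<partial>M) \<longlonglongrightarrow> (\<integral>\<omega>. (0::real) \<partial>M)"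
  proof (rule integral_dominated_convergence[where w = "\<lambda>_. 1"])
    show "AE \<omega> in M. (\<lambda>n. indicator (?A n) \<omega>) \<longlonglongrightarrow> (0::real)"
      using AE
    proof eventually_elim
      case (elim \<omega>)
      have "0 < ennreal \<epsilon>" using e by simp
      from order_tendstoD(2)[OF elim this] show ?case
        by (intro tendsto_eventually) (auto elim!: eventually_mono simp: indicator_def)
    qed
  qed (auto simp: indicator_def)
  then show "(\<lambda>n. prob (?A n)) \<longlonglongrightarrow> 0" by simp
qed

end

section \<open>Convergence along a single trajectory\<close>

context transformed_sde begin

lemma section_measurable:
  assumes t: "t \<in> {0..T}" and \<omega>: "\<omega> \<in> space M"
  shows "(\<lambda>s. indicator {0..t} s *\<^sub>R H s \<omega>) \<in> borel_measurable lborel"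
proof -
  have "(\<lambda>s. H s \<omega>) \<in> borel_measurable (time_measure T)"
    using measurable_compose[OF measurable_Pair2'[OF \<omega>] H_P] by simp
  then have [measurable]: "(\<lambda>s. indicator {0..T} s *\<^sub>R H s \<omega>) \<in> borel_measurable lborel"
    unfolding time_measure_def by (subst (asm) borel_measurable_restrict_space_iff) auto
  have eq: "indicator {0..t} s *\<^sub>R H s \<omega> = indicator {0..t} s *\<^sub>R (indicator {0..T} s *\<^sub>R H s \<omega>)" for s
    using t by (auto simp: indicator_def)
  show ?thesis unfolding eq by measurable
qed

lemma pathwise_diffusion:
  assumes t: "t \<in> {0..T}" and \<omega>: "\<omega> \<in> space M"
    and step: "\<And>n. step_process M \<F> t (k n) (\<tau> n) (\<xi> n)"
    and mesh: "\<And>n i. i < k n \<Longrightarrow> \<tau> n (Suc i) - \<tau> n i \<le> \<delta> n" "\<delta> \<longlonglongrightarrow> 0"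
    and lim: "(\<lambda>n. \<integral>\<^sup>+s\<in>{0..t}. ennreal ((norm (step_value (k n) (\<tau> n) (\<xi> n) s \<omega> - H s \<omega>))\<^sup>2) \<partial>lborel) \<longlonglongrightarrow> 0"
  shows "(\<lambda>n. \<integral>\<^sup>+s\<in>{0..t}. ennreal ((norm (step_value (k n) (\<tau> n)
      (\<lambda>i \<omega>. matrix (w (\<tau> n (Suc i)) (X (\<tau> n i) \<omega>)) ** \<xi> n i \<omega>) s \<omega> - tdiffusion s \<omega>))\<^sup>2) \<partial>lborel) \<longlonglongrightarrow> 0"
proof -
  interpret p: flow_path T L F A B "\<lambda>t. Y t \<omega>" by (rule flow_path_Y[OF \<omega>])
  have px: "p.x s = X s \<omega>" for s by (simp add: X_eq \<omega>)
  define N where "N = real CARD('d) * (real CARD('d) * E)"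
  have N: "norm (matrix (w s z)) \<le> N" "0 \<le> N" if "s \<in> {0..T}" for s z
    unfolding N_def using norm_matrix_w[OF that] E by auto
  define S where "S n s = step_value (k n) (\<tau> n) (\<xi> n) s \<omega> - H s \<omega>" for n s
  define I where "I n = (\<integral>\<^sup>+s\<in>{0..t}. ennreal ((norm (S n s))\<^sup>2) \<partial>lborel)" for n
  let ?V = "\<lambda>n s. step_value (k n) (\<tau> n) (\<lambda>i \<omega>. matrix (w (\<tau> n (Suc i)) (X (\<tau> n i) \<omega>)) ** \<xi> n i \<omega>) s \<omega>"
  define U where "U n s = indicator {0..t} s *\<^sub>R S n s" for n s
  have [measurable]: "U n \<in> borel_measurable lborel" for n
    unfolding U_def[abs_def] S_def step_value_def scaleR_diff_right using section_measurable[OF t \<omega>] by measurable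
  show ?thesis
  proof (rule ennreal_tendsto_0_if_eventually_le)
    show "(\<lambda>n. ennreal (2 * N\<^sup>2) * I n) \<longlonglongrightarrow> 0"
      using lim unfolding I_def S_def by (intro ennreal_tendsto_0_mult) auto
    show "0 \<le> 2 * sigma_bound\<^sup>2 * t" using t by simp
    fix e :: real assume e: "0 < e"
    \<comment> \<open>Distances enter squared, so a tolerance of \<open>sqrt e\<close> is
      requested.\<close>
    then have e': "0 < sqrt e" by simp
    obtain d where d: "0 < d" "\<And>a s b s'. a \<in> {0..T} \<and> b \<in> {0..T} \<and> s \<in> {0..T} \<and> s' \<in> {0..T} \<and> \<bar>b - s\<bar> < d \<and> \<bar>a - s'\<bar> < d \<Longrightarrow>
      dist (matrix (w b (p.x a))) (matrix (w s (p.x s'))) < sqrt e"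
      using p.frozen_unif[OF matrix_w_cont e'] by blast
    show "\<forall>\<^sub>F n in sequentially. (\<integral>\<^sup>+s\<in>{0..t}. ennreal ((norm (?V n s - tdiffusion s \<omega>))\<^sup>2) \<partial>lborel) \<le> ennreal (2 * N\<^sup>2) * I n + ennreal (2 * sigma_bound\<^sup>2 * t * e)"
      using order_tendstoD(2)[OF mesh(2) d(1)]
    proof eventually_elim
      case (elim n)
      have b: "(norm (?V n s - tdiffusion s \<omega>))\<^sup>2 \<le> 2 * N\<^sup>2 * (norm (S n s))\<^sup>2 + 2 * sigma_bound\<^sup>2 * e" if s: "s \<in> {0<..t}" for s
      proof -
        obtain i where i: "i < k n" "s \<in> {\<tau> n i<..\<tau> n (Suc i)}"
          using interval_cover[of "\<tau> n" s "k n"] s step[of n] unfolding step_process_def by auto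
        have sT: "s \<in> {0..T}" "\<tau> n i \<in> {0..T}" "\<tau> n (Suc i) \<in> {0..T}"
          using s t step_bounds[OF step, of i n] step_bounds[OF step, of "Suc i" n] i by auto
        define a b where "a = matrix (w (\<tau> n (Suc i)) (X (\<tau> n i) \<omega>))" and "b = matrix (w s (X s \<omega>))"
        have V: "?V n s = a ** \<xi> n i \<omega>" "S n s = \<xi> n i \<omega> - H s \<omega>"
          unfolding step_value_def S_def a_def by (simp_all only: step_sum_eq[OF step i])
        have "dist a b < sqrt e"
          unfolding a_def b_def px[symmetric]
          by (rule d(2)) (use sT i mesh(1)[OF i(1)] elim in auto)
        then have ab: "norm (a - b) \<le> sqrt e" by (simp add: dist_norm)
        have "?V n s - tdiffusion s \<omega> = a ** S n s + (a - b) ** H s \<omega>"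
          unfolding V tdiffusion_eq[OF sT(1)] b_def[symmetric]
          by (simp add: matrix_matrix_mult_diff_right matrix_matrix_mult_diff_left)
        then have "norm (?V n s - tdiffusion s \<omega>) \<le> norm (a ** S n s) + norm ((a - b) ** H s \<omega>)"
          by (simp only: norm_triangle_ineq)
        also have "\<dots> \<le> N * norm (S n s) + sqrt e * sigma_bound"
        proof (rule add_mono)
          show "norm (a ** S n s) \<le> N * norm (S n s)"
            by (rule order_trans[OF norm_matrix_matrix_le mult_right_mono]) (use N[OF sT(3)] a_def in auto)
          show "norm ((a - b) ** H s \<omega>) \<le> sqrt e * sigma_bound"
            by (rule order_trans[OF norm_matrix_matrix_le mult_mono[OF ab norm_H[OF sT(1)]]]) (use e in auto)
        qed
        finally have "(norm (?V n s - tdiffusion s \<omega>))\<^sup>2 \<le> (N * norm (S n s) + sqrt e * sigma_bound)\<^sup>2"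
          by (rule power_mono) simp
        also have "\<dots> \<le> 2 * (N * norm (S n s))\<^sup>2 + 2 * (sqrt e * sigma_bound)\<^sup>2"
          using power2_norm_add_le[of "N * norm (S n s)" "sqrt e * sigma_bound"] by simp
        finally show ?thesis using e by (simp add: power_mult_distrib algebra_simps)
      qed
      have "(\<integral>\<^sup>+s\<in>{0..t}. ennreal ((norm (?V n s - tdiffusion s \<omega>))\<^sup>2) \<partial>lborel)
        \<le> (\<integral>\<^sup>+s. ennreal (2 * N\<^sup>2) * (ennreal ((norm (U n s))\<^sup>2)) + ennreal (2 * sigma_bound\<^sup>2 * e) * indicator {0..t} s \<partial>lborel)"
      proof (rule nn_integral_mono_AE)
        \<comment> \<open>Time 0 belongs to no half-open grid interval, so the pointwise estimate is
          claimed off this null set.\<close>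
        have "AE s in lborel. s \<noteq> (0::real)" by (rule AE_lborel_singleton)
        then show "AE s in lborel. ennreal ((norm (?V n s - tdiffusion s \<omega>))\<^sup>2) * indicator {0..t} s \<le>
          ennreal (2 * N\<^sup>2) * (ennreal ((norm (U n s))\<^sup>2)) + ennreal (2 * sigma_bound\<^sup>2 * e) * indicator {0..t} s"
        proof eventually_elim
          case (elim s)
          show ?case
          proof (cases "s \<in> {0..t}")
            case True
            then have "s \<in> {0<..t}" using elim by auto
            from ennreal_leI[OF b[OF this]] True e show ?thesis
              by (simp add: ennreal_mult U_def)
          qed (simp add: U_def)
        qed
      qed
      also have "\<dots> = ennreal (2 * N\<^sup>2) * (\<integral>\<^sup>+s. ennreal ((norm (U n s))\<^sup>2) \<partial>lborel) + ennreal (2 * sigma_bound\<^sup>2 * e) * emeasure lborel {0..t}"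
        by (subst nn_integral_add) (auto simp: nn_integral_cmult nn_integral_cmult_indicator)
      also have "(\<integral>\<^sup>+s. ennreal ((norm (U n s))\<^sup>2) \<partial>lborel) = I n"
        unfolding I_def U_def by (intro nn_integral_cong) (auto simp: indicator_def)
      also have "ennreal (2 * sigma_bound\<^sup>2 * e) * emeasure lborel {0..t} = ennreal (2 * sigma_bound\<^sup>2 * t * e)"
        using t e by (simp add: emeasure_lborel_Icc_eq ennreal_mult'[symmetric] mult_ac)
      finally show ?case .
    qed
  qed
qed

lemma norm2_increment: "(norm (W b \<omega> - W a \<omega>))\<^sup>2 = (\<Sum>p\<in>UNIV. qv p p a b \<omega>) + real CARD('d) * (b - a)"
proof -
  have "(norm (W b \<omega> - W a \<omega>))\<^sup>2 = (\<Sum>p\<in>UNIV. ((W b \<omega> - W a \<omega>) $ p)\<^sup>2)"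
    unfolding norm_vec_def L2_set_def by (simp add: sum_nonneg)
  then show ?thesis by (simp add: qv_def sum_subtractf power2_eq_square)
qed

text \<open>A product of coordinate increments is its compensated version plus, on the diagonal, the
  length of the interval. The compensated part will vanish in the limit; the diagonal part becomes
  the correction of the drift.\<close>

lemma q_increment:
  assumes s: "s \<in> {0..T}"
  shows "q s z (S *v (W b \<omega> - W a \<omega>)) (S *v (W b \<omega> - W a \<omega>)) =
    (\<Sum>p\<in>UNIV. \<Sum>p'\<in>UNIV. qv p p' a b \<omega> *\<^sub>R q s z (S *v axis p 1) (S *v axis p' 1)) +
    (\<Sum>p\<in>UNIV. (b - a) *\<^sub>R q s z (S *v axis p 1) (S *v axis p 1))"
proof -
  define \<Delta> where "\<Delta> = W b \<omega> - W a \<omega>"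
  have "\<Delta> = (\<Sum>p\<in>UNIV. \<Delta> $ p *\<^sub>R axis p 1)"
    using basis_expansion[of \<Delta>] by (simp add: scalar_mult_eq_scaleR)
  then have "S *v \<Delta> = S *v (\<Sum>p\<in>UNIV. \<Delta> $ p *\<^sub>R axis p 1)" by simp
  then have S: "S *v \<Delta> = (\<Sum>p\<in>UNIV. \<Delta> $ p *\<^sub>R (S *v axis p 1))"
    by (simp add: matrix_vector_mult_sum_right scaleR_matrix_vector_assoc matrix_scaleR_vector_ac)
  have "q s z (S *v \<Delta>) (S *v \<Delta>) = (\<Sum>p\<in>UNIV. \<Delta> $ p *\<^sub>R q s z (S *v axis p 1) (S *v \<Delta>))"
    by (subst (1) S) (simp only: linear_sum[OF q_linear1[OF s]] linear_scale[OF q_linear1[OF s]])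
  also have "\<dots> = (\<Sum>p\<in>UNIV. \<Sum>p'\<in>UNIV. (\<Delta> $ p * \<Delta> $ p') *\<^sub>R q s z (S *v axis p 1) (S *v axis p' 1))"
    by (subst S) (simp only: linear_sum[OF q_linear2[OF s]] linear_scale[OF q_linear2[OF s]] scaleR_sum_right scaleR_scaleR)
  also have "\<dots> = (\<Sum>p\<in>UNIV. \<Sum>p'\<in>UNIV. qv p p' a b \<omega> *\<^sub>R q s z (S *v axis p 1) (S *v axis p' 1)
    + (if p' = p then (b - a) *\<^sub>R q s z (S *v axis p 1) (S *v axis p' 1) else 0))"
    by (intro sum.cong refl) (simp add: qv_def \<Delta>_def algebra_simps)
  also have "\<dots> = (\<Sum>p\<in>UNIV. \<Sum>p'\<in>UNIV. qv p p' a b \<omega> *\<^sub>R q s z (S *v axis p 1) (S *v axis p' 1)) +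
    (\<Sum>p\<in>UNIV. (b - a) *\<^sub>R q s z (S *v axis p 1) (S *v axis p 1))"
    by (simp add: sum.distrib)
  finally show ?thesis unfolding \<Delta>_def .
qed

lemma q_path_integrable_H:
  assumes t: "t \<in> {0..T}" and \<omega>: "\<omega> \<in> space M"
  shows "set_integrable lborel {0..t} (\<lambda>s. q s (X s \<omega>) (H s \<omega> *v axis p 1) (H s \<omega> *v axis p 1))"
    and "(\<lambda>s. indicator {0..t} s *\<^sub>R (H s \<omega> *v axis p 1)) \<in> borel_measurable lborel"
proof -
  interpret p: flow_path T L F A B "\<lambda>t. Y t \<omega>" by (rule flow_path_Y[OF \<omega>])
  define U where "U s = indicator {0..t} s *\<^sub>R H s \<omega>" for s
  have [measurable]: "U \<in> borel_measurable lborel" unfolding U_def[abs_def] by (rule section_measurable[OF t \<omega>])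
  have "(\<lambda>s. U s *v axis p 1) \<in> borel_measurable lborel" by measurable
  moreover have "U s *v axis p 1 = indicator {0..t} s *\<^sub>R (H s \<omega> *v axis p 1)" for s
    by (simp add: U_def indicator_def)
  ultimately show m: "(\<lambda>s. indicator {0..t} s *\<^sub>R (H s \<omega> *v axis p 1)) \<in> borel_measurable lborel" by simp
  have "norm (H s \<omega> *v axis p 1) \<le> sigma_bound" if "s \<in> {0..t}" for s
    by (rule order_trans[OF norm_mult_axis norm_H]) (use that t in auto)
  from p.q_path_integrable[OF t m this sigma_bound_nonneg]
  show "set_integrable lborel {0..t} (\<lambda>s. q s (X s \<omega>) (H s \<omega> *v axis p 1) (H s \<omega> *v axis p 1))"
    by (simp add: X_eq \<omega>)
qed

lemma m_path_cont: "\<omega> \<in> space M \<Longrightarrow> continuous_on {0..T} (\<lambda>s. m s (Y s \<omega>))"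
  using continuous_on_compose2[OF m_cont continuous_on_Pair[OF continuous_on_id Y_cont]] by fastforce

lemma drift_integral_eq:
  assumes t: "t \<in> {0..T}" and \<omega>: "\<omega> \<in> space M"
  shows "(LINT s:{0..t}|lborel. tdrift s \<omega>) = (LINT s:{0..t}|lborel. w s (X s \<omega>) (m s (Y s \<omega>)))
    - (1 / 2) *\<^sub>R (\<Sum>p\<in>UNIV. LINT s:{0..t}|lborel. q s (X s \<omega>) (H s \<omega> *v axis p 1) (H s \<omega> *v axis p 1))"
proof -
  interpret p: flow_path T L F A B "\<lambda>t. Y t \<omega>" by (rule flow_path_Y[OF \<omega>])
  let ?q = "\<lambda>p s. q s (X s \<omega>) (H s \<omega> *v axis p 1) (H s \<omega> *v axis p 1)"
  have "continuous_on {0..T} (\<lambda>s. w s (X s \<omega>) (m s (Y s \<omega>)))"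
    using p.w_path_cont[OF m_path_cont[OF \<omega>]] by (simp add: X_eq \<omega>)
  then have 1: "set_integrable lborel {0..t} (\<lambda>s. w s (X s \<omega>) (m s (Y s \<omega>)))"
    by (intro set_integrable_continuous_Icc) (use t in \<open>auto elim!: continuous_on_subset\<close>)
  have 2: "set_integrable lborel {0..t} (\<lambda>s. (1 / 2) *\<^sub>R (\<Sum>p\<in>UNIV. ?q p s))"
    using q_path_integrable_H(1)[OF t \<omega>] unfolding set_integrable_def scaleR_sum_right
    by (subst scaleR_left_commute) (intro Bochner_Integration.integrable_sum integrable_scaleR_right)
  have "(LINT s:{0..t}|lborel. tdrift s \<omega>) = (LINT s:{0..t}|lborel. w s (X s \<omega>) (m s (Y s \<omega>)) - (1 / 2) *\<^sub>R (\<Sum>p\<in>UNIV. ?q p s))"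
    by (rule set_lebesgue_integral_cong) (use t tdrift_eq in auto)
  also have "\<dots> = (LINT s:{0..t}|lborel. w s (X s \<omega>) (m s (Y s \<omega>))) - (LINT s:{0..t}|lborel. (1 / 2) *\<^sub>R (\<Sum>p\<in>UNIV. ?q p s))"
    by (rule set_integral_diff(2)[OF 1 2])
  also have "(LINT s:{0..t}|lborel. (1 / 2) *\<^sub>R (\<Sum>p\<in>UNIV. ?q p s)) = (1 / 2) *\<^sub>R (LINT s:{0..t}|lborel. \<Sum>p\<in>UNIV. ?q p s)"
    by (rule set_integral_scaleR_right)
  also have "(LINT s:{0..t}|lborel. \<Sum>p\<in>UNIV. ?q p s) = (\<Sum>p\<in>UNIV. LINT s:{0..t}|lborel. ?q p s)"
    using q_path_integrable_H(1)[OF t \<omega>] unfolding set_integrable_def set_lebesgue_integral_def scaleR_sum_right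
    by (intro Bochner_Integration.integral_sum) auto
  finally show ?thesis .
qed

text \<open>The limit of the linear sums is recovered from \<open>pathwise_ito\<close> by adding
  half of the limit of the quadratic sums from \<open>pathwise_quadratic\<close>. What is left
  besides the initial value is the integral of the transformed drift.\<close>

lemma pathwise_transform:
  assumes t: "t \<in> {0..T}" and \<omega>: "\<omega> \<in> space M"
    and step: "\<And>n. step_process M \<F> t (k n) (\<tau> n) (\<xi> n)"
    and \<xi>: "\<And>n i. norm (\<xi> n i \<omega>) \<le> sigma_bound"
    and mesh: "\<And>n i. i < k n \<Longrightarrow> \<tau> n (Suc i) - \<tau> n i \<le> \<delta> n" "\<delta> \<longlonglongrightarrow> 0"
    and Y: "\<And>n i. i \<le> k n \<Longrightarrow> Y (\<tau> n i) \<omega> = x0 + (LINT s:{0..\<tau> n i}|lborel. F s (Y s \<omega>) + m s (Y s \<omega>)) + J (\<tau> n i) \<omega>"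
    and Y0: "Y 0 \<omega> = x0"
    and \<epsilon>_def: "\<And>n i. \<epsilon> n i = J (\<tau> n (Suc i)) \<omega> - J (\<tau> n i) \<omega> - \<xi> n i \<omega> *v (W (\<tau> n (Suc i)) \<omega> - W (\<tau> n i) \<omega>)"
    and \<epsilon>1: "(\<lambda>n. \<Sum>i<k n. matrix (w (\<tau> n (Suc i)) (X (\<tau> n i) \<omega>)) *v \<epsilon> n i) \<longlonglongrightarrow> 0"
    and \<epsilon>2: "(\<lambda>n. \<Sum>i<k n. (norm (\<epsilon> n i))\<^sup>2) \<longlonglongrightarrow> 0"
    and qv: "\<And>p p'. (\<lambda>n. \<Sum>i<k n. qv p p' (\<tau> n i) (\<tau> n (Suc i)) \<omega> *\<^sub>R
      q (\<tau> n (Suc i)) (X (\<tau> n i) \<omega>) (\<xi> n i \<omega> *v axis p 1) (\<xi> n i \<omega> *v axis p' 1)) \<longlonglongrightarrow> 0"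
    and qv': "\<And>p. (\<lambda>n. \<Sum>i<k n. qv p p (\<tau> n i) (\<tau> n (Suc i)) \<omega>) \<longlonglongrightarrow> 0"
    and lim: "(\<lambda>n. \<integral>\<^sup>+s\<in>{0..t}. ennreal ((norm (step_value (k n) (\<tau> n) (\<xi> n) s \<omega> - H s \<omega>))\<^sup>2) \<partial>lborel) \<longlonglongrightarrow> 0"
  shows "(\<lambda>n. step_integral W (k n) (\<tau> n) (\<lambda>i \<omega>. matrix (w (\<tau> n (Suc i)) (X (\<tau> n i) \<omega>)) ** \<xi> n i \<omega>) \<omega>)
    \<longlonglongrightarrow> X t \<omega> - x0 - (LINT s:{0..t}|lborel. tdrift s \<omega>)"
proof -
  interpret p: flow_path T L F A B "\<lambda>t. Y t \<omega>" by (rule flow_path_Y[OF \<omega>])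
  have px: "p.x s = X s \<omega>" for s by (simp add: X_eq \<omega>)
  have \<tau>: "\<tau> n 0 = 0" "\<tau> n (k n) = t" "i < k n \<Longrightarrow> \<tau> n i \<le> \<tau> n (Suc i)" for n i
    using step[of n] unfolding step_process_def by auto
  have \<tau>T: "\<tau> n i \<in> {0..T}" "\<tau> n (Suc i) \<in> {0..T}" if "i < k n" for n i
    using step_bounds[OF step, of i n] step_bounds[OF step, of "Suc i" n] that t by auto
  define \<Delta> where "\<Delta> n i = W (\<tau> n (Suc i)) \<omega> - W (\<tau> n i) \<omega>" for n i
  define \<beta> where "\<beta> n i = \<xi> n i \<omega> *v \<Delta> n i" for n i
  have X0: "X 0 \<omega> = x0"
    using inv_g[of 0 x0] t Y0 by (simp add: X_def g_0)
  have Fm_int: "set_integrable lborel {0..T} (\<lambda>s. F s (Y s \<omega>) + m s (Y s \<omega>))"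
  proof (intro set_integrable_continuous_Icc continuous_on_add m_path_cont[OF \<omega>])
    show "continuous_on {0..T} (\<lambda>s. F s (Y s \<omega>))" by (rule p.comp_path_cont[OF contF p.y_cont])
  qed
  have incr: "Y (\<tau> n (Suc i)) \<omega> - Y (\<tau> n i) \<omega> = (LINT s:{\<tau> n i<..\<tau> n (Suc i)}|lborel. F s (Y s \<omega>) + m s (Y s \<omega>)) + \<epsilon> n i + \<beta> n i" if i: "i < k n" for n i
  proof -
    have "(LINT s:{\<tau> n i<..\<tau> n (Suc i)}|lborel. F s (Y s \<omega>) + m s (Y s \<omega>)) =
      (LINT s:{0..\<tau> n (Suc i)}|lborel. F s (Y s \<omega>) + m s (Y s \<omega>)) - (LINT s:{0..\<tau> n i}|lborel. F s (Y s \<omega>) + m s (Y s \<omega>))"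
      by (rule set_integral_Icc_diff(2)[OF Fm_int]) (use \<tau>T[OF i] \<tau>(3)[OF i] in auto)
    then show ?thesis using Y[of "Suc i" n] Y[of i n] i by (simp add: \<epsilon>_def \<beta>_def \<Delta>_def)
  qed
  have "(\<lambda>n. \<Sum>p\<in>UNIV. \<Sum>i<k n. qv p p (\<tau> n i) (\<tau> n (Suc i)) \<omega>) \<longlonglongrightarrow> (\<Sum>p\<in>(UNIV::'d set). 0)"
    by (intro tendsto_sum qv')
  then have "Bseq (\<lambda>n. \<Sum>p\<in>UNIV. \<Sum>i<k n. qv p p (\<tau> n i) (\<tau> n (Suc i)) \<omega>)"
    by (intro convergent_imp_Bseq convergentI)
  \<comment> \<open>Convergent sums are bounded uniformly in \<open>n\<close>; this yields the
    uniform bound on the square sums of \<open>\<beta>\<close> that \<open>pathwise_ito\<close> asks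
    for.\<close>
  then obtain b where b: "0 < b" "\<And>n. \<bar>\<Sum>p\<in>UNIV. \<Sum>i<k n. qv p p (\<tau> n i) (\<tau> n (Suc i)) \<omega>\<bar> \<le> b"
    unfolding Bseq_def by auto
  have \<beta>: "(\<Sum>i<k n. (norm (\<beta> n i))\<^sup>2) \<le> sigma_bound\<^sup>2 * (b + real CARD('d) * t)" for n
  proof -
    have "(\<Sum>i<k n. (norm (\<beta> n i))\<^sup>2) \<le> (\<Sum>i<k n. sigma_bound\<^sup>2 * (norm (\<Delta> n i))\<^sup>2)"
    proof (rule sum_mono)
      fix i
      have "norm (\<beta> n i) \<le> sigma_bound * norm (\<Delta> n i)"
        unfolding \<beta>_def by (rule order_trans[OF norm_matrix_vector_le mult_right_mono[OF \<xi>]]) simp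
      from power_mono[OF this, of 2] show "(norm (\<beta> n i))\<^sup>2 \<le> sigma_bound\<^sup>2 * (norm (\<Delta> n i))\<^sup>2"
        by (simp add: power_mult_distrib)
    qed
    also have "\<dots> = sigma_bound\<^sup>2 * (\<Sum>i<k n. (norm (\<Delta> n i))\<^sup>2)" by (simp add: sum_distrib_left)
    also have "(\<Sum>i<k n. (norm (\<Delta> n i))\<^sup>2) = (\<Sum>p\<in>UNIV. \<Sum>i<k n. qv p p (\<tau> n i) (\<tau> n (Suc i)) \<omega>) + real CARD('d) * (\<Sum>i<k n. \<tau> n (Suc i) - \<tau> n i)"
      unfolding \<Delta>_def norm2_increment sum.distrib by (subst sum.swap) (simp add: sum_distrib_left)
    also have "(\<Sum>i<k n. \<tau> n (Suc i) - \<tau> n i) = t"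
      using sum_lessThan_telescope[of "\<tau> n" "k n"] \<tau> by simp
    also have "sigma_bound\<^sup>2 * ((\<Sum>p\<in>UNIV. \<Sum>i<k n. qv p p (\<tau> n i) (\<tau> n (Suc i)) \<omega>) + real CARD('d) * t) \<le> sigma_bound\<^sup>2 * (b + real CARD('d) * t)"
      using b(2)[of n] by (intro mult_left_mono add_right_mono) auto
    finally show ?thesis .
  qed
  let ?q = "\<lambda>p s. q s (X s \<omega>) (H s \<omega> *v axis p 1) (H s \<omega> *v axis p 1)"
  have ito: "(\<lambda>n. (\<Sum>i<k n. w (\<tau> n (Suc i)) (X (\<tau> n i) \<omega>) (\<beta> n i)) - (1 / 2) *\<^sub>R (\<Sum>i<k n. q (\<tau> n (Suc i)) (X (\<tau> n i) \<omega>) (\<beta> n i) (\<beta> n i)))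
    \<longlonglongrightarrow> X t \<omega> - X 0 \<omega> - (LINT s:{0..t}|lborel. w s (X s \<omega>) (m s (Y s \<omega>)))"
    unfolding px[symmetric]
  proof (rule p.pathwise_ito[OF t m_path_cont[OF \<omega>] \<tau> mesh incr _ \<epsilon>2 \<beta>])
    have "(\<Sum>i<k n. matrix (w (\<tau> n (Suc i)) (X (\<tau> n i) \<omega>)) *v \<epsilon> n i) = (\<Sum>i<k n. w (\<tau> n (Suc i)) (p.x (\<tau> n i)) (\<epsilon> n i))" for n
      by (intro sum.cong refl) (simp add: matrix_w[OF \<tau>T(2)] px)
    with \<epsilon>1 show "(\<lambda>n. \<Sum>i<k n. w (\<tau> n (Suc i)) (p.x (\<tau> n i)) (\<epsilon> n i)) \<longlonglongrightarrow> 0" by simp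
  qed
  have quad: "(\<lambda>n. \<Sum>i<k n. (\<tau> n (Suc i) - \<tau> n i) *\<^sub>R q (\<tau> n (Suc i)) (X (\<tau> n i) \<omega>) (\<xi> n i \<omega> *v axis p 1) (\<xi> n i \<omega> *v axis p 1))
    \<longlonglongrightarrow> (LINT s:{0..t}|lborel. ?q p s)" for p
    unfolding px[symmetric]
  proof (rule p.pathwise_quadratic[OF t \<tau> mesh q_path_integrable_H(2)[OF t \<omega>] _ _ sigma_bound_nonneg])
    show "norm (H s \<omega> *v axis p 1) \<le> sigma_bound" if "s \<in> {0..t}" for s
      by (rule order_trans[OF norm_mult_axis norm_H]) (use that t in auto)
    show "norm (\<xi> n i \<omega> *v axis p 1) \<le> sigma_bound" for n i
      by (rule order_trans[OF norm_mult_axis \<xi>])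
    show "(\<lambda>n. \<integral>\<^sup>+s\<in>{0..t}. ennreal ((norm ((\<Sum>i<k n. indicator {\<tau> n i<..\<tau> n (Suc i)} s *\<^sub>R (\<xi> n i \<omega> *v axis p 1)) - H s \<omega> *v axis p 1))\<^sup>2) \<partial>lborel) \<longlonglongrightarrow> 0"
    proof (rule ennreal_tendsto_0_le[OF nn_integral_mono lim])
      fix n s
      have "(\<Sum>i<k n. indicator {\<tau> n i<..\<tau> n (Suc i)} s *\<^sub>R (\<xi> n i \<omega> *v axis p 1)) = step_value (k n) (\<tau> n) (\<xi> n) s \<omega> *v axis p 1"
        unfolding step_value_def by (rule step_fun[OF step, symmetric, of "\<lambda>A. A *v axis p 1"]) simp
      then have eq: "(\<Sum>i<k n. indicator {\<tau> n i<..\<tau> n (Suc i)} s *\<^sub>R (\<xi> n i \<omega> *v axis p 1)) - H s \<omega> *v axis p 1 =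
        (step_value (k n) (\<tau> n) (\<xi> n) s \<omega> - H s \<omega>) *v axis p 1"
        by (simp only: matrix_vector_mult_diff_rdistrib)
      show "ennreal ((norm ((\<Sum>i<k n. indicator {\<tau> n i<..\<tau> n (Suc i)} s *\<^sub>R (\<xi> n i \<omega> *v axis p 1)) - H s \<omega> *v axis p 1))\<^sup>2) * indicator {0..t} s
        \<le> ennreal ((norm (step_value (k n) (\<tau> n) (\<xi> n) s \<omega> - H s \<omega>))\<^sup>2) * indicator {0..t} s"
        unfolding eq by (intro mult_right_mono ennreal_leI power_mono norm_mult_axis) auto
    qed
  qed
  have "(\<Sum>i<k n. q (\<tau> n (Suc i)) (X (\<tau> n i) \<omega>) (\<beta> n i) (\<beta> n i)) =
    (\<Sum>p\<in>UNIV. \<Sum>p'\<in>UNIV. \<Sum>i<k n. qv p p' (\<tau> n i) (\<tau> n (Suc i)) \<omega> *\<^sub>R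
      q (\<tau> n (Suc i)) (X (\<tau> n i) \<omega>) (\<xi> n i \<omega> *v axis p 1) (\<xi> n i \<omega> *v axis p' 1)) +
    (\<Sum>p\<in>UNIV. \<Sum>i<k n. (\<tau> n (Suc i) - \<tau> n i) *\<^sub>R q (\<tau> n (Suc i)) (X (\<tau> n i) \<omega>) (\<xi> n i \<omega> *v axis p 1) (\<xi> n i \<omega> *v axis p 1))" (is "?l n = ?r1 n + ?r2 n") for n
  proof -
    let ?a = "\<lambda>p p' i. qv p p' (\<tau> n i) (\<tau> n (Suc i)) \<omega> *\<^sub>R q (\<tau> n (Suc i)) (X (\<tau> n i) \<omega>) (\<xi> n i \<omega> *v axis p 1) (\<xi> n i \<omega> *v axis p' 1)"
    let ?b = "\<lambda>p i. (\<tau> n (Suc i) - \<tau> n i) *\<^sub>R q (\<tau> n (Suc i)) (X (\<tau> n i) \<omega>) (\<xi> n i \<omega> *v axis p 1) (\<xi> n i \<omega> *v axis p 1)"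
    have "?l n = (\<Sum>i<k n. (\<Sum>p\<in>UNIV. \<Sum>p'\<in>UNIV. ?a p p' i) + (\<Sum>p\<in>UNIV. ?b p i))"
      unfolding \<beta>_def \<Delta>_def by (intro sum.cong refl q_increment \<tau>T) simp
    moreover have "(\<Sum>i<k n. \<Sum>p\<in>UNIV. \<Sum>p'\<in>UNIV. ?a p p' i) = (\<Sum>p\<in>UNIV. \<Sum>p'\<in>UNIV. \<Sum>i<k n. ?a p p' i)"
      by (subst sum.swap) (intro sum.cong refl sum.swap)
    moreover have "(\<Sum>i<k n. \<Sum>p\<in>UNIV. ?b p i) = (\<Sum>p\<in>UNIV. \<Sum>i<k n. ?b p i)" by (rule sum.swap)
    ultimately show ?thesis by (simp only: sum.distrib)
  qed
  moreover have "(\<lambda>n. ?r1 n + ?r2 n) \<longlonglongrightarrow> (\<Sum>p\<in>(UNIV::'d set). \<Sum>p'\<in>(UNIV::'d set). 0) + (\<Sum>p\<in>UNIV. LINT s:{0..t}|lborel. ?q p s)"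
    by (intro tendsto_add tendsto_sum qv quad)
  ultimately have Q: "?l \<longlonglongrightarrow> (\<Sum>p\<in>UNIV. LINT s:{0..t}|lborel. ?q p s)" by simp
  have "(\<lambda>n. \<Sum>i<k n. w (\<tau> n (Suc i)) (X (\<tau> n i) \<omega>) (\<beta> n i)) \<longlonglongrightarrow>
    X t \<omega> - X 0 \<omega> - (LINT s:{0..t}|lborel. w s (X s \<omega>) (m s (Y s \<omega>))) + (1 / 2) *\<^sub>R (\<Sum>p\<in>UNIV. LINT s:{0..t}|lborel. ?q p s)"
    using tendsto_add[OF ito tendsto_scaleR[OF tendsto_const[of "1 / 2"] Q]] by simp
  moreover have "step_integral W (k n) (\<tau> n) (\<lambda>i \<omega>. matrix (w (\<tau> n (Suc i)) (X (\<tau> n i) \<omega>)) ** \<xi> n i \<omega>) \<omega> =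
    (\<Sum>i<k n. w (\<tau> n (Suc i)) (X (\<tau> n i) \<omega>) (\<beta> n i))" for n
    unfolding step_integral_def
    by (intro sum.cong refl) (simp add: matrix_vector_mul_assoc[symmetric] matrix_w[OF \<tau>T(2)] \<beta>_def \<Delta>_def)
  ultimately show ?thesis by (simp add: drift_integral_eq[OF t \<omega>] X0 algebra_simps)
qed

end

lemma has_ito_integral_cong:
  assumes eq: "\<And>s \<omega>. s \<in> {0..t} \<Longrightarrow> H s \<omega> = H' s \<omega>" and H: "has_ito_integral M \<F> W t H J"
  shows "has_ito_integral M \<F> W t H' J"
proof -
  have "progressive_upto \<F> t H = progressive_upto \<F> t H'"
    unfolding progressive_upto_def
  proof (intro ball_cong refl measurable_cong)
    fix s p assume "s \<in> {0..t}" "p \<in> space (restrict_space borel {0..s} \<Otimes>\<^sub>M \<F> s)"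
    then show "(\<lambda>(r, \<omega>). H r \<omega>) p = (\<lambda>(r, \<omega>). H' r \<omega>) p"
      using eq by (auto simp: space_pair_measure space_restrict_space)
  qed
  moreover have "(\<integral>\<^sup>+s\<in>{0..t}. ennreal ((norm (H s \<omega>))\<^sup>2) \<partial>lborel) = (\<integral>\<^sup>+s\<in>{0..t}. ennreal ((norm (H' s \<omega>))\<^sup>2) \<partial>lborel)" for \<omega>
    by (intro nn_integral_cong) (auto simp: indicator_def eq)
  moreover have "(\<integral>\<^sup>+s\<in>{0..t}. ennreal ((norm (step_value k \<tau> \<xi> s \<omega> - H s \<omega>))\<^sup>2) \<partial>lborel) =
    (\<integral>\<^sup>+s\<in>{0..t}. ennreal ((norm (step_value k \<tau> \<xi> s \<omega> - H' s \<omega>))\<^sup>2) \<partial>lborel)" for k \<tau> \<xi> \<omega>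
    by (intro nn_integral_cong) (auto simp: indicator_def eq)
  ultimately show ?thesis using H unfolding has_ito_integral_def ito_integrand_def by simp
qed

text \<open>Bridges \<open>inverse_flow\<close> and \<open>inv (g t)\<close>, which are identified
  for times in \<open>{0..T}\<close> only; outside this interval solutions are arbitrary.\<close>

lemma sde_solution_cong:
  assumes eq: "\<And>t \<omega>. t \<in> {0..T} \<Longrightarrow> Y t \<omega> = Y' t \<omega>" and T: "0 \<le> T" and Y: "sde_solution M T \<F> W b S x0 Y"
  shows "sde_solution M T \<F> W b S x0 Y'"
proof -
  have eq': "Y t = Y' t" if "t \<in> {0..T}" for t using eq[OF that] by auto
  have "(\<forall>\<omega>\<in>space M. continuous_on {0..T} (\<lambda>t. Y t \<omega>)) = (\<forall>\<omega>\<in>space M. continuous_on {0..T} (\<lambda>t. Y' t \<omega>))"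
    by (intro ball_cong refl continuous_on_cong eq)
  moreover have "set_integrable lborel {0..T} (\<lambda>s. b s (Y s \<omega>)) = set_integrable lborel {0..T} (\<lambda>s. b s (Y' s \<omega>))" for \<omega>
    by (rule set_integrable_cong) (auto simp: eq)
  moreover have "(LINT s:{0..t}|lborel. b s (Y s \<omega>)) = (LINT s:{0..t}|lborel. b s (Y' s \<omega>))" if "t \<in> {0..T}" for t \<omega>
    by (rule set_lebesgue_integral_cong) (use that eq in auto)
  moreover have "has_ito_integral M \<F> W t (\<lambda>s \<omega>. S s (Y' s \<omega>)) J" if "t \<in> {0..T}" "has_ito_integral M \<F> W t (\<lambda>s \<omega>. S s (Y s \<omega>)) J" for t J
    by (rule has_ito_integral_cong[OF _ that(2)]) (use that eq in auto)
  ultimately show ?thesis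
    using Y eq' T unfolding sde_solution_def by fastforce
qed

section \<open>The transformed process solves the transformed equation\<close>

context transformed_sde begin

lemma has_ito_integral_tdiffusion:
  assumes t: "t \<in> {0..T}"
  shows "has_ito_integral M \<F> W t tdiffusion (\<lambda>\<omega>. X t \<omega> - x0 - (LINT s:{0..t}|lborel. tdrift s \<omega>))"
proof -
  let ?J = "\<lambda>\<omega>. X t \<omega> - x0 - (LINT s:{0..t}|lborel. tdrift s \<omega>)"
  have JH: "has_ito_integral M \<F> W s H (J s)" if "s \<in> {0..T}" for s
    using J[OF that] by (simp add: H_def[abs_def])
  have H_entry: "\<bar>H s \<omega> $ i $ j\<bar> \<le> C" if "s \<in> {0..T}" for s \<omega> i j
    using \<sigma>_bound[OF that] by (simp add: H_def)
  obtain k \<tau> \<xi> where step: "\<And>n. step_process M \<F> t (k n) (\<tau> n) (\<xi> n)"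
    and \<xi>': "\<And>n i \<omega>. norm (\<xi> n i \<omega>) \<le> real CARD('d) * (real CARD('d) * C)"
    and gap: "\<And>n i. i < k n \<Longrightarrow> \<tau> n (Suc i) - \<tau> n i \<le> t / real (Suc n)"
    and lim: "(\<lambda>n. nsq P (\<lambda>z. step_value (k n) (\<tau> n) (\<xi> n) (fst z) (snd z) - indicator {0<..t} (fst z) *\<^sub>R H (fst z) (snd z))) \<longlonglongrightarrow> 0"
    using has_ito_integral_approx(1)[OF t JH[OF t] C H_entry H_P] by blast
  note \<xi> = \<xi>'[folded sigma_bound_def]
  have itoJ: "ito (\<lambda>z. indicator {0<..s} (fst z) *\<^sub>R H (fst z) (snd z)) (J s)" if "s \<in> {0..T}" for s
    by (rule has_ito_integral_approx(2)[OF that JH[OF that] C H_entry H_P])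
  have \<tau>T: "\<tau> n i \<in> {0..T}" if "i \<le> k n" for n i
    using step_bounds[OF step that] t by auto
  have \<tau>: "\<tau> n i \<le> \<tau> n (Suc i)" "\<xi> n i \<in> borel_measurable (\<F> (\<tau> n i))" if "i < k n" for n i
    using step[of n] that unfolding step_process_def by auto
  define \<theta> where "\<theta> n i \<omega> = matrix (w (\<tau> n (Suc i)) (X (\<tau> n i) \<omega>))" for n i \<omega>
  define \<eta> where "\<eta> p p' n i \<omega> = q (\<tau> n (Suc i)) (X (\<tau> n i) \<omega>) (\<xi> n i \<omega> *v axis p 1) (\<xi> n i \<omega> *v axis p' 1)" for p p' n i \<omega>
  \<comment> \<open>The coefficient is evaluated at the right end of the interval and the process at
    the left one; only the latter is random.\<close>
  have frozen_adapted: "(\<lambda>\<omega>. f (\<tau> n (Suc i)) (X (\<tau> n i) \<omega>)) \<in> borel_measurable (\<F> (\<tau> n i))"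
    if i: "i < k n" and "continuous_on ({0..T} \<times> UNIV) (\<lambda>(t, x). f t x)" for f :: "real \<Rightarrow> real^'d \<Rightarrow> 'z::metric_space" and n i
    by (rule comp_adapted[OF that(2) _ _ X_adapted]) (use i \<tau>T \<tau>(1)[OF i] Suc_leI[OF i] in auto)
  have \<theta>_adapted: "\<theta> n i \<in> borel_measurable (\<F> (\<tau> n i))" if "i < k n" for n i
    unfolding \<theta>_def[abs_def] by (rule frozen_adapted[OF that matrix_w_cont])
  have \<theta>_bound: "norm (\<theta> n i \<omega>) \<le> real CARD('d) * (real CARD('d) * E)" if "i < k n" for n i \<omega>
    unfolding \<theta>_def by (rule norm_matrix_w[OF \<tau>T]) (use that in simp)
  have \<eta>_adapted: "\<eta> p p' n i \<in> borel_measurable (\<F> (\<tau> n i))" if i: "i < k n" for p p' n i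
  proof -
    note [measurable] = frozen_adapted[OF i q_cont] \<tau>(2)[OF i]
    have "\<eta> p p' n i \<omega> = (\<Sum>b\<in>Basis. \<Sum>c\<in>Basis. (((\<xi> n i \<omega> *v axis p 1) \<bullet> b) * ((\<xi> n i \<omega> *v axis p' 1) \<bullet> c)) *\<^sub>R
      q (\<tau> n (Suc i)) (X (\<tau> n i) \<omega>) b c)" for \<omega>
      unfolding \<eta>_def by (rule q_expand[OF \<tau>T]) (use i in simp)
    then show ?thesis by (simp only: cong: measurable_cong) measurable
  qed
  have \<eta>_bound: "norm (\<eta> p p' n i \<omega>) \<le> Q * sigma_bound * sigma_bound" if "i < k n" for p p' n i \<omega>
  proof -
    have "norm (\<xi> n i \<omega> *v axis p 1) \<le> sigma_bound" for p by (rule order_trans[OF norm_mult_axis \<xi>])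
    then have "Q * norm (\<xi> n i \<omega> *v axis p 1) * norm (\<xi> n i \<omega> *v axis p' 1) \<le> Q * sigma_bound * sigma_bound"
      using Q sigma_bound_nonneg by (intro mult_mono) auto
    then show ?thesis unfolding \<eta>_def using q_bound[OF \<tau>T[of "Suc i" n]] that order_trans by (metis Suc_leI)
  qed
  define \<epsilon> where "\<epsilon> n i \<omega> = J (\<tau> n (Suc i)) \<omega> - J (\<tau> n i) \<omega> - \<xi> n i \<omega> *v (W (\<tau> n (Suc i)) \<omega> - W (\<tau> n i) \<omega>)" for n i \<omega>
  have nonneg: "0 \<le> real CARD('d) * (real CARD('d) * E)" "0 \<le> Q * sigma_bound * sigma_bound"
    using E Q sigma_bound_nonneg by auto
  obtain r :: "nat \<Rightarrow> nat" where r: "strict_mono r" "AE \<omega> in M.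
    (\<lambda>n. \<Sum>i<k (r n). \<theta> (r n) i \<omega> *v \<epsilon> (r n) i \<omega>) \<longlonglongrightarrow> 0 \<and>
    (\<lambda>n. \<Sum>i<k (r n). (norm (\<epsilon> (r n) i \<omega>))\<^sup>2) \<longlonglongrightarrow> 0 \<and>
    (\<forall>p p'. (\<lambda>n. \<Sum>i<k (r n). qv p p' (\<tau> (r n) i) (\<tau> (r n) (Suc i)) \<omega> *\<^sub>R \<eta> p p' (r n) i \<omega>) \<longlonglongrightarrow> 0) \<and>
    (\<forall>p. (\<lambda>n. \<Sum>i<k (r n). qv p p (\<tau> (r n) i) (\<tau> (r n) (Suc i)) \<omega>) \<longlonglongrightarrow> 0) \<and>
    (\<lambda>n. \<integral>\<^sup>+s\<in>{0..t}. ennreal ((norm (step_value (k (r n)) (\<tau> (r n)) (\<xi> (r n)) s \<omega> - H s \<omega>))\<^sup>2) \<partial>lborel) \<longlonglongrightarrow> 0"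
    using riemann_AE_subseq[where \<eta> = \<eta> and \<theta> = \<theta>, OF t H_P itoJ step gap lim \<theta>_adapted \<theta>_bound nonneg(1) \<eta>_adapted \<eta>_bound nonneg(2)]
    unfolding \<epsilon>_def by blast
  define \<zeta> where "\<zeta> n i \<omega> = \<theta> n i \<omega> ** \<xi> n i \<omega>" for n i \<omega>
  have mesh: "(\<lambda>n. t / real (Suc (r n))) \<longlonglongrightarrow> 0"
  proof -
    have "(\<lambda>n. t * (1 / real (Suc n))) \<longlonglongrightarrow> t * 0" by (intro tendsto_mult tendsto_const LIMSEQ_Suc lim_1_over_n)
    from LIMSEQ_subseq_LIMSEQ[OF this r(1)] show ?thesis by (simp add: o_def)
  qed
  \<comment> \<open>Each time has its own exceptional null set. All grids together have countably
    many points, so one null set serves them all.\<close>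
  have "AE \<omega> in M. \<forall>n. \<forall>i\<in>{..k n}. Y (\<tau> n i) \<omega> = x0 + (LINT s:{0..\<tau> n i}|lborel. F s (Y s \<omega>) + m s (Y s \<omega>)) + J (\<tau> n i) \<omega>"
    by (subst AE_all_countable, intro allI AE_finite_allI finite_atMost Y_eq \<tau>T) simp
  with r(2) Y_0 AE_space have AE: "AE \<omega> in M.
    (\<lambda>n. step_integral W (k (r n)) (\<tau> (r n)) (\<zeta> (r n)) \<omega>) \<longlonglongrightarrow> ?J \<omega> \<and>
    (\<lambda>n. \<integral>\<^sup>+s\<in>{0..t}. ennreal ((norm (step_value (k (r n)) (\<tau> (r n)) (\<zeta> (r n)) s \<omega> - tdiffusion s \<omega>))\<^sup>2) \<partial>lborel) \<longlonglongrightarrow> 0"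
  proof eventually_elim
    case (elim \<omega>)
    show ?case
      unfolding \<zeta>_def[abs_def] \<theta>_def
    proof (intro conjI pathwise_transform[where \<epsilon> = "\<lambda>n i. \<epsilon> (r n) i \<omega>" and \<delta> = "\<lambda>n. t / real (Suc (r n))"] pathwise_diffusion[where \<delta> = "\<lambda>n. t / real (Suc (r n))"] t step \<xi> gap mesh; (fact elim)?)
    qed (use elim in \<open>auto simp: \<epsilon>_def \<theta>_def \<eta>_def\<close>)
  qed
  have step': "step_process M \<F> t (k n) (\<tau> n) (\<zeta> n)" for n
    unfolding step_process_def
  proof (intro conjI allI impI)
    fix i assume i: "i < k n"
    note [measurable] = \<theta>_adapted[OF i] \<tau>(2)[OF i]
    show "\<zeta> n i \<in> borel_measurable (\<F> (\<tau> n i))" unfolding \<zeta>_def[abs_def] by measurable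
    show "bounded (\<zeta> n i ` space M)"
    proof (rule boundedI)
      fix z assume "z \<in> \<zeta> n i ` space M"
      then obtain \<omega> where "z = \<zeta> n i \<omega>" by blast
      then show "norm z \<le> real CARD('d) * (real CARD('d) * E) * sigma_bound"
        unfolding \<zeta>_def using order_trans[OF norm_matrix_matrix_le mult_mono[OF \<theta>_bound[OF i] \<xi> nonneg(1) norm_ge_zero]] by simp
    qed
  qed (use step[of n] in \<open>auto simp: step_process_def\<close>)
  have Jm[measurable]: "?J \<in> borel_measurable M"
    using adapted_measurable[OF t X_adapted[OF t]] drift_integral_measurable[OF t] by measurable
  show ?thesis
    unfolding has_ito_integral_def
  proof (intro conjI tdiffusion_integrand[OF t] Jm exI[of _ "\<lambda>n. k (r n)"] exI[of _ "\<lambda>n. \<tau> (r n)"] exI[of _ "\<lambda>n. \<zeta> (r n)"] allI step')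
    have Sm: "step_integral W (k n) (\<tau> n) (\<zeta> n) \<in> borel_measurable M" for n
      using simple_measurable(2)[OF step_simple[OF step'[of n] t]] .
    show "tendsto_0_in_prob M (\<lambda>n \<omega>. ennreal (norm (step_integral W (k (r n)) (\<tau> (r n)) (\<zeta> (r n)) \<omega> - ?J \<omega>)))"
    proof (rule AE_imp_tendsto_0_in_prob)
      show "(\<lambda>\<omega>. ennreal (norm (step_integral W (k (r n)) (\<tau> (r n)) (\<zeta> (r n)) \<omega> - ?J \<omega>))) \<in> borel_measurable M" for n
        using Sm[of "r n"] by measurable
      show "AE \<omega> in M. (\<lambda>n. ennreal (norm (step_integral W (k (r n)) (\<tau> (r n)) (\<zeta> (r n)) \<omega> - ?J \<omega>))) \<longlonglongrightarrow> 0"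
        using AE
      proof eventually_elim
        case (elim \<omega>)
        then have "(\<lambda>n. norm (step_integral W (k (r n)) (\<tau> (r n)) (\<zeta> (r n)) \<omega> - ?J \<omega>)) \<longlonglongrightarrow> 0"
          by (intro tendsto_norm_zero LIM_zero) simp
        from tendsto_ennrealI[OF this] show ?case by simp
      qed
    qed
    show "tendsto_0_in_prob M (\<lambda>n \<omega>. \<integral>\<^sup>+s\<in>{0..t}. ennreal ((norm (step_value (k (r n)) (\<tau> (r n)) (\<zeta> (r n)) s \<omega> - tdiffusion s \<omega>))\<^sup>2) \<partial>lborel)"
    proof (rule AE_imp_tendsto_0_in_prob)
      show "AE \<omega> in M. (\<lambda>n. \<integral>\<^sup>+s\<in>{0..t}. ennreal ((norm (step_value (k (r n)) (\<tau> (r n)) (\<zeta> (r n)) s \<omega> - tdiffusion s \<omega>))\<^sup>2) \<partial>lborel) \<longlonglongrightarrow> 0"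
        using AE by eventually_elim simp
      fix n
      have "T \<in> {0..T}" using T by simp
      note [measurable] = simple_measurable(1)[OF step_simple[OF step'[of "r n"] t]]
        progressive_imp_P_measurable[OF tdiffusion_progressive[OF this]]
      let ?f = "\<lambda>s \<omega>. ennreal ((norm (step_value (k (r n)) (\<tau> (r n)) (\<zeta> (r n)) s \<omega> - tdiffusion s \<omega>))\<^sup>2)"
      have "(\<lambda>\<omega>. \<integral>\<^sup>+s. ?f s \<omega> * indicator {0..t} s \<partial>time_measure T) \<in> borel_measurable M"
      proof (rule time.borel_measurable_nn_integral)
        have "(\<lambda>(\<omega>, s). ennreal ((norm (step_value (k (r n)) (\<tau> (r n)) (\<zeta> (r n)) (fst (s, \<omega>)) (snd (s, \<omega>)) -
          (case (s, \<omega>) of (s, \<omega>) \<Rightarrow> tdiffusion s \<omega>)))\<^sup>2) * indicator {0..t} s) \<in> borel_measurable (M \<Otimes>\<^sub>M time_measure T)"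
          by measurable
        then show "(\<lambda>(\<omega>, s). ?f s \<omega> * indicator {0..t} s) \<in> borel_measurable (M \<Otimes>\<^sub>M time_measure T)" by simp
      qed
      moreover have "(\<integral>\<^sup>+s. ?f s \<omega> * indicator {0..t} s \<partial>time_measure T) = (\<integral>\<^sup>+s\<in>{0..t}. ?f s \<omega> \<partial>lborel)" for \<omega>
        unfolding nn_integral_time_measure using t by (intro nn_integral_cong) (auto simp: indicator_def)
      ultimately show "(\<lambda>\<omega>. \<integral>\<^sup>+s\<in>{0..t}. ?f s \<omega> \<partial>lborel) \<in> borel_measurable M" by (simp cong: measurable_cong)
    qed
  qed
qed

lemma sde_solution_transformed:
  "sde_solution M T \<F> W (transformed_drift F m \<sigma> T) (transformed_diffusion F \<sigma> T) x0 X"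
  unfolding sde_solution_def
proof (intro conjI ballI X_adapted X_cont)
  show "AE \<omega> in M. X 0 \<omega> = x0"
    using Y_0 by eventually_elim (use inv_g[of 0] T in \<open>simp add: X_def g_0\<close>)
  show "AE \<omega> in M. set_integrable lborel {0..T} (\<lambda>s. tdrift s \<omega>)"
    by (rule AE_I2) (rule tdrift_integrable)
  fix t assume "t \<in> {0..T}"
  \<comment> \<open>With this integral the equation holds identically, since the candidate was
    defined by solving it for the stochastic term.\<close>
  from has_ito_integral_tdiffusion[OF this]
  show "\<exists>J. has_ito_integral M \<F> W t tdiffusion J \<and> (AE \<omega> in M. X t \<omega> = x0 + (LINT s:{0..t}|lborel. tdrift s \<omega>) + J \<omega>)"
    by (intro exI conjI) auto
qed

end

theorem mainTheorem1:
  fixes T :: real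
    and F m :: "real \<Rightarrow> real^'d \<Rightarrow> real^'d"
    and \<sigma> :: "real \<Rightarrow> real^'d \<Rightarrow> real^'d^'d"
    and M :: "'w measure"
    and \<F> :: "real \<Rightarrow> 'w measure"
    and W Y :: "real \<Rightarrow> 'w \<Rightarrow> real^'d"
    and x0 :: "real^'d"
  assumes "0 < T"
    and "uniformly_elliptic T \<sigma>"
    and "smooth_drift T F"
    and "continuous_bounded_drift T m"
    and "wiener_process M T \<F> W"
    and "sde_solution M T \<F> W (\<lambda>t x. F t x + m t x) \<sigma> x0 Y"
  shows "sde_solution M T \<F> W (transformed_drift F m \<sigma> T) (transformed_diffusion F \<sigma> T) x0
           (\<lambda>t \<omega>. inverse_flow F T t (Y t \<omega>)) \<and>
         bounded ((\<lambda>(t, x). transformed_drift F m \<sigma> T t x) ` ({0..T} \<times> UNIV)) \<and>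
         bounded ((\<lambda>(t, x). transformed_diffusion F \<sigma> T t x) ` ({0..T} \<times> UNIV))"
proof -
  have T: "0 \<le> T" using assms(1) by simp
  obtain L A B where flow: "smooth_flow T L F A B" using smooth_drift_imp_smooth_flow[OF T assms(3)] by blast
  obtain C where C: "0 \<le> C" "\<And>t x i j. t \<in> {0..T} \<Longrightarrow> \<bar>\<sigma> t x $ i $ j\<bar> \<le> C"
    using uniformly_elliptic_bound[OF assms(2)] by blast
  have m: "continuous_on ({0..T} \<times> UNIV) (\<lambda>(t, x). m t x)" "bounded ((\<lambda>(t, x). m t x) ` ({0..T} \<times> UNIV))"
    using assms(4) by (auto simp: continuous_bounded_drift_def)
  obtain Cm where Cm: "\<And>t z. t \<in> {0..T} \<Longrightarrow> norm (m t z) \<le> Cm"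
    using m(2) unfolding bounded_iff by fastforce
  note Y = assms(6)[unfolded sde_solution_def]
  from Y have "\<forall>t\<in>{0..T}. \<exists>J. has_ito_integral M \<F> W t (\<lambda>s \<omega>. \<sigma> s (Y s \<omega>)) J \<and>
    (AE \<omega> in M. Y t \<omega> = x0 + (LINT s:{0..t}|lborel. F s (Y s \<omega>) + m s (Y s \<omega>)) + J \<omega>)" by blast
  \<comment> \<open>One version of the integral is fixed for each time, as the locale of the
    transformed equation expects a family indexed by time.\<close>
  from bchoice[OF this] obtain J where J: "\<forall>t\<in>{0..T}. has_ito_integral M \<F> W t (\<lambda>s \<omega>. \<sigma> s (Y s \<omega>)) (J t) \<and>
    (AE \<omega> in M. Y t \<omega> = x0 + (LINT s:{0..t}|lborel. F s (Y s \<omega>) + m s (Y s \<omega>)) + J t \<omega>)" by blast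
  interpret smooth_flow T L F A B by (rule flow)
  interpret wiener M T \<F> W by (rule wiener.intro) (use assms(5) T in auto)
  interpret transformed_sde M T \<F> W L F A B m \<sigma> x0 Y J C Cm
    by unfold_locales (use C m Cm Y J in auto)
  have "sde_solution M T \<F> W (transformed_drift F m \<sigma> T) (transformed_diffusion F \<sigma> T) x0 (\<lambda>t \<omega>. inverse_flow F T t (Y t \<omega>))"
    by (rule sde_solution_cong[OF _ T sde_solution_transformed]) (simp add: inverse_flow_eq X_def)
  then show ?thesis using bounded_transformed by blast
qed

end
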